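(* Spaces of finite CW type (spaces homotopy equivalent to finite CW complexes), equipped with their fine uniformities, are uniformly cofibrant.
   Context: Spaces and uniform spaces. $\mathscr{T}$ is the category of Tychonoff spaces which are colimits of compact, locally connected, second-countable spaces, and continuous maps; it is Cartesian closed. A space means a $\mathscr{T}$-object. Metrics are allowed to take the value $\infty$. $\mathscr{U}$ is the category of separated uniform spaces which are uniform colimits (colimits of uniform spaces and uniform maps) of connected, locally connected metric spaces, and uniform maps; it is Cartesian closed and coreflective in separated uniform spaces. Write $Y^X$ for exponentials in $\mathscr{U}$; $\mathscr{U}$ is $\mathscr{T}$-enriched with $\mathscr{U}(X,Y)$ given the uniform topology of $Y^X$. The fine uniformity on a completely regular space is its maximal compatible uniformity; a space with its fine uniformity is a $\mathscr{U}$-object. A uniform map $f$ is a uniform Hurewicz fibration if for every $\mathscr{U}$-object $Z$ the continuous map $\mathscr{U}(Z,f)$ has the right lifting property against the inclusion $\{0\}\hookrightarrow[0,1]$. Cubical sets and realizations. Let $[n]=\{0<\cdots<n\}$. $\square$ is the submonoidal category of the Cartesian monoidal category of small categories generated by $[0],[1]$, the two functors $[0]\to[1]$, the functor $[1]\to[0]$ and the join $\vee:[1]^2\to[1]$; its objects are the posets $[1]^n$. Cubical sets are functors $\square^{op}\to\mathbf{Set}$, forming the category $c\mathbf{Set}$; $\square[1]^n$ is the representable on $[1]^n$. $\mathscr{M}$ is the category of extended metric spaces and $1$-Lipschitz maps; the forgetful functor $\mathscr{M}\to\mathscr{U}$ sends $X$ to the coreflection in $\mathscr{U}$ of its underlying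 uniform space. Geometric realization $|-|_\sphericalangle:c\mathbf{Set}\to\mathscr{M}$ is the cocontinuous functor sending $\square[1]^n$ to $[0,1]^n$ with the max metric and sending $\square[\phi]$, for $\phi:[1]^m\to[1]^n$ in $\square$, to the map $[0,1]^m\to[0,1]^n$ extending $\phi$ that is linear on the convex hull of each chain of the poset $[1]^m$. Uniform realization $|-|_\infty:c\mathbf{Set}\to\mathscr{U}$ is $|-|_\sphericalangle$ followed by $\mathscr{M}\to\mathscr{U}$. Topological realization $|-|:c\mathbf{Set}\to\mathscr{T}$ is the analogous cocontinuous functor to spaces ($|\square[1]^n|=[0,1]^n$), taking values in CW complexes. A map $f:X\to Y$ of spaces is a classical weak equivalence if $\pi_0\mathscr{T}(|C|,f)$ (path-components of mapping spaces) is bijective for all cubical sets $C$. A uniform map $f:X\to Y$ is a uniform weak equivalence if $\mathscr{U}(|C|_\infty,f)$ is a classical weak equivalence of spaces for all cubical sets $C$. A $\mathscr{U}$-object $X$ is uniformly cofibrant if every uniform map $X\to Y$ lifts along every uniform map to $Y$ that is at once a uniform weak equivalence and a uniform Hurewicz fibration. *)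

theory Defs
  imports "HOL-Analysis.Analysis"
begin

text \<open>
  Size convention.  HOL has no quantification over types inside a formula, so one type \<open>'u\<close>
  plays the role of the universe: the objects over which the definitions below quantify (spaces,
  uniform spaces, metric spaces, cubical sets) have their points or cells in \<open>'u\<close>.
  Structures built from those objects, such as function spaces, may live on other types; being an
  object of \<open>\<U>\<close> then still refers to diagrams of metric spaces in \<open>'u\<close>, and \<open>'u\<close> is passed
  explicitly as \<open>TYPE('u)\<close>.  All notions are the intended ones as soon as \<open>'u\<close> is at least
  as large as the continuum, so that cubes, disks and realizations have copies in \<open>'u\<close>.
\<close>

section \<open>Colimits in concrete categories\<close>

text \<open>
  A diagram has a set \<open>I\<close> of indices, objects \<open>D i\<close>, and a set \<open>A\<close> of arrows
  \<open>(i, j, f)\<close> with \<open>f\<close> a morphism from \<open>D i\<close> to \<open>D j\<close>.  Closure of \<open>A\<close> under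
  composition is not required: a cocone over \<open>A\<close> is the same as a cocone over the functor on
  the free category on \<open>A\<close>.  The objects of the diagram may have another type of points than
  the colimit, which is why the morphisms between diagram objects (\<open>dd\<close>), from these to the
  colimit (\<open>dx\<close>) and between candidates for the colimit (\<open>xx\<close>) are separate arguments.
\<close>

definition is_diagram ::
    "('d \<Rightarrow> 'd \<Rightarrow> ('p \<Rightarrow> 'p) \<Rightarrow> bool) \<Rightarrow> 'i set \<Rightarrow> ('i \<Rightarrow> 'd) \<Rightarrow> ('i \<times> 'i \<times> ('p \<Rightarrow> 'p)) set \<Rightarrow> bool" where
  "is_diagram dd I D A \<longleftrightarrow> (\<forall>(i, j, f) \<in> A. i \<in> I \<and> j \<in> I \<and> dd (D i) (D j) f)"

definition is_cocone ::
    "('d \<Rightarrow> 'p set) \<Rightarrow> ('d \<Rightarrow> 'x \<Rightarrow> ('p \<Rightarrow> 'q) \<Rightarrow> bool) \<Rightarrow>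
     'i set \<Rightarrow> ('i \<Rightarrow> 'd) \<Rightarrow> ('i \<times> 'i \<times> ('p \<Rightarrow> 'p)) set \<Rightarrow> ('i \<Rightarrow> 'p \<Rightarrow> 'q) \<Rightarrow> 'x \<Rightarrow> bool" where
  "is_cocone pd dx I D A k W \<longleftrightarrow>
     (\<forall>i\<in>I. dx (D i) W (k i)) \<and> (\<forall>(i, j, f) \<in> A. \<forall>p \<in> pd (D i). k j (f p) = k i p)"

definition is_colimit ::
    "('d \<Rightarrow> 'p set) \<Rightarrow> ('x \<Rightarrow> 'q set) \<Rightarrow> ('d \<Rightarrow> 'd \<Rightarrow> ('p \<Rightarrow> 'p) \<Rightarrow> bool) \<Rightarrow>
     ('d \<Rightarrow> 'x \<Rightarrow> ('p \<Rightarrow> 'q) \<Rightarrow> bool) \<Rightarrow> ('x \<Rightarrow> 'x \<Rightarrow> ('q \<Rightarrow> 'q) \<Rightarrow> bool) \<Rightarrow> ('x \<Rightarrow> bool) \<Rightarrow>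
     'i set \<Rightarrow> ('i \<Rightarrow> 'd) \<Rightarrow> ('i \<times> 'i \<times> ('p \<Rightarrow> 'p)) set \<Rightarrow> ('i \<Rightarrow> 'p \<Rightarrow> 'q) \<Rightarrow> 'x \<Rightarrow> bool" where
  "is_colimit pd px dd dx xx ob I D A h X \<longleftrightarrow>
     is_diagram dd I D A \<and> ob X \<and> is_cocone pd dx I D A h X \<and>
     (\<forall>W k. ob W \<and> is_cocone pd dx I D A k W \<longrightarrow>
        (\<exists>g. xx X W g \<and> (\<forall>i\<in>I. \<forall>p \<in> pd (D i). g (h i p) = k i p)) \<and>
        (\<forall>g g'. xx X W g \<and> (\<forall>i\<in>I. \<forall>p \<in> pd (D i). g (h i p) = k i p) \<and>
                xx X W g' \<and> (\<forall>i\<in>I. \<forall>p \<in> pd (D i). g' (h i p) = k i p) \<longrightarrow>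
                (\<forall>x \<in> px X. g x = g' x)))"


section \<open>Uniform spaces and extended metric spaces\<close>

record 'a uspace =
  upoints :: "'a set"
  entourages :: "('a \<times> 'a) filter"

definition is_uspace :: "'a uspace \<Rightarrow> bool" where
  "is_uspace X \<longleftrightarrow>
     entourages X \<le> principal (upoints X \<times> upoints X) \<and>
     (\<forall>P. eventually P (entourages X) \<longrightarrow>
        (\<forall>x \<in> upoints X. P (x, x)) \<and>
        eventually (\<lambda>(x, y). P (y, x)) (entourages X) \<and>
        (\<exists>Q. eventually Q (entourages X) \<and> (\<forall>x y z. Q (x, y) \<longrightarrow> Q (y, z) \<longrightarrow> P (x, z))))"

definition separated :: "'a uspace \<Rightarrow> bool" where
  "separated X \<longleftrightarrow>
     (\<forall>x \<in> upoints X. \<forall>y \<in> upoints X. (\<forall>P. eventually P (entourages X) \<longrightarrow> P (x, y)) \<longrightarrow> x = y)"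

definition umap :: "'a uspace \<Rightarrow> 'b uspace \<Rightarrow> ('a \<Rightarrow> 'b) \<Rightarrow> bool" where
  "umap X Y f \<longleftrightarrow>
     f \<in> upoints X \<rightarrow> upoints Y \<and> filterlim (map_prod f f) (entourages Y) (entourages X)"

definition utopology :: "'a uspace \<Rightarrow> 'a topology" where
  "utopology X =
     topology (\<lambda>U. U \<subseteq> upoints X \<and> (\<forall>x\<in>U. eventually (\<lambda>(a, b). a = x \<longrightarrow> b \<in> U) (entourages X)))"

lemma openin_utopology:
  "openin (utopology X) U \<longleftrightarrow>
     U \<subseteq> upoints X \<and> (\<forall>x\<in>U. eventually (\<lambda>(a, b). a = x \<longrightarrow> b \<in> U) (entourages X))"
proof -
  have "istopology (\<lambda>U. U \<subseteq> upoints X \<and>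
          (\<forall>x\<in>U. eventually (\<lambda>(a, b). a = x \<longrightarrow> b \<in> U) (entourages X)))"
    unfolding istopology_def
  proof (intro conjI allI impI)
    fix S T
    assume S: "S \<subseteq> upoints X \<and> (\<forall>x\<in>S. \<forall>\<^sub>F (a, b) in entourages X. a = x \<longrightarrow> b \<in> S)"
      and T: "T \<subseteq> upoints X \<and> (\<forall>x\<in>T. \<forall>\<^sub>F (a, b) in entourages X. a = x \<longrightarrow> b \<in> T)"
    show "S \<inter> T \<subseteq> upoints X" using S by blast
    show "\<forall>x\<in>S \<inter> T. \<forall>\<^sub>F (a, b) in entourages X. a = x \<longrightarrow> b \<in> S \<inter> T"
    proof
      fix x assume "x \<in> S \<inter> T"
      then have "\<forall>\<^sub>F (a, b) in entourages X. a = x \<longrightarrow> b \<in> S"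
        and "\<forall>\<^sub>F (a, b) in entourages X. a = x \<longrightarrow> b \<in> T" using S T by auto
      then show "\<forall>\<^sub>F (a, b) in entourages X. a = x \<longrightarrow> b \<in> S \<inter> T"
        by eventually_elim auto
    qed
  next
    fix K
    assume K: "\<forall>S\<in>K. S \<subseteq> upoints X \<and> (\<forall>x\<in>S. \<forall>\<^sub>F (a, b) in entourages X. a = x \<longrightarrow> b \<in> S)"
    show "\<Union>K \<subseteq> upoints X" using K by blast
    show "\<forall>x\<in>\<Union>K. \<forall>\<^sub>F (a, b) in entourages X. a = x \<longrightarrow> b \<in> \<Union>K"
    proof
      fix x assume "x \<in> \<Union>K"
      then obtain S where S: "S \<in> K" "x \<in> S" by blast
      then have "\<forall>\<^sub>F (a, b) in entourages X. a = x \<longrightarrow> b \<in> S" using K by blast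
      then show "\<forall>\<^sub>F (a, b) in entourages X. a = x \<longrightarrow> b \<in> \<Union>K"
        by eventually_elim (use S in auto)
    qed
  qed
  then show ?thesis by (simp add: utopology_def)
qed

lemma topspace_utopology:
  assumes "is_uspace X"
  shows "topspace (utopology X) = upoints X"
proof -
  have "\<forall>\<^sub>F (a, b) in entourages X. a \<in> upoints X \<and> b \<in> upoints X"
    using assms by (auto simp: is_uspace_def le_principal case_prod_unfold mem_Times_iff)
  then have "\<forall>\<^sub>F (a, b) in entourages X. a = x \<longrightarrow> b \<in> upoints X" for x
    by eventually_elim auto
  then have "openin (utopology X) (upoints X)"
    by (auto simp: openin_utopology)
  then show ?thesis
    by (meson openin_subset openin_topspace openin_utopology subset_antisym)
qed

definition uprod :: "'a uspace \<Rightarrow> 'b uspace \<Rightarrow> ('a \<times> 'b) uspace" where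
  "uprod X Y = \<lparr> upoints = upoints X \<times> upoints Y,
     entourages = inf (filtercomap (map_prod fst fst) (entourages X))
                      (filtercomap (map_prod snd snd) (entourages Y)) \<rparr>"

definition is_fine_uniformity :: "'a topology \<Rightarrow> 'a uspace \<Rightarrow> bool" where
  "is_fine_uniformity X U \<longleftrightarrow>
     is_uspace U \<and> utopology U = X \<and>
     (\<forall>V. is_uspace V \<and> utopology V = X \<longrightarrow> entourages U \<le> entourages V)"

definition fine_uspace :: "'a topology \<Rightarrow> 'a uspace" where
  "fine_uspace X = (THE U. is_fine_uniformity X U)"

record 'a emetric =
  epoints :: "'a set"
  edist :: "'a \<Rightarrow> 'a \<Rightarrow> ennreal"

definition is_emetric :: "'a emetric \<Rightarrow> bool" where
  "is_emetric M \<longleftrightarrow>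
     (\<forall>x \<in> epoints M. \<forall>y \<in> epoints M. edist M x y = 0 \<longleftrightarrow> x = y) \<and>
     (\<forall>x \<in> epoints M. \<forall>y \<in> epoints M. edist M x y = edist M y x) \<and>
     (\<forall>x \<in> epoints M. \<forall>y \<in> epoints M. \<forall>z \<in> epoints M. edist M x z \<le> edist M x y + edist M y z)"

definition short_map :: "'a emetric \<Rightarrow> 'b emetric \<Rightarrow> ('a \<Rightarrow> 'b) \<Rightarrow> bool" where
  "short_map M N f \<longleftrightarrow>
     f \<in> epoints M \<rightarrow> epoints N \<and>
     (\<forall>x \<in> epoints M. \<forall>y \<in> epoints M. edist N (f x) (f y) \<le> edist M x y)"

definition metric_uspace :: "'a emetric \<Rightarrow> 'a uspace" where
  "metric_uspace M = \<lparr> upoints = epoints M,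
     entourages = (INF e\<in>{0<..}. principal {(x, y) \<in> epoints M \<times> epoints M. edist M x y < e}) \<rparr>"

definition metric_topology :: "'a emetric \<Rightarrow> 'a topology" where
  "metric_topology M = utopology (metric_uspace M)"


section \<open>The category of spaces\<close>

text \<open>
  In both definitions of objects, the index type of the diagram is the type of pairs of a diagram
  object and a map to the colimit.  This is no restriction: indices having the same object and
  the same leg of the colimit cocone can be merged without changing the colimit.
\<close>

definition T_space :: "'u topology \<Rightarrow> bool" where
  "T_space X \<longleftrightarrow> completely_regular_space X \<and> Hausdorff_space X \<and>
     (\<exists>(I :: ('u topology \<times> ('u \<Rightarrow> 'u)) set) (D :: _ \<Rightarrow> 'u topology) A h.
        (\<forall>i\<in>I. compact_space (D i) \<and> locally_connected_space (D i) \<and> second_countable (D i)) \<and>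
        is_colimit topspace topspace continuous_map continuous_map continuous_map (\<lambda>_. True)
          I D A h X)"

definition disk :: "nat \<Rightarrow> (nat \<Rightarrow> real) topology" where
  "disk n = subtopology (Euclidean_space n) {x. (\<Sum>i<n. x i ^ 2) \<le> 1}"

definition open_disk :: "nat \<Rightarrow> (nat \<Rightarrow> real) set" where
  "open_disk n = {x \<in> topspace (Euclidean_space n). (\<Sum>i<n. x i ^ 2) < 1}"

text \<open>
  The weak topology condition is automatic, since there are only finitely many cells.
\<close>

definition finite_CW_complex :: "'a topology \<Rightarrow> bool" where
  "finite_CW_complex K \<longleftrightarrow> Hausdorff_space K \<and>
     (\<exists>(I :: nat set) dm \<Phi>. finite I \<and>
        (\<forall>i\<in>I. continuous_map (disk (dm i)) K (\<Phi> i) \<and>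
           homeomorphic_map (subtopology (disk (dm i)) (open_disk (dm i)))
             (subtopology K (\<Phi> i ` open_disk (dm i))) (\<Phi> i)) \<and>
        disjoint_family_on (\<lambda>i. \<Phi> i ` open_disk (dm i)) I \<and>
        topspace K = (\<Union>i\<in>I. \<Phi> i ` open_disk (dm i)) \<and>
        (\<forall>i\<in>I. \<Phi> i ` (topspace (disk (dm i)) - open_disk (dm i)) \<subseteq>
           (\<Union>j \<in> {j \<in> I. dm j < dm i}. \<Phi> j ` open_disk (dm j))))"

definition finite_CW_type :: "'u topology \<Rightarrow> bool" where
  "finite_CW_type X \<longleftrightarrow> (\<exists>K :: 'u topology. finite_CW_complex K \<and> X homotopy_equivalent_space K)"


section \<open>The category of uniform spaces\<close>

definition U_object :: "'u itself \<Rightarrow> 'a uspace \<Rightarrow> bool" where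
  "U_object T X \<longleftrightarrow> separated X \<and>
     (\<exists>(I :: ('u emetric \<times> ('u \<Rightarrow> 'a)) set) (M :: _ \<Rightarrow> 'u emetric) A h.
        (\<forall>i\<in>I. is_emetric (M i) \<and> connected_space (metric_topology (M i)) \<and>
               locally_connected_space (metric_topology (M i))) \<and>
        is_colimit upoints upoints umap umap umap is_uspace I (\<lambda>i. metric_uspace (M i)) A h X)"

text \<open>
  Coreflections are bijective on points, since a one-point space is an object; they are normalized
  to be the identity on points.
\<close>

definition is_ucoref :: "'u itself \<Rightarrow> 'a uspace \<Rightarrow> 'a uspace \<Rightarrow> bool" where
  "is_ucoref T S C \<longleftrightarrow>
     U_object T C \<and> upoints C = upoints S \<and> umap C S (\<lambda>x. x) \<and>
     (\<forall>(W :: 'u uspace) f. U_object T W \<and> umap W S f \<longrightarrow> umap W C f)"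

definition ucoref :: "'u itself \<Rightarrow> 'a uspace \<Rightarrow> 'a uspace" where
  "ucoref T S = (THE C. is_ucoref T S C)"

definition U_prod :: "'u uspace \<Rightarrow> 'u uspace \<Rightarrow> ('u \<times> 'u) uspace" where
  "U_prod X Y = ucoref TYPE('u) (uprod X Y)"

definition uhom :: "'a uspace \<Rightarrow> 'b uspace \<Rightarrow> ('a \<Rightarrow> 'b) set" where
  "uhom X Y = {f \<in> extensional (upoints X). umap X Y f}"

definition is_U_exponential :: "'u uspace \<Rightarrow> 'u uspace \<Rightarrow> ('u \<Rightarrow> 'u) uspace \<Rightarrow> bool" where
  "is_U_exponential X Y E \<longleftrightarrow>
     U_object TYPE('u) E \<and> upoints E = uhom X Y \<and>
     (\<forall>(W :: 'u uspace) g. U_object TYPE('u) W \<and> g \<in> upoints W \<rightarrow> uhom X Y \<longrightarrow>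
        (umap W E g \<longleftrightarrow> umap (U_prod W X) Y (\<lambda>(w, x). g w x)))"

definition U_exponential :: "'u uspace \<Rightarrow> 'u uspace \<Rightarrow> ('u \<Rightarrow> 'u) uspace" where
  "U_exponential X Y = (THE E. is_U_exponential X Y E)"

definition U_hom :: "'u uspace \<Rightarrow> 'u uspace \<Rightarrow> ('u \<Rightarrow> 'u) topology" where
  "U_hom X Y = utopology (U_exponential X Y)"

definition U_hom_map :: "'a uspace \<Rightarrow> ('b \<Rightarrow> 'c) \<Rightarrow> ('a \<Rightarrow> 'b) \<Rightarrow> ('a \<Rightarrow> 'c)" where
  "U_hom_map Z f = (\<lambda>g. restrict (f \<circ> g) (upoints Z))"

definition uniform_Hurewicz_fibration :: "'u uspace \<Rightarrow> 'u uspace \<Rightarrow> ('u \<Rightarrow> 'u) \<Rightarrow> bool" where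
  "uniform_Hurewicz_fibration E Y f \<longleftrightarrow> umap E Y f \<and>
     (\<forall>Z :: 'u uspace. U_object TYPE('u) Z \<longrightarrow>
        (\<forall>\<gamma> e. continuous_map (top_of_set {0..1::real}) (U_hom Z Y) \<gamma> \<and>
               e \<in> topspace (U_hom Z E) \<and> U_hom_map Z f e = \<gamma> 0 \<longrightarrow>
           (\<exists>\<delta>. continuous_map (top_of_set {0..1::real}) (U_hom Z E) \<delta> \<and> \<delta> 0 = e \<and>
                (\<forall>t\<in>{0..1}. U_hom_map Z f (\<delta> t) = \<gamma> t))))"


section \<open>Cubical sets\<close>

text \<open>
  The poset \<open>[1]\<^sup>n\<close> is the set of Boolean lists of length \<open>n\<close>, and the monoidal product is
  concatenation of lists.
\<close>

definition verts :: "nat \<Rightarrow> bool list set" where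
  "verts n = {v. length v = n}"

inductive box_map :: "nat \<Rightarrow> nat \<Rightarrow> (bool list \<Rightarrow> bool list) \<Rightarrow> bool" where
  ident: "box_map n n (restrict (\<lambda>v. v) (verts n))"
| compose: "box_map l m \<phi> \<Longrightarrow> box_map m n \<psi> \<Longrightarrow> box_map l n (restrict (\<psi> \<circ> \<phi>) (verts l))"
| tensor: "box_map m n \<phi> \<Longrightarrow> box_map m' n' \<psi> \<Longrightarrow>
    box_map (m + m') (n + n') (restrict (\<lambda>v. \<phi> (take m v) @ \<psi> (drop m v)) (verts (m + m')))"
| coface: "box_map 0 1 (restrict (\<lambda>v. [b]) (verts 0))"
| codegeneracy: "box_map 1 0 (restrict (\<lambda>v. []) (verts 1))"
| join: "box_map 2 1 (restrict (\<lambda>v. [v ! 0 \<or> v ! 1]) (verts 2))"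

text \<open>
  \<open>action C m n \<phi>\<close> is the map from \<open>n\<close>-cells to \<open>m\<close>-cells induced by \<open>\<phi> : [1]\<^sup>m \<rightarrow> [1]\<^sup>n\<close>.
\<close>

record 'c cubical =
  cells :: "nat \<Rightarrow> 'c set"
  action :: "nat \<Rightarrow> nat \<Rightarrow> (bool list \<Rightarrow> bool list) \<Rightarrow> 'c \<Rightarrow> 'c"

definition cubical_set :: "'c cubical \<Rightarrow> bool" where
  "cubical_set C \<longleftrightarrow>
     (\<forall>m n \<phi>. box_map m n \<phi> \<longrightarrow> action C m n \<phi> \<in> cells C n \<rightarrow> cells C m) \<and>
     (\<forall>n. \<forall>c \<in> cells C n. action C n n (restrict (\<lambda>v. v) (verts n)) c = c) \<and>
     (\<forall>l m n \<phi> \<psi>. box_map l m \<phi> \<and> box_map m n \<psi> \<longrightarrow>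
        (\<forall>c \<in> cells C n.
           action C l n (restrict (\<psi> \<circ> \<phi>) (verts l)) c = action C l m \<phi> (action C m n \<psi> c)))"

definition cube :: "nat \<Rightarrow> real list emetric" where
  "cube n = \<lparr> epoints = {x. length x = n \<and> set x \<subseteq> {0..1}},
              edist = (\<lambda>x y. SUP i\<in>{..<n}. ennreal \<bar>x ! i - y ! i\<bar>) \<rparr>"

text \<open>The convex combination of the vertices \<open>p v\<close> of the \<open>n\<close>-cube with weights \<open>w v\<close>.\<close>

definition conv_comb ::
    "nat \<Rightarrow> (bool list \<Rightarrow> bool list) \<Rightarrow> bool list set \<Rightarrow> (bool list \<Rightarrow> real) \<Rightarrow> real list" where
  "conv_comb n p S w = map (\<lambda>i. \<Sum>v\<in>S. w v * of_bool (p v ! i)) [0..<n]"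

definition is_vert_chain :: "nat \<Rightarrow> bool list set \<Rightarrow> bool" where
  "is_vert_chain n S \<longleftrightarrow>
     S \<subseteq> verts n \<and> (\<forall>u\<in>S. \<forall>v\<in>S. list_all2 (\<le>) u v \<or> list_all2 (\<le>) v u)"

text \<open>
  \<open>g\<close> extends \<open>\<phi>\<close> linearly over the convex hull of each chain.  These hulls cover the cube, so
  \<open>g\<close> is determined on \<open>cube m\<close>.
\<close>

definition realizes :: "nat \<Rightarrow> nat \<Rightarrow> (bool list \<Rightarrow> bool list) \<Rightarrow> (real list \<Rightarrow> real list) \<Rightarrow> bool" where
  "realizes m n \<phi> g \<longleftrightarrow>
     (\<forall>S w. is_vert_chain m S \<and> (\<forall>v\<in>S. 0 \<le> w v) \<and> (\<Sum>v\<in>S. w v) = 1 \<longrightarrow>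
        g (conv_comb m (\<lambda>v. v) S w) = conv_comb n \<phi> S w)"

text \<open>
  The cocontinuous extension of a functor on cubes sends \<open>C\<close> to a colimit over the category of
  elements of \<open>C\<close>.
\<close>

definition element_indices :: "'c cubical \<Rightarrow> (nat \<times> 'c) set" where
  "element_indices C = (SIGMA n:UNIV. cells C n)"

definition element_arrows ::
    "'c cubical \<Rightarrow> ((nat \<times> 'c) \<times> (nat \<times> 'c) \<times> (real list \<Rightarrow> real list)) set" where
  "element_arrows C =
     {((m, action C m n \<phi> c), (n, c), g) | m n \<phi> c g. box_map m n \<phi> \<and> c \<in> cells C n \<and> realizes m n \<phi> g}"

definition is_geometric_realization :: "'u cubical \<Rightarrow> 'u emetric \<Rightarrow> bool" where
  "is_geometric_realization C R \<longleftrightarrow>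
     (\<exists>h. is_colimit epoints epoints short_map short_map short_map is_emetric
        (element_indices C) (\<lambda>(n, c). cube n) (element_arrows C) h R)"

definition is_topological_realization :: "'u cubical \<Rightarrow> 'u topology \<Rightarrow> bool" where
  "is_topological_realization C K \<longleftrightarrow>
     (\<exists>h. is_colimit topspace topspace continuous_map continuous_map continuous_map T_space
        (element_indices C) (\<lambda>(n, c). metric_topology (cube n)) (element_arrows C) h K)"

definition is_uniform_realization :: "'u cubical \<Rightarrow> 'u uspace \<Rightarrow> bool" where
  "is_uniform_realization C Z \<longleftrightarrow>
     (\<exists>R. is_geometric_realization C R \<and> Z = ucoref TYPE('u) (metric_uspace R))"


section \<open>Weak equivalences and cofibrant objects\<close>

text \<open>
  By the defining adjunction of the exponential, a path in the mapping space of maps from \<open>K\<close> to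
  \<open>X\<close> is a homotopy between such maps, so its path-components are the homotopy classes.
\<close>

definition pi0_maps :: "'a topology \<Rightarrow> 'b topology \<Rightarrow> ('a \<Rightarrow> 'b) set set" where
  "pi0_maps K X =
     {g. continuous_map K X g} //
     {(g, h). continuous_map K X g \<and> continuous_map K X h \<and> homotopic_with (\<lambda>_. True) K X g h}"

definition pi0_maps_map ::
    "'a topology \<Rightarrow> 'c topology \<Rightarrow> ('b \<Rightarrow> 'c) \<Rightarrow> ('a \<Rightarrow> 'b) set \<Rightarrow> ('a \<Rightarrow> 'c) set" where
  "pi0_maps_map K Y f P = {h. \<exists>g\<in>P. homotopic_with (\<lambda>_. True) K Y (f \<circ> g) h}"

definition classical_weak_equivalence ::
    "'u itself \<Rightarrow> 'a topology \<Rightarrow> 'b topology \<Rightarrow> ('a \<Rightarrow> 'b) \<Rightarrow> bool" where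
  "classical_weak_equivalence T X Y f \<longleftrightarrow> continuous_map X Y f \<and>
     (\<forall>(C :: 'u cubical) K. cubical_set C \<and> is_topological_realization C K \<longrightarrow>
        bij_betw (pi0_maps_map K Y f) (pi0_maps K X) (pi0_maps K Y))"

definition uniform_weak_equivalence :: "'u uspace \<Rightarrow> 'u uspace \<Rightarrow> ('u \<Rightarrow> 'u) \<Rightarrow> bool" where
  "uniform_weak_equivalence X Y f \<longleftrightarrow> umap X Y f \<and>
     (\<forall>(C :: 'u cubical) Z. cubical_set C \<and> is_uniform_realization C Z \<longrightarrow>
        classical_weak_equivalence TYPE('u) (U_hom Z X) (U_hom Z Y) (U_hom_map Z f))"

definition uniformly_cofibrant :: "'u uspace \<Rightarrow> bool" where
  "uniformly_cofibrant X \<longleftrightarrow> U_object TYPE('u) X \<and>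
     (\<forall>(E :: 'u uspace) (Y :: 'u uspace) p g.
        U_object TYPE('u) E \<and> U_object TYPE('u) Y \<and>
        uniform_weak_equivalence E Y p \<and> uniform_Hurewicz_fibration E Y p \<and> umap X Y g \<longrightarrow>
        (\<exists>l. umap X E l \<and> (\<forall>x \<in> upoints X. p (l x) = g x)))"

end

theory Submission
  imports Defs
begin

text \<open>
  Let \<open>p\<close> be both a uniform Hurewicz fibration and a uniform weak equivalence, and \<open>g\<close> a uniform map to
  its base, defined on a space \<open>X\<close> of finite CW type with its fine uniformity.  A map out of a fine
  uniformity is uniform as soon as it is continuous, so what is needed is a continuous lift of \<open>g\<close>.
  The idea is that the map of topological spaces underlying \<open>p\<close> is an acyclic fibration as far as
  finite CW complexes can detect.  Two facts of uniform topology give access to the underlying spaces.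

  Firstly, the mapping space out of the uniform realization of a point is the underlying space of the
  target, so \<open>p\<close> induces bijections on homotopy classes of continuous maps from topological
  realizations of cubical sets (\<open>weak_equivalence_underlying\<close>).

  Secondly, \<open>p\<close> has homotopy lifting in the topological sense over spaces in \<open>\<T>\<close>
  (\<open>fibration_lift_end\<close>, \<open>fibration_lift_compact\<close>).  Here a continuous homotopy has to be turned
  into a path in a mapping space in \<open>\<U>\<close>, and back.  The topology of a space in \<open>\<T>\<close> is final for
  maps out of Peano continua, whence its fine uniformity is an object of \<open>\<U>\<close>; exponentials in \<open>\<U>\<close>
  are constructed as final uniformities for families of metric spaces for which evaluation is
  uniform; and a connected metric space has bounded image under a map that stays uniform after all
  continuous changes of the target, which gives the uniform bounds needed for a homotopy to be a
  path (\<open>uniform_evaluation\<close>, \<open>homotopy_path\<close>).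

  The rest is homotopy theory with few spaces to test on.  The cubical sets used are families of
  \<open>n\<close>-cubes glued along their boundaries (locale \<open>glued_cubes\<close>), in particular spheres and bouquets
  of circles.  A large bouquet, with one circle for each point of a fibre, shows that fibres are
  path-connected (\<open>fiber_connected\<close>); then lifts over a box are vertically homotopic
  (\<open>vertical_homotopy\<close>).  A lift prescribed on the boundary of a box extends to the box because
  its image in the base is null-homotopic, hence so is the given map by injectivity on homotopy
  classes; the extension obtained is moved over the right map by a comparison of spheres
  (\<open>boundary_extends\<close>, \<open>box_extension\<close>).  So lifts over a finite CW complex are constructed cell by
  cell (\<open>finite_CW_lift\<close>), and homotopy lifting carries a lift along a homotopy equivalence
  (\<open>finite_CW_type_lift\<close>).
\<close>

section \<open>Uniform spaces and uniform maps\<close>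

lemma uspace_refl:
  "is_uspace X \<Longrightarrow> eventually P (entourages X) \<Longrightarrow> x \<in> upoints X \<Longrightarrow> P (x, x)"
  by (auto simp: is_uspace_def)

lemma uspace_sym:
  "is_uspace X \<Longrightarrow> eventually P (entourages X) \<Longrightarrow> eventually (\<lambda>(x, y). P (y, x)) (entourages X)"
  by (auto simp: is_uspace_def)

lemma uspace_half:
  assumes "is_uspace X" "eventually P (entourages X)"
  obtains Q where "eventually Q (entourages X)" "\<And>x y z. Q (x, y) \<Longrightarrow> Q (y, z) \<Longrightarrow> P (x, z)"
  using assms by (force simp: is_uspace_def)

lemma uspace_points:
  "is_uspace X \<Longrightarrow> eventually (\<lambda>(x, y). x \<in> upoints X \<and> y \<in> upoints X) (entourages X)"
  by (auto simp: is_uspace_def le_principal case_prod_unfold mem_Times_iff)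

lemma is_uspaceI:
  assumes "eventually (\<lambda>(x, y). x \<in> upoints X \<and> y \<in> upoints X) (entourages X)"
    and "\<And>P x. eventually P (entourages X) \<Longrightarrow> x \<in> upoints X \<Longrightarrow> P (x, x)"
    and "\<And>P. eventually P (entourages X) \<Longrightarrow> eventually (\<lambda>(x, y). P (y, x)) (entourages X)"
    and "\<And>P. eventually P (entourages X) \<Longrightarrow>
       \<exists>Q. eventually Q (entourages X) \<and> (\<forall>x y z. Q (x, y) \<longrightarrow> Q (y, z) \<longrightarrow> P (x, z))"
  shows "is_uspace X"
  using assms by (auto simp: is_uspace_def le_principal case_prod_unfold mem_Times_iff)

lemma umap_iff:
  "umap X Y f \<longleftrightarrow> f \<in> upoints X \<rightarrow> upoints Y \<and>
     (\<forall>P. eventually P (entourages Y) \<longrightarrow> eventually (\<lambda>(x, y). P (f x, f y)) (entourages X))"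
  by (auto simp: umap_def filterlim_iff map_prod_def case_prod_unfold)

lemma umap_points: "umap X Y f \<Longrightarrow> x \<in> upoints X \<Longrightarrow> f x \<in> upoints Y"
  by (auto simp: umap_def)

lemma umap_eventually:
  "umap X Y f \<Longrightarrow> eventually P (entourages Y) \<Longrightarrow> eventually (\<lambda>(x, y). P (f x, f y)) (entourages X)"
  by (auto simp: umap_iff)

lemma umap_comp: "umap X Y f \<Longrightarrow> umap Y Z g \<Longrightarrow> umap X Z (\<lambda>x. g (f x))"
  unfolding umap_iff by (auto simp: Pi_iff case_prod_unfold)

lemma umap_id: "umap X X (\<lambda>x. x)"
  by (auto simp: umap_iff)

lemma umap_cong:
  assumes X: "is_uspace X" and f: "umap X Y f" and eq: "\<And>x. x \<in> upoints X \<Longrightarrow> f x = g x"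
  shows "umap X Y g"
  unfolding umap_iff
proof (intro conjI allI impI)
  show "g \<in> upoints X \<rightarrow> upoints Y" using f eq by (auto simp: umap_iff Pi_iff)
  fix P assume "eventually P (entourages Y)"
  from umap_eventually[OF f this] uspace_points[OF X]
  show "eventually (\<lambda>(x, y). P (g x, g y)) (entourages X)"
    by eventually_elim (auto simp: eq)
qed

lemma umap_const:
  assumes "is_uspace Y" "c \<in> upoints Y"
  shows "umap X Y (\<lambda>x. c)"
  using assms by (auto simp: umap_iff case_prod_unfold intro: always_eventually dest: uspace_refl)

lemma umap_continuous:
  assumes X: "is_uspace X" and Y: "is_uspace Y" and f: "umap X Y f"
  shows "continuous_map (utopology X) (utopology Y) f"
proof -
  show ?thesis unfolding continuous_map topspace_utopology[OF X] topspace_utopology[OF Y]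
  proof (intro conjI allI impI)
    show "f ` upoints X \<subseteq> upoints Y" using f by (auto simp: umap_def)
    fix U assume U: "openin (utopology Y) U"
    show "openin (utopology X) {x \<in> upoints X. f x \<in> U}"
      unfolding openin_utopology
    proof (intro conjI ballI)
      fix x assume x: "x \<in> {x \<in> upoints X. f x \<in> U}"
      then have "eventually (\<lambda>(a, b). a = f x \<longrightarrow> b \<in> U) (entourages Y)"
        using U by (auto simp: openin_utopology)
      from umap_eventually[OF f this] uspace_points[OF X]
      show "\<forall>\<^sub>F (a, b) in entourages X. a = x \<longrightarrow> b \<in> {x \<in> upoints X. f x \<in> U}"
        by eventually_elim auto
    qed auto
  qed
qed

text \<open>
  The neighbourhoods of \<open>x\<close> in the uniform topology are the sections of entourages at \<open>x\<close>.
\<close>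

lemma utopology_nbhd:
  assumes X: "is_uspace X" and P: "eventually P (entourages X)" and x: "x \<in> upoints X"
  obtains U where "openin (utopology X) U" "x \<in> U" "\<And>y. y \<in> U \<Longrightarrow> P (x, y)"
proof -
  define U where "U = {y \<in> upoints X. eventually (\<lambda>(a, b). a = y \<longrightarrow> P (x, b)) (entourages X)}"
  have "openin (utopology X) U"
    unfolding openin_utopology
  proof (intro conjI ballI)
    fix y assume y: "y \<in> U"
    then have "eventually (\<lambda>(a, b). a = y \<longrightarrow> P (x, b)) (entourages X)" by (simp add: U_def)
    then obtain Q where Q: "eventually Q (entourages X)"
      "\<And>u v w. Q (u, v) \<Longrightarrow> Q (v, w) \<Longrightarrow> (case (u, w) of (a, b) \<Rightarrow> a = y \<longrightarrow> P (x, b))"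
      using uspace_half[OF X] by blast
    have *: "eventually (\<lambda>(a, c). a = b \<longrightarrow> P (x, c)) (entourages X)" if "Q (y, b)" for b
      using Q(1) by eventually_elim (use that Q(2) in auto)
    show "\<forall>\<^sub>F (a, b) in entourages X. a = y \<longrightarrow> b \<in> U"
      using Q(1) uspace_points[OF X] by eventually_elim (use * in \<open>auto simp: U_def\<close>)
  qed (auto simp: U_def)
  moreover have "x \<in> U" using P x by (auto simp: U_def elim!: eventually_mono)
  moreover have "P (x, y)" if "y \<in> U" for y
    using that uspace_refl[OF X, of "\<lambda>(a, b). a = y \<longrightarrow> P (x, b)" y] by (auto simp: U_def)
  ultimately show ?thesis using that by blast
qed

lemma Hausdorff_utopology:
  assumes X: "is_uspace X" and s: "separated X"
  shows "Hausdorff_space (utopology X)"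
  unfolding Hausdorff_space_def topspace_utopology[OF X]
proof (intro allI impI, elim conjE)
  fix x y assume xy: "x \<in> upoints X" "y \<in> upoints X" "x \<noteq> y"
  then obtain P where P: "eventually P (entourages X)" "\<not> P (x, y)"
    using s by (auto simp: separated_def)
  obtain Q where Q: "eventually Q (entourages X)" "\<And>x y z. Q (x, y) \<Longrightarrow> Q (y, z) \<Longrightarrow> P (x, z)"
    using uspace_half[OF X P(1)] by blast
  obtain U where U: "openin (utopology X) U" "x \<in> U" "\<And>z. z \<in> U \<Longrightarrow> Q (x, z)"
    using utopology_nbhd[OF X Q(1) xy(1)] by blast
  obtain V where V: "openin (utopology X) V" "y \<in> V" "\<And>z. z \<in> V \<Longrightarrow> Q (z, y)"
    by (rule utopology_nbhd[OF X uspace_sym[OF X Q(1)] xy(2)]) auto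
  show "\<exists>U V. openin (utopology X) U \<and> openin (utopology X) V \<and> x \<in> U \<and> y \<in> V \<and> disjnt U V"
    by (rule exI[of _ U], rule exI[of _ V]) (use U V Q(2) P(2) in \<open>unfold disjnt_iff, blast\<close>)
qed


subsection \<open>Constructions\<close>

definition upullback :: "'a set \<Rightarrow> ('a \<Rightarrow> 'b) \<Rightarrow> 'b uspace \<Rightarrow> 'a uspace" where
  "upullback S f Y = \<lparr> upoints = S,
     entourages = inf (filtercomap (map_prod f f) (entourages Y)) (principal (S \<times> S)) \<rparr>"

lemma eventually_upullback:
  "eventually P (entourages (upullback S f Y)) \<longleftrightarrow>
     (\<exists>Q. eventually Q (entourages Y) \<and> (\<forall>x\<in>S. \<forall>y\<in>S. Q (f x, f y) \<longrightarrow> P (x, y)))"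
  by (auto simp: upullback_def eventually_inf_principal eventually_filtercomap map_prod_def case_prod_unfold)

lemma is_uspace_upullback:
  assumes Y: "is_uspace Y" and f: "f \<in> S \<rightarrow> upoints Y"
  shows "is_uspace (upullback S f Y)"
proof (rule is_uspaceI)
  let ?X = "upullback S f Y"
  have [simp]: "upoints ?X = S" by (simp add: upullback_def)
  show "eventually (\<lambda>(x, y). x \<in> upoints ?X \<and> y \<in> upoints ?X) (entourages ?X)"
    by (auto simp: eventually_upullback intro: exI[of _ "\<lambda>_. True"])
  show "P (x, x)" if "eventually P (entourages ?X)" "x \<in> upoints ?X" for P x
    using that f by (auto simp: eventually_upullback Pi_iff) (metis uspace_refl[OF Y])
  show "eventually (\<lambda>(x, y). P (y, x)) (entourages ?X)" if "eventually P (entourages ?X)" for P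
  proof -
    obtain Q where "eventually Q (entourages Y)" "\<forall>x\<in>S. \<forall>y\<in>S. Q (f x, f y) \<longrightarrow> P (x, y)"
      using \<open>eventually P (entourages ?X)\<close> by (auto simp: eventually_upullback)
    then show ?thesis unfolding eventually_upullback
      by (intro exI[of _ "\<lambda>(x,y). Q (y,x)"]) (auto intro: uspace_sym[OF Y])
  qed
  show "\<exists>Q. eventually Q (entourages ?X) \<and> (\<forall>x y z. Q (x, y) \<longrightarrow> Q (y, z) \<longrightarrow> P (x, z))"
    if "eventually P (entourages ?X)" for P
  proof -
    obtain Q where Q: "eventually Q (entourages Y)" "\<forall>x\<in>S. \<forall>y\<in>S. Q (f x, f y) \<longrightarrow> P (x, y)"
      using \<open>eventually P (entourages ?X)\<close> by (auto simp: eventually_upullback)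
    obtain R where "eventually R (entourages Y)" "\<And>x y z. R (x, y) \<Longrightarrow> R (y, z) \<Longrightarrow> Q (x, z)"
      using uspace_half[OF Y Q(1)] by blast
    then show ?thesis using Q(2)
      by (intro exI[of _ "\<lambda>(x, y). x \<in> S \<and> y \<in> S \<and> R (f x, f y)"])
        (auto simp: eventually_upullback intro!: exI[of _ R])
  qed
qed

text \<open>The coarsest uniformity finer than two given ones, on the same points.\<close>

definition umeet :: "'a uspace \<Rightarrow> 'a uspace \<Rightarrow> 'a uspace" where
  "umeet X Y = \<lparr> upoints = upoints X, entourages = inf (entourages X) (entourages Y) \<rparr>"

lemma is_uspace_umeet:
  assumes X: "is_uspace X" and Y: "is_uspace Y" and eq: "upoints X = upoints Y"
  shows "is_uspace (umeet X Y)"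
proof (rule is_uspaceI)
  show "eventually (\<lambda>(x, y). x \<in> upoints (umeet X Y) \<and> y \<in> upoints (umeet X Y)) (entourages (umeet X Y))"
    using uspace_points[OF X] by (auto simp: umeet_def intro: filter_leD[OF inf_le1])
next
  fix P x assume "eventually P (entourages (umeet X Y))" "x \<in> upoints (umeet X Y)"
  then obtain Q R where "eventually Q (entourages X)" "eventually R (entourages Y)"
    "\<And>z. Q z \<Longrightarrow> R z \<Longrightarrow> P z" "x \<in> upoints X" by (auto simp: umeet_def eventually_inf)
  then show "P (x, x)" using uspace_refl[OF X] uspace_refl[OF Y] eq by metis
next
  fix P assume "eventually P (entourages (umeet X Y))"
  then obtain Q R where "eventually Q (entourages X)" "eventually R (entourages Y)"
    "\<And>z. Q z \<Longrightarrow> R z \<Longrightarrow> P z" by (auto simp: umeet_def eventually_inf)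
  then show "eventually (\<lambda>(x, y). P (y, x)) (entourages (umeet X Y))"
    unfolding umeet_def eventually_inf uspace.simps
    by (intro exI[of _ "\<lambda>(x, y). Q (y, x)"] exI[of _ "\<lambda>(x, y). R (y, x)"])
      (auto intro: uspace_sym[OF X] uspace_sym[OF Y])
next
  fix P assume "eventually P (entourages (umeet X Y))"
  then obtain Q R where QR: "eventually Q (entourages X)" "eventually R (entourages Y)"
    "\<And>z. Q z \<Longrightarrow> R z \<Longrightarrow> P z" by (auto simp: umeet_def eventually_inf)
  obtain Q' where Q': "eventually Q' (entourages X)" "\<And>x y z. Q' (x, y) \<Longrightarrow> Q' (y, z) \<Longrightarrow> Q (x, z)"
    using uspace_half[OF X QR(1)] by blast
  obtain R' where R': "eventually R' (entourages Y)" "\<And>x y z. R' (x, y) \<Longrightarrow> R' (y, z) \<Longrightarrow> R (x, z)"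
    using uspace_half[OF Y QR(2)] by blast
  have "eventually (\<lambda>z. Q' z \<and> R' z) (entourages (umeet X Y))"
    using Q'(1) R'(1) by (auto simp: umeet_def eventually_inf)
  then show "\<exists>Q. eventually Q (entourages (umeet X Y)) \<and> (\<forall>x y z. Q (x, y) \<longrightarrow> Q (y, z) \<longrightarrow> P (x, z))"
    using Q'(2) R'(2) QR(3) by (intro exI[of _ "\<lambda>z. Q' z \<and> R' z"]) auto
qed

lemma uprod_simps:
  "upoints (uprod X Y) = upoints X \<times> upoints Y"
  "eventually P (entourages (uprod X Y)) \<longleftrightarrow>
    (\<exists>Q R. eventually Q (entourages X) \<and> eventually R (entourages Y) \<and>
       (\<forall>x y x' y'. Q (x, x') \<longrightarrow> R (y, y') \<longrightarrow> P ((x, y), (x', y'))))"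
proof -
  show "upoints (uprod X Y) = upoints X \<times> upoints Y" by (simp add: uprod_def)
  have "eventually P (entourages (uprod X Y)) \<longleftrightarrow> (\<exists>Q' R'. (\<exists>Q. eventually Q (entourages X) \<and> (\<forall>z. Q (map_prod fst fst z) \<longrightarrow> Q' z)) \<and>
       (\<exists>R. eventually R (entourages Y) \<and> (\<forall>z. R (map_prod snd snd z) \<longrightarrow> R' z)) \<and> (\<forall>z. Q' z \<and> R' z \<longrightarrow> P z))"
    by (simp add: uprod_def eventually_inf eventually_filtercomap)
  also have "\<dots> \<longleftrightarrow> (\<exists>Q R. eventually Q (entourages X) \<and> eventually R (entourages Y) \<and>
       (\<forall>z. Q (map_prod fst fst z) \<longrightarrow> R (map_prod snd snd z) \<longrightarrow> P z))" (is "?L \<longleftrightarrow> ?R")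
  proof
    assume ?R
    then obtain Q R where "eventually Q (entourages X)" "eventually R (entourages Y)"
       "\<forall>z. Q (map_prod fst fst z) \<longrightarrow> R (map_prod snd snd z) \<longrightarrow> P z" by blast
    then show ?L
      by (intro exI[of _ "\<lambda>z. Q (map_prod fst fst z)"] exI[of _ "\<lambda>z. R (map_prod snd snd z)"]) auto
  qed blast
  finally show "eventually P (entourages (uprod X Y)) \<longleftrightarrow>
    (\<exists>Q R. eventually Q (entourages X) \<and> eventually R (entourages Y) \<and>
       (\<forall>x y x' y'. Q (x, x') \<longrightarrow> R (y, y') \<longrightarrow> P ((x, y), (x', y'))))"
    by (simp add: map_prod_def case_prod_unfold split_paired_All)
qed

lemma is_uspace_uprod:
  assumes X: "is_uspace X" and Y: "is_uspace Y"
  shows "is_uspace (uprod X Y)"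
proof (rule is_uspaceI)
  show "eventually (\<lambda>(x, y). x \<in> upoints (uprod X Y) \<and> y \<in> upoints (uprod X Y)) (entourages (uprod X Y))"
    unfolding uprod_simps using uspace_points[OF X] uspace_points[OF Y] by fastforce
next
  fix P x assume "eventually P (entourages (uprod X Y))" "x \<in> upoints (uprod X Y)"
  then obtain Q R where "eventually Q (entourages X)" "eventually R (entourages Y)"
    "\<And>x y x' y'. Q (x, x') \<Longrightarrow> R (y, y') \<Longrightarrow> P ((x, y), (x', y'))" "fst x \<in> upoints X" "snd x \<in> upoints Y"
    unfolding uprod_simps by auto
  then show "P (x, x)" using uspace_refl[OF X, of Q "fst x"] uspace_refl[OF Y, of R "snd x"]
    by (metis prod.collapse)
next
  fix P assume "eventually P (entourages (uprod X Y))"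
  then obtain Q R where QR: "eventually Q (entourages X)" "eventually R (entourages Y)"
    "\<And>x y x' y'. Q (x, x') \<Longrightarrow> R (y, y') \<Longrightarrow> P ((x, y), (x', y'))" unfolding uprod_simps by blast
  show "eventually (\<lambda>(x, y). P (y, x)) (entourages (uprod X Y))"
    unfolding uprod_simps
    by (rule exI[of _ "\<lambda>(x, y). Q (y, x)"], rule exI[of _ "\<lambda>(x, y). R (y, x)"])
      (use uspace_sym[OF X QR(1)] uspace_sym[OF Y QR(2)] QR(3) in auto)
next
  fix P assume "eventually P (entourages (uprod X Y))"
  then obtain Q R where QR: "eventually Q (entourages X)" "eventually R (entourages Y)"
    "\<And>x y x' y'. Q (x, x') \<Longrightarrow> R (y, y') \<Longrightarrow> P ((x, y), (x', y'))" unfolding uprod_simps by blast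
  obtain Q' where Q': "eventually Q' (entourages X)" "\<And>x y z. Q' (x, y) \<Longrightarrow> Q' (y, z) \<Longrightarrow> Q (x, z)"
    using uspace_half[OF X QR(1)] by blast
  obtain R' where R': "eventually R' (entourages Y)" "\<And>x y z. R' (x, y) \<Longrightarrow> R' (y, z) \<Longrightarrow> R (x, z)"
    using uspace_half[OF Y QR(2)] by blast
  show "\<exists>Q. eventually Q (entourages (uprod X Y)) \<and> (\<forall>x y z. Q (x, y) \<longrightarrow> Q (y, z) \<longrightarrow> P (x, z))"
    unfolding uprod_simps using Q' R' QR(3)
    by (intro exI[of _ "\<lambda>((x,y),(x',y')). Q' (x,x') \<and> R' (y,y')"]) auto
qed

lemma umap_uprod_iff:
  "umap W (uprod X Y) f \<longleftrightarrow> umap W X (\<lambda>w. fst (f w)) \<and> umap W Y (\<lambda>w. snd (f w))"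
proof
  assume f: "umap W (uprod X Y) f"
  have "umap (uprod X Y) X fst"
    unfolding umap_iff
  proof (intro conjI allI impI)
    fix P assume "eventually P (entourages X)"
    then show "eventually (\<lambda>(x, y). P (fst x, fst y)) (entourages (uprod X Y))"
      unfolding uprod_simps by (intro exI[of _ P] exI[of _ "\<lambda>_. True"]) auto
  qed (auto simp: uprod_simps)
  moreover have "umap (uprod X Y) Y snd"
    unfolding umap_iff
  proof (intro conjI allI impI)
    fix P assume "eventually P (entourages Y)"
    then show "eventually (\<lambda>(x, y). P (snd x, snd y)) (entourages (uprod X Y))"
      unfolding uprod_simps by (intro exI[of _ "\<lambda>_. True"] exI[of _ P]) auto
  qed (auto simp: uprod_simps)
  ultimately show "umap W X (\<lambda>w. fst (f w)) \<and> umap W Y (\<lambda>w. snd (f w))"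
    using umap_comp[OF f, of X fst] umap_comp[OF f, of Y snd] by simp
next
  assume a: "umap W X (\<lambda>w. fst (f w)) \<and> umap W Y (\<lambda>w. snd (f w))"
  show "umap W (uprod X Y) f"
    unfolding umap_iff
  proof (intro conjI allI impI)
    show "f \<in> upoints W \<rightarrow> upoints (uprod X Y)" using a
       by (auto simp: umap_def uprod_simps Pi_iff mem_Times_iff)
    fix P assume "eventually P (entourages (uprod X Y))"
    then obtain Q R where QR: "eventually Q (entourages X)" "eventually R (entourages Y)"
      "\<And>x y x' y'. Q (x, x') \<Longrightarrow> R (y, y') \<Longrightarrow> P ((x, y), (x', y'))" unfolding uprod_simps by blast
    have P: "P (u, v)" if "Q (fst u, fst v)" "R (snd u, snd v)" for u v
      using QR(3)[OF that] unfolding prod.collapse .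
    from umap_eventually[OF conjunct1[OF a] QR(1)] umap_eventually[OF conjunct2[OF a] QR(2)]
    show "eventually (\<lambda>(x, y). P (f x, f y)) (entourages W)"
      by eventually_elim (clarsimp simp del: split_paired_All, rule P)
  qed
qed

section \<open>Uniform pseudometrics\<close>

definition pseudometric_on :: "'a set \<Rightarrow> ('a \<Rightarrow> 'a \<Rightarrow> real) \<Rightarrow> bool" where
  "pseudometric_on S d \<longleftrightarrow> (\<forall>x\<in>S. d x x = 0) \<and> (\<forall>x\<in>S. \<forall>y\<in>S. d x y = d y x) \<and>
     (\<forall>x\<in>S. \<forall>y\<in>S. \<forall>z\<in>S. d x z \<le> d x y + d y z)"

lemma pseudometric_on_nonneg: "pseudometric_on S d \<Longrightarrow> x \<in> S \<Longrightarrow> y \<in> S \<Longrightarrow> 0 \<le> d x y"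
  unfolding pseudometric_on_def by (smt (verit, best))

definition uniform_pseudometric :: "'a uspace \<Rightarrow> ('a \<Rightarrow> 'a \<Rightarrow> real) \<Rightarrow> bool" where
  "uniform_pseudometric X d \<longleftrightarrow> pseudometric_on (upoints X) d \<and>
     (\<forall>e>0. eventually (\<lambda>(x, y). d x y < e) (entourages X))"

definition pm_uspace :: "'a set \<Rightarrow> ('a \<Rightarrow> 'a \<Rightarrow> real) \<Rightarrow> 'a uspace" where
  "pm_uspace S d = \<lparr> upoints = S,
     entourages = (INF e\<in>{0<..}. principal {(x, y) \<in> S \<times> S. d x y < e}) \<rparr>"

lemma upoints_pm_uspace [simp]: "upoints (pm_uspace S d) = S"
  by (simp add: pm_uspace_def)

lemma eventually_pm_uspace:
  "eventually P (entourages (pm_uspace S d)) \<longleftrightarrow> (\<exists>e>0. \<forall>x\<in>S. \<forall>y\<in>S. d x y < e \<longrightarrow> P (x, y))"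
proof -
  have "eventually P (entourages (pm_uspace S d)) \<longleftrightarrow>
      (\<exists>e\<in>{0<..}. eventually P (principal {(x, y) \<in> S \<times> S. d x y < e}))"
    unfolding pm_uspace_def uspace.simps
  proof (rule eventually_INF_base)
    fix a b :: real assume "a \<in> {0<..}" "b \<in> {0<..}"
    then show "\<exists>x\<in>{0<..}. principal {(x', y) \<in> S \<times> S. d x' y < x} \<le>
      inf (principal {(x, y) \<in> S \<times> S. d x y < a}) (principal {(x, y) \<in> S \<times> S. d x y < b})"
      by (intro bexI[of _ "min a b"]) auto
  qed auto
  then show ?thesis by (auto simp: eventually_principal)
qed

lemma is_uspace_pm_uspace:
  assumes d: "pseudometric_on S d"
  shows "is_uspace (pm_uspace S d)"
proof (rule is_uspaceI)
  show "\<exists>Q. eventually Q (entourages (pm_uspace S d)) \<and> (\<forall>x y z. Q (x, y) \<longrightarrow> Q (y, z) \<longrightarrow> P (x, z))"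
    if P: "eventually P (entourages (pm_uspace S d))" for P
  proof -
    obtain e where e: "e > 0" "\<forall>x\<in>S. \<forall>y\<in>S. d x y < e \<longrightarrow> P (x, y)"
      using P unfolding eventually_pm_uspace by blast
    have *: "P (x, z)" if "x \<in> S" "y \<in> S" "z \<in> S" "d x y < e/2" "d y z < e/2" for x y z
    proof -
      have "d x z \<le> d x y + d y z" using d that by (auto simp: pseudometric_on_def)
      then have "d x z < e" using that by linarith
      then show ?thesis using e that by auto
    qed
    have "eventually (\<lambda>(x, y). x \<in> S \<and> y \<in> S \<and> d x y < e/2) (entourages (pm_uspace S d))"
      using e by (auto simp: eventually_pm_uspace intro!: exI[of _ "e/2"])
    then show ?thesis
      by (intro exI[of _ "\<lambda>(x, y). x \<in> S \<and> y \<in> S \<and> d x y < e/2"]) (auto intro: *)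
  qed
qed (use d in \<open>auto simp: eventually_pm_uspace pseudometric_on_def intro: exI[of _ 1]\<close>)

lemma umap_pm_uspace_iff:
  "umap X (pm_uspace S d) f \<longleftrightarrow> f \<in> upoints X \<rightarrow> S \<and>
     (\<forall>e>0. eventually (\<lambda>(x, y). f x \<in> S \<and> f y \<in> S \<and> d (f x) (f y) < e) (entourages X))"
  (is "?L \<longleftrightarrow> ?R")
proof
  assume L: ?L
  have "eventually (\<lambda>(x, y). f x \<in> S \<and> f y \<in> S \<and> d (f x) (f y) < e) (entourages X)" if "e > 0" for e
    using umap_eventually[OF L, of "\<lambda>(x, y). x \<in> S \<and> y \<in> S \<and> d x y < e"] that
    by (auto simp: eventually_pm_uspace)
  then show ?R using L by (auto simp: umap_def)
next
  assume R: ?R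
  show ?L unfolding umap_iff eventually_pm_uspace upoints_pm_uspace
  proof (intro conjI allI impI)
    fix P assume "\<exists>e>0. \<forall>x\<in>S. \<forall>y\<in>S. d x y < e \<longrightarrow> P (x, y)"
    then obtain e where e: "e > 0" "\<forall>x\<in>S. \<forall>y\<in>S. d x y < e \<longrightarrow> P (x, y)" by blast
    have "eventually (\<lambda>(x, y). f x \<in> S \<and> f y \<in> S \<and> d (f x) (f y) < e) (entourages X)" using R e by blast
    then show "\<forall>\<^sub>F (x, y) in entourages X. P (f x, f y)"
      by eventually_elim (use e in auto)
  qed (use R in auto)
qed

fun chain_length :: "('a \<Rightarrow> 'a \<Rightarrow> real) \<Rightarrow> 'a list \<Rightarrow> real" where
  "chain_length g [] = 0"
| "chain_length g [x] = 0"
| "chain_length g (x # y # zs) = g x y + chain_length g (y # zs)"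

lemma chain_length_append:
  "chain_length g (as @ a # b # bs) = chain_length g (as @ [a]) + g a b + chain_length g (b # bs)"
  by (induction as rule: induct_list012) auto

lemma chain_length_join:
  "chain_length g (as @ a # bs) = chain_length g (as @ [a]) + chain_length g (a # bs)"
  by (induction as rule: induct_list012) auto

lemma chain_length_nonneg: "(\<And>x y. 0 \<le> g x y) \<Longrightarrow> 0 \<le> chain_length g zs"
  by (induction zs rule: induct_list012) auto

lemma chain_split:
  assumes "length zs \<ge> 2" "0 \<le> t" "t \<le> chain_length g zs"
  shows "\<exists>as a b bs. zs = as @ a # b # bs \<and> chain_length g (as @ [a]) \<le> t \<and>
    chain_length g (b # bs) \<le> chain_length g zs - t"
  using assms
proof (induction zs arbitrary: t rule: induct_list012)
  case (3 x y r)
  show ?case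
  proof (cases "t \<le> g x y")
    case True
    then show ?thesis using 3 by (intro exI[of _ "[]"] exI[of _ x] exI[of _ y] exI[of _ r]) auto
  next
    case False
    then have "r \<noteq> []" using "3.prems" by auto
    then have len: "length (y # r) \<ge> 2" by (cases r) auto
    obtain as a b bs where *: "y # r = as @ a # b # bs" "chain_length g (as @ [a]) \<le> t - g x y"
       "chain_length g (b # bs) \<le> chain_length g (y # r) - (t - g x y)"
      using "3.IH"(2)[of "t - g x y"] len False "3.prems" by auto
    have "chain_length g ((x # as) @ [a]) = g x y + chain_length g (as @ [a])"
      using *(1) by (cases as) auto
    moreover have "x # y # r = (x # as) @ a # b # bs" using *(1) by simp
    moreover have "chain_length g (x # y # r) = g x y + chain_length g (y # r)" by simp
    ultimately have "x # y # r = (x # as) @ a # b # bs \<and> chain_length g ((x # as) @ [a]) \<le> t \<and>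
      chain_length g (b # bs) \<le> chain_length g (x # y # r) - t" using *(2,3) by linarith
    then show ?thesis by blast
  qed
qed auto

text \<open>
  Metrization lemma: a sequence of entourages each of which contains the threefold composite of
  the next is comparable with a pseudometric, the infimum of the lengths of chains where a step in
  the \<open>n\<close>-th entourage costs \<open>2\<^sup>-\<^sup>n\<close>.  Cutting a chain at half its length shows by induction
  that chains of length less than \<open>2\<^sup>-\<^sup>n\<close> stay in the \<open>n\<close>-th entourage.
\<close>

lemma entourage_pseudometric:
  assumes X: "is_uspace X" and P: "eventually P (entourages X)"
  obtains d where "uniform_pseudometric X d" "\<And>x y. d x y \<le> 1"
    "\<And>x y. x \<in> upoints X \<Longrightarrow> y \<in> upoints X \<Longrightarrow> d x y < 1 \<Longrightarrow> P (x, y)"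
proof -
  let ?E = "\<lambda>V. eventually V (entourages X)"
  have "\<exists>U. \<forall>n. ?E (U n) \<and> ((\<forall>x y z w. U (Suc n) (x, y) \<longrightarrow> U (Suc n) (y, z) \<longrightarrow> U (Suc n) (z, w) \<longrightarrow> U n (x, w))
     \<and> U (Suc n) \<le> P)" (is "\<exists>U. \<forall>n. _ \<and> ?Q (U n) (U (Suc n))")
  proof (rule dependent_nat_choice)
    show "\<exists>V. ?E V" using eventually_True by blast
    fix V assume "?E V"
    then obtain V1 where V1: "?E V1" "\<And>x y z. V1 (x, y) \<Longrightarrow> V1 (y, z) \<Longrightarrow> V (x, z)"
      using uspace_half[OF X] by blast
    obtain V2 where V2: "?E V2" "\<And>x y z. V2 (x, y) \<Longrightarrow> V2 (y, z) \<Longrightarrow> V1 (x, z)"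
      using uspace_half[OF X V1(1)] by blast
    have "?E (\<lambda>z. V1 z \<and> V2 z \<and> P z)" using V1(1) V2(1) P by eventually_elim auto
    moreover have "?Q V (\<lambda>z. V1 z \<and> V2 z \<and> P z)" using V1(2) V2(2) by (auto simp: le_fun_def)
    ultimately show "\<exists>V'. ?E V' \<and> ?Q V V'" by blast
  qed
  then obtain U' where U': "\<And>n. ?E (U' n)" "\<And>n. ?Q (U' n) (U' (Suc n))" by blast
  define S where "S = upoints X"
  define U where "U n = (if n = 0 then (\<lambda>_. True) else U' n)" for n
  have UE: "?E (U n)" for n using U' by (simp add: U_def)
  have U3: "U n (x, w)" if "U (Suc n) (x, y)" "U (Suc n) (y, z)" "U (Suc n) (z, w)" for n x y z w
    using that U'(2)[of n] unfolding U_def by (cases n) auto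
  have UP: "P z" if "U (Suc 0) z" for z using that U'(2)[of 0] by (cases z) (auto simp: U_def le_fun_def)
  have Ur: "U n (x, x)" if "x \<in> S" for n x using uspace_refl[OF X UE[of n], of x] that by (simp add: S_def)
  have Usuc: "U n (x, y)" if "U (Suc n) (x, y)" "x \<in> S" "y \<in> S" for n x y
    using U3[of n x x y y] that Ur by blast
  have Umono: "U n (x, y)" if "U m (x, y)" "m \<ge> n" "x \<in> S" "y \<in> S" for n m x y
    using that(2,1) by (induction m rule: dec_induct) (auto intro: Usuc that(3,4))
  define g :: "'a \<Rightarrow> 'a \<Rightarrow> real" where "g x y = (INF n\<in>{n. U n (x, y)}. (1/2)^n)" for x y
  have ne: "{n. U n (x, y)} \<noteq> {}" for x y by (auto simp: U_def intro: exI[of _ 0])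
  have bdd: "bdd_below ((\<lambda>n. (1/2::real)^n) ` A)" for A by (rule bdd_belowI[of _ 0]) auto
  have g0: "0 \<le> g x y" for x y unfolding g_def by (rule cINF_greatest[OF ne]) auto
  have gU: "g x y \<le> (1/2)^n" if "U n (x, y)" for n x y
    unfolding g_def by (rule cINF_lower[OF bdd]) (use that in auto)
  have Ug: "U (Suc n) (x, y)" if gl: "g x y < (1/2)^n" and "x \<in> S" "y \<in> S" for n x y
  proof -
    obtain m where m: "U m (x, y)" "(1/2::real)^m < (1/2)^n"
      using gl cINF_less_iff[OF ne[of x y] bdd, of "(1/2)^n"] unfolding g_def by blast
    have "m \<ge> Suc n"
    proof (rule ccontr)
      assume "\<not> m \<ge> Suc n"
      then have "(1/2::real)^n \<le> (1/2)^m" by (intro power_decreasing) auto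
      then show False using m(2) by simp
    qed
    then show ?thesis using Umono[OF m(1)] that(2,3) by blast
  qed
  have chain: "U n (hd zs, last zs)"
    if "zs \<noteq> []" "set zs \<subseteq> S" "chain_length g zs < (1/2)^n" for n zs
    using that
  proof (induction "length zs" arbitrary: zs n rule: less_induct)
    case less
    show ?case
    proof (cases "length zs \<ge> 2")
      case False
      then obtain x where "zs = [x]" using less.prems by (cases zs; cases "tl zs") auto
      then show ?thesis using Ur less.prems by auto
    next
      case True
      let ?s = "chain_length g zs"
      have s0: "0 \<le> ?s" by (rule chain_length_nonneg[OF g0])
      obtain as a b bs where zs: "zs = as @ a # b # bs" and 1: "chain_length g (as @ [a]) \<le> ?s / 2"
         and 2: "chain_length g (b # bs) \<le> ?s - ?s / 2"
        using chain_split[OF True, of "?s/2" g] s0 by auto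
      have half: "?s / 2 < (1/2)^Suc n" using less.prems by simp
      have "U (Suc n) (hd (as @ [a]), last (as @ [a]))"
        by (rule less.hyps) (use zs 1 half less.prems in auto)
      moreover have "U (Suc n) (hd (b # bs), last (b # bs))"
        by (rule less.hyps) (use zs 2 half less.prems in auto)
      moreover have "g a b \<le> ?s" using chain_length_append[of g as a b bs] zs
         chain_length_nonneg[of g "as @ [a]", OF g0] chain_length_nonneg[of g "b # bs", OF g0] by auto
      then have "U (Suc n) (a, b)" using Ug[of a b n] less.prems zs by auto
      ultimately have "U n (hd (as @ [a]), last (b # bs))" using U3 by auto
      moreover have "hd (as @ [a]) = hd zs" "last (b # bs) = last zs" using zs by (auto simp: hd_append)
      ultimately show ?thesis by simp
    qed
  qed
  define C where "C x y = {zs. zs \<noteq> [] \<and> set zs \<subseteq> S \<and> hd zs = x \<and> last zs = y}" for x y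
  define \<delta> where "\<delta> x y = (INF zs\<in>C x y. chain_length g zs)" for x y
  have bC: "bdd_below (chain_length g ` A)" for A
    by (rule bdd_belowI[of _ 0]) (auto simp: chain_length_nonneg g0)
  have Cxy: "[x, y] \<in> C x y" if "x \<in> S" "y \<in> S" for x y using that by (auto simp: C_def)
  have \<delta>0: "0 \<le> \<delta> x y" if "x \<in> S" "y \<in> S" for x y
    unfolding \<delta>_def by (rule cINF_greatest) (use Cxy[OF that] in \<open>auto simp: chain_length_nonneg g0\<close>)
  have \<delta>g: "\<delta> x y \<le> g x y" if "x \<in> S" "y \<in> S" for x y
    using cINF_lower[OF bC, of "[x, y]" "C x y"] Cxy[OF that] by (auto simp: \<delta>_def)
  have \<delta>U: "U n (x, y)" if gl: "\<delta> x y < (1/2)^n" and xS: "x \<in> S" and yS: "y \<in> S" for n x y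
  proof -
    obtain zs where "zs \<in> C x y" "chain_length g zs < (1/2)^n"
      using gl Cxy[OF xS yS] cINF_less_iff[OF _ bC, of "C x y" "(1/2)^n"]
      unfolding \<delta>_def by blast
    then show ?thesis using chain[of zs n] by (auto simp: C_def)
  qed
  have tri: "\<delta> x z \<le> \<delta> x y + \<delta> y z" if xS: "x \<in> S" and yS: "y \<in> S" and zS: "z \<in> S" for x y z
  proof (rule field_le_epsilon)
    fix e :: real assume e: "e > 0"
    obtain as where as: "as \<in> C x y" "chain_length g as < \<delta> x y + e/2"
      using cINF_less_iff[OF _ bC, of "C x y" "\<delta> x y + e/2"] Cxy[OF xS yS] e
      unfolding \<delta>_def[symmetric] by fastforce
    obtain bs where bs: "bs \<in> C y z" "chain_length g bs < \<delta> y z + e/2"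
      using cINF_less_iff[OF _ bC, of "C y z" "\<delta> y z + e/2"] Cxy[OF yS zS] e
      unfolding \<delta>_def[symmetric] by fastforce
    obtain as' where as': "as = as' @ [y]" using as(1) unfolding C_def
      by (cases as rule: rev_cases) auto
    obtain bs' where bs': "bs = y # bs'" using bs(1) unfolding C_def by (cases bs) auto
    have "as' @ y # bs' \<in> C x z" using as(1) bs(1) unfolding as' bs'
      by (cases as') (auto simp: C_def split: if_splits)
    then have "\<delta> x z \<le> chain_length g (as' @ y # bs')" unfolding \<delta>_def by (rule cINF_lower[OF bC])
    also have "\<dots> = chain_length g as + chain_length g bs"
      using chain_length_join[of g as' y bs'] as' bs' by simp
    finally show "\<delta> x z \<le> \<delta> x y + \<delta> y z + e" using as bs by linarith
  qed
  have \<delta>r: "\<delta> x x = 0" if "x \<in> S" for x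
  proof -
    have "[x] \<in> C x x" using that by (auto simp: C_def)
    then have "\<delta> x x \<le> chain_length g [x]" unfolding \<delta>_def by (rule cINF_lower[OF bC])
    then show ?thesis using \<delta>0[OF that that] by simp
  qed
  define d where "d x y = min 1 (2 * (\<delta> x y + \<delta> y x))" for x y
  have "pseudometric_on S d"
    unfolding pseudometric_on_def
  proof (intro conjI ballI)
    fix x y z assume S: "x \<in> S" "y \<in> S" "z \<in> S"
    show "d x z \<le> d x y + d y z"
      using tri[OF S] tri[of z y x] S \<delta>0[of x y] \<delta>0[of y x] \<delta>0[of y z] \<delta>0[of z y] by (auto simp: d_def)
  qed (auto simp: d_def \<delta>r add.commute)
  moreover have "eventually (\<lambda>(x, y). d x y < e) (entourages X)" if e: "e > 0" for e
  proof -
    obtain n where n: "(1/2::real)^n < e/4" using e real_arch_pow_inv[of "e/4" "1/2"] by auto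
    from UE[of n] uspace_sym[OF X UE[of n]] uspace_points[OF X] show ?thesis
    proof eventually_elim
      case (elim z)
      obtain x y where [simp]: "z = (x, y)" by fastforce
      have "x \<in> S" "y \<in> S" "U n (x, y)" "U n (y, x)" using elim by (auto simp: S_def)
      then have "\<delta> x y < e/4" "\<delta> y x < e/4" using \<delta>g gU n by (meson le_less_trans order.trans)+
      then show ?case by (auto simp: d_def)
    qed
  qed
  ultimately have "uniform_pseudometric X d" by (simp add: uniform_pseudometric_def S_def)
  moreover have "P (x, y)" if "x \<in> upoints X" "y \<in> upoints X" "d x y < 1" for x y
  proof -
    have "\<delta> x y < (1/2)^Suc 0" using that \<delta>0[of y x] by (auto simp: d_def S_def)
    then show ?thesis using \<delta>U UP that by (auto simp: S_def)
  qed
  ultimately show ?thesis using that[of d] by (auto simp: d_def)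
qed

lemma umap_pseudometricI:
  assumes Y: "is_uspace Y" and X: "is_uspace X" and f: "\<And>x. x \<in> upoints X \<Longrightarrow> f x \<in> upoints Y"
    and d: "\<And>d e. uniform_pseudometric Y d \<Longrightarrow> (\<And>x y. d x y \<le> 1) \<Longrightarrow> e > 0 \<Longrightarrow>
      eventually (\<lambda>(x, y). d (f x) (f y) < e) (entourages X)"
  shows "umap X Y f"
  unfolding umap_iff
proof (intro conjI allI impI)
  fix P assume "eventually P (entourages Y)"
  then obtain \<rho> where \<rho>: "uniform_pseudometric Y \<rho>" "\<And>x y. \<rho> x y \<le> 1"
    "\<And>x y. x \<in> upoints Y \<Longrightarrow> y \<in> upoints Y \<Longrightarrow> \<rho> x y < 1 \<Longrightarrow> P (x, y)"
    using entourage_pseudometric[OF Y] by metis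
  have "\<forall>\<^sub>F (x, y) in entourages X. \<rho> (f x) (f y) < 1" by (rule d[OF \<rho>(1,2)]) auto
  then show "\<forall>\<^sub>F (x, y) in entourages X. P (f x, f y)"
    using uspace_points[OF X] by eventually_elim (use \<rho>(3) f in auto)
qed (use f in auto)


section \<open>Extended metric spaces as uniform spaces\<close>

lemma upoints_metric_uspace [simp]: "upoints (metric_uspace M) = epoints M"
  by (simp add: metric_uspace_def)

lemma eventually_metric_uspace:
  "eventually P (entourages (metric_uspace M)) \<longleftrightarrow>
     (\<exists>e>0. \<forall>x\<in>epoints M. \<forall>y\<in>epoints M. edist M x y < ennreal e \<longrightarrow> P (x, y))"
proof -
  have "eventually P (entourages (metric_uspace M)) \<longleftrightarrow>
      (\<exists>e\<in>{0<..}. eventually P (principal {(x, y) \<in> epoints M \<times> epoints M. edist M x y < e}))"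
    unfolding metric_uspace_def uspace.simps
  proof (rule eventually_INF_base)
    fix a b :: ennreal assume "a \<in> {0<..}" "b \<in> {0<..}"
    then show "\<exists>x\<in>{0<..}. principal {(x', y) \<in> epoints M \<times> epoints M. edist M x' y < x} \<le>
      inf (principal {(x, y) \<in> epoints M \<times> epoints M. edist M x y < a})
          (principal {(x, y) \<in> epoints M \<times> epoints M. edist M x y < b})"
      by (intro bexI[of _ "min a b"]) auto
  qed (metis empty_iff greaterThan_iff zero_less_one)
  also have "\<dots> \<longleftrightarrow> (\<exists>e>0. \<forall>x\<in>epoints M. \<forall>y\<in>epoints M. edist M x y < ennreal e \<longrightarrow> P (x, y))"
  proof (intro iffI; elim bexE exE conjE)
    fix e :: ennreal assume e: "e \<in> {0<..}" "eventually P (principal {(x, y) \<in> epoints M \<times> epoints M. edist M x y < e})"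
    obtain r :: real where r: "r > 0" "ennreal r \<le> e"
    proof (cases e)
      case (real r)
      then show ?thesis using e that[of r] by (auto simp: less_le)
    next
      case top
      then show ?thesis using that[of 1] by auto
    qed
    then show "\<exists>e>0. \<forall>x\<in>epoints M. \<forall>y\<in>epoints M. edist M x y < ennreal e \<longrightarrow> P (x, y)"
      using e(2) by (intro exI[of _ r]) (auto simp: eventually_principal)
  next
    fix e :: real assume "e > 0" "\<forall>x\<in>epoints M. \<forall>y\<in>epoints M. edist M x y < ennreal e \<longrightarrow> P (x, y)"
    then show "\<exists>e\<in>{0<..}. eventually P (principal {(x, y) \<in> epoints M \<times> epoints M. edist M x y < e})"
      by (intro bexI[of _ "ennreal e"]) (auto simp: eventually_principal)
  qed
  finally show ?thesis .
qed

lemma emetric_refl: "is_emetric M \<Longrightarrow> x \<in> epoints M \<Longrightarrow> edist M x x = 0"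
  by (auto simp: is_emetric_def)

lemma is_uspace_metric_uspace:
  assumes M: "is_emetric M"
  shows "is_uspace (metric_uspace M)"
proof (rule is_uspaceI)
  show "\<exists>Q. eventually Q (entourages (metric_uspace M)) \<and> (\<forall>x y z. Q (x, y) \<longrightarrow> Q (y, z) \<longrightarrow> P (x, z))"
    if P: "eventually P (entourages (metric_uspace M))" for P
  proof -
    obtain e where e: "e > 0" "\<forall>x\<in>epoints M. \<forall>y\<in>epoints M. edist M x y < ennreal e \<longrightarrow> P (x, y)"
      using P unfolding eventually_metric_uspace by blast
    let ?Q = "\<lambda>(x, y). x \<in> epoints M \<and> y \<in> epoints M \<and> edist M x y < ennreal (e/2)"
    have *: "P (x, z)" if "x \<in> epoints M" "y \<in> epoints M" "z \<in> epoints M"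
        "edist M x y < ennreal (e/2)" "edist M y z < ennreal (e/2)" for x y z
    proof -
      have "edist M x z \<le> edist M x y + edist M y z" using M that by (auto simp: is_emetric_def)
      also have "\<dots> < ennreal (e/2) + ennreal (e/2)" using that by (intro add_strict_mono) auto
      also have "\<dots> = ennreal e" using e by (simp flip: ennreal_plus)
      finally show ?thesis using e that by auto
    qed
    have "eventually ?Q (entourages (metric_uspace M))"
      using e by (auto simp: eventually_metric_uspace intro!: exI[of _ "e/2"])
    then show ?thesis by (intro exI[of _ ?Q]) (auto intro: *)
  qed
  show "eventually (\<lambda>(x, y). P (y, x)) (entourages (metric_uspace M))"
    if "eventually P (entourages (metric_uspace M))" for P
    using that M unfolding eventually_metric_uspace is_emetric_def by (metis case_prod_conv)
  show "P (x, x)" if "eventually P (entourages (metric_uspace M))" "x \<in> upoints (metric_uspace M)" for P x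
    using that M unfolding eventually_metric_uspace by (auto simp: emetric_refl)
qed (auto simp: eventually_metric_uspace intro: exI[of _ 1])

lemma topspace_metric_topology [simp]: "is_emetric M \<Longrightarrow> topspace (metric_topology M) = epoints M"
  by (simp add: metric_topology_def topspace_utopology is_uspace_metric_uspace)

lemma openin_metric_topology:
  assumes "is_emetric M"
  shows "openin (metric_topology M) U \<longleftrightarrow> U \<subseteq> epoints M \<and>
     (\<forall>x\<in>U. \<exists>e>0. \<forall>y\<in>epoints M. edist M x y < ennreal e \<longrightarrow> y \<in> U)"
  unfolding metric_topology_def openin_utopology eventually_metric_uspace by (auto; blast)

lemma separated_metric_uspace:
  assumes M: "is_emetric M" shows "separated (metric_uspace M)"
  unfolding separated_def
proof (intro ballI impI)
  fix x y assume xy: "x \<in> upoints (metric_uspace M)" "y \<in> upoints (metric_uspace M)"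
    and P: "\<forall>P. eventually P (entourages (metric_uspace M)) \<longrightarrow> P (x, y)"
  have small: "edist M x y < ennreal e" if "e > 0" for e
    using P[rule_format, of "\<lambda>(x, y). edist M x y < ennreal e"] that by (auto simp: eventually_metric_uspace)
  have "edist M x y = 0"
  proof (cases "edist M x y")
    case (real r)
    then show ?thesis using small[of r] by (cases "r = 0") auto
  next
    case top
    then show ?thesis using small[of 1] by simp
  qed
  then show "x = y" using M xy by (auto simp: is_emetric_def)
qed

section \<open>Connected metric spaces in fine spaces\<close>

definition ureal :: "real uspace" where
  "ureal = pm_uspace UNIV (\<lambda>x y. \<bar>x - y\<bar>)"

lemma is_uspace_ureal [simp]: "is_uspace ureal"
  unfolding ureal_def by (rule is_uspace_pm_uspace) (auto simp: pseudometric_on_def)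

lemma upoints_ureal [simp]: "upoints ureal = UNIV"
  by (simp add: ureal_def)

lemma umap_ureal_iff:
  "umap X ureal f \<longleftrightarrow> (\<forall>e>0. eventually (\<lambda>(x, y). \<bar>f x - f y\<bar> < e) (entourages X))"
  by (simp add: ureal_def umap_pm_uspace_iff)

definition ramp :: "real \<Rightarrow> real \<Rightarrow> real \<Rightarrow> real" where
  "ramp a b t = max 0 (min 1 ((t - a) / (b - a)))"

lemma ramp_mono: "a < b \<Longrightarrow> s \<le> t \<Longrightarrow> ramp a b s \<le> ramp a b t"
  unfolding ramp_def by (intro max.mono min.mono divide_right_mono) auto

text \<open>A sum of ramps; near each point only finitely many of them are nonzero, as the \<open>a n\<close> tend to infinity.\<close>

lemma steep_function_exists:
  fixes a b :: "nat \<Rightarrow> real"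
  assumes ab: "\<And>n. a n < b n" and a: "\<And>n. real n - 1 \<le> a n"
  obtains \<psi> :: "real \<Rightarrow> real" where "continuous_on UNIV \<psi>" "\<And>s t. s \<le> t \<Longrightarrow> \<psi> s \<le> \<psi> t" "\<And>n. 1 \<le> \<psi> (b n) - \<psi> (a n)"
proof -
  let ?r = "\<lambda>n t. ramp (a n) (b n) t"
  define \<psi> where "\<psi> t = (\<Sum>n < nat \<lceil>t + 1\<rceil>. ?r n t)" for t
  have zero: "?r n t = 0" if "t \<le> real n - 1" for n t
  proof -
    have "(t - a n) / (b n - a n) \<le> 0" using that a[of n] ab[of n] by (intro divide_nonpos_pos) auto
    then show ?thesis by (auto simp: ramp_def)
  qed
  have eq: "\<psi> t = (\<Sum>n<k. ?r n t)" if "t + 1 \<le> real k" for k t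
  proof -
    have "nat \<lceil>t + 1\<rceil> \<le> k" using that by linarith
    moreover have "?r n t = 0" if "n \<ge> nat \<lceil>t + 1\<rceil>" for n
      by (rule zero) (use that in linarith)
    ultimately show ?thesis unfolding \<psi>_def
      by (intro sum.mono_neutral_left) (auto simp: not_less)
  qed
  have nz: "b n - a n \<noteq> 0" for n using ab[of n] by simp
  have "isCont \<psi> t0" for t0
  proof -
    obtain k :: nat where k: "t0 + 2 \<le> real k" using real_arch_simple by blast
    have "isCont (\<lambda>t. \<Sum>n<k. ?r n t) t0"
      unfolding ramp_def using nz by (intro continuous_intros) auto
    moreover have "eventually (\<lambda>t. \<psi> t = (\<Sum>n<k. ?r n t)) (nhds t0)"
      by (rule eventually_nhds_in_open[of "{..<t0+1}", THEN eventually_mono]) (use k eq in auto)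
    ultimately show ?thesis by (simp add: isCont_cong)
  qed
  then have "continuous_on UNIV \<psi>" by (simp add: continuous_on_eq_continuous_at)
  moreover have diff: "?r n t - ?r n s \<le> \<psi> t - \<psi> s" if st: "s \<le> t" for s t n
  proof -
    obtain k :: nat where k: "max (t + 1) (real n + 1) \<le> real k" using real_arch_simple by blast
    have "\<psi> t - \<psi> s = (\<Sum>m<k. ?r m t - ?r m s)" using eq[of t k] eq[of s k] k st
      by (simp add: sum_subtractf)
    also have "\<dots> \<ge> ?r n t - ?r n s"
      by (rule member_le_sum) (use k ramp_mono[OF ab st] in auto)
    finally show ?thesis .
  qed
  have "\<psi> s \<le> \<psi> t" if "s \<le> t" for s t using diff[OF that, of 0] ramp_mono[OF ab that, of 0] by linarith
  moreover have "1 \<le> \<psi> (b n) - \<psi> (a n)" for n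
  proof -
    have "a n \<le> b n" using ab[of n] by simp
    moreover have "?r n (b n) - ?r n (a n) = 1" using ab[of n] by (simp add: ramp_def)
    ultimately show ?thesis using diff[of "a n" "b n" n] by linarith
  qed
  ultimately have "continuous_on UNIV \<psi> \<and> (\<forall>s t. s \<le> t \<longrightarrow> \<psi> s \<le> \<psi> t) \<and> (\<forall>n. 1 \<le> \<psi> (b n) - \<psi> (a n))"
    by simp
  then show ?thesis by (intro that[of \<psi>]) auto
qed

text \<open>
  A connected metric space cannot be mapped onto an unbounded subset of the line by a map that
  remains uniform after composition with every continuous function: connectedness gives, at every
  scale \<open>1/n\<close> and beyond every bound, pairs of points at distance less than \<open>1/n\<close> with
  different images, and a continuous function that is steep enough between all these images is
  not uniform on the space.  This is where connectedness of the generating metric spaces enters.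
\<close>

lemma connected_uniform_to_fine_line_bounded:
  fixes u :: "'a \<Rightarrow> real"
  assumes N: "is_emetric N" and con: "connected_space (metric_topology N)"
    and u: "\<And>\<psi>. continuous_on UNIV \<psi> \<Longrightarrow> umap (metric_uspace N) ureal (\<lambda>x. \<psi> (u x))"
  shows "\<exists>B. \<forall>x\<in>epoints N. u x \<le> B"
proof (rule ccontr)
  assume unb: "\<not> (\<exists>B. \<forall>x\<in>epoints N. u x \<le> B)"
  let ?E = "epoints N"
  have "\<exists>y z. y \<in> ?E \<and> z \<in> ?E \<and> edist N y z < ennreal (1 / real (Suc n)) \<and> u y > real n \<and> u y \<noteq> u z" for n
  proof (rule ccontr)
    assume "\<not> ?thesis"
    then have same: "\<And>y z. y \<in> ?E \<Longrightarrow> z \<in> ?E \<Longrightarrow> edist N y z < ennreal (1 / real (Suc n)) \<Longrightarrow> u y > real n \<Longrightarrow> u y = u z"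
      by (metis (no_types, lifting))
    obtain y0 where y0: "y0 \<in> ?E" "u y0 > real n" using unb by (auto simp: not_le)
    define S where "S = {y\<in>?E. u y = u y0}"
    have pos: "(1 / real (Suc n)) > 0" by simp
    have "openin (metric_topology N) S"
      unfolding openin_metric_topology[OF N]
    proof (intro conjI ballI)
      fix x assume "x \<in> S"
      then show "\<exists>e>0. \<forall>y\<in>?E. edist N x y < ennreal e \<longrightarrow> y \<in> S"
        using same[of x] y0 pos by (intro exI[of _ "1 / real (Suc n)"]) (auto simp: S_def)
    qed (auto simp: S_def)
    moreover have "openin (metric_topology N) (?E - S)"
      unfolding openin_metric_topology[OF N]
    proof (intro conjI ballI)
      fix x assume x: "x \<in> ?E - S"
      have "y \<notin> S" if "y \<in> ?E" "edist N x y < ennreal (1 / real (Suc n))" for y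
      proof
        assume "y \<in> S"
        have "edist N y x < ennreal (1 / real (Suc n))" using N that x by (auto simp: is_emetric_def)
        then have "u y = u x" using same[of y x] that x y0 \<open>y \<in> S\<close> by (auto simp: S_def)
        then show False using x \<open>y \<in> S\<close> by (auto simp: S_def)
      qed
      then show "\<exists>e>0. \<forall>y\<in>?E. edist N x y < ennreal e \<longrightarrow> y \<in> ?E - S"
        by (intro exI[of _ "1 / real (Suc n)"]) auto
    qed auto
    ultimately have "S = {} \<or> S = ?E"
      using con N by (auto simp: connected_space_clopen_in closedin_def S_def)
    then have "S = ?E" using y0 by (auto simp: S_def)
    then have "u x = u y0" if "x \<in> ?E" for x using that by (auto simp: S_def)
    then have "\<forall>x\<in>?E. u x \<le> u y0" by auto
    then show False using unb by blast
  qed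
  moreover define pair where "pair n y z \<longleftrightarrow> y \<in> ?E \<and> z \<in> ?E \<and> edist N y z < ennreal (1 / real (Suc n))
      \<and> u y > real n \<and> u y \<noteq> u z" for n y z
  ultimately have "\<forall>n. \<exists>y z. pair n y z" by simp
  then obtain y z where "\<And>n. pair n (y n) (z n)" by metis
  then have yz: "\<And>n. y n \<in> ?E" "\<And>n. z n \<in> ?E" "\<And>n. edist N (y n) (z n) < ennreal (1 / real (Suc n))"
      "\<And>n. u (y n) > real n" "\<And>n. u (y n) \<noteq> u (z n)"
    unfolding pair_def by auto
  \<comment> \<open>the interval between the two images, cut off so that it lies far out on the line\<close>
  define b where "b n = max (u (y n)) (u (z n))" for n
  define a where "a n = max (min (u (y n)) (u (z n))) (u (y n) - 1)" for n
  have "a n < b n" "real n - 1 \<le> a n" for n using yz(4,5)[of n] by (auto simp: a_def b_def)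
  then obtain \<psi> :: "real \<Rightarrow> real" where \<psi>: "continuous_on UNIV \<psi>" "\<And>s t. s \<le> t \<Longrightarrow> \<psi> s \<le> \<psi> t" "\<And>n. 1 \<le> \<psi> (b n) - \<psi> (a n)"
    using steep_function_exists[of a b] by metis
  have far: "1 \<le> \<bar>\<psi> (u (y n)) - \<psi> (u (z n))\<bar>" for n
  proof -
    have "\<psi> (min (u (y n)) (u (z n))) \<le> \<psi> (a n)" by (rule \<psi>(2)) (simp add: a_def)
    then have "1 \<le> \<psi> (b n) - \<psi> (min (u (y n)) (u (z n)))" using \<psi>(3)[of n] by linarith
    then show ?thesis by (cases "u (y n) \<le> u (z n)") (auto simp: b_def min_def max_def)
  qed
  obtain e where e: "e > 0" "\<forall>x\<in>?E. \<forall>y\<in>?E. edist N x y < ennreal e \<longrightarrow> \<bar>\<psi> (u x) - \<psi> (u y)\<bar> < 1"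
    using u[OF \<psi>(1)] by (auto simp: umap_ureal_iff eventually_metric_uspace dest: spec[of _ 1])
  obtain n where n: "1 / real (Suc n) < e" using e(1) nat_approx_posE by blast
  have "ennreal (1 / real (Suc n)) \<le> ennreal e" by (rule ennreal_leI) (use n in simp)
  then have "edist N (y n) (z n) < ennreal e" by (rule less_le_trans[OF yz(3)[of n]])
  then have "\<bar>\<psi> (u (y n)) - \<psi> (u (z n))\<bar> < 1" using e(2) yz(1)[of n] yz(2)[of n] by blast
  then show False using far[of n] by linarith
qed

lemma abs_SUP_diff_le:
  fixes f g :: "'a \<Rightarrow> real"
  assumes "A \<noteq> {}" "bdd_above (f ` A)" "bdd_above (g ` A)" "\<And>a. a \<in> A \<Longrightarrow> \<bar>f a - g a\<bar> \<le> c"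
  shows "\<bar>(SUP a\<in>A. f a) - (SUP a\<in>A. g a)\<bar> \<le> c"
proof -
  have "(SUP a\<in>A. f a) \<le> (SUP a\<in>A. g a) + c"
  proof (rule cSUP_least[OF assms(1)])
    fix a assume a: "a \<in> A"
    then have "g a \<le> (SUP a\<in>A. g a)" by (rule cSUP_upper[OF _ assms(3)])
    then show "f a \<le> (SUP a\<in>A. g a) + c" using assms(4)[OF a] by linarith
  qed
  moreover have "(SUP a\<in>A. g a) \<le> (SUP a\<in>A. f a) + c"
  proof (rule cSUP_least[OF assms(1)])
    fix a assume a: "a \<in> A"
    then have "f a \<le> (SUP a\<in>A. f a)" by (rule cSUP_upper[OF _ assms(2)])
    then show "g a \<le> (SUP a\<in>A. f a) + c" using assms(4)[OF a] by linarith
  qed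
  ultimately show ?thesis by linarith
qed

text \<open>
  A uniformity \<open>Z\<close> is final for a family of maps out of metric spaces if it is the finest one
  making them uniform.
\<close>

definition final_uspace :: "('m emetric \<times> ('m \<Rightarrow> 'a)) set \<Rightarrow> 'a uspace \<Rightarrow> bool" where
  "final_uspace \<C> Z \<longleftrightarrow> is_uspace Z \<and> (\<forall>(M, c) \<in> \<C>. umap (metric_uspace M) Z c) \<and>
     (\<forall>V. is_uspace V \<and> upoints V = upoints Z \<and> (\<forall>(M, c) \<in> \<C>. umap (metric_uspace M) V c) \<longrightarrow>
        entourages Z \<le> entourages V)"

lemma final_uspace_umap:
  assumes Z: "final_uspace \<C> Z" and W: "is_uspace W" and f: "\<And>z. z \<in> upoints Z \<Longrightarrow> f z \<in> upoints W"
    and c: "\<And>M c. (M, c) \<in> \<C> \<Longrightarrow> umap (metric_uspace M) W (\<lambda>m. f (c m))"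
  shows "umap Z W f"
proof -
  let ?V = "upullback (upoints Z) f W"
  have V: "is_uspace ?V" by (rule is_uspace_upullback[OF W]) (use f in auto)
  have "umap (metric_uspace M) ?V c'" if Mc: "(M, c') \<in> \<C>" for M c'
    unfolding umap_iff
  proof (intro conjI allI impI)
    have cZ: "umap (metric_uspace M) Z c'" using Z Mc by (auto simp: final_uspace_def)
    then show "c' \<in> upoints (metric_uspace M) \<rightarrow> upoints ?V" by (auto simp: umap_def upullback_def)
    fix P assume "eventually P (entourages ?V)"
    then obtain Q where Q: "eventually Q (entourages W)"
      "\<forall>x\<in>upoints Z. \<forall>y\<in>upoints Z. Q (f x, f y) \<longrightarrow> P (x, y)"
      by (auto simp: eventually_upullback)
    have "eventually (\<lambda>(x, y). c' x \<in> upoints Z \<and> c' y \<in> upoints Z) (entourages (metric_uspace M))"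
      using umap_eventually[OF cZ uspace_points] Z by (auto simp: final_uspace_def)
    then show "\<forall>\<^sub>F (x, y) in entourages (metric_uspace M). P (c' x, c' y)"
      using umap_eventually[OF c[OF Mc] Q(1)] by eventually_elim (use Q(2) in auto)
  qed
  then have le: "entourages Z \<le> entourages ?V" using Z V unfolding final_uspace_def
    by (auto simp: upullback_def)
  show ?thesis unfolding umap_iff
  proof (intro conjI allI impI)
    fix P assume "eventually P (entourages W)"
    then have "eventually (\<lambda>(x, y). P (f x, f y)) (entourages ?V)" by (auto simp: eventually_upullback)
    then show "\<forall>\<^sub>F (x, y) in entourages Z. P (f x, f y)" using le by (auto simp: le_filter_def)
  qed (use f in auto)
qed

text \<open>
  Continuity of evaluation.  Uniformity in the point \<open>z\<close>, uniformly in the argument \<open>q\<close>, passes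
  to the final uniformity on \<open>Z\<close> because it is expressed by the pseudometrics \<open>D\<close>.  The moduli of
  continuity of the functions \<open>\<Phi> z\<close> need not be bounded as \<open>z\<close> varies over \<open>Z\<close>, but they are
  controlled by a positive function \<open>\<omega>\<close> on \<open>Z\<close>, all of whose continuous transforms are uniform.
  So \<open>1 / \<omega>\<close> is bounded on a connected metric space.
\<close>

lemma uniform_evaluation:
  assumes N: "is_emetric N" and con: "connected_space (metric_topology N)" and Q: "is_emetric Q"
    and Z: "final_uspace \<C> Z" and Y: "is_uspace Y"
    and surj: "\<And>z. z \<in> upoints Z \<Longrightarrow> \<exists>(M, c) \<in> \<C>. z \<in> c ` epoints M"
    and mets: "\<And>M c. (M, c) \<in> \<C> \<Longrightarrow> is_emetric M"
    and \<Phi>: "\<And>M c. (M, c) \<in> \<C> \<Longrightarrow> umap (uprod (metric_uspace M) (metric_uspace Q)) Y (\<lambda>(m, q). \<Phi> (c m) q)"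
    and \<alpha>: "umap (metric_uspace N) Z \<alpha>"
  shows "umap (uprod (metric_uspace N) (metric_uspace Q)) Y (\<lambda>(n, q). \<Phi> (\<alpha> n) q)"
proof (cases "epoints Q = {}")
  case True
  have "eventually (\<lambda>_. False) (entourages (metric_uspace Q))" using True
    by (auto simp: eventually_metric_uspace intro: exI[of _ 1])
  then have "eventually P (entourages (uprod (metric_uspace N) (metric_uspace Q)))" for P
    unfolding uprod_simps by (intro exI[of _ "\<lambda>_. True"] exI[of _ "\<lambda>_. False"]) auto
  then show ?thesis unfolding umap_iff using True by (auto simp: uprod_simps(1))
next
  case False
  let ?Q = "epoints Q" and ?Z = "upoints Z"
  have Zu: "is_uspace Z" using Z by (simp add: final_uspace_def)
  have \<Phi>Y: "\<Phi> z q \<in> upoints Y" if z: "z \<in> ?Z" and q: "q \<in> ?Q" for z q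
  proof -
    obtain M c m where *: "(M, c) \<in> \<C>" "m \<in> epoints M" "z = c m" using surj[OF z] by auto
    then show ?thesis using umap_points[OF \<Phi>[OF *(1)], of "(m, q)"] q by (auto simp: uprod_simps)
  qed
  have \<alpha>Z: "\<alpha> n \<in> ?Z" if "n \<in> epoints N" for n using umap_points[OF \<alpha>, of n] that by simp
  show ?thesis
  proof (rule umap_pseudometricI[OF Y is_uspace_uprod[OF is_uspace_metric_uspace[OF N] is_uspace_metric_uspace[OF Q]]])
    show "(case x of (n, q) \<Rightarrow> \<Phi> (\<alpha> n) q) \<in> upoints Y"
      if "x \<in> upoints (uprod (metric_uspace N) (metric_uspace Q))" for x
      using that by (auto simp: uprod_simps intro: \<Phi>Y \<alpha>Z)
  next
    fix \<rho> and e0 :: real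
    assume \<rho>: "uniform_pseudometric Y \<rho>" and \<rho>1: "\<And>x y. \<rho> x y \<le> 1" and e0: "e0 > 0"
    define e where "e = e0 / 2"
    have e: "e > 0" using e0 by (simp add: e_def)
    have pm: "pseudometric_on (upoints Y) \<rho>" using \<rho> by (simp add: uniform_pseudometric_def)
    have \<rho>0: "0 \<le> \<rho> x y" if "x \<in> upoints Y" "y \<in> upoints Y" for x y
      using pseudometric_on_nonneg[OF pm that] .
    have \<rho>s: "\<rho> x y = \<rho> y x" if "x \<in> upoints Y" "y \<in> upoints Y" for x y
      using pm that by (auto simp: pseudometric_on_def)
    have \<rho>r: "\<rho> x x = 0" if "x \<in> upoints Y" for x
      using pm that by (auto simp: pseudometric_on_def)
    have \<rho>t: "\<rho> x z \<le> \<rho> x y + \<rho> y z" if "x \<in> upoints Y" "y \<in> upoints Y" "z \<in> upoints Y" for x y z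
      using pm that by (auto simp: pseudometric_on_def)
    have unif: "\<exists>d>0. \<forall>m\<in>epoints M. \<forall>m'\<in>epoints M. \<forall>q\<in>?Q. \<forall>q'\<in>?Q. edist M m m' < ennreal d \<longrightarrow>
       edist Q q q' < ennreal d \<longrightarrow> \<rho> (\<Phi> (c m) q) (\<Phi> (c m') q') < r"
      if Mc: "(M, c) \<in> \<C>" and r: "r > 0" for M c r
    proof -
      have "eventually (\<lambda>(x, y). \<rho> x y < r) (entourages Y)" using \<rho> r by (simp add: uniform_pseudometric_def)
      from umap_eventually[OF \<Phi>[OF Mc] this]
      obtain A B where AB: "eventually A (entourages (metric_uspace M))" "eventually B (entourages (metric_uspace Q))"
        "\<And>x y x' y'. A (x, x') \<Longrightarrow> B (y, y') \<Longrightarrow> \<rho> (\<Phi> (c x) y) (\<Phi> (c x') y') < r"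
        unfolding uprod_simps by auto
      obtain d1 where d1: "d1 > 0" "\<forall>x\<in>epoints M. \<forall>y\<in>epoints M. edist M x y < ennreal d1 \<longrightarrow> A (x, y)"
        using AB(1) by (auto simp: eventually_metric_uspace)
      obtain d2 where d2: "d2 > 0" "\<forall>x\<in>?Q. \<forall>y\<in>?Q. edist Q x y < ennreal d2 \<longrightarrow> B (x, y)"
        using AB(2) by (auto simp: eventually_metric_uspace)
      show ?thesis
      proof (intro exI[of _ "min d1 d2"] conjI ballI impI)
        fix m m' q q' assume "m \<in> epoints M" "m' \<in> epoints M" "q \<in> ?Q" "q' \<in> ?Q"
          "edist M m m' < ennreal (min d1 d2)" "edist Q q q' < ennreal (min d1 d2)"
        moreover have "ennreal (min d1 d2) \<le> ennreal d1" "ennreal (min d1 d2) \<le> ennreal d2"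
          by (auto intro: ennreal_leI)
        ultimately show "\<rho> (\<Phi> (c m) q) (\<Phi> (c m') q') < r"
          using d1(2) d2(2) AB(3) by (meson less_le_trans)
      qed (use d1 d2 in auto)
    qed
    define D where "D z z' = (SUP q\<in>?Q. \<rho> (\<Phi> z q) (\<Phi> z' q))" for z z'
    have bdd: "bdd_above ((\<lambda>a. \<rho> (f a) (g a)) ` A)" for A :: "'x set" and f g
      by (rule bdd_aboveI[of _ 1]) (auto simp: \<rho>1)
    have D_up: "\<rho> (\<Phi> z q) (\<Phi> z' q) \<le> D z z'" if "q \<in> ?Q" for z z' q
      unfolding D_def by (rule cSUP_upper[OF that]) (rule bdd_aboveI[of _ 1], auto simp: \<rho>1)
    have D_least: "D z z' \<le> r" if "\<And>q. q \<in> ?Q \<Longrightarrow> \<rho> (\<Phi> z q) (\<Phi> z' q) \<le> r" for z z' r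
      unfolding D_def by (rule cSUP_least[OF False that])
    have Dpm: "pseudometric_on ?Z D"
      unfolding pseudometric_on_def
    proof (intro conjI ballI)
      fix x y z assume xyz: "x \<in> ?Z" "y \<in> ?Z" "z \<in> ?Z"
      show "D x x = 0" unfolding D_def using False \<rho>r[OF \<Phi>Y[OF xyz(1)]] by simp
      show "D x y = D y x" unfolding D_def using \<rho>s[OF \<Phi>Y[OF xyz(1)] \<Phi>Y[OF xyz(2)]]
        by (intro SUP_cong) auto
      show "D x z \<le> D x y + D y z"
      proof (rule D_least)
        fix q assume q: "q \<in> ?Q"
        show "\<rho> (\<Phi> x q) (\<Phi> z q) \<le> D x y + D y z"
          using \<rho>t[OF \<Phi>Y[OF xyz(1) q] \<Phi>Y[OF xyz(2) q] \<Phi>Y[OF xyz(3) q]] D_up[OF q, of x y] D_up[OF q, of y z]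
          by linarith
      qed
    qed
    have D_M: "eventually (\<lambda>(m, m'). D (c m) (c m') < r) (entourages (metric_uspace M))"
      if Mc: "(M, c) \<in> \<C>" and r: "r > 0" for M c r
    proof -
      obtain d where d: "d > 0" "\<forall>m\<in>epoints M. \<forall>m'\<in>epoints M. \<forall>q\<in>?Q. \<forall>q'\<in>?Q. edist M m m' < ennreal d \<longrightarrow>
        edist Q q q' < ennreal d \<longrightarrow> \<rho> (\<Phi> (c m) q) (\<Phi> (c m') q') < r/2" using unif[OF Mc, of "r/2"] r by auto
      have "D (c m) (c m') < r" if "m \<in> epoints M" "m' \<in> epoints M" "edist M m m' < ennreal d" for m m'
      proof -
        have "D (c m) (c m') \<le> r/2"
          by (rule D_least) (use d that emetric_refl[OF Q] in \<open>auto intro!: less_imp_le\<close>)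
        then show ?thesis using r by linarith
      qed
      then show ?thesis using d(1) by (auto simp: eventually_metric_uspace)
    qed
    have cZ: "umap (metric_uspace M) Z c" if "(M, c) \<in> \<C>" for M c
      using Z that by (auto simp: final_uspace_def)
    have "umap (metric_uspace M) (pm_uspace ?Z D) c" if Mc: "(M, c) \<in> \<C>" for M c
      unfolding umap_pm_uspace_iff
    proof (intro conjI allI impI)
      show "c \<in> upoints (metric_uspace M) \<rightarrow> ?Z" using cZ[OF Mc] by (simp add: umap_def)
      fix r :: real assume "r > 0"
      from D_M[OF Mc this] umap_eventually[OF cZ[OF Mc] uspace_points[OF Zu]]
      show "\<forall>\<^sub>F (x, y) in entourages (metric_uspace M). c x \<in> ?Z \<and> c y \<in> ?Z \<and> D (c x) (c y) < r"
        by eventually_elim auto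
    qed
    then have DZ: "entourages Z \<le> entourages (pm_uspace ?Z D)"
      using Z is_uspace_pm_uspace[OF Dpm] unfolding final_uspace_def by auto
    have D_Z: "eventually (\<lambda>(z, z'). D z z' < r) (entourages Z)" if "r > 0" for r
      by (rule filter_leD[OF DZ]) (use that in \<open>auto simp: eventually_pm_uspace\<close>)
    \<comment> \<open>the modulus of continuity of \<open>\<Phi> z\<close> at scale \<open>2\<^sup>-\<^sup>n\<close>\<close>
    define near where "near n = {(q, q') \<in> ?Q \<times> ?Q. edist Q q q' < ennreal ((1/2)^n)}" for n
    define w where "w z n = (SUP (q, q')\<in>near n. \<rho> (\<Phi> z q) (\<Phi> z q'))" for z n
    have near_ne: "near n \<noteq> {}" for n
    proof -
      obtain q where "q \<in> ?Q" using False by blast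
      then have "(q, q) \<in> near n" using emetric_refl[OF Q] by (auto simp: near_def)
      then show ?thesis by blast
    qed
    have bddw: "bdd_above ((\<lambda>(q, q'). \<rho> (\<Phi> z q) (\<Phi> z q')) ` A)" for z A
      by (rule bdd_aboveI[of _ 1]) (auto simp: \<rho>1)
    have w_up: "\<rho> (\<Phi> z q) (\<Phi> z q') \<le> w z n" if "(q, q') \<in> near n" for z q q' n
      unfolding w_def using cSUP_upper[OF that bddw, of z] by simp
    have w_least: "w z n \<le> r" if "\<And>q q'. (q, q') \<in> near n \<Longrightarrow> \<rho> (\<Phi> z q) (\<Phi> z q') \<le> r" for z n r
      unfolding w_def by (rule cSUP_least[OF near_ne]) (use that in auto)
    have w0: "0 \<le> w z n" if "z \<in> ?Z" for z n
    proof -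
      obtain q where "q \<in> ?Q" using False by blast
      then have "(q, q) \<in> near n" using emetric_refl[OF Q] by (auto simp: near_def)
      then show ?thesis using w_up[of q q n z] \<rho>r[OF \<Phi>Y[OF that \<open>q \<in> ?Q\<close>]] by simp
    qed
    have w_lip: "\<bar>w z n - w z' n\<bar> \<le> 2 * D z z'" if z: "z \<in> ?Z" "z' \<in> ?Z" for z z' n
      unfolding w_def
    proof (rule abs_SUP_diff_le[OF near_ne bddw bddw])
      fix a assume "a \<in> near n"
      then obtain q q' where a: "a = (q, q')" "q \<in> ?Q" "q' \<in> ?Q" by (auto simp: near_def)
      note YY = \<Phi>Y[OF z(1) a(2)] \<Phi>Y[OF z(1) a(3)] \<Phi>Y[OF z(2) a(2)] \<Phi>Y[OF z(2) a(3)]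
      show "\<bar>(case a of (q, q') \<Rightarrow> \<rho> (\<Phi> z q) (\<Phi> z q')) - (case a of (q, q') \<Rightarrow> \<rho> (\<Phi> z' q) (\<Phi> z' q'))\<bar> \<le> 2 * D z z'"
        using \<rho>t[of "\<Phi> z q" "\<Phi> z' q" "\<Phi> z q'"] \<rho>t[of "\<Phi> z' q" "\<Phi> z' q'" "\<Phi> z q'"]
          \<rho>t[of "\<Phi> z' q" "\<Phi> z q" "\<Phi> z' q'"] \<rho>t[of "\<Phi> z q" "\<Phi> z q'" "\<Phi> z' q'"] YY
          D_up[OF a(2), of z z'] D_up[OF a(3), of z z'] \<rho>s[OF YY(1,3)] \<rho>s[OF YY(2,4)] a(1)
        by (simp add: abs_le_iff)
    qed
    have w_mono: "w z n \<le> w z m" if "m \<le> n" for z m n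
    proof (rule w_least)
      fix q q' assume qq: "(q, q') \<in> near n"
      have "ennreal ((1/2)^n) \<le> ennreal ((1/2)^m)" by (rule ennreal_leI) (use that in \<open>auto intro: power_decreasing\<close>)
      moreover have "edist Q q q' < ennreal ((1/2)^n)" "q \<in> ?Q" "q' \<in> ?Q" using qq by (auto simp: near_def)
      ultimately have "edist Q q q' < ennreal ((1/2)^m)" "q \<in> ?Q" "q' \<in> ?Q" by (meson less_le_trans)+
      then have "(q, q') \<in> near m" unfolding near_def by blast
      then show "\<rho> (\<Phi> z q) (\<Phi> z q') \<le> w z m" by (rule w_up)
    qed
    define \<omega> where "\<omega> z = (SUP n. (1/2)^n * max 0 (e - w z n))" for z
    have term_le: "(1/2)^n * max 0 (e - w z n) \<le> e" if "z \<in> ?Z" for z n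
    proof -
      have "(1/2::real)^n * max 0 (e - w z n) \<le> 1 * max 0 (e - w z n)"
        by (rule mult_right_mono) (auto simp: power_le_one)
      also have "\<dots> \<le> e" using w0[OF that, of n] e by auto
      finally show ?thesis .
    qed
    have bdd\<omega>: "bdd_above (range (\<lambda>n. (1/2)^n * max 0 (e - w z n)))" if "z \<in> ?Z" for z
      by (rule bdd_aboveI[of _ e]) (use term_le[OF that] in auto)
    have \<omega>_up: "(1/2)^n * max 0 (e - w z n) \<le> \<omega> z" if "z \<in> ?Z" for z n
      unfolding \<omega>_def by (rule cSUP_upper[OF _ bdd\<omega>[OF that]]) auto
    have \<omega>_le: "\<omega> z \<le> e" if "z \<in> ?Z" for z
      unfolding \<omega>_def by (rule cSUP_least) (use term_le[OF that] in auto)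
    have \<omega>_lip: "\<bar>\<omega> z - \<omega> z'\<bar> \<le> 2 * D z z'" if z: "z \<in> ?Z" "z' \<in> ?Z" for z z'
      unfolding \<omega>_def
    proof (rule abs_SUP_diff_le[OF _ bdd\<omega>[OF z(1)] bdd\<omega>[OF z(2)]])
      fix n
      have "\<bar>(1/2)^n * max 0 (e - w z n) - (1/2)^n * max 0 (e - w z' n)\<bar>
          = (1/2)^n * \<bar>max 0 (e - w z n) - max 0 (e - w z' n)\<bar>"
        by (simp flip: right_diff_distrib add: abs_mult)
      also have "\<dots> \<le> 1 * \<bar>max 0 (e - w z n) - max 0 (e - w z' n)\<bar>"
        by (rule mult_right_mono) (auto simp: power_le_one)
      also have "\<dots> \<le> 2 * D z z'" using w_lip[OF z, of n] by auto
      finally show "\<bar>(1/2)^n * max 0 (e - w z n) - (1/2)^n * max 0 (e - w z' n)\<bar> \<le> 2 * D z z'" .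
    qed auto
    have \<omega>_small: "\<omega> z \<le> (1/2)^n * e" if z: "z \<in> ?Z" and wn: "w z n \<ge> e" for z n
      unfolding \<omega>_def
    proof (rule cSUP_least)
      fix k
      show "(1/2)^k * max 0 (e - w z k) \<le> (1/2)^n * e"
      proof (cases "k \<le> n")
        case True
        then have "max 0 (e - w z k) = 0" using w_mono[OF True, of z] wn by auto
        then show ?thesis using e by simp
      next
        case False
        then show ?thesis using w0[OF z, of k] e
          by (intro mult_mono power_decreasing) auto
      qed
    qed auto
    have \<omega>_M: "\<exists>\<kappa>>0. \<forall>m\<in>epoints M. \<kappa> \<le> \<omega> (c m)" if Mc: "(M, c) \<in> \<C>" for M c
    proof -
      obtain d where d: "d > 0" "\<forall>m\<in>epoints M. \<forall>m'\<in>epoints M. \<forall>q\<in>?Q. \<forall>q'\<in>?Q. edist M m m' < ennreal d \<longrightarrow>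
        edist Q q q' < ennreal d \<longrightarrow> \<rho> (\<Phi> (c m) q) (\<Phi> (c m') q') < e/2" using unif[OF Mc, of "e/2"] e by auto
      obtain n where n: "(1/2::real)^n < d" using d(1) real_arch_pow_inv[of d "1/2"] by auto
      have "(1/2)^n * (e/2) \<le> \<omega> (c m)" if m: "m \<in> epoints M" for m
      proof -
        have z: "c m \<in> ?Z" using umap_points[OF cZ[OF Mc]] m by simp
        have "w (c m) n \<le> e/2"
        proof (rule w_least)
          fix q q' assume qq: "(q, q') \<in> near n"
          have qq': "q \<in> ?Q" "q' \<in> ?Q" "edist Q q q' < ennreal ((1/2)^n)" using qq by (auto simp: near_def)
          have "ennreal ((1/2)^n) \<le> ennreal d" by (rule ennreal_leI) (use n in simp)
          then have "edist Q q q' < ennreal d" using qq'(3) by (meson less_le_trans)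
          moreover have "edist M m m < ennreal d" using emetric_refl[OF mets[OF Mc] m] d(1) by simp
          ultimately have "\<rho> (\<Phi> (c m) q) (\<Phi> (c m) q') < e/2" using d(2) m qq'(1,2) by blast
          then show "\<rho> (\<Phi> (c m) q) (\<Phi> (c m) q') \<le> e/2" by simp
        qed
        then have "e/2 \<le> max 0 (e - w (c m) n)" by linarith
        then have "(1/2)^n * (e/2) \<le> (1/2)^n * max 0 (e - w (c m) n)" by (rule mult_left_mono) simp
        also have "\<dots> \<le> \<omega> (c m)" by (rule \<omega>_up[OF z])
        finally show ?thesis .
      qed
      then show ?thesis using e by (intro exI[of _ "(1/2)^n * (e/2)"]) auto
    qed
    have u_uniform: "umap Z ureal (\<lambda>z. \<psi> (1 / \<omega> z))" if \<psi>: "continuous_on UNIV \<psi>" for \<psi> :: "real \<Rightarrow> real"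
    proof (rule final_uspace_umap[OF Z])
      fix M c assume Mc: "(M, c) \<in> \<C>"
      obtain \<kappa> where \<kappa>: "\<kappa> > 0" "\<forall>m\<in>epoints M. \<kappa> \<le> \<omega> (c m)" using \<omega>_M[OF Mc] by blast
      have "continuous_on {\<kappa>..e} (\<lambda>t. \<psi> (1 / t))"
        using \<kappa>(1) by (intro continuous_on_compose2[OF \<psi>] continuous_intros) auto
      then have uc: "uniformly_continuous_on {\<kappa>..e} (\<lambda>t. \<psi> (1 / t))"
        by (rule compact_uniformly_continuous) simp
      show "umap (metric_uspace M) ureal (\<lambda>m. \<psi> (1 / \<omega> (c m)))"
        unfolding umap_ureal_iff
      proof (intro allI impI)
        fix r :: real assume "r > 0"
        then obtain d where d: "d > 0" "\<And>s t. s \<in> {\<kappa>..e} \<Longrightarrow> t \<in> {\<kappa>..e} \<Longrightarrow> dist s t < d \<Longrightarrow>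
            dist (\<psi> (1 / s)) (\<psi> (1 / t)) < r"
          using uc unfolding uniformly_continuous_on_def by metis
        have "eventually (\<lambda>(m, m'). D (c m) (c m') < d/2) (entourages (metric_uspace M))"
          by (rule D_M[OF Mc]) (use d(1) in simp)
        then show "\<forall>\<^sub>F (x, y) in entourages (metric_uspace M). \<bar>\<psi> (1 / \<omega> (c x)) - \<psi> (1 / \<omega> (c y))\<bar> < r"
          using uspace_points[OF is_uspace_metric_uspace[OF mets[OF Mc]]]
        proof eventually_elim
          case (elim p)
          obtain x y where p: "p = (x, y)" by fastforce
          then have xy: "x \<in> epoints M" "y \<in> epoints M" "D (c x) (c y) < d/2" using elim by auto
          then have z: "c x \<in> ?Z" "c y \<in> ?Z" using umap_points[OF cZ[OF Mc]] by auto
          have "\<bar>\<omega> (c x) - \<omega> (c y)\<bar> < d" using \<omega>_lip[OF z] xy(3) by linarith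
          then have "dist (\<omega> (c x)) (\<omega> (c y)) < d" unfolding dist_real_def .
          then have "dist (\<psi> (1 / \<omega> (c x))) (\<psi> (1 / \<omega> (c y))) < r"
            by (intro d(2)) (use \<kappa>(2) xy \<omega>_le z in auto)
          then show ?case by (simp add: p dist_real_def)
        qed
      qed
    qed auto
    obtain B where B: "\<forall>n\<in>epoints N. 1 / \<omega> (\<alpha> n) \<le> B"
      using connected_uniform_to_fine_line_bounded[OF N con, of "\<lambda>n. 1 / \<omega> (\<alpha> n)"]
        umap_comp[OF \<alpha> u_uniform] by blast
    have \<omega>pos: "\<omega> z > 0" if z: "z \<in> ?Z" for z
    proof -
      obtain M c m where *: "(M, c) \<in> \<C>" "m \<in> epoints M" "z = c m" using surj[OF z] by auto
      then show ?thesis using \<omega>_M[OF *(1)] by force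
    qed
    define \<kappa> where "\<kappa> = 1 / max 1 B"
    have \<kappa>: "\<kappa> > 0" by (simp add: \<kappa>_def)
    have \<omega>\<kappa>: "\<kappa> \<le> \<omega> (\<alpha> n)" if n: "n \<in> epoints N" for n
    proof -
      have "1 / \<omega> (\<alpha> n) \<le> max 1 B" using B n by force
      then have "1 \<le> max 1 B * \<omega> (\<alpha> n)" using \<omega>pos[OF \<alpha>Z[OF n]] by (simp add: divide_le_eq)
      then show ?thesis unfolding \<kappa>_def by (simp add: divide_le_eq mult.commute)
    qed
    obtain k where k: "(1/2::real)^k < \<kappa> / e" using \<kappa> e real_arch_pow_inv[of "\<kappa>/e" "1/2"] by auto
    then have k': "(1/2::real)^k * e < \<kappa>" using e by (simp add: less_divide_eq)
    have wk: "w (\<alpha> n) k < e" if n: "n \<in> epoints N" for n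
      using \<omega>_small[OF \<alpha>Z[OF n], of k] \<omega>\<kappa>[OF n] k' by linarith
    have "eventually (\<lambda>(n, n'). D (\<alpha> n) (\<alpha> n') < e) (entourages (metric_uspace N))"
      using umap_eventually[OF \<alpha> D_Z[OF e]] by simp
    then have evN: "eventually (\<lambda>(n, n'). n \<in> epoints N \<and> n' \<in> epoints N \<and> D (\<alpha> n) (\<alpha> n') < e) (entourages (metric_uspace N))"
      using uspace_points[OF is_uspace_metric_uspace[OF N]] by eventually_elim auto
    have evQ: "eventually (\<lambda>(q, q'). (q, q') \<in> near k) (entourages (metric_uspace Q))"
      by (auto simp: eventually_metric_uspace near_def intro!: exI[of _ "(1/2)^k"])
    show "\<forall>\<^sub>F (x, y) in entourages (uprod (metric_uspace N) (metric_uspace Q)).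
        \<rho> (case x of (n, q) \<Rightarrow> \<Phi> (\<alpha> n) q) (case y of (n, q) \<Rightarrow> \<Phi> (\<alpha> n) q) < e0"
      unfolding uprod_simps
    proof (intro exI conjI, rule evN, rule evQ, intro allI impI)
      fix n q n' q'
      assume 1: "case (n, n') of (n, n') \<Rightarrow> n \<in> epoints N \<and> n' \<in> epoints N \<and> D (\<alpha> n) (\<alpha> n') < e"
        and 2: "case (q, q') of (q, q') \<Rightarrow> (q, q') \<in> near k"
      have q: "q \<in> ?Q" "q' \<in> ?Q" using 2 by (auto simp: near_def)
      have z: "\<alpha> n \<in> ?Z" "\<alpha> n' \<in> ?Z" using 1 \<alpha>Z by auto
      have "\<rho> (\<Phi> (\<alpha> n) q) (\<Phi> (\<alpha> n') q') \<le> \<rho> (\<Phi> (\<alpha> n) q) (\<Phi> (\<alpha> n') q) + \<rho> (\<Phi> (\<alpha> n') q) (\<Phi> (\<alpha> n') q')"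
        using \<Phi>Y z q by (intro \<rho>t) auto
      also have "\<dots> < e + e"
        using D_up[OF q(1), of "\<alpha> n" "\<alpha> n'"] w_up[of q q' k "\<alpha> n'"] wk[of n'] 1 2 by auto
      finally show "case ((n, q), n', q') of (x, y) \<Rightarrow>
        \<rho> (case x of (n, q) \<Rightarrow> \<Phi> (\<alpha> n) q) (case y of (n, q) \<Rightarrow> \<Phi> (\<alpha> n) q) < e0" by (simp add: e_def)
    qed
  qed
qed

section \<open>Objects of the category of uniform spaces\<close>

lemma umap_umeet: "umap X V f \<Longrightarrow> umap X W f \<Longrightarrow> umap X (umeet V W) f"
  by (auto simp: umeet_def umap_def filterlim_inf)

lemma upoints_umeet [simp]: "upoints (umeet V W) = upoints V"
  by (simp add: umeet_def)

definition clc :: "'a emetric \<Rightarrow> bool" where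
  "clc M \<longleftrightarrow> is_emetric M \<and> connected_space (metric_topology M) \<and>
     locally_connected_space (metric_topology M)"

lemma clc_emetric: "clc M \<Longrightarrow> is_emetric M" by (simp add: clc_def)

lemma clc_uspace: "clc M \<Longrightarrow> is_uspace (metric_uspace M)"
  by (simp add: clc_def is_uspace_metric_uspace)

definition clc_maps :: "'u itself \<Rightarrow> 'a uspace \<Rightarrow> ('u emetric \<times> ('u \<Rightarrow> 'a)) set" where
  "clc_maps T X = {(M, h). clc M \<and> umap (metric_uspace M) X h}"

definition pt_emetric :: "'u emetric" where
  "pt_emetric = \<lparr> epoints = {undefined}, edist = (\<lambda>x y. 0) \<rparr>"

lemma epoints_pt [simp]: "epoints pt_emetric = {undefined}"
  by (simp add: pt_emetric_def)

lemma clc_one_point: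
  assumes "epoints M = {a}" "edist M a a = 0"
  shows "clc M"
proof -
  have em: "is_emetric M" using assms by (auto simp: is_emetric_def)
  have "metric_topology M = discrete_topology {a}"
    unfolding topology_eq using assms by (auto simp: openin_metric_topology[OF em] intro: exI[of _ 1])
  then show ?thesis using em
    by (auto simp: clc_def connected_space_discrete_topology locally_connected_space_discrete_topology)
qed

lemma clc_pt: "clc pt_emetric"
  by (rule clc_one_point[of _ undefined]) (auto simp: pt_emetric_def)

lemma umap_pt: "is_uspace X \<Longrightarrow> x \<in> upoints X \<Longrightarrow> umap (metric_uspace pt_emetric) X (\<lambda>_. x)"
  by (rule umap_const)

text \<open>
  Being a uniform colimit of connected, locally connected metric spaces means having the final
  uniformity for all maps out of such spaces.  In the converse direction the colimit is taken over
  all these maps; a cocone is a function on points because one-point spaces occur in the diagram.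
\<close>

lemma U_object_iff:
  fixes X :: "'a uspace"
  shows "U_object TYPE('u) X \<longleftrightarrow> separated X \<and> final_uspace (clc_maps TYPE('u) X) X"
proof
  assume "U_object TYPE('u) X"
  then have "separated X \<and> (\<exists>(I :: ('u emetric \<times> ('u \<Rightarrow> 'a)) set) (M :: _ \<Rightarrow> 'u emetric) A h. (\<forall>i\<in>I. clc (M i)) \<and>
     is_colimit upoints upoints umap umap umap is_uspace I (\<lambda>i. metric_uspace (M i)) A h X)"
    unfolding U_object_def clc_def .
  then obtain I :: "('u emetric \<times> ('u \<Rightarrow> 'a)) set" and M :: "_ \<Rightarrow> 'u emetric" and A h where sep: "separated X"
    and M: "\<And>i. i \<in> I \<Longrightarrow> clc (M i)"
    and col: "is_colimit upoints upoints umap umap umap is_uspace I (\<lambda>i. metric_uspace (M i)) A h X"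
    by (elim conjE exE) (rule that, auto)
  have X: "is_uspace X" and coc: "is_cocone upoints umap I (\<lambda>i. metric_uspace (M i)) A h X"
    using col by (auto simp: is_colimit_def)
  note univ = col[unfolded is_colimit_def upoints_metric_uspace, THEN conjunct2, THEN conjunct2, THEN conjunct2]
  have ext: "\<exists>g. umap X W g \<and> (\<forall>i\<in>I. \<forall>p \<in> epoints (M i). g (h i p) = k i p)"
    if "is_uspace W" "is_cocone upoints umap I (\<lambda>i. metric_uspace (M i)) A k W" for W :: "'a uspace" and k
    by (rule univ[THEN spec, THEN spec, THEN mp, OF conjI[OF that], THEN conjunct1])
  have uni: "g x = g' x" if "is_uspace W" "is_cocone upoints umap I (\<lambda>i. metric_uspace (M i)) A k W"
    "umap X W g" "\<forall>i\<in>I. \<forall>p \<in> epoints (M i). g (h i p) = k i p"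
    "umap X W g'" "\<forall>i\<in>I. \<forall>p \<in> epoints (M i). g' (h i p) = k i p" "x \<in> upoints X" for W :: "'a uspace" and k g g' x
    using univ[THEN spec, THEN spec, THEN mp, OF conjI[OF that(1,2)], THEN conjunct2,
       THEN spec, THEN spec, of g g'] that(3-7) by simp
  have "entourages X \<le> entourages V"
    if V: "is_uspace V" and pts: "upoints V = upoints X"
      and c: "\<forall>(M, c) \<in> clc_maps TYPE('u) X. umap (metric_uspace M) V c" for V
  proof -
    let ?V = "umeet X V"
    have V': "is_uspace ?V" by (rule is_uspace_umeet[OF X V]) (simp add: pts)
    have hV: "umap (metric_uspace (M i)) ?V (h i)" if i: "i \<in> I" for i
    proof -
      have 1: "umap (metric_uspace (M i)) X (h i)" using coc i by (simp add: is_cocone_def)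
      then have "umap (metric_uspace (M i)) V (h i)" using c M[OF i] by (auto simp: clc_maps_def)
      with 1 show ?thesis unfolding umap_def by (auto simp: umeet_def filterlim_inf)
    qed
    then have "is_cocone upoints umap I (\<lambda>i. metric_uspace (M i)) A h ?V"
      using coc by (simp add: is_cocone_def)
    from ext[OF V' this] obtain g where g: "umap X ?V g" "\<forall>i\<in>I. \<forall>p \<in> epoints (M i). g (h i p) = h i p" by blast
    have toX: "umap ?V X (\<lambda>x. x)" and toV: "umap ?V V (\<lambda>x. x)"
      unfolding umap_iff using pts by (auto simp: umeet_def intro: filter_leD[OF inf_le1] filter_leD[OF inf_le2])
    have "g x = x" if "x \<in> upoints X" for x
      using uni[OF X coc umap_comp[OF g(1) toX] _ umap_id _ that] g(2) by simp
    then have "umap X V (\<lambda>x. x)" by (intro umap_cong[OF X umap_comp[OF g(1) toV]])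
    then show ?thesis unfolding umap_iff le_filter_def by auto
  qed
  then show "separated X \<and> final_uspace (clc_maps TYPE('u) X) X"
    using sep X by (auto simp: final_uspace_def clc_maps_def)
next
  assume *: "separated X \<and> final_uspace (clc_maps TYPE('u) X) X"
  then have fin: "final_uspace (clc_maps TYPE('u) X) X" and X: "is_uspace X" by (auto simp: final_uspace_def)
  let ?I = "clc_maps TYPE('u) X" and ?D = "\<lambda>i :: 'u emetric \<times> ('u \<Rightarrow> 'a). metric_uspace (fst i)"
  define A where "A = {(i, j, f). i \<in> ?I \<and> j \<in> ?I \<and> umap (?D i) (?D j) f \<and>
     (\<forall>p \<in> epoints (fst i). snd j (f p) = snd i p)}"
  have "is_colimit upoints upoints umap umap umap is_uspace ?I ?D A snd X"
    unfolding is_colimit_def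
  proof (intro conjI allI impI)
    show "is_diagram umap ?I ?D A" by (auto simp: is_diagram_def A_def)
    show "is_uspace X" by (rule X)
    show "is_cocone upoints umap ?I ?D A snd X" by (auto simp: is_cocone_def A_def clc_maps_def)
    fix W :: "'a uspace" and k
    assume "is_uspace W \<and> is_cocone upoints umap ?I ?D A k W"
    then have W: "is_uspace W" and k: "\<And>i. i \<in> ?I \<Longrightarrow> umap (?D i) W (k i)"
      and kA: "\<And>i j f p. (i, j, f) \<in> A \<Longrightarrow> p \<in> epoints (fst i) \<Longrightarrow> k j (f p) = k i p"
      by (auto simp: is_cocone_def)
    define pt :: "'a \<Rightarrow> 'u emetric \<times> ('u \<Rightarrow> 'a)" where "pt x = (pt_emetric, \<lambda>_. x)" for x
    have pt: "pt x \<in> ?I" if "x \<in> upoints X" for x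
      using that by (simp add: clc_maps_def clc_pt pt_def umap_pt[OF X])
    define g where "g x = k (pt x) undefined" for x
    have gk: "g (snd i p) = k i p" if i: "i \<in> ?I" and p: "p \<in> epoints (fst i)" for i p
    proof -
      have M: "clc (fst i)" "umap (metric_uspace (fst i)) X (snd i)" using i by (auto simp: clc_maps_def)
      have x: "snd i p \<in> upoints X" using umap_points[OF M(2)] p by simp
      have "(pt (snd i p), i, \<lambda>_. p) \<in> A"
        using pt[OF x] i p umap_pt[OF clc_uspace[OF M(1)]] by (auto simp: A_def pt_def)
      from kA[OF this, of undefined] show ?thesis by (simp add: g_def pt_def)
    qed
    have gp: "g x \<in> upoints W" if "x \<in> upoints X" for x
      using umap_points[OF k[OF pt[OF that]], of undefined] by (simp add: g_def pt_def)
    have "umap X W g"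
    proof (rule final_uspace_umap[OF fin W gp])
      fix M c assume Mc: "(M, c) \<in> ?I"
      then have M: "clc M" by (simp add: clc_maps_def)
      show "umap (metric_uspace M) W (\<lambda>m. g (c m))"
        by (rule umap_cong[OF clc_uspace[OF M], of W "k (M, c)"]) (use k[OF Mc] gk[OF Mc] in auto)
    qed
    then show "\<exists>g. umap X W g \<and> (\<forall>i\<in>?I. \<forall>p\<in>upoints (?D i). g (snd i p) = k i p)"
      using gk by auto
    fix g g' x assume **: "umap X W g \<and> (\<forall>i\<in>?I. \<forall>p\<in>upoints (?D i). g (snd i p) = k i p) \<and>
       umap X W g' \<and> (\<forall>i\<in>?I. \<forall>p\<in>upoints (?D i). g' (snd i p) = k i p)"
    show "\<forall>x\<in>upoints X. g x = g' x"
    proof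
      fix x assume x: "x \<in> upoints X"
      show "g x = g' x" using ** pt[OF x] by (force simp: pt_def)
    qed
  qed
  then show "U_object TYPE('u) X"
    unfolding U_object_def using *
    by (intro conjI exI[of _ ?I] exI[of _ fst] exI[of _ A] exI[of _ snd]) (auto simp: clc_maps_def clc_def)
qed

lemma U_object_uspace: "U_object TYPE('u) X \<Longrightarrow> is_uspace X"
  by (simp add: U_object_iff final_uspace_def)

lemma U_object_separated: "U_object TYPE('u) X \<Longrightarrow> separated X"
  by (simp add: U_object_iff)

lemma U_object_umapI:
  assumes X: "U_object TYPE('u) X" and Y: "is_uspace Y"
    and f: "\<And>M h. clc (M :: 'u emetric) \<Longrightarrow> umap (metric_uspace M) X h \<Longrightarrow> umap (metric_uspace M) Y (\<lambda>m. f (h m))"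
  shows "umap X Y f"
proof (rule final_uspace_umap)
  show "final_uspace (clc_maps TYPE('u) X) X" using X by (simp add: U_object_iff)
  show "f x \<in> upoints Y" if "x \<in> upoints X" for x
    using umap_points[OF f[OF clc_pt umap_pt[OF U_object_uspace[OF X] that]], of undefined] by simp
qed (use Y f in \<open>auto simp: clc_maps_def\<close>)

lemma U_objectI_final:
  fixes \<C> :: "('u emetric \<times> ('u \<Rightarrow> 'a)) set"
  assumes "separated X" "final_uspace \<C> X" "\<And>M c. (M, c) \<in> \<C> \<Longrightarrow> clc M"
  shows "U_object TYPE('u) X"
  using assms unfolding U_object_iff final_uspace_def clc_maps_def by blast

lemma U_object_metric:
  fixes M :: "'u emetric" assumes M: "clc M" shows "U_object TYPE('u) (metric_uspace M)"
proof (rule U_objectI_final[of _ "{(M, \<lambda>x. x)}"])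
  show "final_uspace {(M, \<lambda>x. x)} (metric_uspace M)"
    unfolding final_uspace_def using clc_uspace[OF M] by (auto simp: umap_iff le_filter_def)
qed (use M in \<open>auto simp: clc_def separated_metric_uspace\<close>)

text \<open>The supremum of a family of uniformities that is directed by refinement.\<close>

definition usup :: "'a set \<Rightarrow> 'a uspace set \<Rightarrow> 'a uspace" where
  "usup S \<V> = \<lparr> upoints = S, entourages = (INF V\<in>\<V>. entourages V) \<rparr>"

lemma usup_uspace:
  assumes ne: "\<V> \<noteq> {}" and us: "\<And>V. V \<in> \<V> \<Longrightarrow> is_uspace V \<and> upoints V = S"
    and dir: "\<And>V W. V \<in> \<V> \<Longrightarrow> W \<in> \<V> \<Longrightarrow> umeet V W \<in> \<V>"
  shows "is_uspace (usup S \<V>)" "upoints (usup S \<V>) = S"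
    "eventually P (entourages (usup S \<V>)) \<longleftrightarrow> (\<exists>V\<in>\<V>. eventually P (entourages V))"
proof -
  have ev: "eventually P (entourages (usup S \<V>)) \<longleftrightarrow> (\<exists>V\<in>\<V>. eventually P (entourages V))" for P
    unfolding usup_def uspace.simps
  proof (rule eventually_INF_base[OF ne])
    show "\<exists>x\<in>\<V>. entourages x \<le> inf (entourages a) (entourages b)" if "a \<in> \<V>" "b \<in> \<V>" for a b
      using dir[OF that] by (intro bexI[of _ "umeet a b"]) (auto simp: umeet_def)
  qed
  then show "eventually P (entourages (usup S \<V>)) \<longleftrightarrow> (\<exists>V\<in>\<V>. eventually P (entourages V))" .
  show up: "upoints (usup S \<V>) = S" by (simp add: usup_def)
  show "is_uspace (usup S \<V>)"
  proof (rule is_uspaceI)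
    obtain V where V: "V \<in> \<V>" using ne by blast
    show "eventually (\<lambda>(x, y). x \<in> upoints (usup S \<V>) \<and> y \<in> upoints (usup S \<V>)) (entourages (usup S \<V>))"
      unfolding ev up using V us[OF V] uspace_points[of V] by auto
  next
    fix P x assume "eventually P (entourages (usup S \<V>))" "x \<in> upoints (usup S \<V>)"
    then show "P (x, x)" unfolding ev up using us uspace_refl by metis
  next
    fix P assume "eventually P (entourages (usup S \<V>))"
    then show "eventually (\<lambda>(x, y). P (y, x)) (entourages (usup S \<V>))"
      unfolding ev using us uspace_sym by blast
  next
    fix P assume "eventually P (entourages (usup S \<V>))"
    then obtain V where V: "V \<in> \<V>" "eventually P (entourages V)" unfolding ev by blast
    then obtain Q where "eventually Q (entourages V)" "\<And>x y z. Q (x, y) \<Longrightarrow> Q (y, z) \<Longrightarrow> P (x, z)"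
      using uspace_half us by metis
    then show "\<exists>Q. eventually Q (entourages (usup S \<V>)) \<and> (\<forall>x y z. Q (x, y) \<longrightarrow> Q (y, z) \<longrightarrow> P (x, z))"
      unfolding ev using V(1) by blast
  qed
qed

definition final_on :: "'a set \<Rightarrow> ('m emetric \<times> ('m \<Rightarrow> 'a)) set \<Rightarrow> 'a uspace" where
  "final_on S \<C> = usup S {V. is_uspace V \<and> upoints V = S \<and> (\<forall>(M, c) \<in> \<C>. umap (metric_uspace M) V c)}"

lemma final_on:
  assumes C: "\<And>M c. (M, c) \<in> \<C> \<Longrightarrow> is_emetric M \<and> c \<in> epoints M \<rightarrow> S"
  shows "final_uspace \<C> (final_on S \<C>)" "upoints (final_on S \<C>) = S"
proof -
  let ?V = "{V. is_uspace V \<and> upoints V = S \<and> (\<forall>(M, c) \<in> \<C>. umap (metric_uspace M) V c)}"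
  let ?ind = "pm_uspace S (\<lambda>_ _. 0)"
  have "is_uspace ?ind" by (rule is_uspace_pm_uspace) (auto simp: pseudometric_on_def)
  moreover have "umap (metric_uspace M) ?ind c" if "(M, c) \<in> \<C>" for M c
    unfolding umap_pm_uspace_iff
  proof (intro conjI allI impI)
    have em: "is_emetric M" and c: "c \<in> epoints M \<rightarrow> S" using C[OF that] by auto
    then show "c \<in> upoints (metric_uspace M) \<rightarrow> S" by simp
    show "\<forall>\<^sub>F (x, y) in entourages (metric_uspace M). c x \<in> S \<and> c y \<in> S \<and> 0 < e" if "0 < e" for e :: real
      using uspace_points[OF is_uspace_metric_uspace[OF em]] by eventually_elim (use c that in auto)
  qed
  ultimately have ne: "?V \<noteq> {}" by (auto intro!: exI[of _ ?ind])
  have dir: "umeet V W \<in> ?V" if "V \<in> ?V" "W \<in> ?V" for V W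
  proof -
    have "umap (metric_uspace M) (umeet V W) c" if "(M, c) \<in> \<C>" for M c
      using that \<open>V \<in> ?V\<close> \<open>W \<in> ?V\<close> by (intro umap_umeet) auto
    then show ?thesis using that by (auto simp: is_uspace_umeet)
  qed
  have us: "is_uspace (final_on S \<C>)" and up: "upoints (final_on S \<C>) = S"
    and ev: "eventually P (entourages (final_on S \<C>)) \<longleftrightarrow> (\<exists>V\<in>?V. eventually P (entourages V))" for P
    unfolding final_on_def using usup_uspace[OF ne _ dir] by auto
  show "upoints (final_on S \<C>) = S" by (rule up)
  have "umap (metric_uspace M) (final_on S \<C>) c" if Mc: "(M, c) \<in> \<C>" for M c
    unfolding umap_iff up
  proof (intro conjI allI impI)
    show "c \<in> upoints (metric_uspace M) \<rightarrow> S" using C[OF Mc] by simp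
    fix P assume "eventually P (entourages (final_on S \<C>))"
    then obtain V where V: "V \<in> ?V" "eventually P (entourages V)" unfolding ev by blast
    then have "umap (metric_uspace M) V c" using Mc by auto
    from umap_eventually[OF this V(2)] show "\<forall>\<^sub>F (x, y) in entourages (metric_uspace M). P (c x, c y)" .
  qed
  moreover have "entourages (final_on S \<C>) \<le> entourages V" if "V \<in> ?V" for V
    using that by (auto simp: le_filter_def ev)
  ultimately show "final_uspace \<C> (final_on S \<C>)" using us up by (auto simp: final_uspace_def)
qed


subsection \<open>Coreflections and products\<close>

lemma is_ucoref_final_on:
  fixes S :: "'a uspace"
  assumes S: "is_uspace S" and sep: "separated S"
  shows "is_ucoref TYPE('u) S (final_on (upoints S) (clc_maps TYPE('u) S))"
proof -
  let ?C = "final_on (upoints S) (clc_maps TYPE('u) S)"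
  have fin: "final_uspace (clc_maps TYPE('u) S) ?C" and pts: "upoints ?C = upoints S"
    by (auto intro!: final_on simp: clc_maps_def umap_def clc_def)
  have CS: "umap ?C S (\<lambda>x. x)"
    by (rule final_uspace_umap[OF fin S]) (simp add: pts, simp add: clc_maps_def)
  have "separated ?C"
    unfolding separated_def
  proof (intro ballI impI)
    fix x y assume xy: "x \<in> upoints ?C" "y \<in> upoints ?C"
      and P: "\<forall>P. eventually P (entourages ?C) \<longrightarrow> P (x, y)"
    have "P (x, y)" if "eventually P (entourages S)" for P
      using umap_eventually[OF CS that] P by auto
    then show "x = y" using sep xy by (auto simp: separated_def pts)
  qed
  then have "U_object TYPE('u) ?C" by (rule U_objectI_final[OF _ fin]) (simp add: clc_maps_def)
  moreover have "umap W ?C f" if W: "U_object TYPE('u) W" and f: "umap W S f" for W :: "'u uspace" and f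
  proof (rule U_object_umapI[OF W])
    show "is_uspace ?C" using fin by (simp add: final_uspace_def)
    fix M :: "'u emetric" and h assume "clc M" "umap (metric_uspace M) W h"
    then have "(M, \<lambda>m. f (h m)) \<in> clc_maps TYPE('u) S" by (simp add: clc_maps_def umap_comp[OF _ f])
    then show "umap (metric_uspace M) ?C (\<lambda>m. f (h m))" using fin by (auto simp: final_uspace_def)
  qed
  ultimately show ?thesis using pts CS by (simp add: is_ucoref_def)
qed

lemma U_object_eqI:
  fixes C D :: "'a uspace"
  assumes C: "U_object TYPE('u) C" and D: "U_object TYPE('u) D" and pts: "upoints C = upoints D"
    and iff: "\<And>M h. clc (M :: 'u emetric) \<Longrightarrow> h \<in> epoints M \<rightarrow> upoints C \<Longrightarrow>
       umap (metric_uspace M) C h \<longleftrightarrow> umap (metric_uspace M) D h"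
  shows "C = D"
proof -
  have le: "entourages C \<le> entourages D" if "umap C D (\<lambda>x. x)" for C D :: "'a uspace"
    using that by (auto simp: umap_iff le_filter_def)
  have "umap C D (\<lambda>x. x)"
    by (rule U_object_umapI[OF C U_object_uspace[OF D]]) (use iff in \<open>auto simp: umap_def\<close>)
  moreover have "umap D C (\<lambda>x. x)"
    by (rule U_object_umapI[OF D U_object_uspace[OF C]]) (use iff pts in \<open>auto simp: umap_def\<close>)
  ultimately have "entourages C = entourages D" using le by (metis antisym)
  then show ?thesis using pts by (simp add: uspace.equality)
qed

lemma is_ucoref_ucoref:
  fixes S :: "'a uspace"
  assumes S: "is_uspace S" and sep: "separated S"
  shows "is_ucoref TYPE('u) S (ucoref TYPE('u) S)"
  unfolding ucoref_def
proof (rule theI[where P = "is_ucoref TYPE('u) S", OF is_ucoref_final_on[OF assms]])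
  fix C assume C: "is_ucoref TYPE('u) S C"
  let ?D = "final_on (upoints S) (clc_maps TYPE('u) S)"
  have D: "is_ucoref TYPE('u) S ?D" by (rule is_ucoref_final_on[OF assms])
  have iff: "umap (metric_uspace M) E h \<longleftrightarrow> umap (metric_uspace M) S h"
    if M: "clc (M :: 'u emetric)" and E: "is_ucoref TYPE('u) S E" for M E h
    using E U_object_metric[OF M] umap_comp[of "metric_uspace M" E h S "\<lambda>x. x"]
    unfolding is_ucoref_def by auto
  show "C = ?D"
  proof (rule U_object_eqI)
    show "U_object TYPE('u) C" "U_object TYPE('u) ?D" "upoints C = upoints ?D"
      using C D by (auto simp: is_ucoref_def)
  qed (use iff C D in blast)
qed

lemma umap_ucoref_iff:
  assumes S: "is_uspace S" and sep: "separated S" and W: "U_object TYPE('u) (W :: 'u uspace)"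
  shows "umap W (ucoref TYPE('u) S) f \<longleftrightarrow> umap W S f"
  using is_ucoref_ucoref[OF S sep] W umap_comp[of W "ucoref TYPE('u) S" f S "\<lambda>x. x"]
  unfolding is_ucoref_def by auto

lemma separated_uprod:
  assumes X: "separated X" and Y: "separated Y"
  shows "separated (uprod X Y)"
  unfolding separated_def uprod_simps
proof (intro ballI impI)
  fix a b assume ab: "a \<in> upoints X \<times> upoints Y" "b \<in> upoints X \<times> upoints Y"
    and P: "\<forall>P. (\<exists>Q R. eventually Q (entourages X) \<and> eventually R (entourages Y) \<and>
       (\<forall>x y x' y'. Q (x, x') \<longrightarrow> R (y, y') \<longrightarrow> P ((x, y), (x', y')))) \<longrightarrow> P (a, b)"
  have "Q (fst a, fst b)" if Q: "eventually Q (entourages X)" for Q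
  proof -
    have "\<exists>Q' R. eventually Q' (entourages X) \<and> eventually R (entourages Y) \<and>
       (\<forall>x y x' y'. Q' (x, x') \<longrightarrow> R (y, y') \<longrightarrow> (\<lambda>(p, q). Q (fst p, fst q)) ((x, y), (x', y')))"
      using Q by (intro exI[of _ Q] exI[of _ "\<lambda>_. True"]) auto
    from P[rule_format, OF this] show ?thesis by simp
  qed
  then have "fst a = fst b" using X ab unfolding separated_def by (metis mem_Times_iff)
  moreover have "R (snd a, snd b)" if R: "eventually R (entourages Y)" for R
  proof -
    have "\<exists>Q' R'. eventually Q' (entourages X) \<and> eventually R' (entourages Y) \<and>
       (\<forall>x y x' y'. Q' (x, x') \<longrightarrow> R' (y, y') \<longrightarrow> (\<lambda>(p, q). R (snd p, snd q)) ((x, y), (x', y')))"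
      using R by (intro exI[of _ "\<lambda>_. True"] exI[of _ R]) auto
    from P[rule_format, OF this] show ?thesis by simp
  qed
  then have "snd a = snd b" using Y ab unfolding separated_def by (metis mem_Times_iff)
  ultimately show "a = b" by (simp add: prod_eq_iff)
qed

lemma umap_U_prod_iff:
  fixes W X :: "'u uspace"
  assumes W: "U_object TYPE('u) W" and X: "U_object TYPE('u) X" and Y: "is_uspace Y"
  shows "umap (U_prod W X) Y f \<longleftrightarrow>
    (\<forall>(N :: 'u emetric) \<alpha> \<beta>. clc N \<and> umap (metric_uspace N) W \<alpha> \<and> umap (metric_uspace N) X \<beta> \<longrightarrow>
       umap (metric_uspace N) Y (\<lambda>n. f (\<alpha> n, \<beta> n)))"
proof -
  let ?S = "uprod W X"
  have S: "is_uspace ?S" "separated ?S"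
    using W X by (auto intro: is_uspace_uprod separated_uprod U_object_uspace U_object_separated)
  note co = is_ucoref_ucoref[OF S, where ?'u = 'u]
  have C: "U_object TYPE('u) (U_prod W X)" using co by (simp add: is_ucoref_def U_prod_def)
  have to: "umap (metric_uspace N) (U_prod W X) h \<longleftrightarrow> umap (metric_uspace N) ?S h" if "clc N" for N :: "'u emetric" and h
    unfolding U_prod_def by (rule umap_ucoref_iff[OF S U_object_metric[OF that]])
  show ?thesis
  proof (intro iffI allI impI)
    fix N :: "'u emetric" and \<alpha> \<beta>
    assume f: "umap (U_prod W X) Y f" and N: "clc N \<and> umap (metric_uspace N) W \<alpha> \<and> umap (metric_uspace N) X \<beta>"
    then have "umap (metric_uspace N) ?S (\<lambda>n. (\<alpha> n, \<beta> n))" by (simp add: umap_uprod_iff)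
    then have "umap (metric_uspace N) (U_prod W X) (\<lambda>n. (\<alpha> n, \<beta> n))" using N to by simp
    from umap_comp[OF this f] show "umap (metric_uspace N) Y (\<lambda>n. f (\<alpha> n, \<beta> n))" .
  next
    assume *: "\<forall>(N :: 'u emetric) \<alpha> \<beta>. clc N \<and> umap (metric_uspace N) W \<alpha> \<and> umap (metric_uspace N) X \<beta> \<longrightarrow>
       umap (metric_uspace N) Y (\<lambda>n. f (\<alpha> n, \<beta> n))"
    show "umap (U_prod W X) Y f"
    proof (rule U_object_umapI[OF C Y])
      fix M :: "'u emetric" and h assume M: "clc M" "umap (metric_uspace M) (U_prod W X) h"
      then have "umap (metric_uspace M) ?S h" using to by simp
      then show "umap (metric_uspace M) Y (\<lambda>m. f (h m))"
        using *[rule_format, of M "\<lambda>m. fst (h m)" "\<lambda>m. snd (h m)"] M by (simp add: umap_uprod_iff)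
    qed
  qed
qed

lemma utopology_uprod:
  assumes X: "is_uspace X" and Y: "is_uspace Y"
  shows "utopology (uprod X Y) = prod_topology (utopology X) (utopology Y)"
  unfolding topology_eq
proof
  fix S
  show "openin (utopology (uprod X Y)) S \<longleftrightarrow> openin (prod_topology (utopology X) (utopology Y)) S"
  proof
    assume S: "openin (utopology (uprod X Y)) S"
    show "openin (prod_topology (utopology X) (utopology Y)) S"
      unfolding openin_prod_topology_alt
    proof (intro allI impI)
      fix x y assume xy: "(x, y) \<in> S"
      then have xy': "x \<in> upoints X" "y \<in> upoints Y" using S by (auto simp: openin_utopology uprod_simps)
      have "eventually (\<lambda>(a, b). a = (x, y) \<longrightarrow> b \<in> S) (entourages (uprod X Y))"
        using S xy unfolding openin_utopology by blast
      then obtain Q R where QR: "eventually Q (entourages X)" "eventually R (entourages Y)"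
        "\<And>a b c d. Q (a, c) \<Longrightarrow> R (b, d) \<Longrightarrow> (a, b) = (x, y) \<longrightarrow> (c, d) \<in> S"
        unfolding uprod_simps by auto
      obtain U where U: "openin (utopology X) U" "x \<in> U" "\<And>c. c \<in> U \<Longrightarrow> Q (x, c)"
        using utopology_nbhd[OF X QR(1) xy'(1)] by blast
      obtain V where V: "openin (utopology Y) V" "y \<in> V" "\<And>d. d \<in> V \<Longrightarrow> R (y, d)"
        using utopology_nbhd[OF Y QR(2) xy'(2)] by blast
      have "U \<times> V \<subseteq> S" using QR(3)[OF U(3) V(3)] by auto
      then show "\<exists>U V. openin (utopology X) U \<and> openin (utopology Y) V \<and> x \<in> U \<and> y \<in> V \<and> U \<times> V \<subseteq> S"
        using U V by blast
    qed
  next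
    assume S: "openin (prod_topology (utopology X) (utopology Y)) S"
    show "openin (utopology (uprod X Y)) S"
      unfolding openin_utopology
    proof (intro conjI ballI)
      show "S \<subseteq> upoints (uprod X Y)" using openin_subset[OF S]
        by (simp add: topspace_utopology[OF X] topspace_utopology[OF Y] uprod_simps)
      fix z assume "z \<in> S"
      moreover obtain x y where "z = (x, y)" by fastforce
      ultimately have z: "z = (x, y)" "(x, y) \<in> S" by auto
      from S[unfolded openin_prod_topology_alt, rule_format, OF z(2)]
      obtain U V where UV: "openin (utopology X) U" "openin (utopology Y) V" "x \<in> U" "y \<in> V" "U \<times> V \<subseteq> S"
        by (elim exE conjE) (rule that)
      have "eventually (\<lambda>(a, b). a = x \<longrightarrow> b \<in> U) (entourages X)" "eventually (\<lambda>(a, b). a = y \<longrightarrow> b \<in> V) (entourages Y)"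
        using UV unfolding openin_utopology by blast+
      then show "\<forall>\<^sub>F (a, b) in entourages (uprod X Y). a = z \<longrightarrow> b \<in> S"
        unfolding uprod_simps using UV(5) z
        by (intro exI[of _ "\<lambda>(a, b). a = x \<longrightarrow> b \<in> U"] exI[of _ "\<lambda>(a, b). a = y \<longrightarrow> b \<in> V"]) auto
    qed
  qed
qed

lemma uniform_iso_homeomorphic:
  assumes "is_uspace X" "is_uspace Y" "umap X Y f" "umap Y X g"
    "\<And>x. x \<in> upoints X \<Longrightarrow> g (f x) = x" "\<And>y. y \<in> upoints Y \<Longrightarrow> f (g y) = y"
  shows "homeomorphic_maps (utopology X) (utopology Y) f g"
  using assms by (auto simp: homeomorphic_maps_def umap_continuous topspace_utopology)


subsection \<open>Copies and products of metric spaces\<close>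

definition eimage :: "('a \<Rightarrow> 'b) \<Rightarrow> 'a emetric \<Rightarrow> 'b emetric" where
  "eimage j M = \<lparr> epoints = j ` epoints M,
     edist = (\<lambda>x y. edist M (inv_into (epoints M) j x) (inv_into (epoints M) j y)) \<rparr>"

lemma epoints_eimage [simp]: "epoints (eimage j M) = j ` epoints M"
  by (simp add: eimage_def)

lemma edist_eimage:
  "inj_on j (epoints M) \<Longrightarrow> x \<in> epoints M \<Longrightarrow> y \<in> epoints M \<Longrightarrow> edist (eimage j M) (j x) (j y) = edist M x y"
  by (simp add: eimage_def)

lemma is_emetric_eimage: "inj_on j (epoints M) \<Longrightarrow> is_emetric M \<Longrightarrow> is_emetric (eimage j M)"
  by (auto simp: is_emetric_def edist_eimage inj_on_eq_iff)

lemma umap_eimage: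
  assumes j: "inj_on j (epoints M)"
  shows "umap (metric_uspace M) (metric_uspace (eimage j M)) j"
    "umap (metric_uspace (eimage j M)) (metric_uspace M) (inv_into (epoints M) j)"
  unfolding umap_iff eventually_metric_uspace using j
  by (auto simp: edist_eimage)

lemma homeomorphic_eimage:
  assumes M: "is_emetric M" and j: "inj_on j (epoints M)"
  shows "homeomorphic_maps (metric_topology M) (metric_topology (eimage j M)) j (inv_into (epoints M) j)"
  unfolding metric_topology_def
  by (rule uniform_iso_homeomorphic)
    (use M j in \<open>auto intro: is_uspace_metric_uspace is_emetric_eimage umap_eimage\<close>)

lemma homeomorphic_space_eimage:
  "is_emetric M \<Longrightarrow> inj_on j (epoints M) \<Longrightarrow> metric_topology M homeomorphic_space metric_topology (eimage j M)"
  using homeomorphic_eimage homeomorphic_space_def by blast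

lemma clc_eimage: "inj_on j (epoints M) \<Longrightarrow> clc M \<Longrightarrow> clc (eimage j M)"
  using homeomorphic_space_eimage[of M j]
  by (auto simp: clc_def is_emetric_eimage homeomorphic_connected_space homeomorphic_locally_connected_space)

definition eprod :: "'a emetric \<Rightarrow> 'b emetric \<Rightarrow> ('a \<times> 'b) emetric" where
  "eprod M N = \<lparr> epoints = epoints M \<times> epoints N,
     edist = (\<lambda>p q. max (edist M (fst p) (fst q)) (edist N (snd p) (snd q))) \<rparr>"

lemma epoints_eprod [simp]: "epoints (eprod M N) = epoints M \<times> epoints N"
  by (simp add: eprod_def)

lemma is_emetric_eprod:
  assumes M: "is_emetric M" and N: "is_emetric N"
  shows "is_emetric (eprod M N)"
  unfolding is_emetric_def
proof (intro conjI ballI)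
  fix x y z assume "x \<in> epoints (eprod M N)" "y \<in> epoints (eprod M N)" "z \<in> epoints (eprod M N)"
  then have "edist M (fst x) (fst z) \<le> edist M (fst x) (fst y) + edist M (fst y) (fst z)"
    "edist N (snd x) (snd z) \<le> edist N (snd x) (snd y) + edist N (snd y) (snd z)"
    using M N unfolding is_emetric_def by auto
  moreover have "\<dots> \<le> edist (eprod M N) x y + edist (eprod M N) y z" by (intro add_mono) (auto simp: eprod_def)
  moreover have "edist M (fst x) (fst y) + edist M (fst y) (fst z) \<le> edist (eprod M N) x y + edist (eprod M N) y z"
    by (intro add_mono) (auto simp: eprod_def)
  ultimately have "max (edist M (fst x) (fst z)) (edist N (snd x) (snd z)) \<le> edist (eprod M N) x y + edist (eprod M N) y z"
    by auto
  then show "edist (eprod M N) x z \<le> edist (eprod M N) x y + edist (eprod M N) y z"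
    by (simp add: eprod_def)
next
  fix x y assume xy: "x \<in> epoints (eprod M N)" "y \<in> epoints (eprod M N)"
  have "max a b = (0::ennreal) \<longleftrightarrow> a = 0 \<and> b = 0" for a b by (auto simp: max_def)
  then show "edist (eprod M N) x y = 0 \<longleftrightarrow> x = y" using M N xy by (auto simp: eprod_def is_emetric_def)
  show "edist (eprod M N) x y = edist (eprod M N) y x" using M N xy by (auto simp: eprod_def is_emetric_def)
qed

lemma metric_uspace_eprod: "metric_uspace (eprod M N) = uprod (metric_uspace M) (metric_uspace N)"
proof -
  have "entourages (metric_uspace (eprod M N)) = entourages (uprod (metric_uspace M) (metric_uspace N))"
    unfolding filter_eq_iff
  proof (intro allI iffI)
    fix P assume "eventually P (entourages (metric_uspace (eprod M N)))"
    then obtain e where e: "e > 0"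
       "\<forall>x\<in>epoints (eprod M N). \<forall>y\<in>epoints (eprod M N). edist (eprod M N) x y < ennreal e \<longrightarrow> P (x, y)"
      by (auto simp: eventually_metric_uspace)
    show "eventually P (entourages (uprod (metric_uspace M) (metric_uspace N)))"
      unfolding uprod_simps using e
      by (intro exI[of _ "\<lambda>(x, y). x \<in> epoints M \<and> y \<in> epoints M \<and> edist M x y < ennreal e"]
         exI[of _ "\<lambda>(x, y). x \<in> epoints N \<and> y \<in> epoints N \<and> edist N x y < ennreal e"])
        (auto simp: eventually_metric_uspace eprod_def)
  next
    fix P assume "eventually P (entourages (uprod (metric_uspace M) (metric_uspace N)))"
    then obtain Q R d e where *: "\<forall>x y x' y'. Q (x, x') \<longrightarrow> R (y, y') \<longrightarrow> P ((x, y), (x', y'))"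
       "d > 0" "\<forall>x\<in>epoints M. \<forall>y\<in>epoints M. edist M x y < ennreal d \<longrightarrow> Q (x, y)"
       "e > 0" "\<forall>x\<in>epoints N. \<forall>y\<in>epoints N. edist N x y < ennreal e \<longrightarrow> R (x, y)"
      unfolding uprod_simps eventually_metric_uspace by blast
    have le: "ennreal (min d e) \<le> ennreal d" "ennreal (min d e) \<le> ennreal e" by (auto intro: ennreal_leI)
    show "eventually P (entourages (metric_uspace (eprod M N)))"
      unfolding eventually_metric_uspace
    proof (intro exI[of _ "min d e"] conjI ballI impI)
      fix p q assume pq: "p \<in> epoints (eprod M N)" "q \<in> epoints (eprod M N)" "edist (eprod M N) p q < ennreal (min d e)"
      then have "edist M (fst p) (fst q) < ennreal d" "edist N (snd p) (snd q) < ennreal e"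
        using le by (auto simp: eprod_def intro: less_le_trans)
      then have "Q (fst p, fst q)" "R (snd p, snd q)" using * pq by auto
      then show "P (p, q)" using *(1) by (metis prod.collapse)
    qed (use * in auto)
  qed
  then show ?thesis by (simp add: uspace.equality uprod_simps(1))
qed

lemma metric_topology_eprod:
  "is_emetric M \<Longrightarrow> is_emetric N \<Longrightarrow>
     metric_topology (eprod M N) = prod_topology (metric_topology M) (metric_topology N)"
  by (simp add: metric_topology_def metric_uspace_eprod utopology_uprod is_uspace_metric_uspace)

lemma clc_eprod: "clc M \<Longrightarrow> clc N \<Longrightarrow> clc (eprod M N)"
  by (auto simp: clc_def is_emetric_eprod metric_topology_eprod connected_space_prod_topology
     locally_connected_space_prod_topology)

lemma inj_prod_exists:
  assumes "infinite (UNIV :: 'u set)"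
  shows "\<exists>j :: 'u \<times> 'u \<Rightarrow> 'u. inj j"
proof -
  obtain j where "bij_betw j ((UNIV :: 'u set) \<times> (UNIV :: 'u set)) (UNIV :: 'u set)"
    using card_of_Times_same_infinite[OF assms] unfolding card_of_ordIso[symmetric] by blast
  then show ?thesis by (auto simp: bij_betw_def)
qed


section \<open>Exponentials\<close>

definition exp_family :: "'u uspace \<Rightarrow> 'u uspace \<Rightarrow> ('u emetric \<times> ('u \<Rightarrow> 'u \<Rightarrow> 'u)) set" where
  "exp_family X Y = {(M, c). clc M \<and> c \<in> epoints M \<rightarrow> uhom X Y \<and>
     umap (U_prod (metric_uspace M) X) Y (\<lambda>(m, x). c m x)}"

definition exp_uspace :: "'u uspace \<Rightarrow> 'u uspace \<Rightarrow> ('u \<Rightarrow> 'u) uspace" where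
  "exp_uspace X Y = final_on (uhom X Y) (exp_family X Y)"

lemma exp_uspace:
  "final_uspace (exp_family X Y) (exp_uspace X Y)" "upoints (exp_uspace X Y) = uhom X Y"
  unfolding exp_uspace_def by (auto intro!: final_on simp: exp_family_def clc_def)

text \<open>
  Since the generating metric spaces are closed under products, the evaluation map is uniform on
  the product of any such space over \<open>exp_uspace X Y\<close> and any such space over \<open>X\<close>.
\<close>

lemma exp_evaluation:
  fixes X Y :: "'u uspace" and N Q :: "'u emetric"
  assumes inf: "infinite (UNIV :: 'u set)" and X: "U_object TYPE('u) X" and Y: "U_object TYPE('u) Y"
    and N: "clc N" and Q: "clc Q" and \<alpha>: "umap (metric_uspace N) (exp_uspace X Y) \<alpha>"
    and \<beta>: "umap (metric_uspace Q) X \<beta>"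
  shows "umap (uprod (metric_uspace N) (metric_uspace Q)) Y (\<lambda>(n, q). \<alpha> n (\<beta> q))"
proof (rule uniform_evaluation[where \<Phi> = "\<lambda>z q. z (\<beta> q)" and \<C> = "exp_family X Y" and Z = "exp_uspace X Y"])
  have Yu: "is_uspace Y" by (rule U_object_uspace[OF Y])
  show "is_emetric N" "connected_space (metric_topology N)" "is_emetric Q" using N Q by (auto simp: clc_def)
  show "final_uspace (exp_family X Y) (exp_uspace X Y)" by (rule exp_uspace)
  show "is_uspace Y" by (rule Yu)
  show "umap (metric_uspace N) (exp_uspace X Y) \<alpha>" by (rule \<alpha>)
  show "is_emetric M" if "(M, c) \<in> exp_family X Y" for M c using that by (auto simp: exp_family_def clc_def)
  show "\<exists>(M, c)\<in>exp_family X Y. z \<in> c ` epoints M" if z: "z \<in> upoints (exp_uspace X Y)" for z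
  proof -
    have zX: "z \<in> uhom X Y" using z by (simp add: exp_uspace)
    have "umap (U_prod (metric_uspace pt_emetric) X) Y (\<lambda>(m, x). z x)"
      unfolding umap_U_prod_iff[OF U_object_metric[OF clc_pt] X Yu]
      using zX by (auto simp: uhom_def intro: umap_comp)
    then have "(pt_emetric, \<lambda>_. z) \<in> exp_family X Y" using zX by (simp add: exp_family_def clc_pt)
    then show ?thesis by force
  qed
  show "umap (uprod (metric_uspace M) (metric_uspace Q)) Y (\<lambda>(m, q). c m (\<beta> q))"
    if Mc: "(M, c) \<in> exp_family X Y" for M c
  proof -
    have M: "clc M" and U: "umap (U_prod (metric_uspace M) X) Y (\<lambda>(m, x). c m x)"
      using Mc by (auto simp: exp_family_def)
    obtain j :: "'u \<times> 'u \<Rightarrow> 'u" where j: "inj j" using inj_prod_exists[OF inf] by blast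
    let ?P = "eprod M Q"
    have jP: "inj_on j (epoints ?P)" using j by (rule inj_on_subset) simp
    let ?R = "eimage j ?P" and ?i = "inv_into (epoints ?P) j"
    have R: "clc ?R" by (rule clc_eimage[OF jP clc_eprod[OF M Q]])
    have "umap (metric_uspace ?R) (uprod (metric_uspace M) (metric_uspace Q)) ?i"
      using umap_eimage(2)[OF jP] by (simp add: metric_uspace_eprod)
    then have i: "umap (metric_uspace ?R) (metric_uspace M) (\<lambda>r. fst (?i r))"
       "umap (metric_uspace ?R) (metric_uspace Q) (\<lambda>r. snd (?i r))" by (auto simp: umap_uprod_iff)
    have "umap (metric_uspace ?R) Y (\<lambda>r. (\<lambda>(m, x). c m x) (fst (?i r), \<beta> (snd (?i r))))"
      using U R i(1) umap_comp[OF i(2) \<beta>] unfolding umap_U_prod_iff[OF U_object_metric[OF M] X Yu] by blast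
    from umap_comp[OF umap_eimage(1)[OF jP] this]
    have *: "umap (uprod (metric_uspace M) (metric_uspace Q)) Y (\<lambda>p. c (fst (?i (j p))) (\<beta> (snd (?i (j p)))))"
      by (simp add: metric_uspace_eprod)
    show ?thesis
      by (rule umap_cong[OF _ *]) (use M Q jP in
         \<open>auto simp: uprod_simps(1) inv_into_f_f intro: is_uspace_uprod clc_uspace\<close>)
  qed
qed

lemma is_U_exponential_exp_uspace:
  fixes X Y :: "'u uspace"
  assumes inf: "infinite (UNIV :: 'u set)" and X: "U_object TYPE('u) X" and Y: "U_object TYPE('u) Y"
  shows "is_U_exponential X Y (exp_uspace X Y)"
proof -
  let ?E = "exp_uspace X Y"
  have Yu: "is_uspace Y" by (rule U_object_uspace[OF Y])
  note fin = exp_uspace(1)[of X Y] and pts = exp_uspace(2)[of X Y]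
  have Eu: "is_uspace ?E" using fin by (simp add: final_uspace_def)
  have ev: "umap ?E Y (\<lambda>f. f x)" if x: "x \<in> upoints X" for x
  proof (rule final_uspace_umap[OF fin Yu])
    show "z x \<in> upoints Y" if "z \<in> upoints ?E" for z using that x by (auto simp: pts uhom_def umap_def)
    fix M c assume Mc: "(M, c) \<in> exp_family X Y"
    then have M: "clc M" and U: "umap (U_prod (metric_uspace M) X) Y (\<lambda>(m, x). c m x)"
      by (auto simp: exp_family_def)
    show "umap (metric_uspace M) Y (\<lambda>m. c m x)"
      using U[unfolded umap_U_prod_iff[OF U_object_metric[OF M] X Yu], rule_format, of M "\<lambda>m. m" "\<lambda>_. x"]
        M umap_id[of "metric_uspace M"] umap_const[OF U_object_uspace[OF X] x, of "metric_uspace M"] by simp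
  qed
  have "separated ?E"
    unfolding separated_def
  proof (intro ballI impI)
    fix f g assume fg: "f \<in> upoints ?E" "g \<in> upoints ?E"
      and P: "\<forall>P. eventually P (entourages ?E) \<longrightarrow> P (f, g)"
    have "f x = g x" if x: "x \<in> upoints X" for x
    proof -
      have "P (f x, g x)" if "eventually P (entourages Y)" for P
        using umap_eventually[OF ev[OF x] that] P by auto
      moreover have "f x \<in> upoints Y" "g x \<in> upoints Y" using fg x by (auto simp: pts uhom_def umap_def)
      ultimately show ?thesis using U_object_separated[OF Y] by (auto simp: separated_def)
    qed
    then show "f = g" using fg by (auto simp: pts uhom_def intro: extensionalityI)
  qed
  then have E: "U_object TYPE('u) ?E" by (rule U_objectI_final[OF _ fin]) (simp add: exp_family_def)
  have "umap W ?E g \<longleftrightarrow> umap (U_prod W X) Y (\<lambda>(w, x). g w x)"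
    if W: "U_object TYPE('u) W" and g: "g \<in> upoints W \<rightarrow> uhom X Y" for W :: "'u uspace" and g
  proof
    assume gE: "umap W ?E g"
    show "umap (U_prod W X) Y (\<lambda>(w, x). g w x)"
      unfolding umap_U_prod_iff[OF W X Yu]
    proof (intro allI impI, elim conjE)
      fix N :: "'u emetric" and \<alpha> \<beta>
      assume N: "clc N" and \<alpha>: "umap (metric_uspace N) W \<alpha>" and \<beta>: "umap (metric_uspace N) X \<beta>"
      have *: "umap (uprod (metric_uspace N) (metric_uspace N)) Y (\<lambda>(n, q). g (\<alpha> n) (\<beta> q))"
        by (rule exp_evaluation[OF inf X Y N N umap_comp[OF \<alpha> gE] \<beta>])
      have "umap (metric_uspace N) (uprod (metric_uspace N) (metric_uspace N)) (\<lambda>n. (n, n))"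
        by (simp add: umap_uprod_iff umap_id)
      from umap_comp[OF this *] show "umap (metric_uspace N) Y (\<lambda>n. case (\<alpha> n, \<beta> n) of (w, x) \<Rightarrow> g w x)" by simp
    qed
  next
    assume U: "umap (U_prod W X) Y (\<lambda>(w, x). g w x)"
    show "umap W ?E g"
    proof (rule U_object_umapI[OF W Eu])
      fix M :: "'u emetric" and h assume M: "clc M" and h: "umap (metric_uspace M) W h"
      have "umap (U_prod (metric_uspace M) X) Y (\<lambda>(m, x). g (h m) x)"
        unfolding umap_U_prod_iff[OF U_object_metric[OF M] X Yu]
      proof (intro allI impI, elim conjE)
        fix N :: "'u emetric" and \<alpha> \<beta>
        assume N: "clc N" and \<alpha>: "umap (metric_uspace N) (metric_uspace M) \<alpha>" and \<beta>: "umap (metric_uspace N) X \<beta>"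
        show "umap (metric_uspace N) Y (\<lambda>n. case (\<alpha> n, \<beta> n) of (m, x) \<Rightarrow> g (h m) x)"
          using U[unfolded umap_U_prod_iff[OF W X Yu], rule_format, of N "\<lambda>n. h (\<alpha> n)" \<beta>]
            N umap_comp[OF \<alpha> h] \<beta> by simp
      qed
      then have "(M, \<lambda>m. g (h m)) \<in> exp_family X Y"
        using M g umap_points[OF h] by (auto simp: exp_family_def)
      then show "umap (metric_uspace M) ?E (\<lambda>m. g (h m))" using fin by (auto simp: final_uspace_def)
    qed
  qed
  then show ?thesis using E pts by (simp add: is_U_exponential_def)
qed

lemma U_exponential_eq:
  fixes X Y :: "'u uspace"
  assumes inf: "infinite (UNIV :: 'u set)" and X: "U_object TYPE('u) X" and Y: "U_object TYPE('u) Y"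
  shows "U_exponential X Y = exp_uspace X Y"
  unfolding U_exponential_def
proof (rule the_equality[where P = "is_U_exponential X Y", OF is_U_exponential_exp_uspace[OF assms]])
  fix E assume E: "is_U_exponential X Y E"
  note F = is_U_exponential_exp_uspace[OF assms]
  show "E = exp_uspace X Y"
  proof (rule U_object_eqI)
    show "U_object TYPE('u) E" "U_object TYPE('u) (exp_uspace X Y)" "upoints E = upoints (exp_uspace X Y)"
      using E F by (auto simp: is_U_exponential_def)
    fix M :: "'u emetric" and h assume "clc M" "h \<in> epoints M \<rightarrow> upoints E"
    then show "umap (metric_uspace M) E h = umap (metric_uspace M) (exp_uspace X Y) h"
      using E F U_object_metric[of M] unfolding is_U_exponential_def by auto
  qed
qed

lemma umap_exponential_iff:
  fixes X Y W :: "'u uspace"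
  assumes inf: "infinite (UNIV :: 'u set)" and X: "U_object TYPE('u) X" and Y: "U_object TYPE('u) Y"
    and W: "U_object TYPE('u) W" and g: "g \<in> upoints W \<rightarrow> uhom X Y"
  shows "umap W (U_exponential X Y) g \<longleftrightarrow>
    (\<forall>(N :: 'u emetric) \<alpha> \<beta>. clc N \<and> umap (metric_uspace N) W \<alpha> \<and> umap (metric_uspace N) X \<beta> \<longrightarrow>
       umap (metric_uspace N) Y (\<lambda>n. g (\<alpha> n) (\<beta> n)))"
  using is_U_exponential_exp_uspace[OF inf X Y] W g
  unfolding U_exponential_eq[OF inf X Y] is_U_exponential_def
  by (simp add: umap_U_prod_iff[OF W X U_object_uspace[OF Y]])

lemma U_exponential_object:
  fixes X Y :: "'u uspace"
  assumes "infinite (UNIV :: 'u set)" "U_object TYPE('u) X" "U_object TYPE('u) Y"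
  shows "U_object TYPE('u) (U_exponential X Y)" "upoints (U_exponential X Y) = uhom X Y"
    "topspace (U_hom X Y) = uhom X Y"
proof -
  show 1: "U_object TYPE('u) (U_exponential X Y)" and 2: "upoints (U_exponential X Y) = uhom X Y"
    using is_U_exponential_exp_uspace[OF assms] U_exponential_eq[OF assms] by (auto simp: is_U_exponential_def)
  show "topspace (U_hom X Y) = uhom X Y"
    unfolding U_hom_def using topspace_utopology[OF U_object_uspace[OF 1]] 2 by simp
qed

section \<open>Fine uniformities\<close>

lemma openin_utopologyI:
  assumes V: "is_uspace V" and pts: "upoints V = topspace X"
    and nbhd: "\<And>P x. eventually P (entourages V) \<Longrightarrow> x \<in> topspace X \<Longrightarrow> \<exists>U. openin X U \<and> x \<in> U \<and> (\<forall>y\<in>U. P (x, y))"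
    and U: "openin (utopology V) U"
  shows "openin X U"
proof (subst openin_subopen, intro ballI)
  fix x assume x: "x \<in> U"
  then have ev: "eventually (\<lambda>(a, b). a = x \<longrightarrow> b \<in> U) (entourages V)" and xX: "x \<in> topspace X"
    using U pts by (auto simp: openin_utopology)
  from nbhd[OF this] show "\<exists>T. openin X T \<and> x \<in> T \<and> T \<subseteq> U" by fastforce
qed

definition coarser_uniformities :: "'a topology \<Rightarrow> 'a uspace set" where
  "coarser_uniformities X = {V. is_uspace V \<and> upoints V = topspace X \<and>
     (\<forall>U. openin (utopology V) U \<longrightarrow> openin X U)}"

lemma coarser_nbhd:
  assumes V: "V \<in> coarser_uniformities X" and P: "eventually P (entourages V)" and x: "x \<in> topspace X"
  shows "\<exists>U. openin X U \<and> x \<in> U \<and> (\<forall>y\<in>U. P (x, y))"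
proof -
  have "is_uspace V" "x \<in> upoints V" using V x by (auto simp: coarser_uniformities_def)
  from utopology_nbhd[OF this(1) P this(2)]
  obtain U where "openin (utopology V) U" "x \<in> U" "\<And>y. y \<in> U \<Longrightarrow> P (x, y)" by blast
  then show ?thesis using V by (auto simp: coarser_uniformities_def)
qed

lemma umeet_coarser:
  assumes V: "V \<in> coarser_uniformities X" and W: "W \<in> coarser_uniformities X"
  shows "umeet V W \<in> coarser_uniformities X"
proof -
  have 1: "is_uspace V" "is_uspace W" "upoints V = topspace X" "upoints W = topspace X"
    using V W by (auto simp: coarser_uniformities_def)
  have u: "is_uspace (umeet V W)" by (rule is_uspace_umeet) (use 1 in auto)
  have "openin X U" if "openin (utopology (umeet V W)) U" for U
  proof (rule openin_utopologyI[OF u _ _ that])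
    fix P x assume "eventually P (entourages (umeet V W))" and x: "x \<in> topspace X"
    then obtain Q R where QR: "eventually Q (entourages V)" "eventually R (entourages W)"
      "\<And>z. Q z \<Longrightarrow> R z \<Longrightarrow> P z" by (auto simp: umeet_def eventually_inf)
    obtain A where A: "openin X A" "x \<in> A" "\<forall>y\<in>A. Q (x, y)" using coarser_nbhd[OF V QR(1) x] by blast
    obtain B where B: "openin X B" "x \<in> B" "\<forall>y\<in>B. R (x, y)" using coarser_nbhd[OF W QR(2) x] by blast
    show "\<exists>U. openin X U \<and> x \<in> U \<and> (\<forall>y\<in>U. P (x, y))"
      by (intro exI[of _ "A \<inter> B"]) (use A B QR(3) in auto)
  qed (use 1 in simp)
  then show ?thesis using u 1 by (simp add: coarser_uniformities_def)
qed

lemma function_uniformity_coarser: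
  fixes f :: "'a \<Rightarrow> real"
  assumes f: "continuous_map X euclideanreal f"
  shows "pm_uspace (topspace X) (\<lambda>a b. \<bar>f a - f b\<bar>) \<in> coarser_uniformities X"
proof -
  let ?V = "pm_uspace (topspace X) (\<lambda>a b. \<bar>f a - f b\<bar>)"
  have u: "is_uspace ?V" by (rule is_uspace_pm_uspace) (auto simp: pseudometric_on_def)
  have "openin X U" if "openin (utopology ?V) U" for U
  proof (rule openin_utopologyI[OF u _ _ that])
    fix P x assume "eventually P (entourages ?V)" and x: "x \<in> topspace X"
    then obtain e where e: "e > 0" "\<forall>x\<in>topspace X. \<forall>y\<in>topspace X. \<bar>f x - f y\<bar> < e \<longrightarrow> P (x, y)"
      by (auto simp: eventually_pm_uspace)
    have "openin X {y \<in> topspace X. f y \<in> ball (f x) e}"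
      by (rule openin_continuous_map_preimage[OF f]) simp
    then show "\<exists>U. openin X U \<and> x \<in> U \<and> (\<forall>y\<in>U. P (x, y))"
      using e x by (intro exI[of _ "{y \<in> topspace X. f y \<in> ball (f x) e}"]) (auto simp: dist_real_def)
  qed simp
  then show ?thesis using u by (simp add: coarser_uniformities_def)
qed

lemma pullback_coarser:
  assumes W: "is_uspace W" and f: "continuous_map X (utopology W) f"
  shows "upullback (topspace X) f W \<in> coarser_uniformities X"
proof -
  let ?V = "upullback (topspace X) f W"
  have fW: "f \<in> topspace X \<rightarrow> upoints W"
    using continuous_map_funspace[OF f] topspace_utopology[OF W] by simp
  have u: "is_uspace ?V" by (rule is_uspace_upullback[OF W fW])
  have pts: "upoints ?V = topspace X" by (simp add: upullback_def)
  have "openin X U" if "openin (utopology ?V) U" for U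
  proof (rule openin_utopologyI[OF u pts _ that])
    fix P x assume "eventually P (entourages ?V)" and x: "x \<in> topspace X"
    then obtain Q where Q: "eventually Q (entourages W)" "\<forall>x\<in>topspace X. \<forall>y\<in>topspace X. Q (f x, f y) \<longrightarrow> P (x, y)"
      by (auto simp: eventually_upullback)
    have "f x \<in> upoints W" using fW x by auto
    from utopology_nbhd[OF W Q(1) this]
    obtain A where A: "openin (utopology W) A" "f x \<in> A" "\<And>y. y \<in> A \<Longrightarrow> Q (f x, y)" by blast
    have "openin X {y \<in> topspace X. f y \<in> A}" by (rule openin_continuous_map_preimage[OF f A(1)])
    then show "\<exists>U. openin X U \<and> x \<in> U \<and> (\<forall>y\<in>U. P (x, y))"
      using x A Q(2) by (intro exI[of _ "{y \<in> topspace X. f y \<in> A}"]) auto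
  qed
  then show ?thesis using u pts by (simp add: coarser_uniformities_def)
qed

definition fine_sup :: "'a topology \<Rightarrow> 'a uspace" where
  "fine_sup X = usup (topspace X) (coarser_uniformities X)"

lemma fine_sup:
  "is_uspace (fine_sup X)" "upoints (fine_sup X) = topspace X"
  "eventually P (entourages (fine_sup X)) \<longleftrightarrow> (\<exists>V\<in>coarser_uniformities X. eventually P (entourages V))"
proof -
  have ne: "coarser_uniformities X \<noteq> {}"
    using function_uniformity_coarser[of X "\<lambda>_. 0"] by (metis continuous_map_const emptyE iso_tuple_UNIV_I topspace_euclidean)
  have us: "is_uspace V \<and> upoints V = topspace X" if "V \<in> coarser_uniformities X" for V
    using that unfolding coarser_uniformities_def by blast
  show "is_uspace (fine_sup X)"
    unfolding fine_sup_def by (rule usup_uspace(1)[OF ne]) (erule us, erule (1) umeet_coarser)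
  show "upoints (fine_sup X) = topspace X" by (simp add: fine_sup_def usup_def)
  show "eventually P (entourages (fine_sup X)) \<longleftrightarrow> (\<exists>V\<in>coarser_uniformities X. eventually P (entourages V))"
    unfolding fine_sup_def
    by (rule usup_uspace(3)[OF ne, where S = "topspace X"]) (erule us, erule (1) umeet_coarser)
qed

lemma utopology_fine_sup:
  assumes X: "completely_regular_space X"
  shows "utopology (fine_sup X) = X"
  unfolding topology_eq
proof
  fix U
  show "openin (utopology (fine_sup X)) U \<longleftrightarrow> openin X U"
  proof
    assume "openin (utopology (fine_sup X)) U"
    then show "openin X U"
    proof (rule openin_utopologyI[OF fine_sup(1,2), rotated])
      fix P x assume P: "eventually P (entourages (fine_sup X))" and x: "x \<in> topspace X"
      obtain V where "V \<in> coarser_uniformities X" "eventually P (entourages V)"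
        using P unfolding fine_sup(3) by (elim bexE)
      then show "\<exists>U. openin X U \<and> x \<in> U \<and> (\<forall>y\<in>U. P (x, y))" using x by (rule coarser_nbhd)
    qed
  next
    assume U: "openin X U"
    show "openin (utopology (fine_sup X)) U"
      unfolding openin_utopology fine_sup
    proof (intro conjI ballI)
      show "U \<subseteq> topspace X" using openin_subset[OF U] .
      fix x assume x: "x \<in> U"
      have "closedin X (topspace X - U)" "x \<in> topspace X - (topspace X - U)"
        using U x openin_subset[OF U] by auto
      then obtain f :: "'a \<Rightarrow> real" where f: "continuous_map X (top_of_set {0..1}) f" "f x = 0" "f ` (topspace X - U) \<subseteq> {1}"
        using X unfolding completely_regular_space_def by blast
      have "continuous_map X euclideanreal f" using f(1) by (rule continuous_map_into_fulltopology)
      from function_uniformity_coarser[OF this]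
      show "\<exists>V\<in>coarser_uniformities X. \<forall>\<^sub>F (a, b) in entourages V. a = x \<longrightarrow> b \<in> U"
        by (rule bexI[rotated]) (use f(2,3) in \<open>auto simp: eventually_pm_uspace intro!: exI[of _ 1]\<close>)
    qed
  qed
qed

lemma fine_uspace_eq:
  assumes X: "completely_regular_space X"
  shows "fine_uspace X = fine_sup X"
  unfolding fine_uspace_def
proof (rule the_equality)
  have le: "entourages (fine_sup X) \<le> entourages V" if "is_uspace V" "utopology V = X" for V
  proof -
    have "V \<in> coarser_uniformities X" using that topspace_utopology[OF that(1)]
      by (simp add: coarser_uniformities_def)
    then show ?thesis by (auto simp: le_filter_def fine_sup(3))
  qed
  then show "is_fine_uniformity X (fine_sup X)"
    by (simp add: is_fine_uniformity_def fine_sup(1) utopology_fine_sup[OF X])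
  fix U assume U: "is_fine_uniformity X U"
  then have "entourages U \<le> entourages (fine_sup X)" "entourages (fine_sup X) \<le> entourages U"
    using le fine_sup(1) utopology_fine_sup[OF X] by (auto simp: is_fine_uniformity_def)
  moreover have "upoints U = topspace X" using U topspace_utopology[of U] by (auto simp: is_fine_uniformity_def)
  ultimately show "U = fine_sup X" by (auto intro!: uspace.equality simp: fine_sup(2))
qed

lemma fine_uspace:
  assumes X: "completely_regular_space X"
  shows "is_uspace (fine_uspace X)" "upoints (fine_uspace X) = topspace X" "utopology (fine_uspace X) = X"
  by (simp_all add: fine_uspace_eq[OF X] fine_sup utopology_fine_sup[OF X])

lemma umap_fine_iff:
  assumes X: "completely_regular_space X" and W: "is_uspace W"
  shows "umap (fine_uspace X) W f \<longleftrightarrow> continuous_map X (utopology W) f"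
proof
  assume "umap (fine_uspace X) W f"
  from umap_continuous[OF _ W this] show "continuous_map X (utopology W) f" by (simp add: fine_uspace[OF X])
next
  assume f: "continuous_map X (utopology W) f"
  have "upullback (topspace X) f W \<in> coarser_uniformities X" by (rule pullback_coarser[OF W f])
  moreover have "eventually (\<lambda>(x, y). P (f x, f y)) (entourages (upullback (topspace X) f W))"
    if "eventually P (entourages W)" for P using that by (auto simp: eventually_upullback)
  ultimately show "umap (fine_uspace X) W f"
    unfolding umap_iff fine_uspace_eq[OF X] fine_sup
    using continuous_map_funspace[OF f] topspace_utopology[OF W] by auto
qed

lemma separated_fine:
  assumes X: "completely_regular_space X" and H: "Hausdorff_space X"
  shows "separated (fine_uspace X)"
  unfolding separated_def
proof (intro ballI impI, rule ccontr)
  fix x y assume xy: "x \<in> upoints (fine_uspace X)" "y \<in> upoints (fine_uspace X)"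
    and P: "\<forall>P. eventually P (entourages (fine_uspace X)) \<longrightarrow> P (x, y)" and "x \<noteq> y"
  then have xy': "x \<in> topspace X" "y \<in> topspace X" by (simp_all add: fine_uspace[OF X])
  obtain U where U: "openin X U" "x \<in> U" "y \<notin> U"
    using H xy' \<open>x \<noteq> y\<close> unfolding Hausdorff_space_def disjnt_def by blast
  then have "openin (utopology (fine_uspace X)) U" by (simp add: fine_uspace[OF X])
  then have "eventually (\<lambda>(a, b). a = x \<longrightarrow> b \<in> U) (entourages (fine_uspace X))"
    using U(2) by (auto simp: openin_utopology)
  then show False using P U(3) by auto
qed


section \<open>Compact metric spaces and the objects of the category of spaces\<close>

lemma compact_umap:
  assumes M: "is_emetric M" and comp: "compact_space (metric_topology M)" and W: "is_uspace W"
    and f: "continuous_map (metric_topology M) (utopology W) f"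
  shows "umap (metric_uspace M) W f"
  unfolding umap_iff
proof (intro conjI allI impI)
  have fW: "f x \<in> upoints W" if "x \<in> epoints M" for x
    using continuous_map_funspace[OF f] that topspace_utopology[OF W] M by auto
  then show "f \<in> upoints (metric_uspace M) \<rightarrow> upoints W" by simp
  fix P assume "eventually P (entourages W)"
  then obtain Q where Q: "eventually Q (entourages W)" "\<And>x y z. Q (x, y) \<Longrightarrow> Q (y, z) \<Longrightarrow> P (x, z)"
    using uspace_half[OF W] by metis
  define R where "R = (\<lambda>(x, y). Q (x, y) \<and> Q (y, x))"
  have R: "eventually R (entourages W)"
    using Q(1) uspace_sym[OF W Q(1)] by eventually_elim (auto simp: R_def)
  have "\<exists>e>0. \<forall>y\<in>epoints M. edist M x y < ennreal (2 * e) \<longrightarrow> R (f x, f y)" if x: "x \<in> epoints M" for x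
  proof -
    obtain A where A: "openin (utopology W) A" "f x \<in> A" "\<And>y. y \<in> A \<Longrightarrow> R (f x, y)"
      using utopology_nbhd[OF W R fW[OF x]] by blast
    have "openin (metric_topology M) {y \<in> topspace (metric_topology M). f y \<in> A}"
      by (rule openin_continuous_map_preimage[OF f A(1)])
    then obtain e where "e > 0" "\<forall>y\<in>epoints M. edist M x y < ennreal e \<longrightarrow> f y \<in> A"
      using x A(2) M unfolding openin_metric_topology[OF M] by auto
    then show ?thesis using A(3) by (intro exI[of _ "e/2"]) auto
  qed
  then obtain \<epsilon> where \<epsilon>: "\<And>x. x \<in> epoints M \<Longrightarrow> \<epsilon> x > 0"
     "\<And>x y. x \<in> epoints M \<Longrightarrow> y \<in> epoints M \<Longrightarrow> edist M x y < ennreal (2 * \<epsilon> x) \<Longrightarrow> R (f x, f y)"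
    by metis
  define B where "B x = {y\<in>epoints M. \<exists>e>0. \<forall>z\<in>epoints M. edist M y z < ennreal e \<longrightarrow> edist M x z < ennreal (\<epsilon> x)}" for x
  have tri: "edist M a c < ennreal (r + s)"
    if "a \<in> epoints M" "b \<in> epoints M" "c \<in> epoints M" "edist M a b < ennreal r" "edist M b c < ennreal s" "r > 0" "s > 0"
    for a b c r s
  proof -
    have "edist M a c \<le> edist M a b + edist M b c" using M that by (auto simp: is_emetric_def)
    also have "\<dots> < ennreal r + ennreal s" using that by (intro add_strict_mono) auto
    also have "\<dots> = ennreal (r + s)" using that by simp
    finally show ?thesis .
  qed
  have "openin (metric_topology M) (B x)" if x: "x \<in> epoints M" for x
    unfolding openin_metric_topology[OF M]
  proof (intro conjI ballI)
    fix y assume y: "y \<in> B x"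
    then obtain e where e: "e > 0" "\<forall>z\<in>epoints M. edist M y z < ennreal e \<longrightarrow> edist M x z < ennreal (\<epsilon> x)"
      by (auto simp: B_def)
    have "z \<in> B x" if z: "z \<in> epoints M" "edist M y z < ennreal (e/2)" for z
    proof -
      have "edist M x w < ennreal (\<epsilon> x)" if w: "w \<in> epoints M" "edist M z w < ennreal (e/2)" for w
      proof -
        have "edist M y w < ennreal (e/2 + e/2)"
          by (rule tri[of y z w]) (use y z w e in \<open>auto simp: B_def\<close>)
        then show ?thesis using e(2) w by simp
      qed
      then show ?thesis using z e(1) unfolding B_def by (intro CollectI conjI exI[of _ "e/2"]) auto
    qed
    then show "\<exists>e>0. \<forall>z\<in>epoints M. edist M y z < ennreal e \<longrightarrow> z \<in> B x"
      using e(1) by (intro exI[of _ "e/2"]) auto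
  qed (auto simp: B_def)
  moreover have xB: "x \<in> B x" if "x \<in> epoints M" for x using \<epsilon>(1)[OF that] that by (auto simp: B_def)
  ultimately have "\<exists>\<F>. finite \<F> \<and> \<F> \<subseteq> B ` epoints M \<and> topspace (metric_topology M) \<subseteq> \<Union>\<F>"
    using comp M unfolding compact_space_alt by (elim allE[of _ "B ` epoints M"]) auto
  then obtain \<F> where \<F>: "finite \<F>" "\<F> \<subseteq> B ` epoints M" "topspace (metric_topology M) \<subseteq> \<Union>\<F>"
    by (elim exE conjE)
  then obtain F where "F \<subseteq> epoints M" "finite F" "\<F> = B ` F" using finite_subset_image[OF \<F>(1,2)] by (elim exE conjE)
  then have F: "finite F" "F \<subseteq> epoints M" "epoints M \<subseteq> (\<Union>x\<in>F. B x)"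
    using M \<F>(3) by auto
  define e where "e = Min (insert 1 (\<epsilon> ` F))"
  have e0: "e > 0" unfolding e_def using F \<epsilon>(1) by (subst Min_gr_iff) auto
  have e\<epsilon>: "e \<le> \<epsilon> x" if "x \<in> F" for x unfolding e_def using F(1) that by (intro Min_le) auto
  have "P (f y, f z)" if yz: "y \<in> epoints M" "z \<in> epoints M" "edist M y z < ennreal e" for y z
  proof -
    obtain x where x: "x \<in> F" "y \<in> B x" using F yz by blast
    then have xM: "x \<in> epoints M" using F by blast
    have xy: "edist M x y < ennreal (\<epsilon> x)" using x(2) yz(1) emetric_refl[OF M yz(1)] by (auto simp: B_def)
    have "ennreal e \<le> ennreal (\<epsilon> x)" using e\<epsilon>[OF x(1)] by (rule ennreal_leI)
    then have "edist M y z < ennreal (\<epsilon> x)" using yz(3) by (rule less_le_trans[rotated])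
    then have "edist M x z < ennreal (\<epsilon> x + \<epsilon> x)" by (rule tri[OF xM yz(1,2) xy _ \<epsilon>(1)[OF xM] \<epsilon>(1)[OF xM]])
    moreover have "\<epsilon> x + \<epsilon> x = 2 * \<epsilon> x" by simp
    ultimately have "R (f x, f z)" using \<epsilon>(2)[OF xM yz(2)] by metis
    moreover have "ennreal (\<epsilon> x) \<le> ennreal (2 * \<epsilon> x)" using \<epsilon>(1)[OF xM] by (intro ennreal_leI) simp
    then have "R (f x, f y)" using \<epsilon>(2)[OF xM yz(1)] xy by (meson less_le_trans)
    ultimately show ?thesis using Q(2) by (auto simp: R_def)
  qed
  then show "\<forall>\<^sub>F (x, y) in entourages (metric_uspace M). P (f x, f y)"
    using e0 by (auto simp: eventually_metric_uspace)
qed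

definition metric_emetric :: "'a set \<Rightarrow> ('a \<Rightarrow> 'a \<Rightarrow> real) \<Rightarrow> 'a emetric" where
  "metric_emetric S d = \<lparr> epoints = S, edist = (\<lambda>x y. ennreal (d x y)) \<rparr>"

lemma epoints_metric_emetric [simp]: "epoints (metric_emetric S d) = S"
  by (simp add: metric_emetric_def)

lemma (in Metric_space) metric_emetric:
  "is_emetric (metric_emetric M d)" "metric_topology (metric_emetric M d) = mtopology"
proof -
  show em: "is_emetric (metric_emetric M d)"
    unfolding is_emetric_def metric_emetric_def
    by (auto simp: commute ennreal_eq_0_iff triangle simp flip: ennreal_plus intro!: ennreal_leI)
       (metis nonneg zero order_antisym)+
  show "metric_topology (metric_emetric M d) = mtopology"
    unfolding topology_eq
  proof
    fix U
    have eq: "(\<exists>e>0. \<forall>y\<in>M. edist (metric_emetric M d) x y < ennreal e \<longrightarrow> y \<in> U) \<longleftrightarrow> (\<exists>r>0. mball x r \<subseteq> U)"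
      if "x \<in> M" for x
      using that by (intro ex_cong1 conj_cong refl) (auto simp: metric_emetric_def ennreal_less_iff)
    have "(\<forall>x\<in>U. \<exists>e>0. \<forall>y\<in>M. edist (metric_emetric M d) x y < ennreal e \<longrightarrow> y \<in> U) \<longleftrightarrow>
        (\<forall>x. x \<in> U \<longrightarrow> (\<exists>r>0. mball x r \<subseteq> U))" if "U \<subseteq> M"
    proof -
      have "(\<exists>e>0. \<forall>y\<in>M. edist (metric_emetric M d) x y < ennreal e \<longrightarrow> y \<in> U) \<longleftrightarrow> (\<exists>r>0. mball x r \<subseteq> U)"
        if "x \<in> U" for x using eq \<open>U \<subseteq> M\<close> that by (meson subsetD)
      then show ?thesis by (simp cong: ball_cong) (simp add: Ball_def)
    qed
    then show "openin (metric_topology (metric_emetric M d)) U = openin mtopology U"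
      unfolding openin_metric_topology[OF em] openin_mtopology by (simp cong: conj_cong)
  qed
qed

lemma metric_emetric_dist:
  fixes S :: "'a::metric_space set"
  shows "is_emetric (metric_emetric S dist)" "metric_topology (metric_emetric S dist) = top_of_set S"
proof -
  show em: "is_emetric (metric_emetric S dist)"
    unfolding is_emetric_def metric_emetric_def
    by (auto simp: dist_commute ennreal_eq_0_iff dist_triangle simp flip: ennreal_plus intro!: ennreal_leI)
  show "metric_topology (metric_emetric S dist) = top_of_set S"
    unfolding topology_eq openin_metric_topology[OF em] openin_euclidean_subtopology_iff
    by (auto simp: metric_emetric_def ennreal_less_iff dist_commute)
qed

definition peano_maps :: "'u topology \<Rightarrow> ('u emetric \<times> ('u \<Rightarrow> 'u)) set" where
  "peano_maps X = {(M, c). clc M \<and> compact_space (metric_topology M) \<and> continuous_map (metric_topology M) X c}"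

lemma T_space_final:
  fixes X W :: "'u topology"
  assumes T: "T_space X" and W: "topspace W = topspace X"
    and h: "\<And>(D :: 'u topology) h. compact_space D \<Longrightarrow> locally_connected_space D \<Longrightarrow> second_countable D \<Longrightarrow>
       continuous_map D X h \<Longrightarrow> continuous_map D W h"
  shows "continuous_map X W (\<lambda>x. x)"
proof -
  obtain I :: "('u topology \<times> ('u \<Rightarrow> 'u)) set" and D :: "_ \<Rightarrow> 'u topology" and A h where
    D: "\<forall>i\<in>I. compact_space (D i) \<and> locally_connected_space (D i) \<and> second_countable (D i)"
    and col: "is_colimit topspace topspace continuous_map continuous_map continuous_map (\<lambda>_. True) I D A h X"
    using T unfolding T_space_def by (elim conjE exE) (rule that)
  note univ = col[unfolded is_colimit_def, THEN conjunct2, THEN conjunct2, THEN conjunct2, THEN spec, THEN spec, THEN mp]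
  have coc: "is_cocone topspace continuous_map I D A h X" using col by (simp add: is_colimit_def)
  then have hX: "continuous_map (D i) X (h i)" if "i \<in> I" for i using that by (simp add: is_cocone_def)
  have "is_cocone topspace continuous_map I D A h W"
    using coc D h hX by (simp add: is_cocone_def)
  from univ[OF conjI[OF TrueI this]] obtain g where
    g: "continuous_map X W g" "\<forall>i\<in>I. \<forall>p \<in> topspace (D i). g (h i p) = h i p" by blast
  \<comment> \<open>the indiscrete topology receives all functions, so the universal property forces \<open>g\<close> to be the identity\<close>
  let ?J = "utopology (pm_uspace (topspace X) (\<lambda>_ _. 0))"
  have Ju: "is_uspace (pm_uspace (topspace X) (\<lambda>_ _. 0))"
    by (rule is_uspace_pm_uspace) (auto simp: pseudometric_on_def)
  have J: "continuous_map T ?J f" if "f \<in> topspace T \<rightarrow> topspace X" for T :: "'u topology" and f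
    unfolding continuous_map
  proof (intro conjI allI impI)
    show "f ` topspace T \<subseteq> topspace ?J" using that by (auto simp: topspace_utopology[OF Ju])
    fix U assume U: "openin ?J U"
    have "U = {} \<or> U = topspace X"
    proof (cases "U = {}")
      case False
      then obtain x where x: "x \<in> U" by blast
      then have "eventually (\<lambda>(a, b). a = x \<longrightarrow> b \<in> U) (entourages (pm_uspace (topspace X) (\<lambda>_ _. 0)))" "x \<in> topspace X"
        using U by (auto simp: openin_utopology)
      then have "topspace X \<subseteq> U" by (auto simp: eventually_pm_uspace)
      then show ?thesis using openin_subset[OF U] by (auto simp: topspace_utopology[OF Ju])
    qed simp
    then show "openin T {x \<in> topspace T. f x \<in> U}"
      using that by (auto simp: Pi_iff cong: conj_cong)
  qed
  have "is_cocone topspace continuous_map I D A h ?J"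
    using coc J continuous_map_funspace[OF hX] by (simp add: is_cocone_def)
  note uni = univ[OF conjI[OF TrueI this], THEN conjunct2, THEN spec, THEN spec, of g "\<lambda>x. x", THEN mp]
  have "g x = x" if x: "x \<in> topspace X" for x
  proof -
    have "g \<in> topspace X \<rightarrow> topspace X" using continuous_map_funspace[OF g(1)] W by simp
    then have "continuous_map X ?J g" "continuous_map X ?J (\<lambda>x. x)" by (auto intro!: J)
    then show ?thesis using uni g(2) x by simp
  qed
  then show ?thesis by (rule continuous_map_eq[OF g(1)])
qed

text \<open>
  The map is closed, so the complement of the image of the complement of an open set is open; for finite
  unions of basic open sets these sets form a countable basis, since the fibres are compact.
\<close>

lemma second_countable_compact_image:
  assumes D: "compact_space D" "second_countable D" and H: "Hausdorff_space Q"
    and h: "continuous_map D Q h" and surj: "h ` topspace D = topspace Q"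
  shows "second_countable Q"
proof -
  obtain \<B> where B: "countable \<B>" "\<And>V. V \<in> \<B> \<Longrightarrow> openin D V"
    "\<And>U x. openin D U \<Longrightarrow> x \<in> U \<Longrightarrow> \<exists>V\<in>\<B>. x \<in> V \<and> V \<subseteq> U"
    using D(2) unfolding second_countable_def by metis
  define W where "W \<F> = topspace Q - h ` (topspace D - \<Union>\<F>)" for \<F>
  have cl: "closed_map D Q h" by (rule T1_Spaces.continuous_imp_closed_map[OF h D(1) H])
  have "countable (W ` {\<F>. finite \<F> \<and> \<F> \<subseteq> \<B>})"
    by (intro countable_image countable_Collect_finite_subset B(1))
  moreover have "openin Q (W \<F>)" if "\<F> \<subseteq> \<B>" for \<F>
  proof -
    have "closedin D (topspace D - \<Union>\<F>)" using that B(2) by (intro closedin_diff) auto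
    then show ?thesis using cl by (auto simp: W_def closed_map_def)
  qed
  moreover have "\<exists>V\<in>W ` {\<F>. finite \<F> \<and> \<F> \<subseteq> \<B>}. q \<in> V \<and> V \<subseteq> U" if U: "openin Q U" and q: "q \<in> U" for U q
  proof -
    have qQ: "q \<in> topspace Q" using openin_subset[OF U] q by auto
    let ?C = "{x \<in> topspace D. h x \<in> {q}}"
    have "closedin D ?C"
    proof (rule closedin_continuous_map_preimage[OF h])
      show "closedin Q {q}" using Hausdorff_imp_t1_space[OF H] qQ by (simp add: closedin_t1_singleton)
    qed
    then have C: "compactin D ?C" using D(1) closedin_compact_space by blast
    have UD: "openin D {x \<in> topspace D. h x \<in> U}" by (rule openin_continuous_map_preimage[OF h U])
    let ?G = "{V\<in>\<B>. V \<subseteq> {x \<in> topspace D. h x \<in> U}}"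
    have "?C \<subseteq> \<Union>?G" using B(3)[OF UD] q by fastforce
    then obtain \<F> where F: "finite \<F>" "\<F> \<subseteq> ?G" "?C \<subseteq> \<Union>\<F>" using compactinD[OF C, of ?G] B(2)
      by (metis (no_types, lifting) mem_Collect_eq)
    have "q \<in> W \<F>" using F(3) qQ by (auto simp: W_def)
    moreover have "W \<F> \<subseteq> U"
    proof
      fix y assume y: "y \<in> W \<F>"
      then obtain x where x: "x \<in> topspace D" "y = h x" using surj by (auto simp: W_def)
      then have "x \<in> \<Union>\<F>" using y by (auto simp: W_def)
      then show "y \<in> U" using F(2) x by auto
    qed
    moreover have "W \<F> \<in> W ` {\<F>. finite \<F> \<and> \<F> \<subseteq> \<B>}" using F by (intro imageI) auto
    ultimately show ?thesis by (intro bexI[of _ "W \<F>"] conjI)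
  qed
  ultimately show ?thesis unfolding second_countable_def
    by (intro exI[of _ "W ` {\<F>. finite \<F> \<and> \<F> \<subseteq> \<B>}"]) auto
qed

text \<open>
  Urysohn's metrization theorem in the compact case: the Urysohn functions of the countably many
  pairs of basic sets, one with closure in the other, separate points and embed the space in a
  countable power of the line.
\<close>

lemma compact_second_countable_metrizable:
  assumes Q: "compact_space Q" "Hausdorff_space Q" and sc: "second_countable Q"
  shows "metrizable_space Q"
proof -
  obtain \<B> where B: "countable \<B>" "\<And>V. V \<in> \<B> \<Longrightarrow> openin Q V"
    "\<And>U x. openin Q U \<Longrightarrow> x \<in> U \<Longrightarrow> \<exists>V\<in>\<B>. x \<in> V \<and> V \<subseteq> U"
    using sc unfolding second_countable_def by metis
  have norm: "normal_space Q" using Q by (simp add: compact_Hausdorff_or_regular_imp_normal_space)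
  have reg: "regular_space Q" using Q by (simp add: compact_Hausdorff_imp_regular_space)
  define \<P> where "\<P> = {(U, V) \<in> \<B> \<times> \<B>. Q closure_of U \<subseteq> V}"
  have cP: "countable \<P>" by (rule countable_subset[of _ "\<B> \<times> \<B>"]) (use B(1) in \<open>auto simp: \<P>_def\<close>)
  have ury: "\<exists>f::'a\<Rightarrow>real. continuous_map Q (top_of_set {0..1}) f \<and> f ` (Q closure_of U) \<subseteq> {0} \<and> f ` (topspace Q - V) \<subseteq> {1}"
    if "(U, V) \<in> \<P>" for U V
  proof -
    have "closedin Q (Q closure_of U)" "closedin Q (topspace Q - V)" "disjnt (Q closure_of U) (topspace Q - V)"
      using that B(2) by (auto simp: \<P>_def disjnt_iff)
    then show ?thesis using norm unfolding normal_space_iff_Urysohn by blast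
  qed
  have "\<exists>f::'a\<Rightarrow>real. continuous_map Q euclideanreal f \<and> (p \<in> \<P> \<longrightarrow> f ` (Q closure_of (fst p)) \<subseteq> {0} \<and> f ` (topspace Q - snd p) \<subseteq> {1})" for p
  proof (cases "p \<in> \<P>")
    case True
    then have "(fst p, snd p) \<in> \<P>" by simp
    from ury[OF this] obtain f :: "'a \<Rightarrow> real" where "continuous_map Q (top_of_set {0..1}) f"
      and f: "f ` (Q closure_of (fst p)) \<subseteq> {0}" "f ` (topspace Q - snd p) \<subseteq> {1}" by (elim exE conjE)
    from this(1) have "continuous_map Q euclideanreal f" by (rule continuous_map_into_fulltopology)
    with f show ?thesis by (intro exI[of _ f]) simp
  next
    case False
    then show ?thesis by (intro exI[of _ "\<lambda>_. 0"]) simp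
  qed
  then have "\<forall>p. \<exists>f::'a\<Rightarrow>real. continuous_map Q euclideanreal f \<and> (p \<in> \<P> \<longrightarrow> f ` (Q closure_of (fst p)) \<subseteq> {0} \<and> f ` (topspace Q - snd p) \<subseteq> {1})"
    by (intro allI)
  from choice[OF this] obtain f :: "('a set \<times> 'a set) \<Rightarrow> 'a \<Rightarrow> real" where
    f': "\<forall>p. continuous_map Q euclideanreal (f p) \<and> (p \<in> \<P> \<longrightarrow> f p ` (Q closure_of (fst p)) \<subseteq> {0} \<and> f p ` (topspace Q - snd p) \<subseteq> {1})"
    by (elim exE)
  have f: "continuous_map Q euclideanreal (f p)"
      "p \<in> \<P> \<Longrightarrow> f p ` (Q closure_of (fst p)) \<subseteq> {0} \<and> f p ` (topspace Q - snd p) \<subseteq> {1}" for p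
    using f'[THEN spec, of p] by blast+
  define F where "F x = (\<lambda>n. f (from_nat_into \<P> n) x)" for x
  have "continuous_map Q (euclidean :: (nat \<Rightarrow> real) topology) F"
    unfolding euclidean_product_topology[symmetric] continuous_map_componentwise_UNIV F_def using f(1) by blast
  moreover have "inj_on F (topspace Q)"
  proof (rule inj_onI, rule ccontr)
    fix x y assume xy: "x \<in> topspace Q" "y \<in> topspace Q" "F x = F y" "x \<noteq> y"
    obtain U0 where U0: "openin Q U0" "x \<in> U0" "y \<notin> U0"
      using Q(2) xy unfolding Hausdorff_space_def disjnt_def by blast
    obtain V where V: "V \<in> \<B>" "x \<in> V" "V \<subseteq> U0" using B(3)[OF U0(1,2)] by blast
    have "closedin Q (topspace Q - V)" "x \<in> topspace Q - (topspace Q - V)" using B(2)[OF V(1)] V(2) xy by auto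
    then obtain U1 where U1: "openin Q U1" "x \<in> U1" "disjnt (topspace Q - V) (Q closure_of U1)"
      using reg unfolding regular_space by blast
    obtain U where U: "U \<in> \<B>" "x \<in> U" "U \<subseteq> U1" using B(3)[OF U1(1,2)] by blast
    have "Q closure_of U \<subseteq> V"
      using closure_of_mono[OF U(3), of Q] closure_of_subset_topspace[of Q U] U1(3) by (auto simp: disjnt_iff)
    then have p: "(U, V) \<in> \<P>" using U V by (simp add: \<P>_def)
    then obtain n where n: "from_nat_into \<P> n = (U, V)" using from_nat_into_surj[OF cP] by blast
    have "x \<in> Q closure_of U" using closure_of_subset[of U Q] openin_subset[OF B(2)[OF U(1)]] U(2) by blast
    then have "f (U, V) x = 0" "f (U, V) y = 1" using f(2)[OF p] xy V U0 by auto
    moreover have "f (U, V) x = f (U, V) y" using fun_cong[OF xy(3), of n] by (simp add: F_def n)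
    ultimately show False by simp
  qed
  ultimately have "embedding_map Q (euclidean :: (nat \<Rightarrow> real) topology) F"
    using Q(1) by (intro continuous_imp_embedding_map) auto
  then have "Q homeomorphic_space (subtopology euclidean (F ` topspace Q))"
    by (rule embedding_map_imp_homeomorphic_space)
  then show ?thesis
    using metrizable_space_subtopology[OF metrizable_space_euclidean] homeomorphic_metrizable_space by blast
qed

text \<open>
  The image of a compact, locally connected, second-countable space in a Hausdorff space is a
  finite disjoint union of Peano continua.  So the topology of a space in \<open>\<T>\<close> is final for maps
  out of Peano continua.
\<close>

lemma T_space_peano:
  fixes X W :: "'u topology"
  assumes T: "T_space X" and W: "topspace W = topspace X"
    and c: "\<And>M c. (M, c) \<in> peano_maps X \<Longrightarrow> continuous_map (metric_topology M) W c"
  shows "continuous_map X W (\<lambda>x. x)"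
proof (rule T_space_final[OF T W])
  fix D :: "'u topology" and h
  assume D: "compact_space D" "locally_connected_space D" "second_countable D" and h: "continuous_map D X h"
  let ?Q = "subtopology X (h ` topspace D)"
  have HX: "Hausdorff_space X" using T by (simp add: T_space_def)
  have sub: "h ` topspace D \<subseteq> topspace X" using continuous_map_image_subset_topspace[OF h] .
  have hQ: "continuous_map D ?Q h" using h by (simp add: continuous_map_in_subtopology)
  have tQ: "topspace ?Q = h ` topspace D" using sub by auto
  have HQ: "Hausdorff_space ?Q" using HX by (rule Hausdorff_space_subtopology)
  have quot: "quotient_map D ?Q h"
    by (rule continuous_imp_quotient_map[OF hQ D(1) HQ]) (use tQ in auto)
  have lc: "locally_connected_space ?Q" using locally_connected_space_quotient_map_image[OF D(2) quot] .
  have comp: "compact_space ?Q" using image_compactin[OF _ hQ, of "topspace D"] D(1) tQ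
    by (simp add: compact_space_def)
  have met: "metrizable_space ?Q"
    by (rule compact_second_countable_metrizable[OF comp HQ second_countable_compact_image[OF D(1,3) HQ hQ tQ[symmetric]]])
  have "continuous_map ?Q W (\<lambda>x. x)"
    unfolding continuous_map
  proof (intro conjI allI impI)
    show "(\<lambda>x. x) ` topspace ?Q \<subseteq> topspace W" using W by auto
    fix U assume U: "openin W U"
    show "openin ?Q {x \<in> topspace ?Q. x \<in> U}"
    proof (subst openin_subopen, intro ballI)
      fix x assume x: "x \<in> {x \<in> topspace ?Q. x \<in> U}"
      define P where "P = connected_component_of_set ?Q x"
      have xP: "x \<in> P" using x by (auto simp: P_def connected_component_of_refl)
      have Pcc: "P \<in> connected_components_of ?Q" unfolding P_def connected_components_of_def using x by blast
      have oP: "openin ?Q P" unfolding P_def by (rule openin_connected_component_of_locally_connected_space[OF lc])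
      have PQ: "P \<subseteq> topspace ?Q" using openin_subset[OF oP] .
      have con: "connected_space (subtopology ?Q P)" using connectedin_connected_components_of[OF Pcc] by (simp add: connectedin_def)
      have lcP: "locally_connected_space (subtopology ?Q P)" by (rule locally_connected_space_open_subset[OF lc oP])
      have compP: "compact_space (subtopology ?Q P)"
        using closedin_connected_components_of[OF Pcc] comp closedin_compact_space compact_space_subtopology by blast
      obtain M d where Md: "Metric_space M d" "subtopology ?Q P = Metric_space.mtopology M d"
        using metrizable_space_subtopology[OF met, of P] unfolding metrizable_space_def by auto
      let ?N = "metric_emetric M d"
      have N: "is_emetric ?N" "metric_topology ?N = subtopology ?Q P"
        using Metric_space.metric_emetric[OF Md(1)] Md(2) by auto
      have "continuous_map (subtopology ?Q P) X (\<lambda>x. x)"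
        by (simp add: continuous_map_from_subtopology)
      then have "(?N, \<lambda>x. x) \<in> peano_maps X"
        using N con lcP compP by (simp add: peano_maps_def clc_def)
      from c[OF this] have "continuous_map (subtopology ?Q P) W (\<lambda>x. x)" by (simp add: N)
      from openin_continuous_map_preimage[OF this U]
      have "openin (subtopology ?Q P) {y \<in> topspace (subtopology ?Q P). y \<in> U}" .
      moreover have "{y \<in> topspace (subtopology ?Q P). y \<in> U} = P \<inter> U" using PQ by auto
      ultimately have "openin (subtopology ?Q P) (P \<inter> U)" by (simp only:)
      then have "openin ?Q (P \<inter> U)" using oP openin_trans_full by blast
      then show "\<exists>T. openin ?Q T \<and> x \<in> T \<and> T \<subseteq> {x \<in> topspace ?Q. x \<in> U}"
        using xP x PQ by (intro exI[of _ "P \<inter> U"]) auto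
    qed
  qed
  from continuous_map_compose[OF hQ this] show "continuous_map D W h" by (simp add: o_def)
qed

lemma T_space_cr: "T_space X \<Longrightarrow> completely_regular_space X" by (simp add: T_space_def)

lemma fine_T_space:
  fixes X :: "'u topology"
  assumes T: "T_space X"
  shows "final_uspace (peano_maps X) (fine_uspace X)" "U_object TYPE('u) (fine_uspace X)"
proof -
  note cr = T_space_cr[OF T]
  note F = fine_uspace[OF cr]
  show fin: "final_uspace (peano_maps X) (fine_uspace X)"
    unfolding final_uspace_def
  proof (intro conjI allI impI ballI)
    show "is_uspace (fine_uspace X)" by (rule F)
    fix x assume x: "x \<in> peano_maps X"
    then obtain M c where Mc: "x = (M, c)" "clc M" "compact_space (metric_topology M)" "continuous_map (metric_topology M) X c"
      by (auto simp: peano_maps_def)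
    then have "umap (metric_uspace M) (fine_uspace X) c"
      by (intro compact_umap) (auto simp: F clc_def)
    then show "case x of (M, c) \<Rightarrow> umap (metric_uspace M) (fine_uspace X) c" using Mc by simp
  next
    fix V assume V: "is_uspace V \<and> upoints V = upoints (fine_uspace X) \<and> (\<forall>(M, c)\<in>peano_maps X. umap (metric_uspace M) V c)"
    have "continuous_map X (utopology V) (\<lambda>x. x)"
    proof (rule T_space_peano[OF T])
      show "topspace (utopology V) = topspace X" using V F by (simp add: topspace_utopology)
      fix M c assume Mc: "(M, c) \<in> peano_maps X"
      then have "clc M" "umap (metric_uspace M) V c" using V by (auto simp: peano_maps_def)
      then show "continuous_map (metric_topology M) (utopology V) c"
        using V by (auto simp: metric_topology_def clc_uspace intro: umap_continuous)
    qed
    then have "umap (fine_uspace X) V (\<lambda>x. x)" using V by (simp add: umap_fine_iff[OF cr])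
    then show "entourages (fine_uspace X) \<le> entourages V" by (auto simp: umap_iff le_filter_def)
  qed
  show "U_object TYPE('u) (fine_uspace X)"
  proof (rule U_objectI_final[OF _ fin])
    show "separated (fine_uspace X)" using T cr by (auto simp: T_space_def separated_fine)
  qed (auto simp: peano_maps_def)
qed

section \<open>Paths in mapping spaces and lifting of homotopies\<close>

abbreviation unit_I :: "real topology" where "unit_I \<equiv> top_of_set {0..1}"

definition real_I :: "real emetric" where "real_I = metric_emetric {0..1} dist"

lemma real_I [simp]: "is_emetric real_I" "metric_topology real_I = unit_I" "epoints real_I = {0..1}"
  unfolding real_I_def by (simp_all add: metric_emetric_dist)

lemma locally_connected_unit_I: "locally_connected_space unit_I"
proof (rule locally_connected_space_retraction_map_image[OF _ locally_connected_space_euclideanreal])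
  have "continuous_map euclideanreal unit_I (\<lambda>x. max 0 (min 1 x))"
    unfolding continuous_map_in_subtopology by (auto simp: continuous_map_iff_continuous2 intro!: continuous_intros)
  then show "retraction_map euclideanreal unit_I (\<lambda>x. max 0 (min 1 x))"
    unfolding retraction_map_def retraction_maps_def
    by (intro exI[of _ "\<lambda>x. x"]) (auto simp: continuous_map_from_subtopology)
qed

lemma compact_unit_I: "compact_space unit_I"
  by (simp add: compact_space_subtopology compactin_euclidean_iff)

lemma connected_unit_I: "connected_space unit_I"
  using connectedin_iff_connected[of "{0..1::real}"] by (simp add: connectedin_def)

lemma clc_real_I: "clc real_I"
  by (simp add: clc_def connected_unit_I locally_connected_unit_I)

lemma inj_real_infinite: "inj (\<iota> :: real \<Rightarrow> 'u) \<Longrightarrow> infinite (UNIV :: 'u set)"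
  using finite_subset[OF subset_UNIV] finite_imageD infinite_UNIV_char_0 by blast

text \<open>
  A homotopy on \<open>Z\<close> is a path in the mapping space: this is the exponential law together with the
  fact that the homotopy, though uniform only on the product of the unit interval with each compact
  metric space over \<open>Z\<close>, is uniform when tested on connected metric spaces over that product.
\<close>

lemma homotopy_path:
  fixes Z Y :: "'u uspace" and \<iota> :: "real \<Rightarrow> 'u"
  assumes \<iota>: "inj \<iota>" and Z: "U_object TYPE('u) Z" and fin: "final_uspace \<C> Z"
    and \<C>: "\<And>M c. (M, c) \<in> \<C> \<Longrightarrow> clc M \<and> compact_space (metric_topology M)"
    and surj: "\<And>z. z \<in> upoints Z \<Longrightarrow> \<exists>(M, c) \<in> \<C>. z \<in> c ` epoints M"
    and Y: "U_object TYPE('u) Y"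
    and H: "continuous_map (prod_topology unit_I (utopology Z)) (utopology Y) H"
  shows "continuous_map unit_I (U_hom Z Y) (\<lambda>t. restrict (\<lambda>z. H (t, z)) (upoints Z))"
proof -
  have inf: "infinite (UNIV :: 'u set)" by (rule inj_real_infinite[OF \<iota>])
  have Zu: "is_uspace Z" and Yu: "is_uspace Y" using Z Y by (auto intro: U_object_uspace)
  have jI: "inj_on \<iota> (epoints real_I)" using \<iota> by (rule inj_on_subset) simp
  let ?I = "eimage \<iota> real_I" and ?i = "inv_into (epoints real_I) \<iota>"
  have I: "clc ?I" by (rule clc_eimage[OF jI clc_real_I])
  have iI: "?i w \<in> {0..1}" if "w \<in> epoints ?I" for w using that inv_into_into[of w \<iota> "epoints real_I"] by simp
  have cont: "continuous_map (metric_topology M) (utopology Z) c" if "(M, c) \<in> \<C>" for M c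
    using umap_continuous[OF _ Zu, of "metric_uspace M" c] that fin \<C>[OF that]
    by (auto simp: final_uspace_def metric_topology_def clc_uspace)
  have fam: "umap (uprod (metric_uspace M) (metric_uspace real_I)) Y (\<lambda>(m, t). H (t, c m))"
    if Mc: "(M, c) \<in> \<C>" for M c
  proof -
    have M: "is_emetric M" "compact_space (metric_topology M)" using \<C>[OF Mc] by (auto simp: clc_def)
    have T: "metric_topology (eprod M real_I) = prod_topology (metric_topology M) unit_I"
      using metric_topology_eprod[OF M(1) real_I(1)] by simp
    have "continuous_map (prod_topology (metric_topology M) unit_I) (utopology Y) (\<lambda>x. H (snd x, c (fst x)))"
      using cont[OF Mc] continuous_map_compose[OF continuous_map_fst]
      by (intro continuous_map_compose[OF _ H, unfolded o_def] continuous_map_pairedI continuous_map_snd)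
         (auto simp: o_def)
    then have "umap (metric_uspace (eprod M real_I)) Y (\<lambda>x. H (snd x, c (fst x)))"
      using M compact_unit_I by (intro compact_umap is_emetric_eprod) (auto simp: T compact_space_prod_topology Yu)
    then show ?thesis by (simp add: metric_uspace_eprod case_prod_unfold)
  qed
  have HZ: "umap Z Y (\<lambda>z. H (t, z))" if t: "t \<in> {0..1}" for t
  proof (rule final_uspace_umap[OF fin Yu])
    show "H (t, z) \<in> upoints Y" if "z \<in> upoints Z" for z
      using continuous_map_funspace[OF H] t that by (auto simp: topspace_utopology Zu Yu)
    fix M c assume Mc: "(M, c) \<in> \<C>"
    have "umap (metric_uspace M) (uprod (metric_uspace M) (metric_uspace real_I)) (\<lambda>m. (m, t))"
    proof -
      have "umap (metric_uspace M) (metric_uspace real_I) (\<lambda>_. t)"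
        by (rule umap_const[OF is_uspace_metric_uspace[OF real_I(1)]]) (use t in auto)
      then show ?thesis by (simp add: umap_uprod_iff umap_id)
    qed
    from umap_comp[OF this fam[OF Mc]] show "umap (metric_uspace M) Y (\<lambda>m. H (t, c m))" by simp
  qed
  define g where "g w = restrict (\<lambda>z. H (?i w, z)) (upoints Z)" for w
  have gU: "g \<in> upoints (metric_uspace ?I) \<rightarrow> uhom Z Y"
  proof
    fix w assume "w \<in> upoints (metric_uspace ?I)"
    then have "?i w \<in> {0..1}" using iI by simp
    from umap_cong[OF Zu HZ[OF this], of "g w"] show "g w \<in> uhom Z Y" by (auto simp: uhom_def g_def)
  qed
  have "umap (metric_uspace ?I) (U_exponential Z Y) g"
    unfolding umap_exponential_iff[OF inf Z Y U_object_metric[OF I] gU]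
  proof (intro allI impI, elim conjE)
    fix N :: "'u emetric" and \<alpha> \<beta>
    assume N: "clc N" and \<alpha>: "umap (metric_uspace N) (metric_uspace ?I) \<alpha>" and \<beta>: "umap (metric_uspace N) Z \<beta>"
    have *: "umap (uprod (metric_uspace N) (metric_uspace real_I)) Y (\<lambda>(n, t). H (t, \<beta> n))"
      by (rule uniform_evaluation[where \<Phi> = "\<lambda>z t. H (t, z)" and \<C> = \<C> and Z = Z])
        (use N fin Yu surj \<C> fam \<beta> in \<open>auto simp: clc_def\<close>)
    have "umap (metric_uspace N) (uprod (metric_uspace N) (metric_uspace real_I)) (\<lambda>n. (n, ?i (\<alpha> n)))"
      using umap_comp[OF \<alpha> umap_eimage(2)[OF jI]] by (simp add: umap_uprod_iff umap_id)
    from umap_comp[OF this *] have "umap (metric_uspace N) Y (\<lambda>n. H (?i (\<alpha> n), \<beta> n))" by simp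
    then show "umap (metric_uspace N) Y (\<lambda>n. g (\<alpha> n) (\<beta> n))"
      by (rule umap_cong[OF clc_uspace[OF N]]) (use umap_points[OF \<beta>] in \<open>auto simp: g_def\<close>)
  qed
  then have "continuous_map (metric_topology ?I) (U_hom Z Y) g"
    unfolding metric_topology_def U_hom_def
    by (intro umap_continuous clc_uspace[OF I] U_object_uspace[OF U_exponential_object(1)[OF inf Z Y]])
  moreover have "continuous_map unit_I (metric_topology ?I) \<iota>"
    using homeomorphic_eimage[OF real_I(1) jI] by (simp add: homeomorphic_maps_def)
  ultimately have "continuous_map unit_I (U_hom Z Y) (g \<circ> \<iota>)"
    by (rule continuous_map_compose[rotated])
  then have "continuous_map unit_I (U_hom Z Y) (\<lambda>t. g (\<iota> t))" unfolding o_def .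
  then show ?thesis
    by (rule continuous_map_eq) (use inv_into_f_f[OF jI] in \<open>auto simp: g_def\<close>)
qed

text \<open>
  The unit interval itself is an object of \<open>\<U>\<close>, once its points are encoded in the universe, and
  continuous paths on it are uniform by compactness; so a path in a mapping space is adjoint to a uniform map on the product.
\<close>

lemma path_continuous:
  fixes B :: "'u emetric" and E :: "'u uspace" and \<iota> :: "real \<Rightarrow> 'u"
  assumes \<iota>: "inj \<iota>" and B: "clc B" and E: "U_object TYPE('u) E"
    and \<delta>: "continuous_map unit_I (U_hom (metric_uspace B) E) \<delta>"
  shows "continuous_map (prod_topology unit_I (metric_topology B)) (utopology E) (\<lambda>(t, b). \<delta> t b)"
proof -
  have inf: "infinite (UNIV :: 'u set)" by (rule inj_real_infinite[OF \<iota>])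
  have Eu: "is_uspace E" using E by (rule U_object_uspace)
  have jI: "inj_on \<iota> (epoints real_I)" using \<iota> by (rule inj_on_subset) simp
  let ?I = "eimage \<iota> real_I" and ?i = "inv_into (epoints real_I) \<iota>"
  have I: "clc ?I" by (rule clc_eimage[OF jI clc_real_I])
  note UB = U_object_metric[OF B]
  note ex = U_exponential_object[OF inf UB E]
  have "umap (metric_uspace real_I) (U_exponential (metric_uspace B) E) \<delta>"
    by (rule compact_umap) (use \<delta> compact_unit_I U_object_uspace[OF ex(1)] in \<open>auto simp: U_hom_def\<close>)
  from umap_comp[OF umap_eimage(2)[OF jI] this]
  have u: "umap (metric_uspace ?I) (U_exponential (metric_uspace B) E) (\<lambda>w. \<delta> (?i w))" .
  have gU: "(\<lambda>w. \<delta> (?i w)) \<in> upoints (metric_uspace ?I) \<rightarrow> uhom (metric_uspace B) E"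
    using umap_points[OF u] ex(2) by auto
  obtain j :: "'u \<times> 'u \<Rightarrow> 'u" where j: "inj j" using inj_prod_exists[OF inf] by blast
  let ?P = "eprod ?I B"
  have jP: "inj_on j (epoints ?P)" using j by (rule inj_on_subset) simp
  let ?R = "eimage j ?P" and ?k = "inv_into (epoints ?P) j"
  have R: "clc ?R" by (rule clc_eimage[OF jP clc_eprod[OF I B]])
  have "umap (metric_uspace ?R) (uprod (metric_uspace ?I) (metric_uspace B)) ?k"
    using umap_eimage(2)[OF jP] by (simp add: metric_uspace_eprod)
  then have k: "umap (metric_uspace ?R) (metric_uspace ?I) (\<lambda>r. fst (?k r))"
     "umap (metric_uspace ?R) (metric_uspace B) (\<lambda>r. snd (?k r))" by (auto simp: umap_uprod_iff)
  have *: "umap (metric_uspace ?R) E (\<lambda>r. \<delta> (?i (fst (?k r))) (snd (?k r)))"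
    using u[unfolded umap_exponential_iff[OF inf UB E U_object_metric[OF I] gU]] R k by blast
  let ?S = "uprod (metric_uspace real_I) (metric_uspace B)"
  have Su: "is_uspace ?S" by (intro is_uspace_uprod is_uspace_metric_uspace clc_uspace[OF B]) simp
  have "umap ?S (metric_uspace real_I) (\<lambda>x. fst x)" "umap ?S (metric_uspace B) (\<lambda>x. snd x)"
    using umap_id[of ?S] by (auto simp: umap_uprod_iff)
  then have "umap ?S (metric_uspace ?P) (\<lambda>x. (\<iota> (fst x), snd x))"
    using umap_comp[OF _ umap_eimage(1)[OF jI]] by (simp add: umap_uprod_iff metric_uspace_eprod)
  from umap_comp[OF umap_comp[OF this umap_eimage(1)[OF jP]] *]
  have "umap ?S E (\<lambda>x. \<delta> (?i (fst (?k (j (\<iota> (fst x), snd x))))) (snd (?k (j (\<iota> (fst x), snd x)))))" .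
  then have "umap ?S E (\<lambda>(t, b). \<delta> t b)"
  proof (rule umap_cong[OF Su])
    fix x assume "x \<in> upoints ?S"
    then have x: "fst x \<in> {0..1}" "snd x \<in> epoints B" by (auto simp: uprod_simps)
    then have "?k (j (\<iota> (fst x), snd x)) = (\<iota> (fst x), snd x)" by (intro inv_into_f_f[OF jP]) auto
    moreover have "?i (\<iota> (fst x)) = fst x" by (rule inv_into_f_f[OF jI]) (use x in simp)
    ultimately show "\<delta> (?i (fst (?k (j (\<iota> (fst x), snd x))))) (snd (?k (j (\<iota> (fst x), snd x)))) = (case x of (t, b) \<Rightarrow> \<delta> t b)"
      by (simp add: case_prod_unfold)
  qed
  from umap_continuous[OF Su Eu this]
  show ?thesis
    using real_I(2) by (simp add: utopology_uprod is_uspace_metric_uspace clc_uspace[OF B] flip: metric_topology_def)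
qed

text \<open>
  Lifting of homotopies, first with only the end of the lifted homotopy retained, over an arbitrary
  space, and then as a continuous homotopy, over a compact metric space.
\<close>

lemma fibration_path_lift:
  fixes Z E Y :: "'u uspace" and \<iota> :: "real \<Rightarrow> 'u"
  assumes \<iota>: "inj \<iota>" and E: "U_object TYPE('u) E" and Y: "U_object TYPE('u) Y"
    and p: "uniform_Hurewicz_fibration E Y p"
    and Z: "U_object TYPE('u) Z" and fin: "final_uspace \<C> Z"
    and \<C>: "\<And>M c. (M, c) \<in> \<C> \<Longrightarrow> clc M \<and> compact_space (metric_topology M)"
    and surj: "\<And>z. z \<in> upoints Z \<Longrightarrow> \<exists>(M, c) \<in> \<C>. z \<in> c ` epoints M"
    and H: "continuous_map (prod_topology unit_I (utopology Z)) (utopology Y) H"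
    and f: "umap Z E f" and pf: "\<And>z. z \<in> upoints Z \<Longrightarrow> p (f z) = H (0, z)"
  shows "\<exists>\<delta>. continuous_map unit_I (U_hom Z E) \<delta> \<and> (\<forall>z\<in>upoints Z. \<delta> 0 z = f z) \<and>
    (\<forall>t\<in>{0..1}. \<forall>z\<in>upoints Z. p (\<delta> t z) = H (t, z)) \<and> (\<forall>t\<in>{0..1}. umap Z E (\<delta> t))"
proof -
  have inf: "infinite (UNIV :: 'u set)" by (rule inj_real_infinite[OF \<iota>])
  have Zu: "is_uspace Z" using Z by (rule U_object_uspace)
  let ?\<gamma> = "\<lambda>t. restrict (\<lambda>z. H (t, z)) (upoints Z)" and ?e = "restrict f (upoints Z)"
  note ex = U_exponential_object[OF inf Z E]
  have "continuous_map unit_I (U_hom Z Y) ?\<gamma>" by (rule homotopy_path[OF \<iota> Z fin \<C> surj Y H])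
  moreover have "?e \<in> topspace (U_hom Z E)"
    unfolding ex(3) uhom_def by (auto intro!: umap_cong[OF Zu f])
  moreover have "U_hom_map Z p ?e = ?\<gamma> 0"
    unfolding U_hom_map_def by (auto simp: fun_eq_iff pf)
  ultimately have "continuous_map unit_I (U_hom Z Y) ?\<gamma> \<and> ?e \<in> topspace (U_hom Z E) \<and> U_hom_map Z p ?e = ?\<gamma> 0"
    by (intro conjI)
  from p[unfolded uniform_Hurewicz_fibration_def, THEN conjunct2, THEN spec, THEN mp, OF Z, THEN spec, THEN spec, THEN mp, OF this]
  obtain \<delta> where \<delta>: "continuous_map unit_I (U_hom Z E) \<delta>" "\<delta> 0 = ?e"
      "\<forall>t\<in>{0..1}. U_hom_map Z p (\<delta> t) = ?\<gamma> t"
    by (elim exE conjE)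
  show ?thesis
  proof (intro exI[of _ \<delta>] conjI ballI \<delta>(1))
    show "\<delta> 0 z = f z" if "z \<in> upoints Z" for z using \<delta>(2) that by simp
    show "p (\<delta> t z) = H (t, z)" if "t \<in> {0..1}" "z \<in> upoints Z" for t z
      using fun_cong[OF \<delta>(3)[rule_format, OF that(1)], of z] that by (simp add: U_hom_map_def)
    show "umap Z E (\<delta> t)" if "t \<in> {0..1}" for t
      using continuous_map_funspace[OF \<delta>(1)] that by (auto simp: ex(3) uhom_def)
  qed
qed

lemma fibration_lift_end:
  fixes X :: "'u topology" and E Y :: "'u uspace" and \<iota> :: "real \<Rightarrow> 'u"
  assumes \<iota>: "inj \<iota>" and E: "U_object TYPE('u) E" and Y: "U_object TYPE('u) Y"
    and p: "uniform_Hurewicz_fibration E Y p" and X: "T_space X"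
    and H: "continuous_map (prod_topology unit_I X) (utopology Y) H"
    and f: "continuous_map X (utopology E) f" and pf: "\<And>x. x \<in> topspace X \<Longrightarrow> p (f x) = H (0, x)"
  obtains f' where "continuous_map X (utopology E) f'" "\<And>x. x \<in> topspace X \<Longrightarrow> p (f' x) = H (1, x)"
proof -
  note cr = T_space_cr[OF X]
  note F = fine_uspace[OF cr]
  have surj: "\<exists>(M, c)\<in>peano_maps X. z \<in> c ` epoints M" if "z \<in> upoints (fine_uspace X)" for z
  proof -
    have z: "z \<in> topspace X" using that F by simp
    have "compact_space (metric_topology (pt_emetric :: 'u emetric))"
      unfolding compact_space_def using clc_emetric[OF clc_pt, where 'a = 'u] by (intro finite_imp_compactin) auto
    moreover have "continuous_map (metric_topology (pt_emetric :: 'u emetric)) X (\<lambda>_. z)" using z by simp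
    ultimately have "(pt_emetric, \<lambda>_. z) \<in> peano_maps X" using clc_pt by (simp add: peano_maps_def)
    then show ?thesis by force
  qed
  have f': "umap (fine_uspace X) E f" using f umap_fine_iff[OF cr U_object_uspace[OF E]] by simp
  have pm: "clc M \<and> compact_space (metric_topology M)" if "(M, c) \<in> peano_maps X" for M c
    using that by (simp add: peano_maps_def)
  have H': "continuous_map (prod_topology unit_I (utopology (fine_uspace X))) (utopology Y) H"
    unfolding F by (rule H)
  have pf': "p (f z) = H (0, z)" if "z \<in> upoints (fine_uspace X)" for z
    using that pf unfolding F by simp
  have "\<exists>\<delta>. continuous_map unit_I (U_hom (fine_uspace X) E) \<delta> \<and> (\<forall>z\<in>upoints (fine_uspace X). \<delta> 0 z = f z) \<and>
    (\<forall>t\<in>{0..1}. \<forall>z\<in>upoints (fine_uspace X). p (\<delta> t z) = H (t, z)) \<and> (\<forall>t\<in>{0..1}. umap (fine_uspace X) E (\<delta> t))"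
    by (rule fibration_path_lift[OF \<iota> E Y p fine_T_space(2)[OF X] fine_T_space(1)[OF X] _ _ H' f'])
      (erule pm, erule surj, erule pf')
  then obtain \<delta> where \<delta>: "\<forall>t\<in>{0..1}. \<forall>z\<in>upoints (fine_uspace X). p (\<delta> t z) = H (t, z)"
     "\<forall>t\<in>{0..1}. umap (fine_uspace X) E (\<delta> t)"
    by (elim exE conjE)
  show ?thesis
  proof (rule that)
    show "continuous_map X (utopology E) (\<delta> 1)"
      using \<delta>(2) umap_fine_iff[OF cr U_object_uspace[OF E]] by simp
    show "p (\<delta> 1 x) = H (1, x)" if "x \<in> topspace X" for x using \<delta>(1) that F by simp
  qed
qed

lemma fibration_lift_compact:
  fixes S :: "'b::metric_space set" and E Y :: "'u uspace" and \<iota> :: "real \<Rightarrow> 'u" and j :: "'b \<Rightarrow> 'u"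
  assumes \<iota>: "inj \<iota>" and E: "U_object TYPE('u) E" and Y: "U_object TYPE('u) Y"
    and p: "uniform_Hurewicz_fibration E Y p"
    and S: "compact S" "connected S" "locally_connected_space (top_of_set S)" and j: "inj_on j S"
    and H: "continuous_map (prod_topology unit_I (top_of_set S)) (utopology Y) H"
    and f: "continuous_map (top_of_set S) (utopology E) f" and pf: "\<And>x. x \<in> S \<Longrightarrow> p (f x) = H (0, x)"
  obtains G where "continuous_map (prod_topology unit_I (top_of_set S)) (utopology E) G"
    "\<And>x. x \<in> S \<Longrightarrow> G (0, x) = f x" "\<And>t x. t \<in> {0..1} \<Longrightarrow> x \<in> S \<Longrightarrow> p (G (t, x)) = H (t, x)"
proof -
  let ?S = "metric_emetric S dist"
  have jS: "inj_on j (epoints ?S)" using j by simp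
  let ?B = "eimage j ?S" and ?i = "inv_into S j"
  have comp: "compact_space (top_of_set S)" using S(1) by (simp add: compact_space_subtopology compactin_euclidean_iff)
  have "clc ?S" using S connectedin_iff_connected[of S]
    by (simp add: clc_def metric_emetric_dist connectedin_def)
  then have B: "clc ?B" by (rule clc_eimage[OF jS])
  have hm: "homeomorphic_maps (top_of_set S) (metric_topology ?B) j ?i"
    using homeomorphic_eimage[OF metric_emetric_dist(1) jS] by (simp add: metric_emetric_dist)
  then have jc: "continuous_map (top_of_set S) (metric_topology ?B) j"
    and ic: "continuous_map (metric_topology ?B) (top_of_set S) ?i" by (auto simp: homeomorphic_maps_def)
  have compB: "compact_space (metric_topology ?B)"
    using hm comp homeomorphic_compact_space homeomorphic_space_def by blast
  note UB = U_object_metric[OF B]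
  have fin: "final_uspace {(?B, \<lambda>x. x)} (metric_uspace ?B)"
    unfolding final_uspace_def using clc_uspace[OF B] by (auto simp: umap_iff le_filter_def)
  have H': "continuous_map (prod_topology unit_I (utopology (metric_uspace ?B))) (utopology Y) (\<lambda>x. H (fst x, ?i (snd x)))"
    unfolding metric_topology_def[symmetric]
    using continuous_map_compose[OF continuous_map_snd ic]
    by (intro continuous_map_compose[OF _ H, unfolded o_def] continuous_map_pairedI continuous_map_fst) (auto simp: o_def)
  have f': "umap (metric_uspace ?B) E (\<lambda>b. f (?i b))"
    using continuous_map_compose[OF ic f] B compB U_object_uspace[OF E]
    by (intro compact_umap) (auto simp: clc_def o_def)
  have pf': "p (f (?i b)) = (\<lambda>x. H (fst x, ?i (snd x))) (0, b)" if "b \<in> upoints (metric_uspace ?B)" for b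
    using that pf inv_into_into[of b j S] by simp
  have "\<exists>\<delta>. continuous_map unit_I (U_hom (metric_uspace ?B) E) \<delta> \<and> (\<forall>z\<in>upoints (metric_uspace ?B). \<delta> 0 z = f (?i z)) \<and>
    (\<forall>t\<in>{0..1}. \<forall>z\<in>upoints (metric_uspace ?B). p (\<delta> t z) = (\<lambda>x. H (fst x, ?i (snd x))) (t, z)) \<and>
    (\<forall>t\<in>{0..1}. umap (metric_uspace ?B) E (\<delta> t))"
    by (rule fibration_path_lift[OF \<iota> E Y p UB fin _ _ H' f' pf']) (use B compB in auto)
  then obtain \<delta> where \<delta>: "continuous_map unit_I (U_hom (metric_uspace ?B) E) \<delta>"
      "\<forall>b\<in>upoints (metric_uspace ?B). \<delta> 0 b = f (?i b)"
      "\<forall>t\<in>{0..1}. \<forall>b\<in>upoints (metric_uspace ?B). p (\<delta> t b) = (\<lambda>x. H (fst x, ?i (snd x))) (t, b)"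
    by (elim exE conjE)
  have c: "continuous_map (prod_topology unit_I (metric_topology ?B)) (utopology E) (\<lambda>(t, b). \<delta> t b)"
    by (rule path_continuous[OF \<iota> B E \<delta>(1)])
  have "continuous_map (prod_topology unit_I (top_of_set S)) (metric_topology ?B) (\<lambda>x. j (snd x))"
    using continuous_map_compose[OF continuous_map_snd jc] unfolding o_def .
  then have "continuous_map (prod_topology unit_I (top_of_set S)) (prod_topology unit_I (metric_topology ?B)) (\<lambda>x. (fst x, j (snd x)))"
    by (rule continuous_map_pairedI[OF continuous_map_fst])
  from continuous_map_compose[OF this c]
  have "continuous_map (prod_topology unit_I (top_of_set S)) (utopology E) (\<lambda>x. \<delta> (fst x) (j (snd x)))"
    by (simp add: o_def)
  then show ?thesis by (rule that) (use \<delta>(2,3) inv_into_f_f[OF j] in auto)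
qed

lemma exp_eval_umap:
  fixes X Y :: "'u uspace"
  assumes inf: "infinite (UNIV :: 'u set)" and X: "U_object TYPE('u) X" and Y: "U_object TYPE('u) Y"
    and x: "x \<in> upoints X"
  shows "umap (U_exponential X Y) Y (\<lambda>f. f x)"
proof (rule U_object_umapI[OF U_exponential_object(1)[OF inf X Y] U_object_uspace[OF Y]])
  fix M :: "'u emetric" and h assume M: "clc M" and h: "umap (metric_uspace M) (U_exponential X Y) h"
  have hU: "h \<in> upoints (metric_uspace M) \<rightarrow> uhom X Y"
    using umap_points[OF h] U_exponential_object(2)[OF inf X Y] by auto
  show "umap (metric_uspace M) Y (\<lambda>m. h m x)"
    using h[unfolded umap_exponential_iff[OF inf X Y U_object_metric[OF M] hU], rule_format, of M "\<lambda>m. m" "\<lambda>_. x"]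
      M umap_id[of "metric_uspace M"] umap_const[OF U_object_uspace[OF X] x, of "metric_uspace M"] by simp
qed

section \<open>Maps of cubes and their realizations\<close>

lemma finite_verts [simp]: "finite (verts n)"
  using finite_lists_length_eq[of "UNIV :: bool set" n] by (simp add: verts_def)

text \<open>
  Every coordinate of a map in \<open>\<box>\<close> is constant or the join of a set of coordinates of the argument.
\<close>

definition box_form :: "nat \<Rightarrow> nat \<Rightarrow> (bool list \<Rightarrow> bool list) \<Rightarrow> (nat \<Rightarrow> nat set) \<Rightarrow> (nat \<Rightarrow> bool) \<Rightarrow> bool" where
  "box_form m n \<phi> S b \<longleftrightarrow> \<phi> \<in> extensional (verts m) \<and> (\<forall>v\<in>verts m. \<phi> v \<in> verts n) \<and>
     (\<forall>j<n. S j \<subseteq> {..<m}) \<and> (\<forall>v\<in>verts m. \<forall>j<n. \<phi> v ! j \<longleftrightarrow> b j \<or> (\<exists>i\<in>S j. v ! i))"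

lemma box_map_form: "box_map m n \<phi> \<Longrightarrow> \<exists>S b. box_form m n \<phi> S b"
proof (induction rule: box_map.induct)
  case (ident n)
  show ?case
    by (intro exI[of _ "\<lambda>j. {j}"] exI[of _ "\<lambda>_. False"]) (auto simp: box_form_def extensional_def)
next
  case (compose l m \<phi> n \<psi>)
  then obtain S b T c where f: "box_form l m \<phi> S b" "box_form m n \<psi> T c" by blast
  show ?case
  proof (intro exI[of _ "\<lambda>j. \<Union>i\<in>T j. S i"] exI[of _ "\<lambda>j. c j \<or> (\<exists>i\<in>T j. b i)"])
    have "(\<psi> (\<phi> v) ! j) = ((c j \<or> (\<exists>i\<in>T j. b i)) \<or> (\<exists>k\<in>(\<Union>i\<in>T j. S i). v ! k))"
      if v: "v \<in> verts l" and j: "j < n" for v j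
    proof -
      have "\<phi> v \<in> verts m" and T: "T j \<subseteq> {..<m}" using f v j by (auto simp: box_form_def)
      then have "\<psi> (\<phi> v) ! j \<longleftrightarrow> c j \<or> (\<exists>i\<in>T j. \<phi> v ! i)" using f(2) j by (auto simp: box_form_def)
      moreover have "\<phi> v ! i \<longleftrightarrow> b i \<or> (\<exists>k\<in>S i. v ! k)" if "i \<in> T j" for i
      proof -
        have "i < m" using T that by auto
        then show ?thesis using f(1) v unfolding box_form_def by blast
      qed
      ultimately show ?thesis by auto
    qed
    moreover have "(\<Union>i\<in>T j. S i) \<subseteq> {..<l}" if "j < n" for j
    proof -
      have "T j \<subseteq> {..<m}" "\<And>i. i < m \<Longrightarrow> S i \<subseteq> {..<l}" using f that by (simp_all add: box_form_def)
      then show ?thesis by (meson UN_least lessThan_iff subsetD)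
    qed
    moreover have "\<psi> (\<phi> v) \<in> verts n" if "v \<in> verts l" for v using f that by (simp add: box_form_def)
    ultimately show "box_form l n (restrict (\<psi> \<circ> \<phi>) (verts l)) (\<lambda>j. \<Union>i\<in>T j. S i) (\<lambda>j. c j \<or> (\<exists>i\<in>T j. b i))"
      unfolding box_form_def by simp
  qed
next
  case (tensor m n \<phi> m' n' \<psi>)
  then obtain S b T c where f: "box_form m n \<phi> S b" "box_form m' n' \<psi> T c" by blast
  let ?S = "\<lambda>j. if j < n then S j else (\<lambda>i. i + m) ` T (j - n)" and ?b = "\<lambda>j. if j < n then b j else c (j - n)"
  let ?f = "restrict (\<lambda>v. \<phi> (take m v) @ \<psi> (drop m v)) (verts (m + m'))"
  show ?case
  proof (intro exI[of _ ?S] exI[of _ ?b])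
    have tv: "take m v \<in> verts m" "drop m v \<in> verts m'" if "v \<in> verts (m + m')" for v
      using that by (auto simp: verts_def)
    have len: "\<phi> u \<in> verts n" "\<psi> w \<in> verts n'" if "u \<in> verts m" "w \<in> verts m'" for u w
      using f that by (auto simp: box_form_def)
    have "?f v ! j \<longleftrightarrow> ?b j \<or> (\<exists>i\<in>?S j. v ! i)" if v: "v \<in> verts (m + m')" and j: "j < n + n'" for v j
    proof (cases "j < n")
      case True
      have "?f v ! j = \<phi> (take m v) ! j" using v True len[OF tv[OF v]] by (auto simp: nth_append verts_def)
      also have "\<dots> \<longleftrightarrow> b j \<or> (\<exists>i\<in>S j. take m v ! i)" using f(1) tv[OF v] True by (auto simp: box_form_def)
      also have "\<dots> \<longleftrightarrow> b j \<or> (\<exists>i\<in>S j. v ! i)" using f(1) True by (force simp: box_form_def)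
      finally show ?thesis using True by simp
    next
      case False
      have "?f v ! j = \<psi> (drop m v) ! (j - n)" using v False len[OF tv[OF v]] by (auto simp: nth_append verts_def)
      also have "\<dots> \<longleftrightarrow> c (j - n) \<or> (\<exists>i\<in>T (j - n). drop m v ! i)" using f(2) tv[OF v] False j by (auto simp: box_form_def)
      also have "\<dots> \<longleftrightarrow> c (j - n) \<or> (\<exists>i\<in>T (j - n). v ! (i + m))" using v by (auto simp: verts_def add.commute)
      finally show ?thesis using False by auto
    qed
    moreover have "?S j \<subseteq> {..<m + m'}" if "j < n + n'" for j
    proof (cases "j < n")
      case True
      then have "S j \<subseteq> {..<m}" using f(1) by (auto simp: box_form_def)
      then show ?thesis using True by auto
    next
      case False
      then have "j - n < n'" using that by simp
      then have "T (j - n) \<subseteq> {..<m'}" using f(2) by (simp add: box_form_def)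
      then show ?thesis using False by auto
    qed
    moreover have "?f v \<in> verts (n + n')" if "v \<in> verts (m + m')" for v
      using that len[OF tv[OF that]] by (auto simp: verts_def)
    ultimately show "box_form (m + m') (n + n') ?f ?S ?b" unfolding box_form_def by blast
  qed
next
  case (coface b)
  show ?case by (intro exI[of _ "\<lambda>_. {}"] exI[of _ "\<lambda>_. b"]) (auto simp: box_form_def verts_def extensional_def)
next
  case codegeneracy
  show ?case by (intro exI) (auto simp: box_form_def verts_def extensional_def)
next
  case join
  show ?case
    by (intro exI[of _ "\<lambda>_. {0, 1}"] exI[of _ "\<lambda>_. False"]) (auto simp: box_form_def verts_def extensional_def)
qed

lemma box_map_extensional: "box_map m n \<phi> \<Longrightarrow> \<phi> \<in> extensional (verts m)"
  and box_map_verts: "box_map m n \<phi> \<Longrightarrow> v \<in> verts m \<Longrightarrow> \<phi> v \<in> verts n"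
  using box_map_form by (auto simp: box_form_def)

lemma box_map_mono:
  assumes "box_map m n \<phi>" "u \<in> verts m" "v \<in> verts m" "list_all2 (\<le>) u v"
  shows "list_all2 (\<le>) (\<phi> u) (\<phi> v)"
proof -
  obtain S b where f: "box_form m n \<phi> S b" using box_map_form[OF assms(1)] by blast
  have l: "length (\<phi> u) = n" "length (\<phi> v) = n" "length u = m" "length v = m"
    using f assms by (auto simp: box_form_def verts_def)
  have "\<phi> u ! j \<le> \<phi> v ! j" if j: "j < n" for j
  proof -
    have S: "S j \<subseteq> {..<m}" using f j by (simp add: box_form_def)
    have "u ! i \<le> v ! i" if "i \<in> S j" for i
      using assms(4) that S l by (auto simp: list_all2_conv_all_nth)
    moreover have "\<phi> u ! j \<longleftrightarrow> b j \<or> (\<exists>i\<in>S j. u ! i)" "\<phi> v ! j \<longleftrightarrow> b j \<or> (\<exists>i\<in>S j. v ! i)"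
      using f assms(2,3) j by (auto simp: box_form_def)
    ultimately show ?thesis by auto
  qed
  then show ?thesis using l by (simp add: list_all2_conv_all_nth)
qed

text \<open>The linear extension on chains of a map in the form above: its joins are replaced by maxima.\<close>

definition box_real :: "nat \<Rightarrow> (nat \<Rightarrow> nat set) \<Rightarrow> (nat \<Rightarrow> bool) \<Rightarrow> real list \<Rightarrow> real list" where
  "box_real n S b x = map (\<lambda>j. if b j then 1 else Max (insert 0 ((\<lambda>i. x ! i) ` S j))) [0..<n]"

lemma conv_comb_nth: "j < n \<Longrightarrow> conv_comb n p S w ! j = (\<Sum>v\<in>S. w v * of_bool (p v ! j))"
  by (simp add: conv_comb_def)

lemma length_conv_comb [simp]: "length (conv_comb n p S w) = n"
  by (simp add: conv_comb_def)

lemma vert_chain_finite: "is_vert_chain m T \<Longrightarrow> finite T"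
  using finite_subset[OF _ finite_verts] by (auto simp: is_vert_chain_def)

text \<open>
  On a chain of vertices the coordinates are totally ordered by implication, so one of the
  coordinates in \<open>S j\<close> is the join of all of them; hence joins become maxima.
\<close>

lemma realizes_box_real:
  assumes f: "box_form m n \<phi> S b"
  shows "realizes m n \<phi> (box_real n S b)"
  unfolding realizes_def
proof (intro allI impI, elim conjE)
  fix T w assume T: "is_vert_chain m T" and w: "\<forall>v\<in>T. 0 \<le> w v" and sum: "(\<Sum>v\<in>T. w v) = (1::real)"
  have finT: "finite T" by (rule vert_chain_finite[OF T])
  have Tm: "v \<in> verts m" if "v \<in> T" for v using T that by (auto simp: is_vert_chain_def)
  show "box_real n S b (conv_comb m (\<lambda>v. v) T w) = conv_comb n \<phi> T w"
  proof (rule nth_equalityI)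
    fix j assume "j < length (box_real n S b (conv_comb m (\<lambda>v. v) T w))"
    then have j: "j < n" by (simp add: box_real_def)
    have Sj: "S j \<subseteq> {..<m}" using f j by (simp add: box_form_def)
    have fS: "finite (S j)" using Sj finite_subset by blast
    have \<phi>: "\<phi> v ! j \<longleftrightarrow> b j \<or> (\<exists>i\<in>S j. v ! i)" if "v \<in> T" for v using f Tm[OF that] j by (auto simp: box_form_def)
    let ?x = "conv_comb m (\<lambda>v. v) T w"
    have x: "?x ! i = (\<Sum>v\<in>T. w v * of_bool (v ! i))" if "i \<in> S j" for i
      using Sj that by (intro conv_comb_nth) auto
    have r: "conv_comb n \<phi> T w ! j = (\<Sum>v\<in>T. w v * of_bool (b j \<or> (\<exists>i\<in>S j. v ! i)))"
      unfolding conv_comb_nth[OF j] using \<phi> by (intro sum.cong) auto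
    show "box_real n S b ?x ! j = conv_comb n \<phi> T w ! j"
    proof (cases "b j")
      case True
      then show ?thesis using r j sum by (simp add: box_real_def)
    next
      case nb: False
      show ?thesis
      proof (cases "S j = {}")
        case True
        then show ?thesis using r j nb by (simp add: box_real_def)
      next
        case False
        define A where "A i = {v\<in>T. v ! i}" for i
        have finA: "finite (A i)" for i using finT by (simp add: A_def)
        have "Max ((\<lambda>i. card (A i)) ` S j) \<in> (\<lambda>i. card (A i)) ` S j" by (rule Max_in) (use fS False in auto)
        then obtain i0 where i0: "i0 \<in> S j" "Max ((\<lambda>i. card (A i)) ` S j) = card (A i0)" by auto
        have i0m: "card (A i) \<le> card (A i0)" if "i \<in> S j" for i
          unfolding i0(2)[symmetric] using fS that by (intro Max_ge) auto
        have join: "v ! i0" if v: "v \<in> T" and i: "i \<in> S j" "v ! i" for v i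
        proof (rule ccontr)
          assume n: "\<not> v ! i0"
          have "A i0 \<subseteq> A i"
          proof
            fix u assume u: "u \<in> A i0"
            then have uT: "u \<in> T" "u ! i0" by (auto simp: A_def)
            have lens: "length u = m" "length v = m" using Tm uT v by (auto simp: verts_def)
            have im: "i < m" "i0 < m" using i i0 Sj by auto
            have "list_all2 (\<le>) u v \<or> list_all2 (\<le>) v u" using T uT v by (auto simp: is_vert_chain_def)
            moreover have "\<not> list_all2 (\<le>) u v" using uT n im lens by (auto simp: list_all2_conv_all_nth)
            ultimately have "v ! i \<le> u ! i" using im lens by (auto simp: list_all2_conv_all_nth)
            then show "u \<in> A i" using i uT by (auto simp: A_def)
          qed
          moreover have "v \<in> A i - A i0" using v i n by (auto simp: A_def)
          ultimately have "A i0 \<subset> A i" by blast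
          then have "card (A i0) < card (A i)" by (rule psubset_card_mono[OF finA])
          then show False using i0m[OF i(1)] by simp
        qed
        have "Max (insert 0 ((\<lambda>i. ?x ! i) ` S j)) = (\<Sum>v\<in>T. w v * of_bool (\<exists>i\<in>S j. v ! i))"
        proof (rule Max_eqI)
          show "finite (insert 0 ((\<lambda>i. ?x ! i) ` S j))" using fS by simp
          show "y \<le> (\<Sum>v\<in>T. w v * of_bool (\<exists>i\<in>S j. v ! i))" if "y \<in> insert 0 ((\<lambda>i. ?x ! i) ` S j)" for y
            using that w by (auto simp: x intro!: sum_nonneg sum_mono mult_left_mono)
          have "?x ! i0 = (\<Sum>v\<in>T. w v * of_bool (\<exists>i\<in>S j. v ! i))"
            unfolding x[OF i0(1)] using join i0(1) by (intro sum.cong refl arg_cong2[of _ _ _ _ "(*)"]) auto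
          then show "(\<Sum>v\<in>T. w v * of_bool (\<exists>i\<in>S j. v ! i)) \<in> insert 0 ((\<lambda>i. ?x ! i) ` S j)"
            using i0(1) by (metis imageI insertI2)
        qed
        then show ?thesis using r j nb by (simp add: box_real_def)
      qed
    qed
  qed (simp add: box_real_def)
qed

text \<open>
  Every point of the cube is a convex combination of a chain: peel off the smallest nonzero
  coordinate.
\<close>

lemma chain_combination:
  assumes "length x = m" "\<forall>i<m. 0 \<le> x ! i \<and> x ! i \<le> c" "0 \<le> (c::real)"
  shows "\<exists>T w. is_vert_chain m T \<and> (\<forall>v\<in>T. 0 \<le> w v) \<and> (\<Sum>v\<in>T. w v) = c \<and>
     conv_comb m (\<lambda>v. v) T w = x \<and> (\<forall>v\<in>T. \<forall>i<m. v ! i \<longrightarrow> x ! i \<noteq> 0)"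
  using assms
proof (induction "card {i. i < m \<and> x ! i \<noteq> 0}" arbitrary: x c rule: less_induct)
  case less
  let ?U = "{i. i < m \<and> x ! i \<noteq> 0}"
  show ?case
  proof (cases "?U = {}")
    case True
    show ?thesis
    proof (intro exI[of _ "{replicate m False}"] exI[of _ "\<lambda>_. c"] conjI)
      show "conv_comb m (\<lambda>v. v) {replicate m False} (\<lambda>_. c) = x"
        using True less.prems by (intro nth_equalityI) (auto simp: conv_comb_nth)
    qed (use less.prems in \<open>auto simp: is_vert_chain_def verts_def list_all2_conv_all_nth\<close>)
  next
    case False
    define \<mu> where "\<mu> = Min ((\<lambda>i. x ! i) ` ?U)"
    have fU: "finite ?U" by simp
    have \<mu>in: "\<mu> \<in> (\<lambda>i. x ! i) ` ?U" unfolding \<mu>_def by (rule Min_in) (use False in auto)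
    then obtain i0 where i0: "i0 \<in> ?U" "x ! i0 = \<mu>" by auto
    have \<mu>le: "\<mu> \<le> x ! i" if "i \<in> ?U" for i unfolding \<mu>_def using that by (intro Min_le) auto
    have \<mu>0: "0 < \<mu>" "\<mu> \<le> c" using i0 less.prems(2) by (auto simp: less_le)
    define u where "u = map (\<lambda>i. x ! i \<noteq> 0) [0..<m]"
    define y where "y = map (\<lambda>i. if x ! i \<noteq> 0 then x ! i - \<mu> else 0) [0..<m]"
    have um: "u \<in> verts m" and ui: "u ! i \<longleftrightarrow> x ! i \<noteq> 0" if "i < m" for i using that by (auto simp: u_def verts_def)
    have um: "u \<in> verts m" by (auto simp: u_def verts_def)
    have yi: "y ! i = (if x ! i \<noteq> 0 then x ! i - \<mu> else 0)" if "i < m" for i using that by (simp add: y_def)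
    have sub: "{i. i < m \<and> y ! i \<noteq> 0} \<subset> ?U"
    proof
      show "{i. i < m \<and> y ! i \<noteq> 0} \<subseteq> ?U" using yi by auto
      show "{i. i < m \<and> y ! i \<noteq> 0} \<noteq> ?U" using i0 yi[of i0] by auto
    qed
    have "\<exists>T w. is_vert_chain m T \<and> (\<forall>v\<in>T. 0 \<le> w v) \<and> (\<Sum>v\<in>T. w v) = c - \<mu> \<and>
       conv_comb m (\<lambda>v. v) T w = y \<and> (\<forall>v\<in>T. \<forall>i<m. v ! i \<longrightarrow> y ! i \<noteq> 0)"
    proof (rule less.hyps)
      show "card {i. i < m \<and> y ! i \<noteq> 0} < card ?U" by (rule psubset_card_mono[OF fU sub])
      show "length y = m" by (simp add: y_def)
      show "\<forall>i<m. 0 \<le> y ! i \<and> y ! i \<le> c - \<mu>" using yi \<mu>le less.prems(2) \<mu>0 by auto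
    qed (use \<mu>0 in simp)
    then obtain T w where T: "is_vert_chain m T" "\<forall>v\<in>T. 0 \<le> w v" "(\<Sum>v\<in>T. w v) = c - \<mu>"
       "conv_comb m (\<lambda>v. v) T w = y" "\<forall>v\<in>T. \<forall>i<m. v ! i \<longrightarrow> y ! i \<noteq> 0" by blast
    have finT: "finite T" by (rule vert_chain_finite[OF T(1)])
    have Tm: "v \<in> verts m" if "v \<in> T" for v using T(1) that by (auto simp: is_vert_chain_def)
    have uT: "u \<notin> T" using T(5) i0 yi[of i0] ui[of i0] by auto
    have below: "list_all2 (\<le>) v u" if v: "v \<in> T" for v
    proof -
      have "v ! i \<le> u ! i" if i: "i < m" for i
      proof -
        have "u ! i" if "v ! i"
        proof -
          have "y ! i \<noteq> 0" using T(5) v i that by blast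
          then show ?thesis using yi[OF i] ui[OF i] by (auto split: if_splits)
        qed
        then show ?thesis by auto
      qed
      then show ?thesis using Tm[OF v] um by (simp add: list_all2_conv_all_nth verts_def)
    qed
    have uu: "list_all2 (\<le>) u u" by (simp add: list_all2_conv_all_nth)
    show ?thesis
    proof (intro exI[of _ "insert u T"] exI[of _ "w(u := \<mu>)"] conjI)
      show "is_vert_chain m (insert u T)" using T(1) um below uu by (auto simp: is_vert_chain_def)
      show "\<forall>v\<in>insert u T. 0 \<le> (w(u := \<mu>)) v" using T(2) \<mu>0 by auto
      have s: "(\<Sum>v\<in>insert u T. (w(u := \<mu>)) v * g v) = \<mu> * g u + (\<Sum>v\<in>T. w v * g v)" for g :: "bool list \<Rightarrow> real"
      proof -
        have "(\<Sum>v\<in>T. (w(u := \<mu>)) v * g v) = (\<Sum>v\<in>T. w v * g v)" using uT by (intro sum.cong) auto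
        then show ?thesis using finT uT by (simp add: sum.insert)
      qed
      show "(\<Sum>v\<in>insert u T. (w(u := \<mu>)) v) = c" using s[of "\<lambda>_. 1"] T(3) by simp
      show "conv_comb m (\<lambda>v. v) (insert u T) (w(u := \<mu>)) = x"
      proof (rule nth_equalityI)
        fix i assume "i < length (conv_comb m (\<lambda>v. v) (insert u T) (w(u := \<mu>)))"
        then have i: "i < m" by simp
        have "conv_comb m (\<lambda>v. v) (insert u T) (w(u := \<mu>)) ! i = \<mu> * of_bool (u ! i) + y ! i"
          unfolding conv_comb_nth[OF i] s T(4)[symmetric] by simp
        then show "conv_comb m (\<lambda>v. v) (insert u T) (w(u := \<mu>)) ! i = x ! i"
          using ui[OF i] yi[OF i] by auto
      qed (use less.prems in simp)
      show "\<forall>v\<in>insert u T. \<forall>i<m. v ! i \<longrightarrow> x ! i \<noteq> 0"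
      proof (intro ballI allI impI)
        fix v i assume v: "v \<in> insert u T" and i: "i < m" "v ! i"
        have "u ! i"
        proof (cases "v = u")
          case False
          then have "v \<in> T" using v by simp
          from below[OF this] Tm[OF this] i show ?thesis by (auto simp: list_all2_conv_all_nth verts_def)
        qed (use i in simp)
        then show "x ! i \<noteq> 0" using ui[OF i(1)] by simp
      qed
    qed
  qed
qed

lemma epoints_cube: "epoints (cube n) = {x. length x = n \<and> set x \<subseteq> {0..1}}"
  by (simp add: cube_def)

lemma cube_nth: "x \<in> epoints (cube n) \<longleftrightarrow> length x = n \<and> (\<forall>i<n. 0 \<le> x ! i \<and> x ! i \<le> 1)"
  unfolding epoints_cube by (auto simp: subset_iff in_set_conv_nth)

lemma cube_chain:
  assumes "x \<in> epoints (cube m)"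
  obtains T w where "is_vert_chain m T" "\<forall>v\<in>T. 0 \<le> w v" "(\<Sum>v\<in>T. w v) = 1" "conv_comb m (\<lambda>v. v) T w = x"
  using chain_combination[of x m 1] assms by (auto simp: cube_nth)

lemma realizes_eq:
  assumes "realizes m n \<phi> g" "realizes m n \<phi> g'" "x \<in> epoints (cube m)"
  shows "g x = g' x"
  using assms cube_chain[OF assms(3)] unfolding realizes_def by metis

lemma realizes_compose:
  assumes \<phi>: "box_map l m \<phi>" and g: "realizes l m \<phi> g" and g': "realizes m n \<psi> g'"
  shows "realizes l n (restrict (\<psi> \<circ> \<phi>) (verts l)) (g' \<circ> g)"
  unfolding realizes_def
proof (intro allI impI, elim conjE)
  fix T w assume T: "is_vert_chain l T" and w: "\<forall>v\<in>T. 0 \<le> w v" and sum: "(\<Sum>v\<in>T. w v) = (1::real)"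
  have finT: "finite T" by (rule vert_chain_finite[OF T])
  have Tl: "v \<in> verts l" if "v \<in> T" for v using T that by (auto simp: is_vert_chain_def)
  define w' where "w' u = (\<Sum>v\<in>{v\<in>T. \<phi> v = u}. w v)" for u
  have push: "(\<Sum>u\<in>\<phi> ` T. w' u * h u) = (\<Sum>v\<in>T. w v * h (\<phi> v))" for h :: "bool list \<Rightarrow> real"
  proof -
    have "(\<Sum>v\<in>T. w v * h (\<phi> v)) = (\<Sum>u\<in>\<phi> ` T. \<Sum>v\<in>{v\<in>T. \<phi> v = u}. w v * h (\<phi> v))"
      by (rule sum.image_gen[OF finT])
    also have "\<dots> = (\<Sum>u\<in>\<phi> ` T. w' u * h u)"
      unfolding w'_def sum_distrib_right by (intro sum.cong) auto
    finally show ?thesis by simp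
  qed
  have "is_vert_chain m (\<phi> ` T)"
    unfolding is_vert_chain_def
  proof (intro conjI ballI)
    show "\<phi> ` T \<subseteq> verts m" using box_map_verts[OF \<phi>] Tl by auto
    fix a b assume "a \<in> \<phi> ` T" "b \<in> \<phi> ` T"
    then obtain u v where uv: "a = \<phi> u" "b = \<phi> v" "u \<in> T" "v \<in> T" by auto
    then have "list_all2 (\<le>) u v \<or> list_all2 (\<le>) v u" using T by (auto simp: is_vert_chain_def)
    then show "list_all2 (\<le>) a b \<or> list_all2 (\<le>) b a" using box_map_mono[OF \<phi>] Tl uv by auto
  qed
  moreover have "\<forall>u\<in>\<phi> ` T. 0 \<le> w' u" unfolding w'_def using w by (auto intro: sum_nonneg)
  moreover have "(\<Sum>u\<in>\<phi> ` T. w' u) = 1" using push[of "\<lambda>_. 1"] sum by simp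
  ultimately have "g' (conv_comb m (\<lambda>v. v) (\<phi> ` T) w') = conv_comb n \<psi> (\<phi> ` T) w'"
    using g' unfolding realizes_def by blast
  moreover have "conv_comb m (\<lambda>v. v) (\<phi> ` T) w' = conv_comb m \<phi> T w"
    unfolding conv_comb_def push by simp
  moreover have "conv_comb n \<psi> (\<phi> ` T) w' = conv_comb n (restrict (\<psi> \<circ> \<phi>) (verts l)) T w"
    unfolding conv_comb_def push using Tl by (intro map_cong refl sum.cong) auto
  moreover have "g (conv_comb l (\<lambda>v. v) T w) = conv_comb m \<phi> T w" using g T w sum unfolding realizes_def by blast
  ultimately show "(g' \<circ> g) (conv_comb l (\<lambda>v. v) T w) = conv_comb n (restrict (\<psi> \<circ> \<phi>) (verts l)) T w"
    by simp
qed

lemma edist_cube_le_iff: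
  assumes "0 \<le> r"
  shows "edist (cube n) x y \<le> ennreal r \<longleftrightarrow> (\<forall>i<n. \<bar>x ! i - y ! i\<bar> \<le> r)"
  using assms by (auto simp: cube_def SUP_le_iff)

lemma cube_coord_le: "i < n \<Longrightarrow> ennreal \<bar>x ! i - y ! i\<bar> \<le> edist (cube n) x y"
  by (auto simp: cube_def intro: SUP_upper)

lemma is_emetric_cube: "is_emetric (cube n)"
  unfolding is_emetric_def
proof (intro conjI ballI)
  fix x y z assume xyz: "x \<in> epoints (cube n)" "y \<in> epoints (cube n)" "z \<in> epoints (cube n)"
  show "edist (cube n) x z \<le> edist (cube n) x y + edist (cube n) y z"
    unfolding cube_def emetric.simps
  proof (rule SUP_least)
    fix i assume i: "i \<in> {..<n}"
    have "ennreal \<bar>x ! i - z ! i\<bar> \<le> ennreal (\<bar>x ! i - y ! i\<bar> + \<bar>y ! i - z ! i\<bar>)" by (intro ennreal_leI) linarith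
    also have "\<dots> = ennreal \<bar>x ! i - y ! i\<bar> + ennreal \<bar>y ! i - z ! i\<bar>" by simp
    also have "\<dots> \<le> (SUP i\<in>{..<n}. ennreal \<bar>x ! i - y ! i\<bar>) + (SUP i\<in>{..<n}. ennreal \<bar>y ! i - z ! i\<bar>)"
      using i by (intro add_mono SUP_upper)
    finally show "ennreal \<bar>x ! i - z ! i\<bar> \<le> \<dots>" .
  qed
next
  fix x y assume xy: "x \<in> epoints (cube n)" "y \<in> epoints (cube n)"
  have "edist (cube n) x y = 0 \<longleftrightarrow> (\<forall>i<n. \<bar>x ! i - y ! i\<bar> \<le> 0)"
    using edist_cube_le_iff[of 0 n x y] by simp
  then show "edist (cube n) x y = 0 \<longleftrightarrow> x = y" using xy by (auto simp: cube_nth intro: nth_equalityI)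
  show "edist (cube n) x y = edist (cube n) y x" by (simp add: cube_def abs_minus_commute)
qed

lemma realizes_short_map:
  assumes \<phi>: "box_map m n \<phi>" and g: "realizes m n \<phi> g"
  shows "short_map (cube m) (cube n) g"
proof -
  obtain S b where f: "box_form m n \<phi> S b" using box_map_form[OF \<phi>] by blast
  have eq: "g x = box_real n S b x" if "x \<in> epoints (cube m)" for x
    by (rule realizes_eq[OF g realizes_box_real[OF f] that])
  have S: "S j \<subseteq> {..<m}" "finite (S j)" if "j < n" for j
    using f that finite_subset[of "S j" "{..<m}"] by (auto simp: box_form_def)
  show ?thesis
    unfolding short_map_def
  proof (intro conjI ballI)
    show "g \<in> epoints (cube m) \<rightarrow> epoints (cube n)"
    proof
      fix x assume x: "x \<in> epoints (cube m)"
      have "0 \<le> box_real n S b x ! j \<and> box_real n S b x ! j \<le> 1" if j: "j < n" for j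
        using x j S[OF j] by (auto simp: box_real_def cube_nth)
      then show "g x \<in> epoints (cube n)" unfolding eq[OF x] cube_nth by (simp add: box_real_def)
    qed
    fix x y assume xy: "x \<in> epoints (cube m)" "y \<in> epoints (cube m)"
    show "edist (cube n) (g x) (g y) \<le> edist (cube m) x y"
    proof (cases "edist (cube m) x y")
      case (real r)
      then have r: "\<bar>x ! i - y ! i\<bar> \<le> r" if "i < m" for i using edist_cube_le_iff[of r m x y] that by simp
      have "\<bar>box_real n S b x ! j - box_real n S b y ! j\<bar> \<le> r" if j: "j < n" for j
      proof (cases "b j")
        case True
        then show ?thesis using j real by (simp add: box_real_def)
      next
        case False
        have le: "Max (insert 0 ((\<lambda>i. x ! i) ` S j)) \<le> Max (insert 0 ((\<lambda>i. y ! i) ` S j)) + r"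
          if xy: "\<And>i. i < m \<Longrightarrow> \<bar>x ! i - y ! i\<bar> \<le> r" for x y :: "real list"
        proof (subst Max_le_iff)
          show "\<forall>a\<in>insert 0 ((\<lambda>i. x ! i) ` S j). a \<le> Max (insert 0 ((\<lambda>i. y ! i) ` S j)) + r"
          proof
            fix a assume "a \<in> insert 0 ((\<lambda>i. x ! i) ` S j)"
            then consider "a = 0" | i where "i \<in> S j" "a = x ! i" by auto
            then show "a \<le> Max (insert 0 ((\<lambda>i. y ! i) ` S j)) + r"
            proof cases
              case 1
              have "0 \<le> Max (insert 0 ((\<lambda>i. y ! i) ` S j))" using S[OF j] by (intro Max_ge) auto
              then show ?thesis using 1 real by simp
            next
              case 2
              have "y ! i \<le> Max (insert 0 ((\<lambda>i. y ! i) ` S j))" using S[OF j] 2 by (intro Max_ge) auto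
              moreover have "\<bar>x ! i - y ! i\<bar> \<le> r" using xy 2 S[OF j] by auto
              ultimately show ?thesis using 2 by linarith
            qed
          qed
        qed (use S[OF j] in auto)
        have "\<bar>y ! i - x ! i\<bar> \<le> r" if "i < m" for i using r[OF that] by (simp add: abs_minus_commute)
        then show ?thesis using le[of x y] le[of y x] r j False by (simp add: box_real_def abs_le_iff)
      qed
      then show ?thesis using real xy by (simp add: eq edist_cube_le_iff)
    qed simp
  qed
qed

lemma short_map_umap: "short_map M N f \<Longrightarrow> umap (metric_uspace M) (metric_uspace N) f"
  unfolding umap_iff short_map_def eventually_metric_uspace by (auto; meson PiE le_less_trans)

lemma realizes_continuous:
  assumes \<phi>: "box_map m n \<phi>" and g: "realizes m n \<phi> g"
  shows "continuous_map (metric_topology (cube m)) (metric_topology (cube n)) g"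
  unfolding metric_topology_def using realizes_short_map[OF \<phi> g]
  by (intro umap_continuous is_uspace_metric_uspace is_emetric_cube short_map_umap)

section \<open>Weak equivalences on underlying spaces\<close>

abbreviation homotopic :: "'a topology \<Rightarrow> 'b topology \<Rightarrow> ('a \<Rightarrow> 'b) \<Rightarrow> ('a \<Rightarrow> 'b) \<Rightarrow> bool" where
  "homotopic \<equiv> homotopic_with (\<lambda>_. True)"

lemma homotopic_cont: "homotopic X Y f g \<Longrightarrow> continuous_map X Y f \<and> continuous_map X Y g"
  by (simp add: homotopic_with_imp_continuous_maps)

definition htpy_class :: "'a topology \<Rightarrow> 'b topology \<Rightarrow> ('a \<Rightarrow> 'b) \<Rightarrow> ('a \<Rightarrow> 'b) set" where
  "htpy_class K X g = {h. homotopic K X g h}"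

lemma pi0_maps_eq: "pi0_maps K X = htpy_class K X ` {g. continuous_map K X g}"
proof -
  have "{(g, h). continuous_map K X g \<and> continuous_map K X h \<and> homotopic K X g h} `` {g} = htpy_class K X g"
    if "continuous_map K X g" for g
    using that homotopic_cont by (force simp: htpy_class_def)
  then show ?thesis unfolding pi0_maps_def quotient_def by (auto simp: image_iff)
qed

lemma htpy_class_refl: "continuous_map K X g \<Longrightarrow> g \<in> htpy_class K X g"
  by (simp add: htpy_class_def)

lemma pi0_maps_map_class:
  assumes f: "continuous_map X Y f" and g: "continuous_map K X g"
  shows "pi0_maps_map K Y f (htpy_class K X g) = htpy_class K Y (f \<circ> g)"
proof -
  have "homotopic K Y (f \<circ> g) (f \<circ> g')" if "homotopic K X g g'" for g'
    using homotopic_with_compose_continuous_map_left[OF that f] by simp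
  then show ?thesis
    unfolding pi0_maps_map_def htpy_class_def using g
    by (auto intro: homotopic_with_trans exI[of _ g])
qed

lemma pi0_bij_surj:
  assumes bij: "bij_betw (pi0_maps_map K Y f) (pi0_maps K X) (pi0_maps K Y)"
    and f: "continuous_map X Y f" and w: "continuous_map K Y w"
  shows "\<exists>z. continuous_map K X z \<and> homotopic K Y (f \<circ> z) w"
proof -
  have "htpy_class K Y w \<in> pi0_maps_map K Y f ` pi0_maps K X"
    using bij w by (simp add: bij_betw_def pi0_maps_eq)
  then obtain z where z: "continuous_map K X z" "htpy_class K Y w = pi0_maps_map K Y f (htpy_class K X z)"
    by (auto simp: pi0_maps_eq)
  then have "htpy_class K Y w = htpy_class K Y (f \<circ> z)" using pi0_maps_map_class[OF f z(1)] by simp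
  then have "w \<in> htpy_class K Y (f \<circ> z)" using htpy_class_refl[OF w] by simp
  then show ?thesis using z by (auto simp: htpy_class_def)
qed

lemma pi0_bij_inj:
  assumes bij: "bij_betw (pi0_maps_map K Y f) (pi0_maps K X) (pi0_maps K Y)"
    and f: "continuous_map X Y f" and a: "continuous_map K X a" and b: "continuous_map K X b"
    and h: "homotopic K Y (f \<circ> a) (f \<circ> b)"
  shows "homotopic K X a b"
proof -
  have "htpy_class K Y (f \<circ> a) = htpy_class K Y (f \<circ> b)"
    using h by (auto simp: htpy_class_def intro: homotopic_with_trans homotopic_with_symD)
  then have eq: "pi0_maps_map K Y f (htpy_class K X a) = pi0_maps_map K Y f (htpy_class K X b)"
    by (simp add: pi0_maps_map_class[OF f a] pi0_maps_map_class[OF f b])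
  have "htpy_class K X a = htpy_class K X b"
    by (rule inj_onD[OF bij_betw_imp_inj_on[OF bij] eq]) (use a b in \<open>auto simp: pi0_maps_eq\<close>)
  then have "b \<in> htpy_class K X a" using htpy_class_refl[OF b] by simp
  then show ?thesis by (simp add: htpy_class_def)
qed

text \<open>
  The one-point cubical set: its uniform realization \<open>Z\<close> is a point, and evaluation identifies
  the mapping space from \<open>Z\<close> with the underlying space of the target.
\<close>

definition pt_cubical :: "'u cubical" where
  "pt_cubical = \<lparr> cells = (\<lambda>_. {undefined}), action = (\<lambda>_ _ _ c. c) \<rparr>"

lemma cubical_set_pt: "cubical_set pt_cubical"
  by (auto simp: cubical_set_def pt_cubical_def)

lemma box_map_terminal: "box_map n 0 (restrict (\<lambda>v. []) (verts n))"
proof (induction n)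
  case 0
  have eq: "restrict (\<lambda>v. [] :: bool list) (verts 0) = restrict (\<lambda>v. v) (verts 0)"
    by (auto simp: verts_def)
  show ?case unfolding eq by (rule box_map.ident)
next
  case (Suc n)
  have eq: "restrict (\<lambda>v. restrict (\<lambda>v. []) (verts 1) (take 1 v) @ restrict (\<lambda>v. []) (verts n) (drop 1 v)) (verts (1 + n))
     = restrict (\<lambda>v. [] :: bool list) (verts (Suc n))"
    by (rule ext) (auto simp: verts_def restrict_def)
  have "box_map (1 + n) (0 + 0) (restrict (\<lambda>v. []) (verts (Suc n)))"
    using box_map.tensor[OF box_map.codegeneracy Suc] unfolding eq .
  then show ?case by (simp only: add_0 plus_1_eq_Suc)
qed

lemma geometric_realization_pt: "is_geometric_realization (pt_cubical :: 'u cubical) (pt_emetric :: 'u emetric)"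
  unfolding is_geometric_realization_def
proof (intro exI)
  let ?C = "pt_cubical :: 'u cubical" and ?R = "pt_emetric :: 'u emetric"
  let ?h = "\<lambda>(_ :: nat \<times> 'u) (_ :: real list). (undefined :: 'u)"
  have Rm: "is_emetric ?R" by (rule clc_emetric[OF clc_pt])
  show "is_colimit epoints epoints short_map short_map short_map is_emetric
        (element_indices ?C) (\<lambda>(n, c). cube n) (element_arrows ?C) ?h ?R"
    unfolding is_colimit_def
  proof (intro conjI allI impI)
    show "is_diagram short_map (element_indices ?C) (\<lambda>(n, c). cube n) (element_arrows ?C)"
      by (auto simp: is_diagram_def element_arrows_def element_indices_def pt_cubical_def realizes_short_map)
    show "is_emetric ?R" by (rule Rm)
    show "is_cocone epoints short_map (element_indices ?C) (\<lambda>(n, c). cube n) (element_arrows ?C) ?h ?R"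
      by (auto simp: is_cocone_def short_map_def pt_emetric_def)
  next
    fix W :: "'u emetric" and k
    assume *: "is_emetric W \<and> is_cocone epoints short_map (element_indices ?C) (\<lambda>(n, c). cube n) (element_arrows ?C) k W"
    have k: "short_map (cube n) W (k (n, undefined))" for n
      using * by (auto simp: is_cocone_def element_indices_def pt_cubical_def)
    have kA: "k (0, undefined) [] = k (n, undefined) p" if "p \<in> epoints (cube n)" for n p
    proof -
      have "realizes n 0 (restrict (\<lambda>v. []) (verts n)) (\<lambda>_. [])"
        by (simp add: realizes_def conv_comb_def)
      then have "((n, undefined), (0, undefined), \<lambda>_. []) \<in> element_arrows ?C"
        using box_map_terminal[of n] unfolding element_arrows_def pt_cubical_def by fastforce
      then show ?thesis using * that unfolding is_cocone_def by fastforce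
    qed
    have "k (0, undefined) [] \<in> epoints W" using k[of 0] by (auto simp: short_map_def cube_nth)
    then have "short_map ?R W (\<lambda>_. k (0, undefined) [])"
      using * emetric_refl by (auto simp: short_map_def pt_emetric_def)
    then show "\<exists>g. short_map ?R W g \<and> (\<forall>i\<in>element_indices ?C. \<forall>p\<in>epoints (case i of (n, c) \<Rightarrow> cube n). g (?h i p) = k i p)"
      using kA by (intro exI[of _ "\<lambda>_. k (0, undefined) []"]) (auto simp: element_indices_def pt_cubical_def)
    fix g g' assume gg: "short_map ?R W g \<and> (\<forall>i\<in>element_indices ?C. \<forall>p\<in>epoints (case i of (n, c) \<Rightarrow> cube n). g (?h i p) = k i p) \<and>
       short_map ?R W g' \<and> (\<forall>i\<in>element_indices ?C. \<forall>p\<in>epoints (case i of (n, c) \<Rightarrow> cube n). g' (?h i p) = k i p)"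
    have "(0, undefined) \<in> element_indices ?C" "[] \<in> epoints (cube 0)"
      by (auto simp: element_indices_def pt_cubical_def cube_nth)
    then have "g undefined = g' undefined" using gg by fastforce
    then show "\<forall>x\<in>epoints ?R. g x = g' x" by simp
  qed
qed

text \<open>
  The one-point cubical set has a point \<open>Z\<close> as uniform realization.  Evaluation at the point and the
  constant functions identify the mapping space from \<open>Z\<close> with the underlying space, and \<open>p\<close> with
  the map induced on mapping spaces, to which the hypothesis applies.
\<close>

lemma weak_equivalence_underlying:
  fixes E Y :: "'u uspace" and C :: "'u cubical"
  assumes inf: "infinite (UNIV :: 'u set)" and E: "U_object TYPE('u) E" and Y: "U_object TYPE('u) Y"
    and wk: "uniform_weak_equivalence E Y p"
    and C: "cubical_set C" "is_topological_realization C K"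
  shows "continuous_map K (utopology Y) w \<Longrightarrow> \<exists>z. continuous_map K (utopology E) z \<and> homotopic K (utopology Y) (p \<circ> z) w"
    and "continuous_map K (utopology E) a \<Longrightarrow> continuous_map K (utopology E) b \<Longrightarrow>
      homotopic K (utopology Y) (p \<circ> a) (p \<circ> b) \<Longrightarrow> homotopic K (utopology E) a b"
proof -
  define Z :: "'u uspace" where "Z = ucoref TYPE('u) (metric_uspace pt_emetric)"
  have ptu: "is_uspace (metric_uspace (pt_emetric :: 'u emetric))" "separated (metric_uspace (pt_emetric :: 'u emetric))"
    using clc_emetric[OF clc_pt, where 'a = 'u] by (auto intro: is_uspace_metric_uspace separated_metric_uspace)
  have Z: "U_object TYPE('u) Z" "upoints Z = {undefined}"
    using is_ucoref_ucoref[OF ptu, where ?'u = 'u] by (auto simp: is_ucoref_def Z_def)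
  have "is_uniform_realization (pt_cubical :: 'u cubical) Z"
    unfolding is_uniform_realization_def Z_def using geometric_realization_pt by blast
  then have cwe: "classical_weak_equivalence TYPE('u) (U_hom Z E) (U_hom Z Y) (U_hom_map Z p)"
    using wk cubical_set_pt unfolding uniform_weak_equivalence_def by blast
  then have mc: "continuous_map (U_hom Z E) (U_hom Z Y) (U_hom_map Z p)"
    and bij: "bij_betw (pi0_maps_map K (U_hom Z Y) (U_hom_map Z p)) (pi0_maps K (U_hom Z E)) (pi0_maps K (U_hom Z Y))"
    using C unfolding classical_weak_equivalence_def by blast+
  have pu: "umap E Y p" using wk by (simp add: uniform_weak_equivalence_def)
  let ?ev = "\<lambda>f :: 'u \<Rightarrow> 'u. f undefined" and ?c = "\<lambda>y :: 'u. restrict (\<lambda>_. y) {undefined :: 'u}"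
  have ev: "continuous_map (U_hom Z X) (utopology X) ?ev" if X: "U_object TYPE('u) X" for X :: "'u uspace"
    unfolding U_hom_def using exp_eval_umap[OF inf Z(1) X, of undefined] Z(2)
    by (intro umap_continuous U_object_uspace[OF U_exponential_object(1)[OF inf Z(1) X]] U_object_uspace[OF X]) simp
  have c: "continuous_map (utopology X) (U_hom Z X) ?c" if X: "U_object TYPE('u) X" for X :: "'u uspace"
  proof -
    have "umap Z X (?c y)" if "y \<in> upoints X" for y
      by (rule umap_cong[OF U_object_uspace[OF Z(1)] umap_const[OF U_object_uspace[OF X] that]]) (simp add: Z)
    then have cU: "?c \<in> upoints X \<rightarrow> uhom Z X" by (auto simp: uhom_def Z)
    have "umap X (U_exponential Z X) ?c"
      unfolding umap_exponential_iff[OF inf Z(1) X X cU]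
    proof (intro allI impI, elim conjE)
      fix N :: "'u emetric" and \<alpha> \<beta>
      assume N: "clc N" and \<alpha>: "umap (metric_uspace N) X \<alpha>" and \<beta>: "umap (metric_uspace N) Z \<beta>"
      show "umap (metric_uspace N) X (\<lambda>n. ?c (\<alpha> n) (\<beta> n))"
        by (rule umap_cong[OF clc_uspace[OF N] \<alpha>]) (use umap_points[OF \<beta>] Z in auto)
    qed
    then show ?thesis unfolding U_hom_def
      by (intro umap_continuous U_object_uspace[OF U_exponential_object(1)[OF inf Z(1) X]] U_object_uspace[OF X])
  qed
  have pc: "U_hom_map Z p (?c y) = ?c (p y)" for y by (auto simp: U_hom_map_def Z fun_eq_iff)
  have evp: "?ev (U_hom_map Z p f) = p (?ev f)" for f by (simp add: U_hom_map_def Z)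
  show "\<exists>z. continuous_map K (utopology E) z \<and> homotopic K (utopology Y) (p \<circ> z) w"
    if w: "continuous_map K (utopology Y) w"
  proof -
    have "continuous_map K (U_hom Z Y) (?c \<circ> w)" by (rule continuous_map_compose[OF w c[OF Y]])
    from pi0_bij_surj[OF bij mc this] obtain z where z: "continuous_map K (U_hom Z E) z"
      "homotopic K (U_hom Z Y) (U_hom_map Z p \<circ> z) (?c \<circ> w)" by blast
    have "homotopic K (utopology Y) (?ev \<circ> (U_hom_map Z p \<circ> z)) (?ev \<circ> (?c \<circ> w))"
      by (rule homotopic_with_compose_continuous_map_left[OF z(2) ev[OF Y]]) simp
    moreover have "?ev \<circ> (U_hom_map Z p \<circ> z) = p \<circ> (?ev \<circ> z)" "?ev \<circ> (?c \<circ> w) = w"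
      by (auto simp: fun_eq_iff evp)
    ultimately have "homotopic K (utopology Y) (p \<circ> (?ev \<circ> z)) w" by simp
    moreover have "continuous_map K (utopology E) (?ev \<circ> z)" by (rule continuous_map_compose[OF z(1) ev[OF E]])
    ultimately show ?thesis by blast
  qed
  show "homotopic K (utopology E) a b"
    if a: "continuous_map K (utopology E) a" and b: "continuous_map K (utopology E) b"
      and h: "homotopic K (utopology Y) (p \<circ> a) (p \<circ> b)"
  proof -
    have "homotopic K (U_hom Z Y) (?c \<circ> (p \<circ> a)) (?c \<circ> (p \<circ> b))"
      by (rule homotopic_with_compose_continuous_map_left[OF h c[OF Y]]) simp
    moreover have "?c \<circ> (p \<circ> a) = U_hom_map Z p \<circ> (?c \<circ> a)" "?c \<circ> (p \<circ> b) = U_hom_map Z p \<circ> (?c \<circ> b)"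
      by (simp_all add: fun_eq_iff pc)
    ultimately have "homotopic K (U_hom Z E) (?c \<circ> a) (?c \<circ> b)"
      using continuous_map_compose[OF a c[OF E]] continuous_map_compose[OF b c[OF E]]
      by (intro pi0_bij_inj[OF bij mc]) simp_all
    then have "homotopic K (utopology E) (?ev \<circ> (?c \<circ> a)) (?ev \<circ> (?c \<circ> b))"
      by (rule homotopic_with_compose_continuous_map_left[OF _ ev[OF E]]) simp
    moreover have "?ev \<circ> (?c \<circ> a) = a" "?ev \<circ> (?c \<circ> b) = b" by (auto simp: fun_eq_iff)
    ultimately show ?thesis by simp
  qed
qed


section \<open>Cubes\<close>

lemma locally_connected_interval:
  fixes a b :: real assumes "a \<le> b"
  shows "locally_connected_space (top_of_set {a..b})"
proof (rule locally_connected_space_retraction_map_image[OF _ locally_connected_space_euclideanreal])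
  have "continuous_map euclideanreal (top_of_set {a..b}) (\<lambda>x. max a (min b x))"
    unfolding continuous_map_in_subtopology using assms
    by (auto simp: continuous_map_iff_continuous2 intro!: continuous_intros)
  then show "retraction_map euclideanreal (top_of_set {a..b}) (\<lambda>x. max a (min b x))"
    unfolding retraction_map_def retraction_maps_def
    by (intro exI[of _ "\<lambda>x. x"]) (auto simp: continuous_map_from_subtopology)
qed

definition sbox :: "nat \<Rightarrow> (nat \<Rightarrow> real) set" where
  "sbox n = {x. (\<forall>i<n. \<bar>x i\<bar> \<le> 1) \<and> (\<forall>i\<ge>n. x i = 0)}"

definition sboundary :: "nat \<Rightarrow> (nat \<Rightarrow> real) set" where
  "sboundary n = {x \<in> sbox n. \<exists>i<n. \<bar>x i\<bar> = 1}"

lemma sbox_topology: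
  "top_of_set (sbox n) = product_topology (\<lambda>i. top_of_set (if i < n then {-1..1::real} else {0..0})) UNIV"
proof -
  have "sbox n = (\<Pi>\<^sub>E i\<in>UNIV. if i < n then {-1..1::real} else {0..0})"
    by (auto simp: sbox_def PiE_iff abs_le_iff split: if_splits)
  then show ?thesis
    using subtopology_product_topology[of "\<lambda>_::nat. euclideanreal" UNIV "\<lambda>i. if i < n then {-1..1::real} else {0..0}"]
    by (simp add: euclidean_product_topology)
qed

lemma sbox_space:
  "compact_space (top_of_set (sbox n))" "connected_space (top_of_set (sbox n))"
  "locally_connected_space (top_of_set (sbox n))" "compact (sbox n)" "connected (sbox n)"
proof -
  show c: "compact_space (top_of_set (sbox n))" unfolding sbox_topology
    by (auto simp: compact_space_product_topology compact_space_subtopology compactin_euclidean_iff)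
  have "connected_space (top_of_set {a..b})" for a b :: real
    using connectedin_iff_connected[of "{a..b}"] connected_Icc[of a b] unfolding connectedin_def by blast
  then have con: "connected_space (top_of_set (if i < n then {-1..1::real} else {0..0}))" for i :: nat by presburger
  have lc: "locally_connected_space (top_of_set (if i < n then {-1..1::real} else {0..0}))" for i :: nat
  proof -
    have "locally_connected_space (top_of_set {-1..1::real})" "locally_connected_space (top_of_set {0..0::real})"
      by (rule locally_connected_interval; simp)+
    then show ?thesis by presburger
  qed
  show d: "connected_space (top_of_set (sbox n))"
    unfolding sbox_topology connected_space_product_topology using con by blast
  show "locally_connected_space (top_of_set (sbox n))"
    unfolding sbox_topology locally_connected_space_product_topology using con lc by simp
  have "compactin euclidean (sbox n)" unfolding compactin_subspace using c by simp
  then show "compact (sbox n)" by simp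
  show "connected (sbox n)" using d connectedin_iff_connected by (auto simp: connectedin_def)
qed

definition to_cube :: "nat \<Rightarrow> (nat \<Rightarrow> real) \<Rightarrow> real list" where
  "to_cube n x = map (\<lambda>i. (x i + 1) / 2) [0..<n]"

definition from_cube :: "nat \<Rightarrow> real list \<Rightarrow> nat \<Rightarrow> real" where
  "from_cube n l = (\<lambda>i. if i < n then 2 * l ! i - 1 else 0)"

lemma to_cube: "x \<in> sbox n \<Longrightarrow> to_cube n x \<in> epoints (cube n)"
  unfolding cube_nth sbox_def to_cube_def by (auto simp: abs_le_iff)

lemma from_cube: "l \<in> epoints (cube n) \<Longrightarrow> from_cube n l \<in> sbox n"
  unfolding cube_nth sbox_def from_cube_def by (auto simp: abs_le_iff)

lemma to_from_cube: "l \<in> epoints (cube n) \<Longrightarrow> to_cube n (from_cube n l) = l"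
  unfolding cube_nth from_cube_def to_cube_def by (auto intro: nth_equalityI)

lemma from_to_cube: "x \<in> sbox n \<Longrightarrow> from_cube n (to_cube n x) = x"
  unfolding sbox_def from_cube_def to_cube_def by (auto simp: fun_eq_iff field_simps)

lemma Hausdorff_metric_topology: "is_emetric M \<Longrightarrow> Hausdorff_space (metric_topology M)"
  unfolding metric_topology_def by (intro Hausdorff_utopology is_uspace_metric_uspace separated_metric_uspace)

lemma continuous_to_cube: "continuous_map (top_of_set (sbox n)) (metric_topology (cube n)) (to_cube n)"
  unfolding continuous_map
proof (intro conjI allI impI)
  show "to_cube n ` topspace (top_of_set (sbox n)) \<subseteq> topspace (metric_topology (cube n))"
    using to_cube by (auto simp: is_emetric_cube)
  fix U assume U: "openin (metric_topology (cube n)) U"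
  show "openin (top_of_set (sbox n)) {x \<in> topspace (top_of_set (sbox n)). to_cube n x \<in> U}"
  proof (subst openin_subopen, intro ballI)
    fix x assume x: "x \<in> {x \<in> topspace (top_of_set (sbox n)). to_cube n x \<in> U}"
    then obtain e where e: "e > 0" "\<forall>y\<in>epoints (cube n). edist (cube n) (to_cube n x) y < ennreal e \<longrightarrow> y \<in> U"
      using U unfolding openin_metric_topology[OF is_emetric_cube] by auto
    define T where "T = (\<Inter>i\<in>{..<n}. {y :: nat \<Rightarrow> real. \<bar>y i - x i\<bar> < e})"
    have "open T" unfolding T_def
      by (intro open_INT finite_lessThan ballI open_Collect_less continuous_intros continuous_on_product_coordinates)
    then have "openin (top_of_set (sbox n)) (sbox n \<inter> T)" by (rule openin_open_Int)
    moreover have "x \<in> sbox n \<inter> T" using x e by (auto simp: T_def)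
    moreover have "to_cube n y \<in> U" if y: "y \<in> sbox n \<inter> T" for y
    proof -
      have "\<bar>to_cube n x ! i - to_cube n y ! i\<bar> \<le> e / 2" if "i < n" for i
      proof -
        have "\<bar>y i - x i\<bar> < e" using y that by (auto simp: T_def)
        then show ?thesis using that by (simp add: to_cube_def abs_le_iff abs_less_iff field_simps)
      qed
      then have "edist (cube n) (to_cube n x) (to_cube n y) \<le> ennreal (e / 2)"
        using e by (subst edist_cube_le_iff) auto
      also have "\<dots> < ennreal e" using e by (simp add: ennreal_less_iff)
      finally show ?thesis using e(2) to_cube y by auto
    qed
    ultimately show "\<exists>T. openin (top_of_set (sbox n)) T \<and> x \<in> T \<and> T \<subseteq> {x \<in> topspace (top_of_set (sbox n)). to_cube n x \<in> U}"
      by (intro exI[of _ "sbox n \<inter> T"]) auto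
  qed
qed

lemma homeomorphic_to_cube:
  "homeomorphic_maps (top_of_set (sbox n)) (metric_topology (cube n)) (to_cube n) (from_cube n)"
proof -
  have "homeomorphic_map (top_of_set (sbox n)) (metric_topology (cube n)) (to_cube n)"
  proof (rule continuous_imp_homeomorphic_map[OF continuous_to_cube sbox_space(1) Hausdorff_metric_topology[OF is_emetric_cube]])
    show "to_cube n ` topspace (top_of_set (sbox n)) = topspace (metric_topology (cube n))"
    proof (intro equalityI subsetI)
      fix l assume "l \<in> topspace (metric_topology (cube n))"
      then have l: "l \<in> epoints (cube n)" by (simp add: is_emetric_cube)
      show "l \<in> to_cube n ` topspace (top_of_set (sbox n))"
        using from_cube[OF l] to_from_cube[OF l] by (intro image_eqI[of _ _ "from_cube n l"]) auto
    qed (auto simp: is_emetric_cube to_cube)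
    show "inj_on (to_cube n) (topspace (top_of_set (sbox n)))"
      by (rule inj_on_inverseI[of _ "from_cube n"]) (simp add: from_to_cube)
  qed
  then obtain g where g: "homeomorphic_maps (top_of_set (sbox n)) (metric_topology (cube n)) (to_cube n) g"
    by (auto simp: homeomorphic_map_maps)
  have gl: "g l = from_cube n l" if l: "l \<in> epoints (cube n)" for l
  proof -
    have "g (to_cube n (from_cube n l)) = from_cube n l"
      using g from_cube[OF l] by (simp add: homeomorphic_maps_def)
    then show ?thesis by (simp add: to_from_cube[OF l])
  qed
  have "continuous_map (metric_topology (cube n)) (top_of_set (sbox n)) g"
    using g unfolding homeomorphic_maps_def by blast
  then have c: "continuous_map (metric_topology (cube n)) (top_of_set (sbox n)) (from_cube n)"
    by (rule continuous_map_eq) (simp add: gl is_emetric_cube)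
  show ?thesis
    unfolding homeomorphic_maps_def using c continuous_to_cube[of n]
    by (simp add: from_to_cube to_from_cube is_emetric_cube)
qed

lemma cube_space:
  "compact_space (metric_topology (cube n))" "connected_space (metric_topology (cube n))"
  "locally_connected_space (metric_topology (cube n))" "second_countable (metric_topology (cube n))"
  "normal_space (metric_topology (cube n))"
proof -
  have hs: "top_of_set (sbox n) homeomorphic_space metric_topology (cube n)"
    using homeomorphic_to_cube homeomorphic_space_def by blast
  show c: "compact_space (metric_topology (cube n))" using hs sbox_space(1) homeomorphic_compact_space by blast
  show "connected_space (metric_topology (cube n))" using hs sbox_space(2) homeomorphic_connected_space by blast
  show "locally_connected_space (metric_topology (cube n))"
    using hs sbox_space(3) homeomorphic_locally_connected_space by blast
  show "normal_space (metric_topology (cube n))"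
    using c Hausdorff_metric_topology[OF is_emetric_cube] by (simp add: compact_Hausdorff_or_regular_imp_normal_space)
  obtain B :: "(nat \<Rightarrow> real) set set" where "countable B" "topological_basis B" using ex_countable_basis by blast
  then have "second_countable (euclidean :: (nat \<Rightarrow> real) topology)"
    unfolding second_countable_def
    by (intro exI[of _ B]) (auto simp: topological_basis_open elim: topological_basisE)
  then show "second_countable (metric_topology (cube n))"
    using hs second_countable_subtopology homeomorphic_space_second_countability by blast
qed

lemma continuous_cube_coord:
  assumes "i < n" shows "continuous_map (metric_topology (cube n)) euclideanreal (\<lambda>x. x ! i)"
proof -
  have "umap (metric_uspace (cube n)) (metric_uspace (metric_emetric (UNIV :: real set) dist)) (\<lambda>x. x ! i)"
    by (rule short_map_umap) (use cube_coord_le[OF assms] in \<open>auto simp: short_map_def metric_emetric_def dist_real_def\<close>)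
  from umap_continuous[OF _ _ this] show ?thesis
    using metric_emetric_dist[of "UNIV :: real set"] is_emetric_cube
    by (simp add: is_uspace_metric_uspace flip: metric_topology_def)
qed

section \<open>Cubes glued along their boundary\<close>

text \<open>
  A test for membership in \<open>\<T>\<close>.  As for uniform spaces, the colimit runs over all maps from
  compact, locally connected, second-countable spaces, and one-point spaces make cocones functions.
\<close>

lemma T_spaceI:
  fixes X :: "'u topology"
  assumes cr: "completely_regular_space X" and H: "Hausdorff_space X"
    and fin: "\<And>U. U \<subseteq> topspace X \<Longrightarrow> (\<And>(D :: 'u topology) h. compact_space D \<Longrightarrow> locally_connected_space D \<Longrightarrow>
       second_countable D \<Longrightarrow> continuous_map D X h \<Longrightarrow> openin D {x \<in> topspace D. h x \<in> U}) \<Longrightarrow> openin X U"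
  shows "T_space X"
proof -
  define I where "I = {(D :: 'u topology, h). compact_space D \<and> locally_connected_space D \<and> second_countable D \<and> continuous_map D X h}"
  define A where "A = {(i, j, f). i \<in> I \<and> j \<in> I \<and> continuous_map (fst i) (fst j) f \<and> (\<forall>p\<in>topspace (fst i). snd j (f p) = snd i p)}"
  have I: "compact_space (fst i)" "locally_connected_space (fst i)" "second_countable (fst i)" "continuous_map (fst i) X (snd i)"
    if "i \<in> I" for i using that by (auto simp: I_def)
  have "is_colimit topspace topspace continuous_map continuous_map continuous_map (\<lambda>_. True) I fst A snd X"
    unfolding is_colimit_def
  proof (intro conjI allI impI)
    show "is_diagram continuous_map I fst A" by (auto simp: is_diagram_def A_def)
    show "is_cocone topspace continuous_map I fst A snd X" using I by (auto simp: is_cocone_def A_def)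
    fix W :: "'u topology" and k
    assume "True \<and> is_cocone topspace continuous_map I fst A k W"
    then have k: "\<And>i. i \<in> I \<Longrightarrow> continuous_map (fst i) W (k i)"
      and kA: "\<And>i j f p. (i, j, f) \<in> A \<Longrightarrow> p \<in> topspace (fst i) \<Longrightarrow> k j (f p) = k i p"
      by (auto simp: is_cocone_def)
    define pt :: "'u \<Rightarrow> 'u topology \<times> ('u \<Rightarrow> 'u)" where "pt x = (discrete_topology {undefined}, \<lambda>_. x)" for x
    have pt: "pt x \<in> I" if "x \<in> topspace X" for x
      using that by (auto simp: I_def pt_def compact_space_discrete_topology locally_connected_space_discrete_topology
          second_countable_discrete_topology)
    define g where "g x = k (pt x) undefined" for x
    have gk: "g (snd i p) = k i p" if i: "i \<in> I" and p: "p \<in> topspace (fst i)" for i p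
    proof -
      have x: "snd i p \<in> topspace X" using continuous_map_funspace[OF I(4)[OF i]] p by auto
      have "(pt (snd i p), i, \<lambda>_. p) \<in> A"
        using pt[OF x] i p by (auto simp: A_def pt_def)
      from kA[OF this, of undefined] show ?thesis by (simp add: g_def pt_def)
    qed
    have gW: "g x \<in> topspace W" if x: "x \<in> topspace X" for x
      using continuous_map_funspace[OF k[OF pt[OF x]]] by (auto simp: g_def pt_def)
    have "continuous_map X W g"
      unfolding continuous_map
    proof (intro conjI allI impI)
      show "g ` topspace X \<subseteq> topspace W" using gW by auto
      fix U assume U: "openin W U"
      show "openin X {x \<in> topspace X. g x \<in> U}"
      proof (rule fin)
        fix D :: "'u topology" and h assume "compact_space D" "locally_connected_space D" "second_countable D" "continuous_map D X h"
        then have i: "(D, h) \<in> I" and hX: "h \<in> topspace D \<rightarrow> topspace X"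
          using continuous_map_funspace by (auto simp: I_def)
        have "openin D {x \<in> topspace D. k (D, h) x \<in> U}"
          using openin_continuous_map_preimage[OF k[OF i] U] by simp
        moreover have "{x \<in> topspace D. k (D, h) x \<in> U} = {x \<in> topspace D. h x \<in> {x \<in> topspace X. g x \<in> U}}"
          using gk[OF i] hX by auto
        ultimately show "openin D {x \<in> topspace D. h x \<in> {x \<in> topspace X. g x \<in> U}}" by (simp only:)
      qed auto
    qed
    then show "\<exists>g. continuous_map X W g \<and> (\<forall>i\<in>I. \<forall>p\<in>topspace (fst i). g (snd i p) = k i p)"
      using gk by (intro exI[of _ g]) simp
    fix g g' assume gg: "continuous_map X W g \<and> (\<forall>i\<in>I. \<forall>p\<in>topspace (fst i). g (snd i p) = k i p) \<and>
       continuous_map X W g' \<and> (\<forall>i\<in>I. \<forall>p\<in>topspace (fst i). g' (snd i p) = k i p)"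
    show "\<forall>x\<in>topspace X. g x = g' x"
    proof
      fix x assume x: "x \<in> topspace X"
      have "undefined \<in> topspace (fst (pt x))" "snd (pt x) undefined = x" by (simp_all add: pt_def)
      then show "g x = g' x" using gg pt[OF x] by metis
    qed
  qed simp
  then show ?thesis
    unfolding T_space_def using cr H I(1-3)
    by (intro conjI exI[of _ I] exI[of _ fst] exI[of _ A] exI[of _ snd]) auto
qed

text \<open>
  The space \<open>K\<close>: copies of the \<open>n\<close>-cube indexed by \<open>F\<close>, glued along their boundaries.  Boundary
  points are represented in the copy with index \<open>e0\<close>.
\<close>

locale glued_cubes =
  fixes n :: nat and F :: "'u set" and e0 :: 'u and J :: "'u \<times> real list \<Rightarrow> 'u"
  assumes e0: "e0 \<in> F" and J: "inj J"
begin

abbreviation "TQ \<equiv> metric_topology (cube n)"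
abbreviation "Q \<equiv> epoints (cube n)"

definition bd :: "real list set" where
  "bd = {x \<in> Q. \<exists>i<n. x ! i \<in> {0, 1}}"

definition q :: "'u \<Rightarrow> real list \<Rightarrow> 'u" where
  "q e x = J (if x \<in> bd then e0 else e, x)"

definition K :: "'u topology" where
  "K = topology (\<lambda>U. U \<subseteq> (\<Union>e\<in>F. q e ` Q) \<and> (\<forall>e\<in>F. openin TQ {x \<in> Q. q e x \<in> U}))"

lemma topspace_TQ [simp]: "topspace TQ = Q"
  by (simp add: is_emetric_cube)

lemma q_eq_iff: "q e x = q e' x' \<longleftrightarrow> x = x' \<and> (x \<in> bd \<or> e = e')"
  using J by (auto simp: q_def inj_eq)

lemma openin_K: "openin K U \<longleftrightarrow> U \<subseteq> (\<Union>e\<in>F. q e ` Q) \<and> (\<forall>e\<in>F. openin TQ {x \<in> Q. q e x \<in> U})"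
proof -
  have "istopology (\<lambda>U. U \<subseteq> (\<Union>e\<in>F. q e ` Q) \<and> (\<forall>e\<in>F. openin TQ {x \<in> Q. q e x \<in> U}))"
    unfolding istopology_def
  proof (intro conjI allI impI)
    fix S T assume S: "S \<subseteq> (\<Union>e\<in>F. q e ` Q) \<and> (\<forall>e\<in>F. openin TQ {x \<in> Q. q e x \<in> S})"
       and T: "T \<subseteq> (\<Union>e\<in>F. q e ` Q) \<and> (\<forall>e\<in>F. openin TQ {x \<in> Q. q e x \<in> T})"
    show "S \<inter> T \<subseteq> (\<Union>e\<in>F. q e ` Q)" using S by blast
    have "{x \<in> Q. q e x \<in> S \<inter> T} = {x \<in> Q. q e x \<in> S} \<inter> {x \<in> Q. q e x \<in> T}" for e by auto
    then show "\<forall>e\<in>F. openin TQ {x \<in> Q. q e x \<in> S \<inter> T}" using S T by (simp add: openin_Int)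
  next
    fix \<K> assume K: "\<forall>S\<in>\<K>. S \<subseteq> (\<Union>e\<in>F. q e ` Q) \<and> (\<forall>e\<in>F. openin TQ {x \<in> Q. q e x \<in> S})"
    show "\<Union>\<K> \<subseteq> (\<Union>e\<in>F. q e ` Q)" using K by blast
    have "{x \<in> Q. q e x \<in> \<Union>\<K>} = \<Union>((\<lambda>S. {x \<in> Q. q e x \<in> S}) ` \<K>)" for e by auto
    then show "\<forall>e\<in>F. openin TQ {x \<in> Q. q e x \<in> \<Union>\<K>}" using K by auto
  qed
  then show ?thesis by (simp add: K_def)
qed

lemma topspace_K: "topspace K = (\<Union>e\<in>F. q e ` Q)"
proof -
  have "openin K (\<Union>e\<in>F. q e ` Q)"
    unfolding openin_K
  proof (intro conjI ballI)
    fix e assume "e \<in> F"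
    then have "{x \<in> Q. q e x \<in> (\<Union>e\<in>F. q e ` Q)} = topspace TQ" by auto
    then show "openin TQ {x \<in> Q. q e x \<in> (\<Union>e\<in>F. q e ` Q)}" by (metis openin_topspace)
  qed auto
  then show ?thesis using openin_K[of "topspace K"] openin_subset by fastforce
qed

lemma q_in: "e \<in> F \<Longrightarrow> x \<in> Q \<Longrightarrow> q e x \<in> topspace K"
  by (auto simp: topspace_K)

lemma K_cases:
  assumes "y \<in> topspace K" obtains e x where "e \<in> F" "x \<in> Q" "y = q e x"
  using assms by (auto simp: topspace_K)

lemma continuous_q: "e \<in> F \<Longrightarrow> continuous_map TQ K (q e)"
  unfolding continuous_map by (auto simp: topspace_K openin_K)

lemma continuous_from_K:
  assumes g: "\<And>e. e \<in> F \<Longrightarrow> continuous_map TQ W (\<lambda>x. g (q e x))"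
  shows "continuous_map K W g"
  unfolding continuous_map
proof (intro conjI allI impI)
  show "g ` topspace K \<subseteq> topspace W"
    using continuous_map_funspace[OF g] by (auto simp: topspace_K)
  fix U assume U: "openin W U"
  have "{x \<in> Q. q e x \<in> {y \<in> topspace K. g y \<in> U}} = {x \<in> topspace TQ. g (q e x) \<in> U}" if "e \<in> F" for e
    using q_in[OF that] by auto
  then show "openin K {y \<in> topspace K. g y \<in> U}"
    unfolding openin_K using openin_continuous_map_preimage[OF g U] topspace_K by auto
qed

lemma glue_exists:
  assumes w: "\<And>e. e \<in> F \<Longrightarrow> continuous_map TQ W (w e)" and bd: "\<And>e x. e \<in> F \<Longrightarrow> x \<in> bd \<Longrightarrow> w e x = w e0 x"
  shows "\<exists>G. continuous_map K W G \<and> (\<forall>e\<in>F. \<forall>x\<in>Q. G (q e x) = w e x)"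
proof -
  define G where "G y = (case inv J y of (e, x) \<Rightarrow> w e x)" for y
  have G: "G (q e x) = w e x" if "e \<in> F" for e x
    using inv_f_f[OF J] bd[OF that] by (simp add: G_def q_def)
  then have "continuous_map K W G"
    by (intro continuous_from_K) (simp add: w)
  then show ?thesis using G by (intro exI[of _ G]) simp
qed

lemma closedin_bd: "closedin TQ bd"
proof -
  have "closedin TQ {x \<in> topspace TQ. x ! i \<in> {0, 1}}" if "i < n" for i
    by (rule closedin_continuous_map_preimage[OF continuous_cube_coord[OF that]]) simp
  then have "closedin TQ (\<Union>i\<in>{..<n}. {x \<in> topspace TQ. x ! i \<in> {0, 1}})"
    by (intro closedin_Union) auto
  moreover have "(\<Union>i\<in>{..<n}. {x \<in> topspace TQ. x ! i \<in> {0, 1}}) = bd" by (auto simp: bd_def)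
  ultimately show ?thesis by simp
qed

lemma Urysohn_TQ:
  assumes "closedin TQ A" "closedin TQ B" "A \<inter> B = {}"
  shows "\<exists>f :: real list \<Rightarrow> real. continuous_map TQ (top_of_set {0..1}) f \<and> (\<forall>x\<in>A. f x = 0) \<and> (\<forall>x\<in>B. f x = 1)"
proof -
  have "\<exists>f::real list \<Rightarrow> real. continuous_map TQ (top_of_set {0..1}) f \<and> f ` A \<subseteq> {0} \<and> f ` B \<subseteq> {1}"
    using cube_space(5)[of n] assms unfolding normal_space_iff_Urysohn disjnt_def by blast
  then show ?thesis by (simp add: image_subset_iff)
qed

lemma closedin_point: "x \<in> Q \<Longrightarrow> closedin TQ {x}"
  using Hausdorff_imp_t1_space[OF Hausdorff_metric_topology[OF is_emetric_cube]] by (simp add: closedin_t1_singleton)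

text \<open>
  Separating functions on \<open>K\<close> at a boundary point: a separating function \<open>\<phi>\<close> for the boundary is
  doubled, which makes it equal to one near the closed set, and then it can be raised to one on
  the closed set in each cube without a change on the boundary.
\<close>

lemma completely_regular_K: "completely_regular_space K"
  unfolding completely_regular_space_def
proof (intro allI impI, elim conjE)
  fix A y assume A: "closedin K A" and y: "y \<in> topspace K - A"
  then obtain e1 x1 where yx: "e1 \<in> F" "x1 \<in> Q" "y = q e1 x1" using K_cases by auto
  define Ae where "Ae e = {x \<in> Q. q e x \<in> A}" for e
  have clA: "closedin TQ (Ae e)" if "e \<in> F" for e
    using closedin_continuous_map_preimage[OF continuous_q[OF that] A] by (simp add: Ae_def)
  have Abd: "x \<in> Ae e \<longleftrightarrow> x \<in> Ae e0" if "x \<in> bd" for x e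
    using that q_eq_iff[of e x e0 x] by (auto simp: Ae_def)
  have x1A: "x1 \<notin> Ae e1" using y yx by (auto simp: Ae_def)
  have "\<exists>w. (\<forall>e\<in>F. continuous_map TQ (top_of_set {0..1::real}) (w e)) \<and> (\<forall>e\<in>F. \<forall>x\<in>bd. w e x = w e0 x) \<and>
      (\<forall>e\<in>F. \<forall>x\<in>Ae e. w e x = 1) \<and> w e1 x1 = 0"
  proof (cases "x1 \<in> bd")
    case False
    have "\<exists>f :: real list \<Rightarrow> real. continuous_map TQ (top_of_set {0..1}) f \<and> (\<forall>x\<in>{x1}. f x = 0) \<and> (\<forall>x\<in>Ae e1 \<union> bd. f x = 1)"
      by (rule Urysohn_TQ[of "{x1}" "Ae e1 \<union> bd"])
        (use False x1A closedin_point[OF yx(2)] closedin_Un[OF clA[OF yx(1)] closedin_bd] in auto)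
    then obtain f :: "real list \<Rightarrow> real" where f: "continuous_map TQ (top_of_set {0..1}) f" "\<forall>x\<in>{x1}. f x = 0"
       "\<forall>x\<in>Ae e1 \<union> bd. f x = 1"
      by (elim exE conjE)
    show ?thesis
      by (rule exI[of _ "\<lambda>e x. if e = e1 then f x else 1"]) (use f in auto)
  next
    case True
    have x10: "x1 \<notin> Ae e0" using x1A Abd[OF True] by blast
    have "\<exists>f :: real list \<Rightarrow> real. continuous_map TQ (top_of_set {0..1}) f \<and> (\<forall>x\<in>{x1}. f x = 0) \<and> (\<forall>x\<in>Ae e0. f x = 1)"
      by (rule Urysohn_TQ[of "{x1}" "Ae e0"]) (use x10 closedin_point[OF yx(2)] clA[OF e0] in auto)
    then obtain \<phi> :: "real list \<Rightarrow> real" where \<phi>': "continuous_map TQ (top_of_set {0..1}) \<phi>" "\<forall>x\<in>{x1}. \<phi> x = 0"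
       "\<forall>x\<in>Ae e0. \<phi> x = 1"
      by (elim exE conjE)
    then have \<phi>: "continuous_map TQ (top_of_set {0..1}) \<phi>" "\<And>x. x \<in> {x1} \<Longrightarrow> \<phi> x = 0"
       "\<And>x. x \<in> Ae e0 \<Longrightarrow> \<phi> x = 1" by blast+
    have \<phi>c: "continuous_map TQ euclideanreal \<phi>" using \<phi>(1) by (rule continuous_map_into_fulltopology)
    have \<phi>r: "0 \<le> \<phi> x" "\<phi> x \<le> 1" if "x \<in> Q" for x using continuous_map_funspace[OF \<phi>(1)] that by auto
    define B where "B = bd \<inter> {x \<in> topspace TQ. \<phi> x \<in> {..1/2}}"
    have "closedin TQ {x \<in> topspace TQ. \<phi> x \<in> {..1/2}}"
      by (rule closedin_continuous_map_preimage[OF \<phi>c]) simp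
    then have clB: "closedin TQ B" unfolding B_def by (rule closedin_Int[OF closedin_bd])
    have disj: "B \<inter> Ae e = {}" if "e \<in> F" for e
    proof -
      have False if x: "x \<in> B" "x \<in> Ae e" for x
      proof -
        have "x \<in> bd" "\<phi> x \<le> 1/2" using x(1) by (simp_all add: B_def)
        then have "x \<in> Ae e0" using Abd[of x e] x(2) by simp
        from \<phi>(3)[OF this] \<open>\<phi> x \<le> 1/2\<close> show False by simp
      qed
      then show ?thesis by blast
    qed
    have "\<forall>e. \<exists>s :: real list \<Rightarrow> real. e \<in> F \<longrightarrow> continuous_map TQ (top_of_set {0..1}) s \<and> (\<forall>x\<in>B. s x = 0) \<and> (\<forall>x\<in>Ae e. s x = 1)"
    proof
      fix e
      show "\<exists>s :: real list \<Rightarrow> real. e \<in> F \<longrightarrow> continuous_map TQ (top_of_set {0..1}) s \<and> (\<forall>x\<in>B. s x = 0) \<and> (\<forall>x\<in>Ae e. s x = 1)"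
      proof (cases "e \<in> F")
        case True
        from Urysohn_TQ[OF clB clA[OF True] disj[OF True]] show ?thesis
          by (elim exE) (rule exI, rule impI)
      qed simp
    qed
    from choice[OF this] obtain s :: "'u \<Rightarrow> real list \<Rightarrow> real" where s': "\<forall>e. e \<in> F \<longrightarrow> continuous_map TQ (top_of_set {0..1}) (s e) \<and>
       (\<forall>x\<in>B. s e x = 0) \<and> (\<forall>x\<in>Ae e. s e x = 1)" by (elim exE)
    have s: "continuous_map TQ (top_of_set {0..1}) (s e)" "x \<in> B \<Longrightarrow> s e x = 0" "x \<in> Ae e \<Longrightarrow> s e x = 1" if "e \<in> F" for e x
      using s' that by simp_all
    have sc: "continuous_map TQ euclideanreal (s e)" if "e \<in> F" for e using s(1)[OF that] by (rule continuous_map_into_fulltopology)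
    have sr: "0 \<le> s e x" "s e x \<le> 1" if "e \<in> F" "x \<in> Q" for e x using continuous_map_funspace[OF s(1)[OF that(1)]] that by auto
    define w where "w e x = min 1 (2 * \<phi> x) + (1 - min 1 (2 * \<phi> x)) * s e x" for e x
    have "continuous_map TQ (top_of_set {0..1}) (w e)" if e: "e \<in> F" for e
      unfolding continuous_map_in_subtopology
    proof
      show "continuous_map TQ euclideanreal (w e)"
        unfolding w_def using sc[OF e] \<phi>c by (intro continuous_intros continuous_map_real_min) auto
      have "w e x \<in> {0..1}" if x: "x \<in> Q" for x
      proof -
        define m where "m = min 1 (2 * \<phi> x)"
        have m: "0 \<le> m" "m \<le> 1" using \<phi>r[OF x] by (auto simp: m_def)
        have "0 \<le> (1 - m) * s e x" using m sr[OF e x] by simp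
        moreover have "(1 - m) * s e x \<le> (1 - m) * 1" using m sr[OF e x] by (intro mult_left_mono) auto
        ultimately show ?thesis using m by (simp add: w_def flip: m_def)
      qed
      then show "w e \<in> topspace TQ \<rightarrow> {0..1}" by auto
    qed
    moreover have "w e x = min 1 (2 * \<phi> x)" if e: "e \<in> F" and x: "x \<in> bd" for e x
    proof (cases "\<phi> x \<le> 1/2")
      case True
      then have "x \<in> B" using x by (auto simp: B_def bd_def)
      then show ?thesis using s(2)[OF e] by (simp add: w_def)
    next
      case False
      then show ?thesis by (simp add: w_def)
    qed
    moreover have "w e x = 1" if "e \<in> F" "x \<in> Ae e" for e x using s(3)[OF that] by (simp add: w_def)
    moreover have "w e1 x1 = 0"
    proof -
      have "x1 \<in> B" using True yx(2) \<phi>(2) by (simp add: B_def)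
      then show ?thesis using s(2)[OF yx(1)] \<phi>(2) by (simp add: w_def)
    qed
    ultimately show ?thesis using e0 by (intro exI[of _ w]) simp
  qed
  then obtain w where w: "\<forall>e\<in>F. continuous_map TQ (top_of_set {0..1::real}) (w e)" "\<forall>e\<in>F. \<forall>x\<in>bd. w e x = w e0 x"
      "\<forall>e\<in>F. \<forall>x\<in>Ae e. w e x = 1" "w e1 x1 = 0" by (elim exE conjE)
  obtain G where G: "continuous_map K (top_of_set {0..1::real}) G" "\<And>e x. e \<in> F \<Longrightarrow> x \<in> Q \<Longrightarrow> G (q e x) = w e x"
  proof -
    have "\<exists>G. continuous_map K (top_of_set {0..1::real}) G \<and> (\<forall>e\<in>F. \<forall>x\<in>Q. G (q e x) = w e x)"
      by (rule glue_exists) (use w(1,2) in simp_all)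
    then show thesis by (elim exE conjE) (rule that, assumption, blast)
  qed
  have "G z = 1" if z: "z \<in> A" for z
  proof -
    have "z \<in> topspace K" using closedin_subset[OF A] z by auto
    then obtain e x where "e \<in> F" "x \<in> Q" "z = q e x" by (rule K_cases)
    then show ?thesis using G(2) w(3) z by (simp add: Ae_def)
  qed
  then show "\<exists>f::'u \<Rightarrow> real. continuous_map K (top_of_set {0..1}) f \<and> f y = 0 \<and> f ` A \<subseteq> {1}"
    using G w(4) yx by (intro exI[of _ G]) auto
qed

lemma Hausdorff_K: "Hausdorff_space K"
proof -
  have "closedin K {y}" if y: "y \<in> topspace K" for y
  proof -
    obtain e1 x1 where yx: "e1 \<in> F" "x1 \<in> Q" "y = q e1 x1" using y by (rule K_cases)
    have "openin TQ {x \<in> Q. q e x \<in> topspace K - {y}}" if e: "e \<in> F" for e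
    proof (cases "q e x1 = y")
      case True
      have "{x \<in> Q. q e x \<in> topspace K - {y}} = topspace TQ - {x1}"
        using q_in[OF e] True yx by (auto simp: q_eq_iff)
      moreover have "openin TQ (topspace TQ - {x1})"
        by (rule openin_diff[OF openin_topspace closedin_point[OF yx(2)]])
      ultimately show ?thesis by (simp only:)
    next
      case False
      have "{x \<in> Q. q e x \<in> topspace K - {y}} = topspace TQ"
        using q_in[OF e] False yx by (auto simp: q_eq_iff)
      then show ?thesis by (metis openin_topspace)
    qed
    then show ?thesis unfolding closedin_def openin_K using y by (auto simp: topspace_K)
  qed
  then have "t1_space K" by (simp add: t1_space_closedin_singleton)
  then show ?thesis using completely_regular_imp_regular_space[OF completely_regular_K] regular_t1_imp_Hausdorff_space by blast
qed

lemma T_space_K: "T_space K"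
proof (rule T_spaceI[OF completely_regular_K Hausdorff_K])
  fix U assume UK: "U \<subseteq> topspace K" and op: "\<And>(D :: 'u topology) h. compact_space D \<Longrightarrow> locally_connected_space D \<Longrightarrow>
       second_countable D \<Longrightarrow> continuous_map D K h \<Longrightarrow> openin D {x \<in> topspace D. h x \<in> U}"
  define j where "j x = J (e0, x)" for x
  have j: "inj_on j Q" by (rule inj_onI) (use J in \<open>simp add: j_def inj_eq\<close>)
  let ?D = "metric_topology (eimage j (cube n))" and ?i = "inv_into Q j"
  have hm: "homeomorphic_maps TQ ?D j ?i" by (rule homeomorphic_eimage[OF is_emetric_cube j])
  have hs: "TQ homeomorphic_space ?D" using hm homeomorphic_space_def by blast
  have D: "compact_space ?D" "locally_connected_space ?D" "second_countable ?D"
    using cube_space[of n] homeomorphic_compact_space[OF hs] homeomorphic_locally_connected_space[OF hs]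
      homeomorphic_space_second_countability[OF hs] by auto
  show "openin K U"
    unfolding openin_K
  proof (intro conjI ballI)
    show "U \<subseteq> (\<Union>e\<in>F. q e ` Q)" using UK by (simp add: topspace_K)
    fix e assume e: "e \<in> F"
    have ic: "continuous_map ?D TQ ?i" and jc: "continuous_map TQ ?D j" using hm by (auto simp: homeomorphic_maps_def)
    have "openin ?D {x \<in> topspace ?D. (q e \<circ> ?i) x \<in> U}"
      by (rule op[OF D continuous_map_compose[OF ic continuous_q[OF e]]])
    from openin_continuous_map_preimage[OF jc this]
    have "openin TQ {x \<in> topspace TQ. j x \<in> {x \<in> topspace ?D. (q e \<circ> ?i) x \<in> U}}" .
    moreover have "{x \<in> topspace TQ. j x \<in> {x \<in> topspace ?D. (q e \<circ> ?i) x \<in> U}} = {x \<in> Q. q e x \<in> U}"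
      using continuous_map_funspace[OF jc] inv_into_f_f[OF j] by auto
    ultimately show "openin TQ {x \<in> Q. q e x \<in> U}" by simp
  qed
qed


subsection \<open>The cubical set realized by glued cubes\<close>

definition bdm :: "nat \<Rightarrow> (bool list \<Rightarrow> bool list) \<Rightarrow> bool" where
  "bdm m \<phi> \<longleftrightarrow> (\<exists>i<n. \<exists>c. \<forall>v\<in>verts m. \<phi> v ! i = c)"

definition norm_index :: "nat \<Rightarrow> 'u \<Rightarrow> (bool list \<Rightarrow> bool list) \<Rightarrow> 'u" where
  "norm_index m e \<phi> = (if bdm m \<phi> then e0 else e)"

definition raw_cells :: "nat \<Rightarrow> ('u \<times> (bool list \<Rightarrow> bool list)) set" where
  "raw_cells m = {(e, \<phi>). e \<in> F \<and> box_map m n \<phi> \<and> (bdm m \<phi> \<longrightarrow> e = e0)}"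

definition code_map :: "nat \<Rightarrow> (bool list \<Rightarrow> bool list) \<Rightarrow> nat" where
  "code_map m = (SOME f. inj_on f {\<phi>. box_map m n \<phi>})"

text \<open>
  An \<open>m\<close>-cell is a map to the \<open>n\<close>-cube together with the index of a copy of that cube; if the map goes to the
  boundary, the index is normalized to \<open>e0\<close>.  Cells are encoded in the universe by means of \<open>J\<close>.
\<close>

definition code :: "nat \<Rightarrow> 'u \<times> (bool list \<Rightarrow> bool list) \<Rightarrow> 'u" where
  "code m = (\<lambda>(e, \<phi>). J (e, [real (code_map m \<phi>)]))"

definition decode :: "nat \<Rightarrow> 'u \<Rightarrow> 'u \<times> (bool list \<Rightarrow> bool list)" where
  "decode m = inv_into (raw_cells m) (code m)"

definition C :: "'u cubical" where
  "C = \<lparr> cells = (\<lambda>m. code m ` raw_cells m),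
     action = (\<lambda>m m' \<psi> c. case decode m' c of (e, \<phi>) \<Rightarrow>
       code m (norm_index m e (restrict (\<phi> \<circ> \<psi>) (verts m)), restrict (\<phi> \<circ> \<psi>) (verts m))) \<rparr>"

lemma finite_box_maps: "finite {\<phi>. box_map m n \<phi>}"
proof (rule finite_subset)
  show "{\<phi>. box_map m n \<phi>} \<subseteq> (\<Pi>\<^sub>E v\<in>verts m. verts n)"
  proof
    fix \<phi> assume "\<phi> \<in> {\<phi>. box_map m n \<phi>}"
    then have "box_map m n \<phi>" by simp
    from box_map_extensional[OF this] box_map_verts[OF this]
    show "\<phi> \<in> (\<Pi>\<^sub>E v\<in>verts m. verts n)" by (simp add: PiE_iff)
  qed
qed (simp add: finite_PiE)

lemma inj_code: "inj_on (code m) (raw_cells m)"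
proof -
  have "\<exists>f :: _ \<Rightarrow> nat. inj_on f {\<phi>. box_map m n \<phi>}"
    using finite_imp_inj_to_nat_seg[OF finite_box_maps] by blast
  then have "inj_on (code_map m) {\<phi>. box_map m n \<phi>}" unfolding code_map_def by (rule someI_ex)
  then have c: "\<phi> = \<phi>'" if "code_map m \<phi> = code_map m \<phi>'" "box_map m n \<phi>" "box_map m n \<phi>'" for \<phi> \<phi>'
    using that by (auto dest: inj_onD)
  show ?thesis
  proof (rule inj_onI)
    fix x y assume xy: "x \<in> raw_cells m" "y \<in> raw_cells m" "code m x = code m y"
    obtain e \<phi> e' \<phi>' where [simp]: "x = (e, \<phi>)" "y = (e', \<phi>')" by (metis surj_pair)
    have "e = e'" "code_map m \<phi> = code_map m \<phi>'" using xy(3) J by (simp_all add: code_def inj_eq)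
    then show "x = y" using c[of \<phi> \<phi>'] xy(1,2) by (simp add: raw_cells_def)
  qed
qed

lemma decode_code: "x \<in> raw_cells m \<Longrightarrow> decode m (code m x) = x"
  unfolding decode_def by (rule inv_into_f_f[OF inj_code])

lemma norm_raw: "e \<in> F \<Longrightarrow> box_map m n \<phi> \<Longrightarrow> (norm_index m e \<phi>, \<phi>) \<in> raw_cells m"
  using e0 by (auto simp: raw_cells_def norm_index_def)

lemma action_code:
  assumes "(e, \<phi>) \<in> raw_cells m'"
  shows "action C m m' \<psi> (code m' (e, \<phi>)) =
     code m (norm_index m e (restrict (\<phi> \<circ> \<psi>) (verts m)), restrict (\<phi> \<circ> \<psi>) (verts m))"
  by (simp add: C_def decode_code[OF assms])

lemma cells_C: "cells C m = code m ` raw_cells m"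
  by (simp add: C_def)

lemma bdm_compose: "bdm m' \<phi> \<Longrightarrow> box_map m m' \<psi> \<Longrightarrow> bdm m (restrict (\<phi> \<circ> \<psi>) (verts m))"
proof -
  assume b: "bdm m' \<phi>" and \<psi>: "box_map m m' \<psi>"
  obtain i c where i: "i < n" "\<And>v. v \<in> verts m' \<Longrightarrow> \<phi> v ! i = c" using b unfolding bdm_def by blast
  have "restrict (\<phi> \<circ> \<psi>) (verts m) v ! i = c" if "v \<in> verts m" for v
    using i(2)[OF box_map_verts[OF \<psi> that]] that by simp
  then show ?thesis unfolding bdm_def using i(1) by blast
qed

lemma cubical_set_C: "cubical_set C"
  unfolding cubical_set_def
proof (intro conjI allI impI ballI)
  fix m m' \<psi> assume \<psi>: "box_map m m' \<psi>"
  show "action C m m' \<psi> \<in> cells C m' \<rightarrow> cells C m"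
  proof
    fix c assume "c \<in> cells C m'"
    then obtain e \<phi> where c: "c = code m' (e, \<phi>)" "(e, \<phi>) \<in> raw_cells m'" by (auto simp: cells_C)
    then have "e \<in> F" "box_map m n (restrict (\<phi> \<circ> \<psi>) (verts m))"
      using box_map.compose[OF \<psi>] by (auto simp: raw_cells_def)
    then show "action C m m' \<psi> c \<in> cells C m"
      unfolding c(1) action_code[OF c(2)] cells_C by (intro imageI norm_raw)
  qed
next
  fix m c assume "c \<in> cells C m"
  then obtain e \<phi> where c: "c = code m (e, \<phi>)" "(e, \<phi>) \<in> raw_cells m" by (auto simp: cells_C)
  have "box_map m n \<phi>" using c(2) by (simp add: raw_cells_def)
  from box_map_extensional[OF this]
  have "restrict (\<phi> \<circ> restrict (\<lambda>v. v) (verts m)) (verts m) = \<phi>"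
    by (auto simp: fun_eq_iff extensional_def restrict_def)
  then show "action C m m (restrict (\<lambda>v. v) (verts m)) c = c"
    unfolding c(1) action_code[OF c(2)] using c(2) by (auto simp: raw_cells_def norm_index_def)
next
  fix l m m' \<psi> \<xi> c assume h: "box_map l m \<psi> \<and> box_map m m' \<xi>" and cc: "c \<in> cells C m'"
  then obtain e \<phi> where c: "c = code m' (e, \<phi>)" "(e, \<phi>) \<in> raw_cells m'" by (auto simp: cells_C)
  let ?a = "restrict (\<phi> \<circ> \<xi>) (verts m)"
  have 1: "(norm_index m e ?a, ?a) \<in> raw_cells m"
    using c(2) box_map.compose h by (intro norm_raw) (auto simp: raw_cells_def)
  have eq: "restrict (\<phi> \<circ> restrict (\<xi> \<circ> \<psi>) (verts l)) (verts l) = restrict (?a \<circ> \<psi>) (verts l)"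
    by (rule ext) (use box_map_verts[OF conjunct1[OF h]] in \<open>simp add: restrict_def\<close>)
  have "norm_index l (norm_index m e ?a) (restrict (?a \<circ> \<psi>) (verts l)) = norm_index l e (restrict (?a \<circ> \<psi>) (verts l))"
    using bdm_compose[of m ?a l \<psi>] h by (auto simp: norm_index_def)
  then show "action C l m' (restrict (\<xi> \<circ> \<psi>) (verts l)) c = action C l m \<psi> (action C m m' \<xi> c)"
    unfolding c(1) action_code[OF c(2)] action_code[OF 1] eq by simp
qed

definition rz :: "nat \<Rightarrow> (bool list \<Rightarrow> bool list) \<Rightarrow> real list \<Rightarrow> real list" where
  "rz m \<phi> = (SOME g. realizes m n \<phi> g)"

lemma rz: "box_map m n \<phi> \<Longrightarrow> realizes m n \<phi> (rz m \<phi>)"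
proof -
  assume "box_map m n \<phi>"
  then have "\<exists>g. realizes m n \<phi> g" using box_map_form realizes_box_real by blast
  then show ?thesis unfolding rz_def by (rule someI_ex[where P = "realizes m n \<phi>"])
qed

lemma rz_in: "box_map m n \<phi> \<Longrightarrow> p \<in> epoints (cube m) \<Longrightarrow> rz m \<phi> p \<in> Q"
  using realizes_short_map[OF _ rz] by (auto simp: short_map_def)

lemma rz_bd:
  assumes \<phi>: "box_map m n \<phi>" and b: "bdm m \<phi>" and p: "p \<in> epoints (cube m)"
  shows "rz m \<phi> p \<in> bd"
proof -
  obtain i c where i: "i < n" "\<forall>v\<in>verts m. \<phi> v ! i = c" using b by (auto simp: bdm_def)
  obtain T w where T: "is_vert_chain m T" "\<forall>v\<in>T. 0 \<le> w v" "(\<Sum>v\<in>T. w v) = 1" "conv_comb m (\<lambda>v. v) T w = p"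
    by (rule cube_chain[OF p])
  have "rz m \<phi> p = conv_comb n \<phi> T w" using rz[OF \<phi>] T unfolding realizes_def by blast
  then have "rz m \<phi> p ! i = (\<Sum>v\<in>T. w v * of_bool (\<phi> v ! i))" using i by (simp add: conv_comb_nth)
  also have "\<dots> = (\<Sum>v\<in>T. w v * of_bool c)"
    using i T(1) by (intro sum.cong) (auto simp: is_vert_chain_def)
  also have "\<dots> = of_bool c" using T(3) by (simp flip: sum_distrib_right)
  finally have "rz m \<phi> p ! i \<in> {0, 1}" by auto
  then show ?thesis using i(1) rz_in[OF \<phi> p] by (auto simp: bd_def)
qed

definition leg :: "nat \<times> 'u \<Rightarrow> real list \<Rightarrow> 'u" where
  "leg = (\<lambda>(m, c) p. case decode m c of (e, \<phi>) \<Rightarrow> q e (rz m \<phi> p))"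

lemma leg_code: "(e, \<phi>) \<in> raw_cells m \<Longrightarrow> leg (m, code m (e, \<phi>)) p = q e (rz m \<phi> p)"
  by (simp add: leg_def decode_code)

lemma q_norm:
  assumes "box_map m n \<phi>" "p \<in> epoints (cube m)"
  shows "q (norm_index m e \<phi>) (rz m \<phi> p) = q e (rz m \<phi> p)"
  using rz_bd[OF assms(1) _ assms(2)] by (auto simp: q_eq_iff norm_index_def)

definition idn :: "bool list \<Rightarrow> bool list" where "idn = restrict (\<lambda>v. v) (verts n)"

lemma idn: "box_map n n idn" "\<not> bdm n idn" "e \<in> F \<Longrightarrow> (e, idn) \<in> raw_cells n"
proof -
  show b: "box_map n n idn" unfolding idn_def by (rule box_map.ident)
  show nb: "\<not> bdm n idn"
  proof
    assume "bdm n idn"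
    then obtain i c where i: "i < n" "\<And>v. v \<in> verts n \<Longrightarrow> v ! i = c" by (auto simp: bdm_def idn_def)
    have "replicate n True \<in> verts n" "replicate n False \<in> verts n" by (auto simp: verts_def)
    from i(2)[OF this(1)] i(2)[OF this(2)] i(1) show False by simp
  qed
  show "(e, idn) \<in> raw_cells n" if "e \<in> F" using that b nb by (simp add: raw_cells_def)
qed

lemma rz_idn: "p \<in> Q \<Longrightarrow> rz n idn p = p"
proof -
  assume p: "p \<in> Q"
  have "realizes n n idn (\<lambda>x. x)"
    unfolding realizes_def conv_comb_def idn_def by (auto simp: is_vert_chain_def intro!: sum.cong)
  from realizes_eq[OF rz[OF idn(1)] this p] show ?thesis .
qed

definition face :: "nat \<Rightarrow> bool \<Rightarrow> bool list \<Rightarrow> bool list" where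
  "face i c = restrict (\<lambda>v. take i v @ [c] @ drop i v) (verts (n - 1))"

lemma box_map_face:
  assumes i: "i < n" shows "box_map (n - 1) n (face i c)"
proof -
  define k where "k = n - 1 - i"
  have n: "n = i + 1 + k" "n - 1 = i + 0 + k" using i by (auto simp: k_def)
  let ?f1 = "restrict (\<lambda>v. restrict (\<lambda>v. v) (verts i) (take i v) @ restrict (\<lambda>v. [c]) (verts 0) (drop i v)) (verts (i + 0))"
  let ?f2 = "restrict (\<lambda>v. ?f1 (take (i + 0) v) @ restrict (\<lambda>v. v) (verts k) (drop (i + 0) v)) (verts (i + 0 + k))"
  have "box_map (i + 0 + k) (i + 1 + k) ?f2"
    by (rule box_map.tensor[OF box_map.tensor[OF box_map.ident box_map.coface] box_map.ident])
  moreover have "?f2 = face i c"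
    unfolding face_def n(2) by (rule ext) (auto simp: verts_def restrict_def)
  ultimately have "box_map (i + 0 + k) (i + 1 + k) (face i c)" by simp
  then show ?thesis unfolding n(1)[symmetric] n(2)[symmetric] .
qed

lemma realizes_face:
  assumes i: "i < n" shows "realizes (n - 1) n (face i c) (\<lambda>y. take i y @ [of_bool c] @ drop i y)"
  unfolding realizes_def
proof (intro allI impI, elim conjE)
  fix T w assume T: "is_vert_chain (n - 1) T" and sum: "(\<Sum>v\<in>T. w v) = (1::real)"
  let ?x = "conv_comb (n - 1) (\<lambda>v. v) T w"
  show "take i ?x @ [of_bool c] @ drop i ?x = conv_comb n (face i c) T w"
  proof (rule nth_equalityI)
    show "length (take i ?x @ [of_bool c] @ drop i ?x) = length (conv_comb n (face i c) T w)" using i by simp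
    fix j assume "j < length (take i ?x @ [of_bool c] @ drop i ?x)"
    then have j: "j < n" using i by simp
    have fv: "face i c v ! j = (if j < i then v ! j else if j = i then c else v ! (j - 1))" if "v \<in> T" for v
    proof -
      have "v \<in> verts (n - 1)" using T that by (auto simp: is_vert_chain_def)
      then have l: "length v = n - 1" and fe: "face i c v = take i v @ [c] @ drop i v"
        by (auto simp: face_def verts_def)
      consider "j < i" | "j = i" | d where "j = Suc (i + d)"
        using less_imp_Suc_add linorder_neqE_nat by metis
      then show ?thesis using i j l by cases (auto simp: fe nth_append)
    qed
    have r: "conv_comb n (face i c) T w ! j = (\<Sum>v\<in>T. w v * of_bool (if j < i then v ! j else if j = i then c else v ! (j - 1)))"
      unfolding conv_comb_nth[OF j] by (intro sum.cong refl) (simp add: fv)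
    consider "j < i" | "j = i" | "j > i" by linarith
    then show "(take i ?x @ [of_bool c] @ drop i ?x) ! j = conv_comb n (face i c) T w ! j"
    proof cases
      case 1
      then show ?thesis using i r by (simp add: nth_append conv_comb_nth)
    next
      case 2
      then show ?thesis using i r sum by (simp add: nth_append flip: sum_distrib_right)
    next
      case 3
      then obtain d where d: "j = Suc (i + d)" using less_imp_Suc_add by blast
      then have "(take i ?x @ [of_bool c] @ drop i ?x) ! j = ?x ! (i + d)" using i j by (simp add: nth_append)
      then show ?thesis using i j r d by (simp add: conv_comb_nth)
    qed
  qed
qed

lemma bd_face:
  assumes x: "x \<in> bd"
  obtains i c y where "i < n" "y \<in> epoints (cube (n - 1))" "rz (n - 1) (face i c) y = x"
proof -
  obtain i where i: "i < n" "x ! i \<in> {0, 1}" and xQ: "x \<in> Q" using x by (auto simp: bd_def)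
  define c where "c = (x ! i = 1)"
  have c: "x ! i = of_bool c" using i by (auto simp: c_def)
  have len: "length x = n" using xQ by (simp add: cube_nth)
  define y where "y = take i x @ drop (Suc i) x"
  have y: "y \<in> epoints (cube (n - 1))"
    using xQ i len set_take_subset[of i x] set_drop_subset[of "Suc i" x] by (auto simp: epoints_cube y_def)
  have "rz (n - 1) (face i c) y = take i y @ [of_bool c] @ drop i y"
    by (rule realizes_eq[OF rz[OF box_map_face[OF i(1)]] realizes_face[OF i(1)] y])
  also have "\<dots> = take i x @ x ! i # drop (Suc i) x" using i len c by (simp add: y_def)
  also have "\<dots> = x" using i len by (simp add: id_take_nth_drop[symmetric])
  finally show ?thesis using that i(1) y by blast
qed

lemma bdm_face: "i < n \<Longrightarrow> bdm (n - 1) (face i c)"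
  unfolding bdm_def by (intro exI[of _ i] conjI exI[of _ c]) (auto simp: face_def verts_def nth_append)

text \<open>
  Every cell is induced from the identity cells, so a cocone is determined by its legs at these.  The
  legs agree on the boundary because the faces of the identity cells do not depend on the copy, and
  so they glue to a map on \<open>K\<close>.
\<close>

lemma topological_realization_K: "is_topological_realization C K"
  unfolding is_topological_realization_def
proof (rule exI[of _ leg])
  let ?D = "\<lambda>(m, c :: 'u). metric_topology (cube m)"
  have DT: "topspace (case i of (m, c) \<Rightarrow> metric_topology (cube m)) = epoints (cube (fst i))" for i :: "nat \<times> 'u"
    by (simp add: case_prod_unfold is_emetric_cube)
  show "is_colimit topspace topspace continuous_map continuous_map continuous_map T_space
      (element_indices C) ?D (element_arrows C) leg K"
    unfolding is_colimit_def
  proof (intro conjI allI impI)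
    have act: "action C m m' \<psi> c \<in> cells C m" if "box_map m m' \<psi>" "c \<in> cells C m'" for m m' \<psi> c
      using cubical_set_C that unfolding cubical_set_def by blast
    show "is_diagram continuous_map (element_indices C) ?D (element_arrows C)"
      using act by (auto simp: is_diagram_def element_arrows_def element_indices_def realizes_continuous)
    show "T_space K" by (rule T_space_K)
    show "is_cocone topspace continuous_map (element_indices C) ?D (element_arrows C) leg K"
      unfolding is_cocone_def
    proof (intro conjI ballI)
      fix i assume "i \<in> element_indices C"
      then obtain m e \<phi> where i: "i = (m, code m (e, \<phi>))" "(e, \<phi>) \<in> raw_cells m"
        by (auto simp: element_indices_def cells_C)
      have \<phi>: "e \<in> F" "box_map m n \<phi>" using i by (auto simp: raw_cells_def)
      have "continuous_map (metric_topology (cube m)) K (q e \<circ> rz m \<phi>)"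
        by (rule continuous_map_compose[OF realizes_continuous[OF \<phi>(2) rz[OF \<phi>(2)]] continuous_q[OF \<phi>(1)]])
      moreover have "q e \<circ> rz m \<phi> = leg i" using leg_code[OF i(2)] i(1) by (auto simp: fun_eq_iff)
      ultimately show "continuous_map (?D i) K (leg i)" using i by simp
    next
      fix a assume "a \<in> element_arrows C"
      then obtain m m' \<psi> c g where a: "a = ((m, action C m m' \<psi> c), (m', c), g)" "box_map m m' \<psi>" "c \<in> cells C m'" "realizes m m' \<psi> g"
        by (auto simp: element_arrows_def)
      obtain e \<phi> where c: "c = code m' (e, \<phi>)" "(e, \<phi>) \<in> raw_cells m'" using a(3) by (auto simp: cells_C)
      have \<phi>: "e \<in> F" "box_map m' n \<phi>" using c by (auto simp: raw_cells_def)
      let ?\<xi> = "restrict (\<phi> \<circ> \<psi>) (verts m)"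
      have \<xi>: "box_map m n ?\<xi>" by (rule box_map.compose[OF a(2) \<phi>(2)])
      have "leg (m', c) (g p) = leg (m, action C m m' \<psi> c) p" if p: "p \<in> epoints (cube m)" for p
      proof -
        have "rz m ?\<xi> p = (rz m' \<phi> \<circ> g) p"
          by (rule realizes_eq[OF rz[OF \<xi>] realizes_compose[OF a(2,4) rz[OF \<phi>(2)]] p])
        then show ?thesis
          unfolding c(1) leg_code[OF c(2)] action_code[OF c(2)] leg_code[OF norm_raw[OF \<phi>(1) \<xi>]] q_norm[OF \<xi> p]
          by simp
      qed
      then show "case a of (i, j, f) \<Rightarrow> \<forall>p\<in>topspace (?D i). leg j (f p) = leg i p"
        by (simp add: a(1) is_emetric_cube)
    qed
  next
    fix W :: "'u topology" and k
    assume "T_space W \<and> is_cocone topspace continuous_map (element_indices C) ?D (element_arrows C) k W"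
    then have coc: "is_cocone topspace continuous_map (element_indices C) ?D (element_arrows C) k W" by simp
    have kc: "continuous_map (metric_topology (cube m)) W (k (m, c))" if "c \<in> cells C m" for m c
    proof -
      have "(m, c) \<in> element_indices C" using that by (simp add: element_indices_def)
      from coc[unfolded is_cocone_def, THEN conjunct1, rule_format, OF this] show ?thesis by simp
    qed
    have kA: "k (m', c) (g p) = k (m, action C m m' \<psi> c) p"
      if "box_map m m' \<psi>" "c \<in> cells C m'" "realizes m m' \<psi> g" "p \<in> epoints (cube m)" for m m' \<psi> c g p
    proof -
      have "((m, action C m m' \<psi> c), (m', c), g) \<in> element_arrows C" using that by (auto simp: element_arrows_def)
      from coc[unfolded is_cocone_def, THEN conjunct2, rule_format, OF this] that(4) show ?thesis
        by (simp add: is_emetric_cube)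
    qed
    define w where "w e = k (n, code n (e, idn))" for e
    have wc: "continuous_map TQ W (w e)" if "e \<in> F" for e
      unfolding w_def by (rule kc) (use idn(3)[OF that] in \<open>auto simp: cells_C\<close>)
    have wk: "w e (rz m \<phi> p) = k (m, code m (norm_index m e \<phi>, \<phi>)) p"
      if e: "e \<in> F" and \<phi>: "box_map m n \<phi>" and p: "p \<in> epoints (cube m)" for e m \<phi> p
    proof -
      have "restrict (idn \<circ> \<phi>) (verts m) = \<phi>"
        using box_map_extensional[OF \<phi>] box_map_verts[OF \<phi>]
        by (auto simp: fun_eq_iff idn_def extensional_def restrict_def)
      then have "action C m n \<phi> (code n (e, idn)) = code m (norm_index m e \<phi>, \<phi>)"
        using action_code[OF idn(3)[OF e], of m \<phi>] by simp
      moreover have "code n (e, idn) \<in> cells C n" using idn(3)[OF e] by (auto simp: cells_C)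
      ultimately show ?thesis using kA[OF \<phi> _ rz[OF \<phi>] p, of "code n (e, idn)"] by (simp add: w_def)
    qed
    have wbd: "w e x = w e0 x" if e: "e \<in> F" and x: "x \<in> bd" for e x
    proof -
      obtain i c y where y: "i < n" "y \<in> epoints (cube (n - 1))" "rz (n - 1) (face i c) y = x" using x by (rule bd_face)
      show ?thesis
        using wk[OF e box_map_face[OF y(1)] y(2), of c] wk[OF e0 box_map_face[OF y(1)] y(2), of c] y(3) bdm_face[OF y(1), of c]
        by (simp add: norm_index_def)
    qed
    obtain G where G: "continuous_map K W G" "\<And>e x. e \<in> F \<Longrightarrow> x \<in> Q \<Longrightarrow> G (q e x) = w e x"
    proof -
      have "\<exists>G. continuous_map K W G \<and> (\<forall>e\<in>F. \<forall>x\<in>Q. G (q e x) = w e x)"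
        by (rule glue_exists) (simp_all add: wc wbd)
      then show thesis by (elim exE conjE) (rule that, assumption, blast)
    qed
    have Gk: "G (leg i p) = k i p" if i: "i \<in> element_indices C" and p: "p \<in> epoints (cube (fst i))" for i p
    proof -
      obtain m e \<phi> where i': "i = (m, code m (e, \<phi>))" "(e, \<phi>) \<in> raw_cells m"
        using i by (auto simp: element_indices_def cells_C)
      have \<phi>: "e \<in> F" "box_map m n \<phi>" "norm_index m e \<phi> = e" using i' by (auto simp: raw_cells_def norm_index_def)
      have pm: "p \<in> epoints (cube m)" using p i' by simp
      show ?thesis
        unfolding i'(1) leg_code[OF i'(2)] G(2)[OF \<phi>(1) rz_in[OF \<phi>(2) pm]] wk[OF \<phi>(1,2) pm] \<phi>(3) ..
    qed
    show "\<exists>g. continuous_map K W g \<and> (\<forall>i\<in>element_indices C. \<forall>p\<in>topspace (?D i). g (leg i p) = k i p)"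
      unfolding DT using G(1) Gk by (intro exI[of _ G]) simp
    fix g g' assume gg: "continuous_map K W g \<and> (\<forall>i\<in>element_indices C. \<forall>p\<in>topspace (?D i). g (leg i p) = k i p) \<and>
       continuous_map K W g' \<and> (\<forall>i\<in>element_indices C. \<forall>p\<in>topspace (?D i). g' (leg i p) = k i p)"
    show "\<forall>y\<in>topspace K. g y = g' y"
    proof
      fix y assume "y \<in> topspace K"
      then obtain e x where y: "e \<in> F" "x \<in> Q" "y = q e x" by (rule K_cases)
      have i: "(n, code n (e, idn)) \<in> element_indices C" using idn(3)[OF y(1)] by (auto simp: element_indices_def cells_C)
      have "leg (n, code n (e, idn)) x = y" using leg_code[OF idn(3)[OF y(1)]] rz_idn[OF y(2)] y(3) by simp
      moreover have "g (leg (n, code n (e, idn)) x) = k (n, code n (e, idn)) x" "g' (leg (n, code n (e, idn)) x) = k (n, code n (e, idn)) x"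
        using gg[unfolded DT] i y(2) by simp_all
      ultimately show "g y = g' y" by simp
    qed
  qed
qed

end

section \<open>Continuity and boxes\<close>

text \<open>
  The preimage of a closed set is a finite union of images of compact sets, which are closed.
\<close>

lemma continuous_map_finite_compact_cover:
  fixes \<Phi> :: "'i \<Rightarrow> 'b \<Rightarrow> 'c"
  assumes I: "finite I" and H: "Hausdorff_space K"
    and D: "\<And>i. i \<in> I \<Longrightarrow> compact_space (D i)"
    and \<Phi>: "\<And>i. i \<in> I \<Longrightarrow> continuous_map (D i) K (\<Phi> i)"
    and l: "\<And>i. i \<in> I \<Longrightarrow> continuous_map (D i) W (\<lambda>x. l (\<Phi> i x))"
    and cov: "topspace K \<subseteq> (\<Union>i\<in>I. \<Phi> i ` topspace (D i))"
  shows "continuous_map K W l"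
  unfolding continuous_map_closedin
proof (intro conjI allI impI)
  have lW: "l (\<Phi> i x) \<in> topspace W" if "i \<in> I" "x \<in> topspace (D i)" for i x
    using continuous_map_funspace[OF l[OF that(1)]] that(2) by (rule funcset_mem)
  show "l \<in> topspace K \<rightarrow> topspace W"
  proof
    fix y assume "y \<in> topspace K"
    then obtain i x where "i \<in> I" "x \<in> topspace (D i)" "y = \<Phi> i x" using cov by blast
    then show "l y \<in> topspace W" using lW by simp
  qed
  fix C assume C: "closedin W C"
  let ?P = "\<lambda>i. {x \<in> topspace (D i). l (\<Phi> i x) \<in> C}"
  have cl: "closedin K (\<Phi> i ` ?P i)" if i: "i \<in> I" for i
  proof -
    have "closedin (D i) (?P i)" by (rule closedin_continuous_map_preimage[OF l[OF i] C])
    then have "compactin (D i) (?P i)" by (rule closedin_compact_space[OF D[OF i]])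
    from image_compactin[OF this \<Phi>[OF i]] show ?thesis by (rule compactin_imp_closedin[OF H])
  qed
  have "closedin K (\<Union>i\<in>I. \<Phi> i ` ?P i)" using I cl by (intro closedin_Union) auto
  moreover have "(\<Union>i\<in>I. \<Phi> i ` ?P i) = {y \<in> topspace K. l y \<in> C}"
  proof (intro subset_antisym subsetI)
    fix y assume "y \<in> (\<Union>i\<in>I. \<Phi> i ` ?P i)"
    then obtain i x where x: "i \<in> I" "x \<in> topspace (D i)" "l (\<Phi> i x) \<in> C" "y = \<Phi> i x" by blast
    have "\<Phi> i x \<in> topspace K" using continuous_map_funspace[OF \<Phi>[OF x(1)]] x(2) by (rule funcset_mem)
    then show "y \<in> {y \<in> topspace K. l y \<in> C}" using x by simp
  next
    fix y assume y: "y \<in> {y \<in> topspace K. l y \<in> C}"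
    then obtain i x where x: "i \<in> I" "x \<in> topspace (D i)" "y = \<Phi> i x" using cov by blast
    then show "y \<in> (\<Union>i\<in>I. \<Phi> i ` ?P i)" using y by blast
  qed
  ultimately show "closedin K {y \<in> topspace K. l y \<in> C}" by simp
qed

lemma continuous_map_on_compose:
  assumes f: "continuous_map (top_of_set T) W f" and g: "continuous_on S g" "\<And>x. x \<in> S \<Longrightarrow> g x \<in> T"
  shows "continuous_map (top_of_set S) W (\<lambda>x. f (g x))"
proof -
  have "continuous_map (top_of_set S) (top_of_set T) g" using g by auto
  from continuous_map_compose[OF this f] show ?thesis by (simp add: o_def)
qed

lemma continuous_map_on_cong:
  assumes f: "continuous_map (top_of_set S) W f" and eq: "\<And>x. x \<in> S \<Longrightarrow> f x = g x"
  shows "continuous_map (top_of_set S) W g"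
  by (rule continuous_map_eq[OF f]) (use eq in simp)

lemma continuous_map_closed_Un:
  assumes S: "closed S" and T: "closed T"
    and fS: "continuous_map (top_of_set S) W f" and fT: "continuous_map (top_of_set T) W f"
  shows "continuous_map (top_of_set (S \<union> T)) W f"
  unfolding continuous_map_closedin
proof (intro conjI allI impI)
  show "f \<in> topspace (top_of_set (S \<union> T)) \<rightarrow> topspace W"
    using continuous_map_funspace[OF fS] continuous_map_funspace[OF fT] by auto
  fix C assume C: "closedin W C"
  have "closed {x \<in> S. f x \<in> C}" "closed {x \<in> T. f x \<in> C}"
    using closedin_continuous_map_preimage[OF fS C] closedin_continuous_map_preimage[OF fT C] S T
      closedin_closed_trans by fastforce+
  then have "closed ({x \<in> S. f x \<in> C} \<union> {x \<in> T. f x \<in> C})" by (rule closed_Un)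
  moreover have "{x \<in> S. f x \<in> C} \<union> {x \<in> T. f x \<in> C} = {x \<in> topspace (top_of_set (S \<union> T)). f x \<in> C}" by auto
  ultimately show "closedin (top_of_set (S \<union> T)) {x \<in> topspace (top_of_set (S \<union> T)). f x \<in> C}"
    by (simp only:) (rule closed_subset; auto)
qed

definition box_norm :: "nat set \<Rightarrow> (nat \<Rightarrow> real) \<Rightarrow> real" where
  "box_norm A x = Max (insert 0 ((\<lambda>i. \<bar>x i\<bar>) ` A))"

lemma box_norm_empty [simp]: "box_norm {} x = 0"
  by (simp add: box_norm_def)

lemma box_norm_insert:
  assumes "finite A" shows "box_norm (insert a A) x = max \<bar>x a\<bar> (box_norm A x)"
proof -
  have "box_norm (insert a A) x = Max (insert \<bar>x a\<bar> (insert 0 ((\<lambda>i. \<bar>x i\<bar>) ` A)))"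
    by (simp only: box_norm_def image_insert insert_commute)
  also have "\<dots> = max \<bar>x a\<bar> (box_norm A x)" unfolding box_norm_def using assms by (intro Max_insert) auto
  finally show ?thesis .
qed

lemma box_norm_nonneg: "finite A \<Longrightarrow> 0 \<le> box_norm A x"
  by (induction A rule: finite_induct) (auto simp: box_norm_insert)

lemma box_norm_le_iff: "finite A \<Longrightarrow> 0 \<le> c \<Longrightarrow> box_norm A x \<le> c \<longleftrightarrow> (\<forall>i\<in>A. \<bar>x i\<bar> \<le> c)"
  by (induction A rule: finite_induct) (auto simp: box_norm_insert)

lemma box_norm_ge: "finite A \<Longrightarrow> i \<in> A \<Longrightarrow> \<bar>x i\<bar> \<le> box_norm A x"
  by (induction A rule: finite_induct) (auto simp: box_norm_insert)

lemma box_norm_attained: "finite A \<Longrightarrow> box_norm A x \<noteq> 0 \<Longrightarrow> \<exists>i\<in>A. \<bar>x i\<bar> = box_norm A x"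
  by (induction A rule: finite_induct) (auto simp: box_norm_insert max_def)

lemma box_norm_scale:
  assumes A: "finite A" and c: "0 \<le> c" and y: "\<And>i. i \<in> A \<Longrightarrow> y i = c * x i"
  shows "box_norm A y = c * box_norm A x"
  using A y
proof (induction A rule: finite_induct)
  case (insert a A)
  then show ?case using c
    by (auto simp: box_norm_insert abs_mult max_def mult_left_mono dest: mult_left_mono[OF _ c])
      (use c in \<open>auto simp: not_le mult_le_cancel_left\<close>)
qed simp

lemma continuous_on_box_norm [continuous_intros]:
  assumes A: "finite A" and f: "continuous_on S f"
  shows "continuous_on S (\<lambda>x. box_norm A (f x))"
  using A
proof (induction A rule: finite_induct)
  case (insert a A)
  then show ?case
    unfolding box_norm_insert[OF insert(1)]
    by (intro continuous_on_max continuous_on_rabs continuous_on_product_then_coordinatewise[OF f])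
qed simp

lemma sbox_norm: "x \<in> sbox n \<Longrightarrow> A \<subseteq> {..<n} \<Longrightarrow> box_norm A x \<le> 1"
  using finite_subset[of A "{..<n}"] by (subst box_norm_le_iff) (auto simp: sbox_def)

lemma sboundary_iff: "x \<in> sboundary n \<longleftrightarrow> x \<in> sbox n \<and> box_norm {..<n} x = 1"
proof
  assume x: "x \<in> sboundary n"
  then obtain i where "i < n" "\<bar>x i\<bar> = 1" by (auto simp: sboundary_def)
  then have "1 \<le> box_norm {..<n} x" using box_norm_ge[of "{..<n}" i x] by simp
  then show "x \<in> sbox n \<and> box_norm {..<n} x = 1" using x sbox_norm[of x n "{..<n}"] by (auto simp: sboundary_def)
next
  assume x: "x \<in> sbox n \<and> box_norm {..<n} x = 1"
  then show "x \<in> sboundary n" using box_norm_attained[of "{..<n}" x] by (auto simp: sboundary_def)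
qed

lemma closed_sbox: "closed (sbox n)"
  by (rule compact_imp_closed[OF sbox_space(4)])

definition scale_coords :: "nat set \<Rightarrow> real \<Rightarrow> (nat \<Rightarrow> real) \<Rightarrow> nat \<Rightarrow> real" where
  "scale_coords A c x = (\<lambda>i. if i \<in> A then c * x i else x i)"

lemma continuous_on_scale_coords:
  assumes "continuous_on S c" "continuous_on S f"
  shows "continuous_on S (\<lambda>z. scale_coords A (c z) (f z))"
  unfolding scale_coords_def
proof (rule continuous_on_coordinatewise_then_product)
  fix i
  show "continuous_on S (\<lambda>z. if i \<in> A then c z * f z i else f z i)"
    using assms(1) continuous_on_product_then_coordinatewise[OF assms(2), of i]
    by (cases "i \<in> A") (auto intro: continuous_on_mult)
qed

lemma real_list_encoding:
  fixes \<iota> :: "real \<Rightarrow> 'u" assumes \<iota>: "inj \<iota>"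
  shows "\<exists>c :: real list \<Rightarrow> 'u. inj c"
proof -
  obtain j :: "'u \<times> 'u \<Rightarrow> 'u" where j: "inj j" using inj_prod_exists[OF inj_real_infinite[OF \<iota>]] by blast
  define c where "c = rec_list (j (\<iota> 0, \<iota> 0)) (\<lambda>x _ r. j (\<iota> 1, j (\<iota> x, r)))"
  have [simp]: "c [] = j (\<iota> 0, \<iota> 0)" "c (x # xs) = j (\<iota> 1, j (\<iota> x, c xs))" for x xs
    by (simp_all add: c_def)
  have "c xs = c ys \<longrightarrow> xs = ys" for xs ys
  proof (induction xs arbitrary: ys)
    case Nil
    show ?case by (cases ys) (auto simp: inj_eq[OF j] inj_eq[OF \<iota>])
  next
    case (Cons x xs)
    then show ?case by (cases ys) (auto simp: inj_eq[OF j] inj_eq[OF \<iota>])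
  qed
  then show ?thesis by (intro exI[of _ c] injI) blast
qed

section \<open>Lifting in boxes\<close>

locale acyclic_fibration =
  fixes E Y :: "'u uspace" and p :: "'u \<Rightarrow> 'u" and \<iota> :: "real \<Rightarrow> 'u"
  assumes \<iota>: "inj \<iota>" and E: "U_object TYPE('u) E" and Y: "U_object TYPE('u) Y"
    and fibration: "uniform_Hurewicz_fibration E Y p" and equivalence: "uniform_weak_equivalence E Y p"
begin

abbreviation "TE \<equiv> utopology E"
abbreviation "TY \<equiv> utopology Y"

lemma continuous_p: "continuous_map TE TY p"
  using fibration unfolding uniform_Hurewicz_fibration_def
  by (elim conjE) (rule umap_continuous[OF U_object_uspace[OF E] U_object_uspace[OF Y]])

lemma homotopy_lift:
  fixes H :: "real \<times> (nat \<Rightarrow> real) \<times> real \<Rightarrow> 'u"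
  assumes H: "continuous_map (top_of_set ({0..1} \<times> (sbox n \<times> {0..1}))) TY H"
    and f: "continuous_map (top_of_set (sbox n \<times> {0..1})) TE f"
    and pf: "\<And>y. y \<in> sbox n \<times> {0..1} \<Longrightarrow> p (f y) = H (0, y)"
  shows "\<exists>G. continuous_map (top_of_set ({0..1} \<times> (sbox n \<times> {0..1}))) TE G \<and>
     (\<forall>y \<in> sbox n \<times> {0..1}. G (0, y) = f y \<and> (\<forall>s\<in>{0..1}. p (G (s, y)) = H (s, y)))"
proof -
  let ?B = "sbox n \<times> {0..1::real}"
  obtain c :: "real list \<Rightarrow> 'u" where c: "inj c" using real_list_encoding[OF \<iota>] by blast
  let ?j = "\<lambda>(x, t). c (t # to_cube n x)"
  have j: "inj_on ?j ?B"
  proof (rule inj_onI, clarify)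
    fix x x' and t t' :: real
    assume x: "x \<in> sbox n" "x' \<in> sbox n" and eq: "c (t # to_cube n x) = c (t' # to_cube n x')"
    have t: "t = t'" and "to_cube n x = to_cube n x'" using injD[OF c eq] by blast+
    then have "x = x'" using from_to_cube[OF x(1)] from_to_cube[OF x(2)] by metis
    with t show "x = x' \<and> t = t'" by blast
  qed
  have lc: "locally_connected_space (top_of_set ?B)"
  proof -
    have "locally_connected_space (prod_topology (top_of_set (sbox n)) unit_I)"
      using sbox_space(3)[of n] locally_connected_interval[of 0 1]
      by (subst locally_connected_space_prod_topology) simp
    then show ?thesis by simp
  qed
  have H': "continuous_map (prod_topology unit_I (top_of_set ?B)) TY H" using H by simp
  note B = compact_Times[OF sbox_space(4) compact_Icc] connected_Times[OF sbox_space(5) connected_Icc]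
  have pf': "p (f y) = H (0, y)" if "y \<in> ?B" for y by (rule pf[OF that])
  obtain G where G: "continuous_map (prod_topology unit_I (top_of_set ?B)) TE G"
      "\<And>y. y \<in> ?B \<Longrightarrow> G (0, y) = f y" "\<And>s y. s \<in> {0..1} \<Longrightarrow> y \<in> ?B \<Longrightarrow> p (G (s, y)) = H (s, y)"
    by (rule fibration_lift_compact[where S = ?B and j = ?j and H = H and f = f, OF \<iota> E Y fibration B lc j H' f pf']) blast+
  have "continuous_map (top_of_set ({0..1::real} \<times> ?B)) TE G" using G(1) by simp
  then show ?thesis using G(2,3) by blast
qed

text \<open>
  Homotopy lifting relative to faces: the box times the interval retracts radially, from a point
  above, onto its bottom and those of its faces on which a coordinate in \<open>A\<close> is extremal.  Instead of
  a lift of a homotopy to the retraction, the rays are followed for a time which is zero exactly on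
  the subset, so that the lift is unchanged there.
\<close>

lemma relative_lift:
  fixes v l :: "(nat \<Rightarrow> real) \<times> real \<Rightarrow> 'u"
  assumes A: "A \<subseteq> {..<n}"
    and v: "continuous_map (top_of_set (sbox n \<times> {0..1})) TY v"
    and l: "continuous_map (top_of_set {(x, t). x \<in> sbox n \<and> t \<in> {0..1} \<and> (t = 0 \<or> box_norm A x = 1)}) TE l"
    and pl: "\<And>x t. x \<in> sbox n \<Longrightarrow> t \<in> {0..1} \<Longrightarrow> t = 0 \<or> box_norm A x = 1 \<Longrightarrow> p (l (x, t)) = v (x, t)"
  shows "\<exists>L. continuous_map (top_of_set (sbox n \<times> {0..1})) TE L \<and> (\<forall>y \<in> sbox n \<times> {0..1}. p (L y) = v y) \<and>
     (\<forall>x\<in>sbox n. \<forall>t\<in>{0..1}. t = 0 \<or> box_norm A x = 1 \<longrightarrow> L (x, t) = l (x, t))"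
proof -
  let ?B = "sbox n \<times> {0..1::real}"
  have fin: "finite A" using A finite_subset by blast
  define r where "r = (\<lambda>y :: (nat \<Rightarrow> real) \<times> real. 1 / max (box_norm A (fst y)) (1 - snd y / 2))"
  define \<mu> where "\<mu> c y = (scale_coords A c (fst y), 2 - c * (2 - snd y))" for c :: real and y :: "(nat \<Rightarrow> real) \<times> real"
  have m: "1 / 2 \<le> max (box_norm A (fst y)) (1 - snd y / 2)" "max (box_norm A (fst y)) (1 - snd y / 2) \<le> 1" if "y \<in> ?B" for y
    using that sbox_norm[OF _ A, of "fst y"] by (auto simp: max_def)
  have r1: "1 \<le> r y" "r y \<le> 2" if "y \<in> ?B" for y
    using m[OF that] by (simp_all add: r_def field_simps)
  have r2: "r y * box_norm A (fst y) \<le> 1" "r y * (2 - snd y) \<le> 2" "r y * box_norm A (fst y) = 1 \<or> r y * (2 - snd y) = 2" if "y \<in> ?B" for y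
  proof -
    define M where "M = max (box_norm A (fst y)) (1 - snd y / 2)"
    have M: "M > 0" "box_norm A (fst y) \<le> M" "2 - snd y \<le> 2 * M" "box_norm A (fst y) = M \<or> 2 - snd y = 2 * M"
      using m(1)[OF that] by (simp_all add: M_def max_def)
    have rM: "r y = 1 / M" by (simp add: r_def M_def)
    show "r y * box_norm A (fst y) \<le> 1" "r y * (2 - snd y) \<le> 2"
      unfolding rM using M(1-3) by (simp_all add: divide_le_eq)
    show "r y * box_norm A (fst y) = 1 \<or> r y * (2 - snd y) = 2"
      unfolding rM using M(1,4) by auto
  qed
  have r3: "r (x, t) = 1" if "x \<in> sbox n" "t \<in> {0..1}" "t = 0 \<or> box_norm A x = 1" for x t
    using that sbox_norm[OF that(1) A] box_norm_nonneg[OF fin, of x] by (auto simp: r_def max_def)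
  have \<mu>B: "\<mu> c y \<in> ?B" if y: "y \<in> ?B" and c: "1 \<le> c" "c \<le> r y" for c y
  proof -
    have "\<bar>c * fst y i\<bar> \<le> 1" if i: "i \<in> A" for i
    proof -
      have "\<bar>c * fst y i\<bar> \<le> c * box_norm A (fst y)" using c box_norm_ge[OF fin i, of "fst y"] by (simp add: abs_mult)
      also have "\<dots> \<le> r y * box_norm A (fst y)" using c box_norm_nonneg[OF fin] by (intro mult_right_mono) auto
      finally show ?thesis using r2(1)[OF y] by simp
    qed
    then have "scale_coords A c (fst y) \<in> sbox n" using y A by (auto simp: sbox_def scale_coords_def)
    moreover have "c * (2 - snd y) \<le> 2"
    proof -
      have "c * (2 - snd y) \<le> r y * (2 - snd y)" using c y by (intro mult_right_mono) auto
      then show ?thesis using r2(2)[OF y] by simp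
    qed
    moreover have "1 \<le> c * (2 - snd y)"
    proof -
      have "1 * 1 \<le> c * (2 - snd y)" using c y by (intro mult_mono) auto
      then show ?thesis by simp
    qed
    ultimately show ?thesis by (simp add: \<mu>_def)
  qed
  have \<mu>1: "\<mu> 1 y = y" for y by (cases y) (simp add: \<mu>_def scale_coords_def fun_eq_iff)
  have rc: "continuous_on ?B r"
  proof -
    have c1: "continuous_on ?B (\<lambda>y. box_norm A (fst y))"
      by (rule continuous_on_box_norm[OF fin continuous_on_fst[OF continuous_on_id]])
    have c2: "continuous_on ?B (\<lambda>y. 1 - snd y / 2)" by (intro continuous_intros) simp
    have "max (box_norm A (fst y)) (1 - snd y / 2) \<noteq> 0" if "y \<in> ?B" for y
      using m(1)[OF that] by linarith
    then show ?thesis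
      unfolding r_def by (intro continuous_on_divide[OF continuous_on_const continuous_on_max[OF c1 c2]] ballI)
  qed
  have \<mu>c: "continuous_on S (\<lambda>z. \<mu> (c z) (g z))" if "continuous_on S c" "continuous_on S g" for c g and S :: "'b::topological_space set"
    unfolding \<mu>_def using that
    by (intro continuous_on_Pair continuous_on_scale_coords continuous_intros)
  let ?Z = "{(x, t). x \<in> sbox n \<and> t \<in> {0..1} \<and> (t = 0 \<or> box_norm A x = 1)}"
  have retr: "\<mu> (r y) y \<in> ?Z" if y: "y \<in> ?B" for y
  proof -
    have "box_norm A (scale_coords A (r y) (fst y)) = r y * box_norm A (fst y)"
      using r1[OF y] by (intro box_norm_scale[OF fin]) (auto simp: scale_coords_def)
    then show ?thesis using \<mu>B[OF y r1(1)[OF y] order_refl] r2(3)[OF y] by (auto simp: \<mu>_def)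
  qed
  define H where "H = (\<lambda>(s :: real, y). v (\<mu> (max 1 (r y - s)) y))"
  have "continuous_map (top_of_set ({0..1::real} \<times> ?B)) TY (\<lambda>z. v (\<mu> (max 1 (r (snd z) - fst z)) (snd z)))"
  proof (rule continuous_map_on_compose[OF v])
    have "continuous_on ({0..1::real} \<times> ?B) (\<lambda>z. r (snd z))"
      by (rule continuous_on_compose2[OF rc continuous_on_snd[OF continuous_on_id]]) auto
    then show "continuous_on ({0..1::real} \<times> ?B) (\<lambda>z. \<mu> (max 1 (r (snd z) - fst z)) (snd z))"
      by (intro \<mu>c continuous_intros continuous_on_max)
    fix z assume "z \<in> {0..1::real} \<times> ?B"
    then have z: "snd z \<in> ?B" "0 \<le> fst z" by (auto simp: mem_Times_iff)
    show "\<mu> (max 1 (r (snd z) - fst z)) (snd z) \<in> ?B"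
      by (rule \<mu>B[OF z(1)]) (use r1(1)[OF z(1)] z(2) in auto)
  qed
  then have H: "continuous_map (top_of_set ({0..1::real} \<times> ?B)) TY H" by (simp add: H_def case_prod_unfold)
  have f: "continuous_map (top_of_set ?B) TE (\<lambda>y. l (\<mu> (r y) y))"
    by (rule continuous_map_on_compose[OF l \<mu>c[OF rc continuous_on_id] retr])
  have pf: "p (l (\<mu> (r y) y)) = H (0, y)" if y: "y \<in> ?B" for y
  proof -
    have "p (l (\<mu> (r y) y)) = v (\<mu> (r y) y)" using retr[OF y] pl by (cases "\<mu> (r y) y") auto
    then show ?thesis using r1(1)[OF y] by (simp add: H_def max_def)
  qed
  obtain G where G: "continuous_map (top_of_set ({0..1::real} \<times> ?B)) TE G"
      "\<forall>y\<in>?B. G (0, y) = l (\<mu> (r y) y) \<and> (\<forall>s\<in>{0..1}. p (G (s, y)) = H (s, y))"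
    using homotopy_lift[OF H f pf] by auto
  define L where "L y = G (r y - 1, y)" for y
  have r01: "r y - 1 \<in> {0..1}" if "y \<in> ?B" for y using r1[OF that] by simp
  have "continuous_map (top_of_set ?B) TE L"
    unfolding L_def
    by (rule continuous_map_on_compose[OF G(1) continuous_on_Pair[OF continuous_on_diff[OF rc continuous_on_const] continuous_on_id]])
      (use r01 in blast)
  moreover have "p (L y) = v y" if y: "y \<in> ?B" for y
  proof -
    have "p (L y) = H (r y - 1, y)" unfolding L_def using G(2) y r01[OF y] by blast
    then show ?thesis by (simp add: H_def \<mu>1)
  qed
  moreover have "L (x, t) = l (x, t)" if "x \<in> sbox n" "t \<in> {0..1}" "t = 0 \<or> box_norm A x = 1" for x t
  proof -
    have "(x, t) \<in> ?B" using that by blast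
    then have "G (0, (x, t)) = l (\<mu> (r (x, t)) (x, t))" using G(2) by blast
    then show ?thesis by (simp add: L_def r3[OF that] \<mu>1)
  qed
  ultimately show ?thesis by (intro exI[of _ L] conjI ballI impI) simp_all
qed

abbreviation fiber_path :: "'u \<Rightarrow> 'u \<Rightarrow> bool" where
  "fiber_path e e' \<equiv> path_component_of (subtopology TE {x. p x = p e}) e e'"

text \<open>
  Two lifts of a map on a box are vertically homotopic as soon as their values at one point \<open>c\<close> are
  joined in the fibre: the box is contracted to \<open>c\<close>, and the homotopy is lifted relative to the
  two ends of the interval.
\<close>

lemma vertical_homotopy:
  assumes a: "continuous_map (top_of_set (sbox n)) TE a" and b: "continuous_map (top_of_set (sbox n)) TE b"
    and ab: "\<And>x. x \<in> sbox n \<Longrightarrow> p (a x) = p (b x)" and c: "c \<in> sbox n" and path: "fiber_path (a c) (b c)"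
  shows "\<exists>h :: (nat \<Rightarrow> real) \<times> real \<Rightarrow> 'u. continuous_map (top_of_set (sbox n \<times> {0..1})) TE h \<and>
     (\<forall>x\<in>sbox n. h (x, 0) = a x \<and> h (x, 1) = b x \<and> (\<forall>t\<in>{0..1}. p (h (x, t)) = p (a x)))"
proof -
  obtain \<gamma> where \<gamma>: "continuous_map unit_I (subtopology TE {x. p x = p (a c)}) \<gamma>" "\<gamma> 0 = a c" "\<gamma> 1 = b c"
    using path unfolding path_component_of_def pathin_def by blast
  have \<gamma>c: "continuous_map unit_I TE \<gamma>" using \<gamma>(1) by (rule continuous_map_into_fulltopology)
  have \<gamma>p: "p (\<gamma> t) = p (a c)" if "t \<in> {0..1}" for t
    using continuous_map_funspace[OF \<gamma>(1)] that by auto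
  \<comment> \<open>the last coordinate of the larger box is the interval on whose ends the lift is prescribed\<close>
  define \<kappa> where "\<kappa> = (\<lambda>(x :: nat \<Rightarrow> real, t :: real) i. if i < n then (1 - t) * c i + t * x i else 0)"
  let ?B = "sbox (Suc n) \<times> {0..1::real}"
  have \<kappa>B: "\<kappa> y \<in> sbox n" if y: "y \<in> ?B" for y
  proof -
    obtain x t where y': "y = (x, t)" "x \<in> sbox (Suc n)" "0 \<le> t" "t \<le> 1" using y by auto
    have "\<bar>(1 - t) * c i + t * x i\<bar> \<le> 1" if i: "i < n" for i
    proof -
      have ci: "\<bar>c i\<bar> \<le> 1" "\<bar>x i\<bar> \<le> 1" using c y'(2) i by (auto simp: sbox_def)
      have "\<bar>(1 - t) * c i + t * x i\<bar> \<le> \<bar>(1 - t) * c i\<bar> + \<bar>t * x i\<bar>" by (rule abs_triangle_ineq)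
      also have "\<dots> \<le> (1 - t) * 1 + t * 1"
        unfolding abs_mult using ci y'(3,4) by (intro add_mono mult_mono) auto
      finally show ?thesis by simp
    qed
    then show ?thesis by (simp add: sbox_def \<kappa>_def y'(1))
  qed
  have \<kappa>c: "continuous_on ?B \<kappa>"
  proof (rule continuous_on_coordinatewise_then_product)
    fix i
    have "continuous_on ?B (\<lambda>y. (1 - snd y) * c i + snd y * fst y i)"
      by (intro continuous_intros continuous_on_product_then_coordinatewise[OF continuous_on_fst[OF continuous_on_id]])
    then show "continuous_on ?B (\<lambda>y. \<kappa> y i)" by (cases "i < n") (simp_all add: \<kappa>_def case_prod_unfold)
  qed
  have \<kappa>0: "\<kappa> (x, 0) = c" for x using c by (auto simp: \<kappa>_def sbox_def fun_eq_iff)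
  have ak: "continuous_map (top_of_set S) TE (\<lambda>y. a (\<kappa> y))" "continuous_map (top_of_set S) TE (\<lambda>y. b (\<kappa> y))" if "S \<subseteq> ?B" for S
    using that \<kappa>B by (auto intro!: continuous_map_on_compose[OF a] continuous_map_on_compose[OF b] continuous_on_subset[OF \<kappa>c])
  define v where "v y = p (a (\<kappa> y))" for y
  have v: "continuous_map (top_of_set ?B) TY v"
    using continuous_map_compose[OF ak(1)[OF order_refl] continuous_p] by (simp add: v_def[abs_def] o_def)
  define l where "l = (\<lambda>(x, t). if x n = -1 then a (\<kappa> (x, t)) else if x n = 1 then b (\<kappa> (x, t)) else \<gamma> ((x n + 1) / 2))"
  define Z0 where "Z0 = sbox (Suc n) \<times> {0::real}"
  define Z where "Z s = (sbox (Suc n) \<inter> {x. x n = s}) \<times> {0..1::real}" for s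
  have clZ: "closed Z0" "closed (Z s)" for s
  proof -
    show "closed Z0" unfolding Z0_def by (intro closed_Times closed_sbox closed_singleton)
    have "closed {x :: nat \<Rightarrow> real. x n = s}"
      by (rule closed_Collect_eq[OF continuous_on_product_then_coordinatewise[OF continuous_on_id] continuous_on_const])
    then show "closed (Z s)" unfolding Z_def by (intro closed_Times closed_Int closed_sbox closed_atLeastAtMost)
  qed
  have "continuous_map (top_of_set Z0) TE (\<lambda>y. \<gamma> ((fst y n + 1) / 2))"
    by (rule continuous_map_on_compose[OF \<gamma>c])
      (auto simp: Z0_def sbox_def abs_le_iff
        intro!: continuous_intros continuous_on_product_then_coordinatewise[OF continuous_on_fst[OF continuous_on_id]])
  then have l0: "continuous_map (top_of_set Z0) TE l"
    by (rule continuous_map_on_cong) (auto simp: Z0_def l_def \<kappa>0 \<gamma>)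
  have lm: "continuous_map (top_of_set (Z (-1))) TE l"
    by (rule continuous_map_on_cong[OF ak(1)]) (auto simp: Z_def l_def)
  have lp: "continuous_map (top_of_set (Z 1)) TE l"
    by (rule continuous_map_on_cong[OF ak(2)]) (auto simp: Z_def l_def)
  have bn: "box_norm {n} x = 1 \<longleftrightarrow> x n = 1 \<or> x n = -1" for x
    by (auto simp: box_norm_insert max_def abs_if)
  have ZZ: "{(x, t). x \<in> sbox (Suc n) \<and> t \<in> {0..1::real} \<and> (t = 0 \<or> box_norm {n} x = 1)} = Z0 \<union> (Z (-1) \<union> Z 1)"
    unfolding bn by (auto simp: Z0_def Z_def)
  have l: "continuous_map (top_of_set {(x, t). x \<in> sbox (Suc n) \<and> t \<in> {0..1} \<and> (t = 0 \<or> box_norm {n} x = 1)}) TE l"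
    unfolding ZZ by (intro continuous_map_closed_Un closed_Un clZ l0 lm lp)
  have pl: "p (l (x, t)) = v (x, t)" if "x \<in> sbox (Suc n)" "t \<in> {0..1}" "t = 0 \<or> box_norm {n} x = 1" for x t
  proof -
    have k: "\<kappa> (x, t) \<in> sbox n" using \<kappa>B that by simp
    have "\<bar>x n\<bar> \<le> 1" using that(1) by (simp add: sbox_def)
    then have "(x n + 1) / 2 \<in> {0..1}" by (auto simp: abs_le_iff)
    then show ?thesis using that(3) \<gamma>p ab[OF k] unfolding bn by (auto simp: l_def v_def \<kappa>0)
  qed
  obtain L where L: "continuous_map (top_of_set ?B) TE L" "\<forall>y\<in>?B. p (L y) = v y"
      "\<forall>x\<in>sbox (Suc n). \<forall>t\<in>{0..1}. t = 0 \<or> box_norm {n} x = 1 \<longrightarrow> L (x, t) = l (x, t)"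
  proof -
    have "\<exists>L. continuous_map (top_of_set ?B) TE L \<and> (\<forall>y\<in>?B. p (L y) = v y) \<and>
      (\<forall>x\<in>sbox (Suc n). \<forall>t\<in>{0..1}. t = 0 \<or> box_norm {n} x = 1 \<longrightarrow> L (x, t) = l (x, t))"
      by (rule relative_lift[OF _ v l]) (simp, rule pl)
    then show thesis by (elim exE conjE) (rule that)
  qed
  define e where "e = (\<lambda>(x :: nat \<Rightarrow> real, u :: real) i. if i = n then 2 * u - 1 else x i)"
  have e: "e (x, u) \<in> sbox (Suc n)" if "x \<in> sbox n" "u \<in> {0..1}" for x u
    using that by (auto simp: e_def sbox_def abs_le_iff less_Suc_eq)
  have ec: "continuous_on (sbox n \<times> {0..1}) e"
  proof (rule continuous_on_coordinatewise_then_product)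
    fix i
    have "continuous_on (sbox n \<times> {0..1}) (\<lambda>y. 2 * snd y - 1 :: real)" "continuous_on (sbox n \<times> {0..1::real}) (\<lambda>y. fst y i)"
      by (intro continuous_intros continuous_on_product_then_coordinatewise[OF continuous_on_fst[OF continuous_on_id]])+
    then show "continuous_on (sbox n \<times> {0..1}) (\<lambda>y. e y i)" by (cases "i = n") (simp_all add: e_def case_prod_unfold)
  qed
  have ke: "\<kappa> (e (x, u), 1) = x" if "x \<in> sbox n" for x u
    using that by (auto simp: \<kappa>_def e_def sbox_def fun_eq_iff)
  define h where "h y = L (e y, 1)" for y
  have "continuous_map (top_of_set (sbox n \<times> {0..1})) TE h"
    unfolding h_def
    by (rule continuous_map_on_compose[OF L(1) continuous_on_Pair[OF ec continuous_on_const]]) (auto simp: e)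
  moreover have "h (x, 0) = a x" "h (x, 1) = b x" if x: "x \<in> sbox n" for x
  proof -
    have "box_norm {n} (e (x, 0)) = 1" "box_norm {n} (e (x, 1)) = 1" unfolding bn by (simp_all add: e_def)
    then have "h (x, 0) = l (e (x, 0), 1)" "h (x, 1) = l (e (x, 1), 1)"
      unfolding h_def using L(3) e[OF x] by simp_all
    then show "h (x, 0) = a x" "h (x, 1) = b x"
      using ke[OF x, of 0] ke[OF x, of 1] by (simp_all add: l_def e_def)
  qed
  moreover have "p (h (x, t)) = p (a x)" if x: "x \<in> sbox n" "t \<in> {0..1}" for x t
    using L(2) e[OF x] ke[OF x(1), of t] by (simp add: h_def v_def)
  ultimately show ?thesis by (intro exI[of _ h]) blast
qed

end

section \<open>Simultaneous lifts on families of boxes\<close>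

context glued_cubes
begin

abbreviation cell :: "'u \<Rightarrow> (nat \<Rightarrow> real) \<Rightarrow> 'u" where "cell e x \<equiv> q e (to_cube n x)"

lemma to_cube_boundary: "x \<in> sboundary n \<Longrightarrow> to_cube n x \<in> bd"
proof -
  assume x: "x \<in> sboundary n"
  then obtain i where i: "i < n" "\<bar>x i\<bar> = 1" by (auto simp: sboundary_def)
  then have "to_cube n x ! i \<in> {0, 1}" by (auto simp: to_cube_def)
  then show ?thesis using i x to_cube[of x n] by (auto simp: bd_def sboundary_def)
qed

lemma from_cube_boundary: "l \<in> bd \<Longrightarrow> from_cube n l \<in> sboundary n"
proof -
  assume l: "l \<in> bd"
  then obtain i where i: "i < n" "l ! i \<in> {0, 1}" "l \<in> Q" by (auto simp: bd_def)
  then have "\<bar>from_cube n l i\<bar> = 1" by (auto simp: from_cube_def)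
  then show ?thesis using i from_cube[OF i(3)] by (auto simp: sboundary_def)
qed

lemma continuous_cell: "e \<in> F \<Longrightarrow> continuous_map (top_of_set (sbox n)) K (cell e)"
  using continuous_map_compose[OF continuous_to_cube continuous_q] by (simp add: o_def)

lemma cell_boundary: "x \<in> sboundary n \<Longrightarrow> cell e x = cell e' x"
  using to_cube_boundary[of x] by (simp add: q_def)

lemma cell_cover: "y \<in> topspace K \<Longrightarrow> \<exists>e\<in>F. \<exists>x\<in>sbox n. y = cell e x"
proof -
  assume "y \<in> topspace K"
  then obtain e l where e: "e \<in> F" "l \<in> Q" "y = q e l" by (rule K_cases)
  then show ?thesis using from_cube[OF e(2)] to_from_cube[OF e(2)] by (intro bexI[of _ e] bexI[of _ "from_cube n l"]) auto
qed

lemma cell_glue: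
  assumes w: "\<And>e. e \<in> F \<Longrightarrow> continuous_map (top_of_set (sbox n)) W (w e)"
    and bd: "\<And>e x. e \<in> F \<Longrightarrow> x \<in> sboundary n \<Longrightarrow> w e x = w e0 x"
  shows "\<exists>G. continuous_map K W G \<and> (\<forall>e\<in>F. \<forall>x\<in>sbox n. G (cell e x) = w e x)"
proof -
  have fc: "continuous_map TQ (top_of_set (sbox n)) (from_cube n)"
    using homeomorphic_to_cube unfolding homeomorphic_maps_def by blast
  have "\<exists>G. continuous_map K W G \<and> (\<forall>e\<in>F. \<forall>l\<in>Q. G (q e l) = w e (from_cube n l))"
  proof (rule glue_exists[where W = W and w = "\<lambda>e l. w e (from_cube n l)"])
    fix e assume "e \<in> F"
    from continuous_map_compose[OF fc w[OF this]] show "continuous_map TQ W (\<lambda>l. w e (from_cube n l))" by (simp add: o_def)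
  next
    fix e x assume "e \<in> F" "x \<in> bd"
    then show "w e (from_cube n x) = w e0 (from_cube n x)" by (intro bd from_cube_boundary)
  qed
  then obtain G where G: "continuous_map K W G" "\<forall>e\<in>F. \<forall>l\<in>Q. G (q e l) = w e (from_cube n l)" by (elim exE conjE)
  have "G (cell e x) = w e x" if "e \<in> F" "x \<in> sbox n" for e x
    using G(2) that to_cube[OF that(2)] from_to_cube[OF that(2)] by metis
  then show ?thesis using G(1) by (intro exI[of _ G]) simp
qed

lemma continuous_cell_cylinder:
  assumes e: "e \<in> F"
  shows "continuous_map (top_of_set ({0..1} \<times> sbox n)) (prod_topology unit_I K) (\<lambda>z. (fst z, cell e (snd z)))"
proof -
  have "continuous_map (top_of_set ({0..1} \<times> sbox n)) unit_I fst"
    by (auto intro!: continuous_intros)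
  moreover have "continuous_map (top_of_set ({0..1} \<times> sbox n)) K (\<lambda>z. cell e (snd z))"
    by (rule continuous_map_on_compose[OF continuous_cell[OF e] continuous_on_snd[OF continuous_on_id]]) auto
  ultimately show ?thesis by (simp add: continuous_map_paired)
qed

text \<open>For finitely many boxes, gluing is compatible with the product with the interval by compactness.\<close>

lemma cylinder_glue:
  assumes F: "finite F"
    and w: "\<And>e. e \<in> F \<Longrightarrow> continuous_map (top_of_set ({0..1} \<times> sbox n)) W (w e)"
    and bd: "\<And>e x t. e \<in> F \<Longrightarrow> x \<in> sboundary n \<Longrightarrow> t \<in> {0..1} \<Longrightarrow> w e (t, x) = w e0 (t, x)"
  shows "\<exists>G. continuous_map (prod_topology unit_I K) W G \<and> (\<forall>e\<in>F. \<forall>x\<in>sbox n. \<forall>t\<in>{0..1}. G (t, cell e x) = w e (t, x))"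
proof -
  define G where "G = (\<lambda>(t :: real, y). case inv J y of (e, l) \<Rightarrow> w e (t, from_cube n l))"
  have G: "G (t, cell e x) = w e (t, x)" if "e \<in> F" "x \<in> sbox n" "t \<in> {0..1}" for e x t
  proof (cases "to_cube n x \<in> bd")
    case True
    then have "x \<in> sboundary n" using from_cube_boundary from_to_cube[OF that(2)] by metis
    then show ?thesis using True bd[OF that(1) _ that(3)] inv_f_f[OF J] from_to_cube[OF that(2)]
      by (simp add: G_def q_def)
  next
    case False
    then show ?thesis using inv_f_f[OF J] from_to_cube[OF that(2)] by (simp add: G_def q_def)
  qed
  have "continuous_map (prod_topology unit_I K) W G"
  proof (rule continuous_map_finite_compact_cover[where I = F and D = "\<lambda>_. top_of_set ({0..1::real} \<times> sbox n)"
        and \<Phi> = "\<lambda>e z. (fst z, cell e (snd z))"])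
    show "finite F" by (rule F)
    show "Hausdorff_space (prod_topology unit_I K)"
      using Hausdorff_K by (simp add: Hausdorff_space_prod_topology Hausdorff_space_subtopology)
    show "compact_space (top_of_set ({0..1::real} \<times> sbox n))" if "e \<in> F" for e
      using compact_Times[OF compact_Icc sbox_space(4)] by (simp add: compact_space_subtopology)
    show "continuous_map (top_of_set ({0..1::real} \<times> sbox n)) (prod_topology unit_I K) (\<lambda>z. (fst z, cell e (snd z)))" if "e \<in> F" for e
      by (rule continuous_cell_cylinder[OF that])
    show "continuous_map (top_of_set ({0..1::real} \<times> sbox n)) W (\<lambda>z. G (fst z, cell e (snd z)))" if "e \<in> F" for e
      by (rule continuous_map_on_cong[OF w[OF that]]) (use G[OF that] in auto)
    show "topspace (prod_topology unit_I K) \<subseteq> (\<Union>e\<in>F. (\<lambda>z. (fst z, cell e (snd z))) ` topspace (top_of_set ({0..1::real} \<times> sbox n)))"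
    proof
      fix z assume "z \<in> topspace (prod_topology unit_I K)"
      then have z: "fst z \<in> {0..1}" "snd z \<in> topspace K" by auto
      obtain e x where e: "e \<in> F" "x \<in> sbox n" "snd z = cell e x" using cell_cover[OF z(2)] by blast
      have "z = (\<lambda>z. (fst z, cell e (snd z))) (fst z, x)" using e(3) by (simp add: prod_eq_iff)
      moreover have "(fst z, x) \<in> topspace (top_of_set ({0..1::real} \<times> sbox n))" using z(1) e(2) by simp
      ultimately show "z \<in> (\<Union>e\<in>F. (\<lambda>z. (fst z, cell e (snd z))) ` topspace (top_of_set ({0..1::real} \<times> sbox n)))"
        using e(1) by (intro UN_I[of e] image_eqI)
    qed
  qed
  then show ?thesis using G by (intro exI[of _ G]) simp
qed

end

context acyclic_fibration
begin

lemma cell_encoding: "\<exists>J :: 'u \<times> real list \<Rightarrow> 'u. inj J"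
proof -
  obtain c :: "real list \<Rightarrow> 'u" where c: "inj c" using real_list_encoding[OF \<iota>] by blast
  obtain j :: "'u \<times> 'u \<Rightarrow> 'u" where j: "inj j" using inj_prod_exists[OF inj_real_infinite[OF \<iota>]] by blast
  have "inj (\<lambda>(e, l). j (e, c l))"
    by (rule injI) (auto simp: inj_eq[OF j] inj_eq[OF c] split: prod.splits)
  then show ?thesis by (intro exI)
qed

text \<open>
  Up to homotopy there is a lift because \<open>p\<close> is surjective on homotopy classes of maps from glued
  boxes, and a lift of the homotopy turns it into a strict one.
\<close>

lemma family_lift:
  fixes F :: "'u set"
  assumes e0: "e0 \<in> F"
    and w: "\<And>e. e \<in> F \<Longrightarrow> continuous_map (top_of_set (sbox n)) TY (w e)"
    and bd: "\<And>e x. e \<in> F \<Longrightarrow> x \<in> sboundary n \<Longrightarrow> w e x = w e0 x"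
  shows "\<exists>z. (\<forall>e\<in>F. continuous_map (top_of_set (sbox n)) TE (z e) \<and> (\<forall>x\<in>sbox n. p (z e x) = w e x) \<and>
     (\<forall>x\<in>sboundary n. z e x = z e0 x))"
proof -
  obtain J :: "'u \<times> real list \<Rightarrow> 'u" where J: "inj J" using cell_encoding by blast
  interpret G: glued_cubes n F e0 J by (unfold_locales) (rule e0, rule J)
  have "\<exists>g. continuous_map G.K TY g \<and> (\<forall>e\<in>F. \<forall>x\<in>sbox n. g (G.cell e x) = w e x)"
    by (rule G.cell_glue) (rule w, assumption, rule bd)
  then obtain g where g: "continuous_map G.K TY g" "\<forall>e\<in>F. \<forall>x\<in>sbox n. g (G.cell e x) = w e x" by (elim exE conjE)
  have "\<exists>z. continuous_map G.K TE z \<and> homotopic G.K TY (p \<circ> z) g"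
    by (rule weak_equivalence_underlying(1)[OF inj_real_infinite[OF \<iota>] E Y equivalence G.cubical_set_C G.topological_realization_K g(1)])
  then obtain z where z: "continuous_map G.K TE z" "homotopic G.K TY (p \<circ> z) g" by (elim exE conjE)
  obtain h where h: "continuous_map (prod_topology unit_I G.K) TY h" "\<And>x. h (0, x) = p (z x)" "\<And>x. h (1, x) = g x"
    using z(2) unfolding homotopic_with_def by auto
  obtain f where f: "continuous_map G.K TE f" "\<And>x. x \<in> topspace G.K \<Longrightarrow> p (f x) = h (1, x)"
    by (rule fibration_lift_end[OF \<iota> E Y fibration G.T_space_K h(1) z(1)]) (simp add: h(2), rule that, assumption, blast)
  show ?thesis
  proof (intro exI[of _ "\<lambda>e x. f (G.cell e x)"] ballI conjI)
    fix e assume e: "e \<in> F"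
    show "continuous_map (top_of_set (sbox n)) TE (\<lambda>x. f (G.cell e x))"
      using continuous_map_compose[OF G.continuous_cell[OF e] f(1)] by (simp add: o_def)
    show "p (f (G.cell e x)) = w e x" if x: "x \<in> sbox n" for x
    proof -
      have "G.cell e x \<in> topspace G.K" by (rule G.q_in[OF e to_cube[OF x]])
      then show ?thesis using f(2) h(3) g(2) e x by simp
    qed
    show "f (G.cell e x) = f (G.cell e0 x)" if "x \<in> sboundary n" for x
      using G.cell_boundary[OF that, of e e0] by simp
  qed
qed

text \<open>
  Since \<open>p\<close> is injective on homotopy classes of maps from glued boxes, maps with homotopic images are
  homotopic; the homotopy need not lie over the given one.
\<close>

lemma family_homotopy:
  fixes F :: "'u set" and H :: "'u \<Rightarrow> real \<times> (nat \<Rightarrow> real) \<Rightarrow> 'u"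
  assumes F: "finite F" and e0: "e0 \<in> F"
    and a: "\<And>e. e \<in> F \<Longrightarrow> continuous_map (top_of_set (sbox n)) TE (a e)"
       "\<And>e x. e \<in> F \<Longrightarrow> x \<in> sboundary n \<Longrightarrow> a e x = a e0 x"
    and b: "\<And>e. e \<in> F \<Longrightarrow> continuous_map (top_of_set (sbox n)) TE (b e)"
       "\<And>e x. e \<in> F \<Longrightarrow> x \<in> sboundary n \<Longrightarrow> b e x = b e0 x"
    and H: "\<And>e. e \<in> F \<Longrightarrow> continuous_map (top_of_set ({0..1} \<times> sbox n)) TY (H e)"
       "\<And>e x t. e \<in> F \<Longrightarrow> x \<in> sboundary n \<Longrightarrow> t \<in> {0..1} \<Longrightarrow> H e (t, x) = H e0 (t, x)"
       "\<And>e x. e \<in> F \<Longrightarrow> x \<in> sbox n \<Longrightarrow> H e (0, x) = p (a e x) \<and> H e (1, x) = p (b e x)"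
  shows "\<exists>G. \<forall>e\<in>F. continuous_map (top_of_set ({0..1::real} \<times> sbox n)) TE (G e) \<and>
     (\<forall>x\<in>sbox n. G e (0, x) = a e x \<and> G e (1, x) = b e x) \<and> (\<forall>x\<in>sboundary n. \<forall>t. G e (t, x) = G e0 (t, x))"
proof -
  obtain J :: "'u \<times> real list \<Rightarrow> 'u" where J: "inj J" using cell_encoding by blast
  interpret G: glued_cubes n F e0 J by (unfold_locales) (rule e0, rule J)
  have "\<exists>g. continuous_map G.K TE g \<and> (\<forall>e\<in>F. \<forall>x\<in>sbox n. g (G.cell e x) = a e x)"
    by (rule G.cell_glue) (rule a, assumption, rule a)
  then obtain A where A: "continuous_map G.K TE A" "\<forall>e\<in>F. \<forall>x\<in>sbox n. A (G.cell e x) = a e x" by (elim exE conjE)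
  have "\<exists>g. continuous_map G.K TE g \<and> (\<forall>e\<in>F. \<forall>x\<in>sbox n. g (G.cell e x) = b e x)"
    by (rule G.cell_glue) (rule b, assumption, rule b)
  then obtain B where B: "continuous_map G.K TE B" "\<forall>e\<in>F. \<forall>x\<in>sbox n. B (G.cell e x) = b e x" by (elim exE conjE)
  have "\<exists>k. continuous_map (prod_topology unit_I G.K) TY k \<and> (\<forall>e\<in>F. \<forall>x\<in>sbox n. \<forall>t\<in>{0..1}. k (t, G.cell e x) = H e (t, x))"
    by (rule G.cylinder_glue[OF F]) (rule H, assumption, rule H)
  then obtain k where k: "continuous_map (prod_topology unit_I G.K) TY k"
    "\<forall>e\<in>F. \<forall>x\<in>sbox n. \<forall>t\<in>{0..1}. k (t, G.cell e x) = H e (t, x)" by (elim exE conjE)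
  have kAB: "k (0, y) = p (A y) \<and> k (1, y) = p (B y)" if y: "y \<in> topspace G.K" for y
  proof -
    obtain e x where e: "e \<in> F" "x \<in> sbox n" "y = G.cell e x" using G.cell_cover[OF y] by blast
    then show ?thesis using k(2) H(3)[OF e(1,2)] A(2) B(2) by simp
  qed
  have "homotopic G.K TY (p \<circ> A) (p \<circ> B)"
    by (subst homotopic_with, simp) (rule exI[of _ k], use k(1) kAB in simp)
  then have "homotopic G.K TE A B"
    by (rule weak_equivalence_underlying(2)[OF inj_real_infinite[OF \<iota>] E Y equivalence G.cubical_set_C G.topological_realization_K A(1) B(1)])
  then obtain h where h: "continuous_map (prod_topology unit_I G.K) TE h" "\<And>x. h (0, x) = A x" "\<And>x. h (1, x) = B x"
    unfolding homotopic_with_def by auto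
  show ?thesis
  proof (intro exI[of _ "\<lambda>e z. h (fst z, G.cell e (snd z))"] ballI conjI allI)
    fix e assume e: "e \<in> F"
    show "continuous_map (top_of_set ({0..1::real} \<times> sbox n)) TE (\<lambda>z. h (fst z, G.cell e (snd z)))"
      using continuous_map_compose[OF G.continuous_cell_cylinder[OF e] h(1)] by (simp add: o_def)
    show "h (fst (0, x), G.cell e (snd (0, x))) = a e x" "h (fst (1, x), G.cell e (snd (1, x))) = b e x" if "x \<in> sbox n" for x
      using h(2,3) A(2) B(2) e that by simp_all
    show "h (fst (t, x), G.cell e (snd (t, x))) = h (fst (t, x), G.cell e0 (snd (t, x)))" if "x \<in> sboundary n" for x and t :: real
      using G.cell_boundary[OF that, of e e0] by simp
  qed
qed

lemma fiber_transport:
  assumes a: "continuous_map (top_of_set (sbox n)) TE a" and b: "continuous_map (top_of_set (sbox n)) TE b"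
    and ab: "\<And>x. x \<in> sbox n \<Longrightarrow> p (a x) = p (b x)" and c: "c \<in> sbox n" "c' \<in> sbox n" and path: "fiber_path (a c) (b c)"
  shows "fiber_path (a c') (b c')"
proof -
  obtain h :: "(nat \<Rightarrow> real) \<times> real \<Rightarrow> 'u" where h: "continuous_map (top_of_set (sbox n \<times> {0..1})) TE h"
     "\<forall>x\<in>sbox n. h (x, 0) = a x \<and> h (x, 1) = b x \<and> (\<forall>t\<in>{0..1}. p (h (x, t)) = p (a x))"
  proof -
    have "\<exists>h :: (nat \<Rightarrow> real) \<times> real \<Rightarrow> 'u. continuous_map (top_of_set (sbox n \<times> {0..1})) TE h \<and>
       (\<forall>x\<in>sbox n. h (x, 0) = a x \<and> h (x, 1) = b x \<and> (\<forall>t\<in>{0..1}. p (h (x, t)) = p (a x)))"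
      by (rule vertical_homotopy[OF a b _ c(1) path]) (rule ab)
    then show thesis by (elim exE conjE) (rule that)
  qed
  have "continuous_map unit_I TE (\<lambda>t. h (c', t))"
    by (rule continuous_map_on_compose[OF h(1) continuous_on_Pair[OF continuous_on_const continuous_on_id]]) (use c in auto)
  then have "continuous_map unit_I (subtopology TE {x. p x = p (a c')}) (\<lambda>t. h (c', t))"
    unfolding continuous_map_in_subtopology using h(2) c(2) by auto
  then show ?thesis
    unfolding path_component_of_def pathin_def using h(2) c(2) by (intro exI[of _ "\<lambda>t. h (c', t)"]) auto
qed

text \<open>On one-point spaces, injectivity of \<open>p\<close> on homotopy classes says that points with the same image are joined by a path.\<close>

lemma total_path:
  assumes f: "f \<in> topspace TE" and e: "e \<in> topspace TE" and pe: "p e = p f"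
  shows "\<exists>A. continuous_map unit_I TE A \<and> A 0 = f \<and> A 1 = e"
proof -
  have pf: "p f \<in> topspace TY" using continuous_map_funspace[OF continuous_p] f by (rule funcset_mem)
  have "\<exists>G. \<forall>k\<in>{f}. continuous_map (top_of_set ({0..1::real} \<times> sbox 0)) TE (G k) \<and>
     (\<forall>x\<in>sbox 0. G k (0, x) = f \<and> G k (1, x) = e) \<and> (\<forall>x\<in>sboundary 0. \<forall>t. G k (t, x) = G f (t, x))"
    by (rule family_homotopy[where H = "\<lambda>_ _. p f"]) (use f e pe pf in auto)
  then obtain G where G: "continuous_map (top_of_set ({0..1::real} \<times> sbox 0)) TE (G f)" "\<forall>x\<in>sbox 0. G f (0, x) = f \<and> G f (1, x) = e"
    by auto
  have o: "(\<lambda>_. 0) \<in> sbox 0" by (simp add: sbox_def)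
  have "continuous_map unit_I TE (\<lambda>t. G f (t, \<lambda>_. 0))"
    by (rule continuous_map_on_compose[OF G(1) continuous_on_Pair[OF continuous_on_id continuous_on_const]]) (use o in auto)
  then show ?thesis using G(2) o by (intro exI[of _ "\<lambda>t. G f (t, \<lambda>_. 0)"]) auto
qed

text \<open>
  Paths \<open>A e\<close> in the total space from \<open>f\<close> to all points \<open>e\<close> of its fibre project to loops, which
  have lifts \<open>z e\<close> with common end points \<open>s\<close> and \<open>s'\<close>, as they are lifted simultaneously.
  Comparison of \<open>A e\<close> and \<open>z e\<close> shows that if \<open>s\<close> is in the path-component of \<open>f\<close>, then \<open>s'\<close> is in
  that of \<open>e\<close>, and conversely.  The choice \<open>e = s'\<close> gives the former, hence the latter for all \<open>e\<close>.
\<close>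

lemma fiber_connected:
  assumes f: "f \<in> topspace TE" and e: "e \<in> topspace TE" and pe: "p f = p e"
  shows "fiber_path f e"
proof -
  define F where "F = {e \<in> topspace TE. p e = p f}"
  have fF: "f \<in> F" "e \<in> F" using f e pe by (auto simp: F_def)
  have "\<forall>e\<in>F. \<exists>A. continuous_map unit_I TE A \<and> A 0 = f \<and> A 1 = e"
    using total_path[OF f] by (auto simp: F_def)
  from bchoice[OF this] obtain A where A: "\<forall>e\<in>F. continuous_map unit_I TE (A e) \<and> A e 0 = f \<and> A e 1 = e" by (elim exE)
  define B where "B e x = A e ((x 0 + 1) / 2)" for e and x :: "nat \<Rightarrow> real"
  have Bc: "continuous_map (top_of_set (sbox 1)) TE (B e)" if "e \<in> F" for e
  proof -
    have "continuous_map unit_I TE (A e)" using A that by blast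
    moreover have "continuous_on (sbox 1) (\<lambda>x. (x 0 + 1) / 2)"
      by (intro continuous_on_divide continuous_on_add continuous_on_const
          continuous_on_product_then_coordinatewise[OF continuous_on_id]) simp
    moreover have "(x 0 + 1) / 2 \<in> {0..1}" if "x \<in> sbox 1" for x
      using that by (simp add: sbox_def abs_le_iff)
    ultimately show ?thesis unfolding B_def by (rule continuous_map_on_compose)
  qed
  have B1: "p (B e x) = p f" if "e \<in> F" "x \<in> sboundary 1" for e x
  proof -
    have "x 0 = 1 \<or> x 0 = -1" using that(2) by (auto simp: sboundary_def abs_if split: if_splits)
    then show ?thesis using A that(1) by (auto simp: B_def F_def)
  qed
  have pB: "continuous_map (top_of_set (sbox 1)) TY (\<lambda>x. p (B e x))" if "e \<in> F" for e
    using continuous_map_compose[OF Bc[OF that] continuous_p] by (simp add: o_def)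
  have "\<exists>z. (\<forall>e\<in>F. continuous_map (top_of_set (sbox 1)) TE (z e) \<and> (\<forall>x\<in>sbox 1. p (z e x) = p (B e x)) \<and>
     (\<forall>x\<in>sboundary 1. z e x = z f x))"
    by (rule family_lift[OF fF(1)]) (rule pB, assumption, simp only: B1 fF)
  then obtain z where z: "\<And>e. e \<in> F \<Longrightarrow> continuous_map (top_of_set (sbox 1)) TE (z e)"
     "\<And>e x. e \<in> F \<Longrightarrow> x \<in> sbox 1 \<Longrightarrow> p (z e x) = p (B e x)" "\<And>e x. e \<in> F \<Longrightarrow> x \<in> sboundary 1 \<Longrightarrow> z e x = z f x" by blast
  define m :: "real \<Rightarrow> nat \<Rightarrow> real" where "m s = (\<lambda>i. if i = 0 then s else 0)" for s
  have m: "m 1 \<in> sbox 1" "m (-1) \<in> sbox 1" "m 1 \<in> sboundary 1" "m (-1) \<in> sboundary 1"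
    by (auto simp: m_def sbox_def sboundary_def)
  have Bm: "B e (m (-1)) = f" "B e (m 1) = e" if "e \<in> F" for e
    using A that by (simp_all add: B_def m_def)
  define s' where "s' = z f (m 1)"
  have ps: "p (z f (m 1)) = p f" "p (z f (m (-1))) = p f"
    using z(2)[OF fF(1)] B1[OF fF(1)] m by simp_all
  have zt: "z f x \<in> topspace TE" if "x \<in> sbox 1" for x
    using continuous_map_funspace[OF z(1)[OF fF(1)]] that by auto
  have s'F: "s' \<in> F" using ps zt m by (simp add: F_def s'_def)
  have tr: "fiber_path (z e (m a)) (B e (m a)) \<Longrightarrow> fiber_path (z e (m b)) (B e (m b))"
    if "e \<in> F" "m a \<in> sbox 1" "m b \<in> sbox 1" for e a b
    by (rule fiber_transport[OF z(1)[OF that(1)] Bc[OF that(1)] _ that(2,3)]) (rule z(2)[OF that(1)])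
  have "fiber_path s' s'" using s'F by (simp add: path_component_of_refl F_def)
  then have "fiber_path (z s' (m 1)) (B s' (m 1))" using z(3)[OF s'F m(3)] Bm[OF s'F] by (simp add: s'_def)
  from tr[OF s'F m(1,2) this] have sf: "fiber_path (z f (m (-1))) f" using z(3)[OF s'F m(4)] Bm[OF s'F] by simp
  have s'e: "fiber_path s' e" if e: "e \<in> F" for e
  proof -
    have "fiber_path (z e (m (-1))) (B e (m (-1)))" using sf z(3)[OF e m(4)] Bm[OF e] by simp
    from tr[OF e m(2,1) this] show ?thesis using z(3)[OF e m(3)] Bm[OF e] by (simp add: s'_def)
  qed
  have ps': "p s' = p f" using ps by (simp add: s'_def)
  from path_component_of_trans[OF path_component_of_sym[OF s'e[OF fF(1)]] s'e[OF fF(2)]]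
  show ?thesis by (simp add: ps')
qed

end

section \<open>The sphere as two boxes\<close>

text \<open>
  The sphere is covered by two copies of the box.  The lower one is the bottom face; for the upper
  one, the inner half of the box is stretched over the top face, and the outer half is wrapped
  around the remaining faces.
\<close>

definition hemisphere :: "nat \<Rightarrow> bool \<Rightarrow> (nat \<Rightarrow> real) \<Rightarrow> nat \<Rightarrow> real" where
  "hemisphere n upper x = (let m = (if upper then max (box_norm {..<n} x) (1 / 2) else 1) in
     (\<lambda>i. if i < n then x i / m else if i = n then 3 - 4 * m else 0))"

definition hemisphere_inverse :: "nat \<Rightarrow> (nat \<Rightarrow> real) \<Rightarrow> nat \<Rightarrow> real" where
  "hemisphere_inverse n b = (\<lambda>i. if i < n then b i * (3 - b n) / 4 else 0)"

lemma hemisphere_lower: "hemisphere n False x = (\<lambda>i. if i < n then x i else if i = n then -1 else 0)"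
  by (auto simp: hemisphere_def Let_def fun_eq_iff)

lemma hemisphere_boundary: "x \<in> sboundary n \<Longrightarrow> hemisphere n u x = hemisphere n False x"
  unfolding sboundary_iff by (cases u) (auto simp: hemisphere_def Let_def fun_eq_iff)

lemma hemisphere_height: "x \<in> sbox n \<Longrightarrow> hemisphere n True x n = -1 \<Longrightarrow> x \<in> sboundary n"
  unfolding sboundary_iff by (auto simp: hemisphere_def Let_def max_def split: if_splits)

lemma hemisphere_in:
  assumes x: "x \<in> sbox n" shows "hemisphere n u x \<in> sboundary (Suc n)"
proof -
  define m where "m = (if u then max (box_norm {..<n} x) (1 / 2) else 1)"
  have h: "hemisphere n u x = (\<lambda>i. if i < n then x i / m else if i = n then 3 - 4 * m else 0)"
    unfolding hemisphere_def Let_def m_def by (rule refl)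
  have N: "box_norm {..<n} x \<le> 1" by (rule sbox_norm[OF x order_refl])
  then have m: "1 / 2 \<le> m" "m \<le> 1" "box_norm {..<n} x \<le> m" by (auto simp: m_def)
  have le: "\<bar>x i / m\<bar> \<le> 1" if "i < n" for i
    using box_norm_ge[of "{..<n}" i x] that m by (simp add: abs_divide)
  have "\<exists>i<Suc n. \<bar>hemisphere n u x i\<bar> = 1"
  proof (cases "m = 1 / 2 \<or> m = 1")
    case True
    then show ?thesis by (intro exI[of _ n]) (auto simp: h)
  next
    case False
    then have "m = box_norm {..<n} x" by (auto simp: m_def max_def split: if_splits)
    then obtain i where "i < n" "\<bar>x i\<bar> = m" using box_norm_attained[of "{..<n}" x] m(1) by auto
    then show ?thesis using m(1) by (intro exI[of _ i]) (simp add: h abs_divide)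
  qed
  moreover have "hemisphere n u x \<in> sbox (Suc n)"
  proof -
    have "\<bar>hemisphere n u x i\<bar> \<le> 1" if "i < Suc n" for i
    proof (cases "i < n")
      case True
      then show ?thesis using le[OF True] by (simp only: h if_True)
    next
      case False
      then have "i = n" using that by simp
      then show ?thesis using m by (simp add: h abs_le_iff)
    qed
    moreover have "hemisphere n u x i = 0" if "i \<ge> Suc n" for i using that by (simp add: h)
    ultimately show ?thesis by (simp add: sbox_def)
  qed
  ultimately show ?thesis by (simp add: sboundary_def)
qed

lemma hemisphere_inverse_hemisphere:
  assumes x: "x \<in> sbox n" shows "hemisphere_inverse n (hemisphere n u x) = x"
proof -
  define m where "m = (if u then max (box_norm {..<n} x) (1 / 2) else 1)"
  have m: "m > 0" by (auto simp: m_def)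
  show ?thesis
    using x m by (auto simp: hemisphere_inverse_def hemisphere_def Let_def m_def[symmetric] sbox_def fun_eq_iff)
qed

lemma hemisphere_hemisphere_inverse:
  assumes b: "b \<in> sboundary (Suc n)"
  shows "hemisphere_inverse n b \<in> sbox n" "hemisphere n (b n \<noteq> -1) (hemisphere_inverse n b) = b"
proof -
  have bb: "\<bar>b i\<bar> \<le> 1" for i using b by (auto simp: sboundary_def sbox_def not_less) (metis abs_zero not_less zero_le_one)
  have bz: "b i = 0" if "i > n" for i using b that by (auto simp: sboundary_def sbox_def)
  have bn: "-1 \<le> b n" "b n \<le> 1" using bb[of n] by auto
  have le: "\<bar>b i * (3 - b n) / 4\<bar> \<le> 1" for i
  proof -
    have "\<bar>b i\<bar> * (3 - b n) \<le> 1 * 4" using bb bn by (intro mult_mono) auto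
    then show ?thesis using bn by (simp add: abs_mult)
  qed
  then show "hemisphere_inverse n b \<in> sbox n" by (simp add: sbox_def hemisphere_inverse_def)
  have N: "box_norm {..<n} (hemisphere_inverse n b) = (3 - b n) / 4 * box_norm {..<n} b"
    by (rule box_norm_scale) (use bn in \<open>auto simp: hemisphere_inverse_def\<close>)
  have N1: "box_norm {..<n} b \<le> 1" by (subst box_norm_le_iff) (auto simp: bb)
  show "hemisphere n (b n \<noteq> -1) (hemisphere_inverse n b) = b"
  proof (cases "b n = -1")
    case True
    then show ?thesis by (auto simp: hemisphere_lower hemisphere_inverse_def fun_eq_iff bz)
  next
    case False
    have m: "max (box_norm {..<n} (hemisphere_inverse n b)) (1 / 2) = (3 - b n) / 4"
    proof (cases "b n = 1")
      case True
      then show ?thesis unfolding N using N1 by auto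
    next
      case F: False
      have "box_norm {..<Suc n} b = 1" using b by (simp add: sboundary_iff)
      then have "box_norm {..<n} b = 1" using False F bn by (auto simp: lessThan_Suc box_norm_insert max_def abs_if split: if_splits)
      then show ?thesis unfolding N using bn by auto
    qed
    show ?thesis
    proof
      fix i
      show "hemisphere n (b n \<noteq> -1) (hemisphere_inverse n b) i = b i"
        using False bn bz[of i] by (simp add: hemisphere_def Let_def m) (auto simp: hemisphere_inverse_def field_simps)
    qed
  qed
qed

lemma continuous_on_hemisphere: "continuous_on S (hemisphere n u)"
proof (rule continuous_on_coordinatewise_then_product)
  fix i
  define m where "m x = (if u then max (box_norm {..<n} x) (1 / 2) else 1)" for x
  have mc: "continuous_on S m"
    unfolding m_def using continuous_on_max[OF continuous_on_box_norm[OF finite_lessThan continuous_on_id] continuous_on_const]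
    by (cases u) simp_all
  have m0: "\<forall>x\<in>S. m x \<noteq> 0" by (auto simp: m_def max_def)
  have "continuous_on S (\<lambda>x. x i / m x)"
    by (rule continuous_on_divide[OF continuous_on_product_then_coordinatewise[OF continuous_on_id] mc m0])
  moreover have "continuous_on S (\<lambda>x. 3 - 4 * m x)"
    by (rule continuous_on_diff[OF continuous_on_const continuous_on_mult[OF continuous_on_const mc]])
  moreover have "hemisphere n u x i = (if i < n then x i / m x else if i = n then 3 - 4 * m x else 0)" for x
    by (simp add: hemisphere_def Let_def m_def)
  ultimately show "continuous_on S (\<lambda>x. hemisphere n u x i)" by (cases "i < n"; cases "i = n") simp_all
qed

context acyclic_fibration
begin

lemma zero_sbox: "(\<lambda>_. 0) \<in> sbox n"
  by (simp add: sbox_def)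

lemma surjective_on_points: "y \<in> topspace TY \<Longrightarrow> \<exists>k\<in>topspace TE. p k = y"
proof -
  assume y: "y \<in> topspace TY"
  have "\<exists>z. (\<forall>e\<in>{y}. continuous_map (top_of_set (sbox 0)) TE (z e) \<and> (\<forall>x\<in>sbox 0. p (z e x) = y) \<and>
     (\<forall>x\<in>sboundary 0. z e x = z y x))"
    by (rule family_lift[where w = "\<lambda>_ _. y"]) (use y in simp_all)
  then obtain z where z: "continuous_map (top_of_set (sbox 0)) TE (z y)" "\<forall>x\<in>sbox 0. p (z y x) = y" by auto
  have "z y (\<lambda>_. 0) \<in> topspace TE"
    using continuous_map_funspace[OF z(1)] by (rule funcset_mem) (simp add: zero_sbox)
  then show ?thesis using z(2) zero_sbox by blast
qed

text \<open>
  A map on the boundary sphere is extended to the box first without regard to \<open>w\<close>: its image in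
  the base is null-homotopic, hence so is the map itself.
\<close>

lemma boundary_extends:
  assumes w: "continuous_map (top_of_set (sbox (Suc n))) TY w"
    and a: "continuous_map (top_of_set (sboundary (Suc n))) TE a" and pa: "\<And>x. x \<in> sboundary (Suc n) \<Longrightarrow> p (a x) = w x"
  shows "\<exists>A. continuous_map (top_of_set (sbox (Suc n))) TE A \<and> (\<forall>x\<in>sboundary (Suc n). A x = a x)"
proof -
  let ?F = "{\<iota> 0, \<iota> 1}"
  define hs where "hs e = hemisphere n (e = \<iota> 1)" for e :: 'u
  have \<iota>01: "\<iota> 0 \<noteq> \<iota> 1" using inj_eq[OF \<iota>, of 0 1] by simp
  have hs_in: "hs e x \<in> sboundary (Suc n)" if "x \<in> sbox n" for e x unfolding hs_def by (rule hemisphere_in[OF that])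
  have hs_bd: "hs e x = hs (\<iota> 0) x" if "x \<in> sboundary n" for e x
    unfolding hs_def using hemisphere_boundary[OF that] \<iota>01 by simp
  have zw: "w (\<lambda>_. 0) \<in> topspace TY"
    using continuous_map_funspace[OF w] by (rule funcset_mem) (simp add: zero_sbox)
  \<comment> \<open>the contraction of the box to the origin is a homotopy from the image of the given map to the image of a constant map\<close>
  obtain k where k: "k \<in> topspace TE" "p k = w (\<lambda>_. 0)" using surjective_on_points[OF zw] by blast
  define S where "S e z = (\<lambda>i. (1 - fst z) * hs e (snd z) i)" for e and z :: "real \<times> (nat \<Rightarrow> real)"
  have Sc: "continuous_on ({0..1} \<times> sbox n) (S e)" for e
  proof (rule continuous_on_coordinatewise_then_product)
    fix i
    have "continuous_on ({0..1} \<times> sbox n) (\<lambda>z. hs e (snd z))" unfolding hs_def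
      by (rule continuous_on_compose2[OF continuous_on_hemisphere[of UNIV] continuous_on_snd[OF continuous_on_id]]) simp
    then have "continuous_on ({0..1::real} \<times> sbox n) (\<lambda>z. hs e (snd z) i)"
      by (rule continuous_on_product_then_coordinatewise)
    then show "continuous_on ({0..1} \<times> sbox n) (\<lambda>z. S e z i)" unfolding S_def
      by (intro continuous_on_mult continuous_on_diff continuous_on_const continuous_on_fst continuous_on_id)
  qed
  have S_in: "S e z \<in> sbox (Suc n)" if z: "z \<in> {0..1} \<times> sbox n" for e z
  proof -
    have "hs e (snd z) \<in> sbox (Suc n)" using hs_in[of "snd z" e] z by (auto simp: sboundary_def)
    moreover have "\<bar>(1 - fst z) * c\<bar> \<le> 1" if "\<bar>c\<bar> \<le> 1" for c
      unfolding abs_mult by (rule mult_le_one) (use z that in auto)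
    ultimately show ?thesis by (auto simp: sbox_def S_def)
  qed
  have "\<exists>G. \<forall>e\<in>?F. continuous_map (top_of_set ({0..1::real} \<times> sbox n)) TE (G e) \<and>
     (\<forall>x\<in>sbox n. G e (0, x) = a (hs e x) \<and> G e (1, x) = k) \<and> (\<forall>x\<in>sboundary n. \<forall>t. G e (t, x) = G (\<iota> 0) (t, x))"
  proof (rule family_homotopy[where a = "\<lambda>e x. a (hs e x)" and b = "\<lambda>_ _. k" and H = "\<lambda>e z. w (S e z)"])
    show "finite ?F" "\<iota> 0 \<in> ?F" by simp_all
    show "continuous_map (top_of_set (sbox n)) TE (\<lambda>x. a (hs e x))" if "e \<in> ?F" for e
      by (rule continuous_map_on_compose[OF a _ hs_in]) (simp_all add: hs_def continuous_on_hemisphere)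
    show "a (hs e x) = a (hs (\<iota> 0) x)" if "e \<in> ?F" "x \<in> sboundary n" for e x using hs_bd[OF that(2), of e] by simp
    show "continuous_map (top_of_set (sbox n)) TE (\<lambda>_. k)" if "e \<in> ?F" for e using k(1) by simp
    show "k = k" by simp
    show "continuous_map (top_of_set ({0..1} \<times> sbox n)) TY (\<lambda>z. w (S e z))" if "e \<in> ?F" for e
      by (rule continuous_map_on_compose[OF w Sc S_in])
    show "w (S e (t, x)) = w (S (\<iota> 0) (t, x))" if "e \<in> ?F" "x \<in> sboundary n" "t \<in> {0..1}" for e x t
      using hs_bd[OF that(2), of e] by (simp add: S_def)
    show "w (S e (0, x)) = p (a (hs e x)) \<and> w (S e (1, x)) = p k" if "e \<in> ?F" "x \<in> sbox n" for e x
      using pa[OF hs_in[OF that(2)]] k(2) by (simp add: S_def)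
  qed
  then obtain G where G0: "\<forall>e\<in>?F. continuous_map (top_of_set ({0..1::real} \<times> sbox n)) TE (G e) \<and>
     (\<forall>x\<in>sbox n. G e (0, x) = a (hs e x) \<and> G e (1, x) = k) \<and> (\<forall>x\<in>sboundary n. \<forall>t. G e (t, x) = G (\<iota> 0) (t, x))"
    by (elim exE)
  have G: "continuous_map (top_of_set ({0..1::real} \<times> sbox n)) TE (G e)"
      "x \<in> sbox n \<Longrightarrow> G e (0, x) = a (hs e x) \<and> G e (1, x) = k"
      "x \<in> sboundary n \<Longrightarrow> G e (t, x) = G (\<iota> 0) (t, x)" if "e \<in> ?F" for e x t
    using bspec[OF G0 that] by simp_all
  define N where "N = box_norm {..<Suc n}"
  \<comment> \<open>the null-homotopy is the extension in polar coordinates: time \<open>1 - N y\<close> at the boundary point \<open>y / N y\<close>\<close>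
  define side where "side b = (if b n = -1 then \<iota> 0 else \<iota> 1)" for b :: "nat \<Rightarrow> real"
  define A where "A y = (if N y = 0 then k else G (side (\<lambda>i. y i / N y)) (1 - N y, hemisphere_inverse n (\<lambda>i. y i / N y)))" for y
  have sideF: "side b \<in> ?F" for b by (simp add: side_def)
  have hs_side: "hs (side b) (hemisphere_inverse n b) = b" "hemisphere_inverse n b \<in> sbox n" if "b \<in> sboundary (Suc n)" for b
    using hemisphere_hemisphere_inverse[OF that] \<iota>01 by (auto simp: hs_def side_def split: if_splits)
  have NS: "N (S e (t, x)) = 1 - t" if "x \<in> sbox n" "t \<in> {0..1}" for e t x
  proof -
    have "N (S e (t, x)) = (1 - t) * N (hs e x)"
      unfolding N_def by (rule box_norm_scale) (use that in \<open>auto simp: S_def\<close>)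
    then show ?thesis using hs_in[OF that(1), of e] by (simp add: sboundary_iff N_def)
  qed
  have AS: "A (S e (t, x)) = G e (t, x)" if e: "e \<in> ?F" and x: "x \<in> sbox n" and t: "t \<in> {0..1}" for e t x
  proof (cases "t = 1")
    case True
    then show ?thesis using NS[OF x t, of e] G(2)[OF e x] by (simp add: A_def)
  next
    case False
    then have b: "(\<lambda>i. S e (t, x) i / N (S e (t, x))) = hs e x" unfolding NS[OF x t] by (simp add: S_def)
    have "hemisphere_inverse n (hs e x) = x" unfolding hs_def by (rule hemisphere_inverse_hemisphere[OF x])
    then have "A (S e (t, x)) = G (side (hs e x)) (t, x)" unfolding A_def b using NS[OF x t] False by simp
    moreover have "G (side (hs e x)) (t, x) = G e (t, x)"
    proof (cases "e = \<iota> 0 \<or> hs e x n \<noteq> -1")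
      case True
      have "hs (\<iota> 0) x n = -1" using \<iota>01 by (simp add: hs_def hemisphere_lower)
      then have "side (hs e x) = e" using True e by (auto simp: side_def)
      then show ?thesis by simp
    next
      case False
      then have "e = \<iota> 1" using e by blast
      then have "x \<in> sboundary n" using False hemisphere_height[OF x] by (simp add: hs_def)
      then show ?thesis using G(3)[OF e] G(3)[OF sideF] by metis
    qed
    ultimately show ?thesis by simp
  qed
  have "continuous_map (top_of_set (sbox (Suc n))) TE A"
  proof (rule continuous_map_finite_compact_cover[where I = ?F and D = "\<lambda>_. top_of_set ({0..1::real} \<times> sbox n)" and \<Phi> = S])
    show "finite ?F" by simp
    show "Hausdorff_space (top_of_set (sbox (Suc n)))" by (simp add: Hausdorff_space_subtopology)
    show "compact_space (top_of_set ({0..1::real} \<times> sbox n))"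
      using compact_Times[OF compact_Icc sbox_space(4)] by (simp add: compact_space_subtopology)
    show "continuous_map (top_of_set ({0..1::real} \<times> sbox n)) (top_of_set (sbox (Suc n))) (S e)" for e
      using Sc S_in by (simp add: continuous_map_in_subtopology image_subset_iff_funcset[symmetric] image_subset_iff)
    show "continuous_map (top_of_set ({0..1::real} \<times> sbox n)) TE (\<lambda>z. A (S e z))" if "e \<in> ?F" for e
      by (rule continuous_map_on_cong[OF G(1)[OF that]]) (use AS[OF that] in force)
    show "topspace (top_of_set (sbox (Suc n))) \<subseteq> (\<Union>e\<in>?F. S e ` topspace (top_of_set ({0..1::real} \<times> sbox n)))"
    proof
      fix y assume "y \<in> topspace (top_of_set (sbox (Suc n)))"
      then have y: "y \<in> sbox (Suc n)" by simp
      have N01: "0 \<le> N y" "N y \<le> 1" using box_norm_nonneg[of "{..<Suc n}"] sbox_norm[OF y order_refl] by (auto simp: N_def)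
      show "y \<in> (\<Union>e\<in>?F. S e ` topspace (top_of_set ({0..1::real} \<times> sbox n)))"
      proof (cases "N y = 0")
        case True
        have "y i = 0" for i
        proof (cases "i < Suc n")
          case T: True
          then show ?thesis using box_norm_ge[of "{..<Suc n}" i y] True by (simp add: N_def)
        qed (use y in \<open>simp add: sbox_def\<close>)
        then have "y = S (\<iota> 0) (1, \<lambda>_. 0)" by (simp add: S_def fun_eq_iff)
        moreover have "(1, \<lambda>_. 0) \<in> topspace (top_of_set ({0..1::real} \<times> sbox n))" by (simp add: zero_sbox)
        ultimately show ?thesis by (intro UN_I[of "\<iota> 0"] image_eqI[of _ _ "(1, \<lambda>_. 0)"]) simp_all
      next
        case False
        define b where "b i = y i / N y" for i
        have yi: "\<bar>y i\<bar> \<le> N y" if "i < Suc n" for i using box_norm_ge[of "{..<Suc n}" i y] that by (simp add: N_def)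
        have "N b = 1 / N y * N y" unfolding N_def using N01 by (intro box_norm_scale) (auto simp: b_def N_def)
        then have "b \<in> sboundary (Suc n)"
          unfolding sboundary_iff using False N01 y yi by (auto simp: N_def sbox_def b_def abs_divide)
        from hs_side[OF this] have "S (side b) (1 - N y, hemisphere_inverse n b) = (\<lambda>i. N y * b i)" "hemisphere_inverse n b \<in> sbox n"
          by (simp_all add: S_def)
        moreover have "(\<lambda>i. N y * b i) = y" using False by (simp add: b_def)
        ultimately have "S (side b) (1 - N y, hemisphere_inverse n b) = y"
          "(1 - N y, hemisphere_inverse n b) \<in> topspace (top_of_set ({0..1::real} \<times> sbox n))" using N01 by simp_all
        then show ?thesis using sideF[of b]
          by (intro UN_I[of "side b"] image_eqI[of _ _ "(1 - N y, hemisphere_inverse n b)"]) simp_all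
      qed
    qed
  qed
  moreover have "A b = a b" if b: "b \<in> sboundary (Suc n)" for b
  proof -
    have "N b = 1" using b by (simp add: sboundary_iff N_def)
    then have "A b = G (side b) (0, hemisphere_inverse n b)" by (simp add: A_def)
    then show ?thesis using G(2)[OF sideF[of b] hs_side(2)[OF b]] hs_side(1)[OF b] by simp
  qed
  ultimately show ?thesis by (intro exI[of _ A]) simp
qed

text \<open>
  The extension \<open>A\<close> of \<open>a\<close> need not lie over \<open>w\<close>.  But \<open>w\<close> and \<open>p \<circ> A\<close> agree on the boundary, so they
  have lifts \<open>z\<close> and \<open>z1\<close> which agree there.  As \<open>z1\<close> is vertically homotopic to \<open>A\<close>, the restriction of \<open>z\<close> to
  the boundary is vertically homotopic to \<open>a\<close>, and \<open>z\<close> can be changed along that homotopy.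
\<close>

lemma box_extension:
  assumes w: "continuous_map (top_of_set (sbox n)) TY w"
    and a: "continuous_map (top_of_set (sboundary n)) TE a" and pa: "\<And>x. x \<in> sboundary n \<Longrightarrow> p (a x) = w x"
  shows "\<exists>l. continuous_map (top_of_set (sbox n)) TE l \<and> (\<forall>x\<in>sbox n. p (l x) = w x) \<and> (\<forall>x\<in>sboundary n. l x = a x)"
proof (cases n)
  case 0
  have "\<exists>z. (\<forall>e\<in>{undefined :: 'u}. continuous_map (top_of_set (sbox 0)) TE (z e) \<and> (\<forall>x\<in>sbox 0. p (z e x) = w x) \<and>
     (\<forall>x\<in>sboundary 0. z e x = z undefined x))"
    by (rule family_lift[where w = "\<lambda>_. w"]) (use w 0 in simp_all)
  then show ?thesis using 0 by (auto simp: sboundary_def)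
next
  case (Suc m)
  obtain A where A: "continuous_map (top_of_set (sbox n)) TE A" "\<forall>x\<in>sboundary n. A x = a x"
  proof -
    have "\<exists>A. continuous_map (top_of_set (sbox (Suc m))) TE A \<and> (\<forall>x\<in>sboundary (Suc m). A x = a x)"
      by (rule boundary_extends[OF w[unfolded Suc] a[unfolded Suc]]) (rule pa[unfolded Suc])
    then show thesis unfolding Suc[symmetric] by (elim exE conjE) (rule that)
  qed
  have sub: "sboundary n \<subseteq> sbox n" by (auto simp: sboundary_def)
  have \<iota>01: "\<iota> 0 \<noteq> \<iota> 1" using inj_eq[OF \<iota>, of 0 1] by simp
  have pA: "continuous_map (top_of_set (sbox n)) TY (\<lambda>x. p (A x))"
    using continuous_map_compose[OF A(1) continuous_p] by (simp add: o_def)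
  have "\<exists>z. \<forall>e\<in>{\<iota> 0, \<iota> 1}. continuous_map (top_of_set (sbox n)) TE (z e) \<and>
      (\<forall>x\<in>sbox n. p (z e x) = (if e = \<iota> 0 then w x else p (A x))) \<and> (\<forall>x\<in>sboundary n. z e x = z (\<iota> 0) x)"
    by (rule family_lift[where w = "\<lambda>e x. if e = \<iota> 0 then w x else p (A x)"]) (use w pA A(2) pa \<iota>01 in auto)
  then obtain z where z: "\<forall>e\<in>{\<iota> 0, \<iota> 1}. continuous_map (top_of_set (sbox n)) TE (z e) \<and>
      (\<forall>x\<in>sbox n. p (z e x) = (if e = \<iota> 0 then w x else p (A x))) \<and> (\<forall>x\<in>sboundary n. z e x = z (\<iota> 0) x)" by (elim exE)
  define z0 where "z0 = z (\<iota> 0)"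
  define z1 where "z1 = z (\<iota> 1)"
  have z0: "continuous_map (top_of_set (sbox n)) TE z0" "\<And>x. x \<in> sbox n \<Longrightarrow> p (z0 x) = w x" using z by (auto simp: z0_def)
  have z1: "continuous_map (top_of_set (sbox n)) TE z1" "\<And>x. x \<in> sbox n \<Longrightarrow> p (z1 x) = p (A x)"
     "\<And>x. x \<in> sboundary n \<Longrightarrow> z1 x = z0 x" using z \<iota>01 by (auto simp: z1_def z0_def)
  let ?o = "\<lambda>_ :: nat. 0 :: real"
  have "z1 ?o \<in> topspace TE" "A ?o \<in> topspace TE"
    using continuous_map_funspace[OF z1(1)] continuous_map_funspace[OF A(1)] zero_sbox by auto
  then have path: "fiber_path (z1 ?o) (A ?o)" by (rule fiber_connected) (rule z1(2)[OF zero_sbox])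
  have "\<exists>h :: (nat \<Rightarrow> real) \<times> real \<Rightarrow> 'u. continuous_map (top_of_set (sbox n \<times> {0..1})) TE h \<and>
     (\<forall>x\<in>sbox n. h (x, 0) = z1 x \<and> h (x, 1) = A x \<and> (\<forall>t\<in>{0..1}. p (h (x, t)) = p (z1 x)))"
    by (rule vertical_homotopy[OF z1(1) A(1) _ zero_sbox path]) (rule z1(2))
  then obtain h :: "(nat \<Rightarrow> real) \<times> real \<Rightarrow> 'u" where h: "continuous_map (top_of_set (sbox n \<times> {0..1})) TE h"
     "\<And>x. x \<in> sbox n \<Longrightarrow> h (x, 0) = z1 x \<and> h (x, 1) = A x \<and> (\<forall>t\<in>{0..1}. p (h (x, t)) = p (z1 x))" by blast
  define l where "l = (\<lambda>(x, t). if box_norm {..<n} x = 1 then h (x, t) else z0 x)"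
  define Z0 where "Z0 = sbox n \<times> {0::real}"
  define Z1 where "Z1 = (sbox n \<inter> {x. box_norm {..<n} x = 1}) \<times> {0..1::real}"
  have cl: "closed Z0" "closed Z1"
  proof -
    show "closed Z0" unfolding Z0_def by (intro closed_Times closed_sbox closed_singleton)
    have "closed {x :: nat \<Rightarrow> real. box_norm {..<n} x = 1}"
      by (rule closed_Collect_eq[OF continuous_on_box_norm[OF finite_lessThan continuous_on_id] continuous_on_const])
    then show "closed Z1" unfolding Z1_def by (intro closed_Times closed_Int closed_sbox closed_atLeastAtMost)
  qed
  have "continuous_map (top_of_set Z0) TE (\<lambda>y. z0 (fst y))"
    by (rule continuous_map_on_compose[OF z0(1) continuous_on_fst[OF continuous_on_id]]) (auto simp: Z0_def)
  then have l0: "continuous_map (top_of_set Z0) TE l"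
    by (rule continuous_map_on_cong) (use h(2) z1(3) in \<open>auto simp: Z0_def l_def sboundary_iff\<close>)
  have "continuous_map (top_of_set Z1) TE (\<lambda>y. h y)"
    by (rule continuous_map_on_compose[OF h(1) continuous_on_id]) (auto simp: Z1_def)
  then have l1: "continuous_map (top_of_set Z1) TE l"
    by (rule continuous_map_on_cong) (auto simp: Z1_def l_def)
  have ZZ: "{(x, t). x \<in> sbox n \<and> t \<in> {0..1::real} \<and> (t = 0 \<or> box_norm {..<n} x = 1)} = Z0 \<union> Z1"
    by (auto simp: Z0_def Z1_def)
  have l: "continuous_map (top_of_set {(x, t). x \<in> sbox n \<and> t \<in> {0..1} \<and> (t = 0 \<or> box_norm {..<n} x = 1)}) TE l"
    unfolding ZZ by (intro continuous_map_closed_Un cl l0 l1)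
  have v: "continuous_map (top_of_set (sbox n \<times> {0..1})) TY (\<lambda>y. w (fst y))"
    by (rule continuous_map_on_compose[OF w continuous_on_fst[OF continuous_on_id]]) auto
  have "\<exists>L. continuous_map (top_of_set (sbox n \<times> {0..1::real})) TE L \<and> (\<forall>y \<in> sbox n \<times> {0..1}. p (L y) = w (fst y)) \<and>
     (\<forall>x\<in>sbox n. \<forall>t\<in>{0..1}. t = 0 \<or> box_norm {..<n} x = 1 \<longrightarrow> L (x, t) = l (x, t))"
  proof (rule relative_lift[OF order_refl v l])
    fix x :: "nat \<Rightarrow> real" and t :: real assume x: "x \<in> sbox n" "t \<in> {0..1}"
    show "p (l (x, t)) = w (fst (x, t))"
    proof (cases "box_norm {..<n} x = 1")
      case True
      then have b: "x \<in> sboundary n" using x by (simp add: sboundary_iff)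
      have "p (l (x, t)) = p (z1 x)" using h(2)[OF x(1)] x(2) True by (simp add: l_def)
      then show ?thesis using z1(2)[OF x(1)] A(2) pa[OF b] b by simp
    qed (use z0(2)[OF x(1)] in \<open>simp add: l_def\<close>)
  qed
  then obtain L where L: "continuous_map (top_of_set (sbox n \<times> {0..1::real})) TE L" "\<forall>y \<in> sbox n \<times> {0..1}. p (L y) = w (fst y)"
     "\<forall>x\<in>sbox n. \<forall>t\<in>{0..1}. t = 0 \<or> box_norm {..<n} x = 1 \<longrightarrow> L (x, t) = l (x, t)" by (elim exE conjE)
  have "continuous_map (top_of_set (sbox n)) TE (\<lambda>x. L (x, 1))"
    by (rule continuous_map_on_compose[OF L(1) continuous_on_Pair[OF continuous_on_id continuous_on_const]]) auto
  moreover have "p (L (x, 1)) = w x" if "x \<in> sbox n" for x using L(2) that by auto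
  moreover have "L (x, 1) = a x" if "x \<in> sboundary n" for x
    using L(3) h(2) A(2) that by (auto simp: l_def sboundary_iff)
  ultimately show ?thesis by (intro exI[of _ "\<lambda>x. L (x, 1)"]) simp
qed

end

section \<open>Finite CW complexes\<close>

definition euclidean_norm :: "nat \<Rightarrow> (nat \<Rightarrow> real) \<Rightarrow> real" where
  "euclidean_norm n x = sqrt (\<Sum>i<n. (x i)\<^sup>2)"

text \<open>
  A bijection from the box onto the disk, rescaling each ray so that the boundaries correspond;
  the denominator is chosen so that neither this map nor its inverse is singular at the origin.
\<close>

definition box_to_disk :: "nat \<Rightarrow> (nat \<Rightarrow> real) \<Rightarrow> nat \<Rightarrow> real" where
  "box_to_disk n x = (\<lambda>i. 1 / (1 - box_norm {..<n} x + euclidean_norm n x) * x i)"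

definition disk_to_box :: "nat \<Rightarrow> (nat \<Rightarrow> real) \<Rightarrow> nat \<Rightarrow> real" where
  "disk_to_box n x = (\<lambda>i. 1 / (1 + box_norm {..<n} x - euclidean_norm n x) * x i)"

lemma euclidean_norm_scale:
  assumes "0 \<le> c" shows "euclidean_norm n (\<lambda>i. c * x i) = c * euclidean_norm n x"
proof -
  have "(\<Sum>i<n. (c * x i)\<^sup>2) = c\<^sup>2 * (\<Sum>i<n. (x i)\<^sup>2)" by (simp add: power_mult_distrib sum_distrib_left)
  then show ?thesis using assms by (simp add: euclidean_norm_def real_sqrt_mult)
qed

lemma box_norm_scale': "0 \<le> c \<Longrightarrow> box_norm {..<n} (\<lambda>i. c * x i) = c * box_norm {..<n} x"
  by (rule box_norm_scale) simp_all

lemma euclidean_norm_nonneg: "0 \<le> euclidean_norm n x"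
  by (simp add: euclidean_norm_def sum_nonneg)

lemma box_norm_le_euclidean: "box_norm {..<n} x \<le> euclidean_norm n x"
proof -
  have "\<bar>x i\<bar> \<le> euclidean_norm n x" if "i < n" for i
  proof -
    have "(x i)\<^sup>2 \<le> (\<Sum>i<n. (x i)\<^sup>2)" by (rule member_le_sum) (use that in auto)
    then have "sqrt ((x i)\<^sup>2) \<le> euclidean_norm n x" unfolding euclidean_norm_def by (rule real_sqrt_le_mono)
    then show ?thesis by simp
  qed
  then show ?thesis using euclidean_norm_nonneg[of n x] by (subst box_norm_le_iff) auto
qed

lemma topspace_disk: "topspace (disk n) = {x. (\<forall>i\<ge>n. x i = 0) \<and> euclidean_norm n x \<le> 1}"
  by (auto simp: disk_def topspace_Euclidean_space euclidean_norm_def)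

lemma disk_topology: "disk n = top_of_set (topspace (disk n))"
proof -
  have "disk n = subtopology (powertop_real UNIV) ({x. \<forall>i\<ge>n. x i = 0} \<inter> {x. (\<Sum>i<n. x i ^ 2) \<le> 1})"
    unfolding disk_def Euclidean_space_def subtopology_subtopology ..
  moreover have "{x. \<forall>i\<ge>n. x i = 0} \<inter> {x. (\<Sum>i<n. x i ^ 2) \<le> 1} = topspace (disk n)"
    unfolding topspace_disk by (auto simp: euclidean_norm_def)
  ultimately show ?thesis by (simp only: euclidean_product_topology)
qed

lemma open_disk_eq: "open_disk n = {x. (\<forall>i\<ge>n. x i = 0) \<and> euclidean_norm n x < 1}"
  by (auto simp: open_disk_def topspace_Euclidean_space euclidean_norm_def)

lemma box_to_disk_denominator: "x \<in> sbox n \<Longrightarrow> 1 \<le> 1 - box_norm {..<n} x + euclidean_norm n x"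
  using box_norm_le_euclidean[of n x] by simp

lemma euclidean_norm_box_to_disk:
  assumes x: "x \<in> sbox n"
  shows "euclidean_norm n (box_to_disk n x) \<le> 1" "euclidean_norm n (box_to_disk n x) < 1 \<longleftrightarrow> x \<notin> sboundary n"
proof -
  have d: "1 - box_norm {..<n} x + euclidean_norm n x > 0" using box_to_disk_denominator[OF x] by simp
  have N: "box_norm {..<n} x \<le> 1" by (rule sbox_norm[OF x order_refl])
  have e: "euclidean_norm n (box_to_disk n x) = 1 / (1 - box_norm {..<n} x + euclidean_norm n x) * euclidean_norm n x"
    unfolding box_to_disk_def by (rule euclidean_norm_scale) (use d in simp)
  show "euclidean_norm n (box_to_disk n x) \<le> 1" unfolding e using d N by (simp add: divide_le_eq)
  have "euclidean_norm n (box_to_disk n x) < 1 \<longleftrightarrow> box_norm {..<n} x < 1" unfolding e using d by (simp add: divide_less_eq)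
  then show "euclidean_norm n (box_to_disk n x) < 1 \<longleftrightarrow> x \<notin> sboundary n" using N x by (auto simp: sboundary_iff)
qed

lemma box_to_disk_in: "x \<in> sbox n \<Longrightarrow> box_to_disk n x \<in> topspace (disk n)"
  unfolding topspace_disk using euclidean_norm_box_to_disk(1) by (auto simp: box_to_disk_def sbox_def)

lemma box_to_disk_open: "x \<in> sbox n \<Longrightarrow> box_to_disk n x \<in> open_disk n \<longleftrightarrow> x \<notin> sboundary n"
  unfolding open_disk_eq using euclidean_norm_box_to_disk(2) by (auto simp: box_to_disk_def sbox_def)

lemma disk_to_box_to_disk:
  assumes x: "x \<in> sbox n" shows "disk_to_box n (box_to_disk n x) = x"
proof -
  define d where "d = 1 - box_norm {..<n} x + euclidean_norm n x"
  have d: "d > 0" using box_to_disk_denominator[OF x] by (simp add: d_def)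
  have b: "box_to_disk n x = (\<lambda>i. 1 / d * x i)" by (simp add: box_to_disk_def d_def)
  have "1 + box_norm {..<n} (\<lambda>i. 1 / d * x i) - euclidean_norm n (\<lambda>i. 1 / d * x i)
      = 1 + 1 / d * box_norm {..<n} x - 1 / d * euclidean_norm n x"
    using d by (subst box_norm_scale', simp, subst euclidean_norm_scale) simp_all
  also have "\<dots> = 1 + 1 / d * (1 - d)" by (simp add: d_def algebra_simps diff_divide_distrib add_divide_distrib)
  also have "\<dots> = 1 / d" using d by (simp add: field_simps)
  finally show ?thesis unfolding disk_to_box_def b using d by (simp add: fun_eq_iff)
qed

lemma disk_to_box_open:
  assumes z: "z \<in> open_disk n"
  shows "disk_to_box n z \<in> sbox n" "box_to_disk n (disk_to_box n z) = z"
proof -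
  define d where "d = 1 + box_norm {..<n} z - euclidean_norm n z"
  have r: "euclidean_norm n z < 1" "\<forall>i\<ge>n. z i = 0" using z by (auto simp: open_disk_eq)
  have N: "0 \<le> box_norm {..<n} z" by (rule box_norm_nonneg) simp
  have d: "d > 0" "box_norm {..<n} z \<le> d" using r(1) N by (simp_all add: d_def)
  have b: "disk_to_box n z = (\<lambda>i. 1 / d * z i)" by (simp add: disk_to_box_def d_def)
  have "\<bar>1 / d * z i\<bar> \<le> 1" if "i < n" for i
  proof -
    have "\<bar>z i\<bar> \<le> d" using box_norm_ge[of "{..<n}" i z] that d(2) by simp
    then show ?thesis using d(1) by (simp add: abs_mult)
  qed
  then show "disk_to_box n z \<in> sbox n" using r(2) by (simp add: sbox_def b)
  have "1 - box_norm {..<n} (\<lambda>i. 1 / d * z i) + euclidean_norm n (\<lambda>i. 1 / d * z i)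
      = 1 - 1 / d * box_norm {..<n} z + 1 / d * euclidean_norm n z"
    using d by (subst box_norm_scale', simp, subst euclidean_norm_scale) simp_all
  also have "\<dots> = 1 + 1 / d * (1 - d)" by (simp add: d_def algebra_simps diff_divide_distrib add_divide_distrib)
  also have "\<dots> = 1 / d" using d by (simp add: field_simps)
  finally show "box_to_disk n (disk_to_box n z) = z" unfolding box_to_disk_def b using d by (simp add: fun_eq_iff)
qed

lemma continuous_on_box_to_disk: "continuous_on (sbox n) (box_to_disk n)"
proof (rule continuous_on_coordinatewise_then_product)
  fix i
  have c: "continuous_on (sbox n) (\<lambda>x. x i)" for i :: nat
    by (rule continuous_on_product_then_coordinatewise[OF continuous_on_id])
  have e: "continuous_on (sbox n) (euclidean_norm n)"
    unfolding euclidean_norm_def by (intro continuous_on_real_sqrt continuous_on_sum continuous_on_power c)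
  have b: "continuous_on (sbox n) (\<lambda>x. box_norm {..<n} x)"
    by (rule continuous_on_box_norm[OF finite_lessThan continuous_on_id])
  have "continuous_on (sbox n) (\<lambda>x. 1 - box_norm {..<n} x + euclidean_norm n x)"
    by (rule continuous_on_add[OF continuous_on_diff[OF continuous_on_const b] e])
  then show "continuous_on (sbox n) (\<lambda>x. box_to_disk n x i)"
    unfolding box_to_disk_def
    by (intro continuous_on_mult continuous_on_divide continuous_on_const c)
      (use box_to_disk_denominator in fastforce)+
qed

context acyclic_fibration
begin

text \<open>
  Lifts are constructed cell by cell in the order of dimension.  Instead of lifts on skeleta with
  the subspace topology, functions on \<open>K\<close> are considered which are continuous on each cell of
  lower dimension; this is enough since there are finitely many cells.
\<close>

lemma finite_CW_lift:
  fixes K :: "'u topology"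
  assumes K: "finite_CW_complex K" and g: "continuous_map K TY g"
  shows "\<exists>l. continuous_map K TE l \<and> (\<forall>x\<in>topspace K. p (l x) = g x)"
proof -
  obtain I :: "nat set" and dm \<Phi> where H: "Hausdorff_space K" and I: "finite I"
    and \<Phi>: "\<forall>i\<in>I. continuous_map (disk (dm i)) K (\<Phi> i) \<and>
           homeomorphic_map (subtopology (disk (dm i)) (open_disk (dm i)))
             (subtopology K (\<Phi> i ` open_disk (dm i))) (\<Phi> i)"
    and disj: "disjoint_family_on (\<lambda>i. \<Phi> i ` open_disk (dm i)) I"
    and top: "topspace K = (\<Union>i\<in>I. \<Phi> i ` open_disk (dm i))"
    and bd: "\<forall>i\<in>I. \<Phi> i ` (topspace (disk (dm i)) - open_disk (dm i)) \<subseteq>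
           (\<Union>j \<in> {j \<in> I. dm j < dm i}. \<Phi> j ` open_disk (dm j))"
    using K unfolding finite_CW_complex_def by (elim conjE exE)
  define cell where "cell i = \<Phi> i ` open_disk (dm i)" for i
  define \<Psi> where "\<Psi> i x = \<Phi> i (box_to_disk (dm i) x)" for i x
  define B where "B i = sbox (dm i)" for i
  define skel where "skel k = (\<Union>j \<in> {j \<in> I. dm j < k}. cell j)" for k
  have \<Psi>c: "continuous_map (top_of_set (B i)) K (\<Psi> i)" if i: "i \<in> I" for i
  proof -
    have c: "continuous_map (top_of_set (topspace (disk (dm i)))) K (\<Phi> i)"
      unfolding disk_topology[symmetric] using \<Phi> i by blast
    show ?thesis unfolding \<Psi>_def B_def
      by (rule continuous_map_on_compose[OF c continuous_on_box_to_disk box_to_disk_in])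
  qed
  have od: "open_disk n \<subseteq> topspace (disk n)" for n unfolding open_disk_eq topspace_disk by auto
  have \<Phi>inj: "inj_on (\<Phi> i) (open_disk (dm i))" if "i \<in> I" for i
  proof -
    have "homeomorphic_map (subtopology (disk (dm i)) (open_disk (dm i))) (subtopology K (\<Phi> i ` open_disk (dm i))) (\<Phi> i)"
      using \<Phi> that by blast
    then have "inj_on (\<Phi> i) (topspace (subtopology (disk (dm i)) (open_disk (dm i))))"
      by (rule homeomorphic_imp_injective_map)
    then show ?thesis using od[of "dm i"] by (simp add: Int_absorb1)
  qed
  have \<Psi>int: "\<Psi> i x \<in> cell i" if "x \<in> B i" "x \<notin> sboundary (dm i)" for i x
    using box_to_disk_open[of x "dm i"] that by (simp add: \<Psi>_def cell_def B_def)
  have \<Psi>bd: "\<Psi> i x \<in> skel (dm i)" if "i \<in> I" "x \<in> sboundary (dm i)" for i x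
  proof -
    have x: "x \<in> sbox (dm i)" using that(2) by (simp add: sboundary_def)
    have "box_to_disk (dm i) x \<in> topspace (disk (dm i)) - open_disk (dm i)"
      using box_to_disk_in[OF x] box_to_disk_open[OF x] that(2) by blast
    then have "\<Phi> i (box_to_disk (dm i) x) \<in> \<Phi> i ` (topspace (disk (dm i)) - open_disk (dm i))" by (rule imageI)
    then show ?thesis using bspec[OF bd that(1)] unfolding \<Psi>_def skel_def cell_def by (rule subsetD[rotated])
  qed
  have \<Psi>inv: "\<exists>x\<in>B i. y = \<Psi> i x" if y: "y \<in> cell i" for i y
  proof -
    obtain z where z: "z \<in> open_disk (dm i)" "y = \<Phi> i z" using y by (auto simp: cell_def)
    show ?thesis using disk_to_box_open[OF z(1)] z(2) by (intro bexI[of _ "disk_to_box (dm i) z"]) (simp_all add: \<Psi>_def B_def)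
  qed
  have \<Psi>inj: "x = x'" if "i \<in> I" "x \<in> B i" "x' \<in> B i" "\<Psi> i x \<in> cell i" "x \<notin> sboundary (dm i)" "x' \<notin> sboundary (dm i)" "\<Psi> i x = \<Psi> i x'" for i x x'
  proof -
    have "box_to_disk (dm i) x = box_to_disk (dm i) x'"
      by (rule inj_onD[OF \<Phi>inj[OF that(1)]]) (use that box_to_disk_open in \<open>simp_all add: \<Psi>_def B_def\<close>)
    then show ?thesis using disk_to_box_to_disk[of x "dm i"] disk_to_box_to_disk[of x' "dm i"] that(2,3) unfolding B_def by metis
  qed
  have \<Psi>skel: "\<Psi> i x \<in> skel k" if "i \<in> I" "x \<in> B i" "dm i < k" for i x k
  proof (cases "x \<in> sboundary (dm i)")
    case True
    have "skel (dm i) \<subseteq> skel k" unfolding skel_def using that(3) by (intro UN_mono) auto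
    then show ?thesis using \<Psi>bd[OF that(1) True] by blast
  next
    case False
    then show ?thesis using \<Psi>int[OF that(2)] that by (auto simp: skel_def)
  qed
  have celldisj: "i = j" if "i \<in> I" "j \<in> I" "y \<in> cell i" "y \<in> cell j" for i j y
    using disj that unfolding disjoint_family_on_def cell_def by blast
  have skelK: "skel k \<subseteq> topspace K" for k unfolding skel_def top cell_def by blast
  have skel_cont: "continuous_map (subtopology K (skel k)) TE l"
    if l: "\<And>i. i \<in> I \<Longrightarrow> dm i < k \<Longrightarrow> continuous_map (top_of_set (B i)) TE (\<lambda>x. l (\<Psi> i x))" for k l
  proof (rule continuous_map_finite_compact_cover[where I = "{i \<in> I. dm i < k}" and D = "\<lambda>i. top_of_set (B i)" and \<Phi> = \<Psi>])
    show "finite {i \<in> I. dm i < k}" using I by simp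
    show "Hausdorff_space (subtopology K (skel k))" by (rule Hausdorff_space_subtopology[OF H])
    show "compact_space (top_of_set (B i))" for i unfolding B_def by (rule sbox_space(1))
    show "continuous_map (top_of_set (B i)) (subtopology K (skel k)) (\<Psi> i)" if "i \<in> {i \<in> I. dm i < k}" for i
      unfolding continuous_map_in_subtopology using \<Psi>c[of i] \<Psi>skel[of i _ k] that by auto
    show "continuous_map (top_of_set (B i)) TE (\<lambda>x. l (\<Psi> i x))" if "i \<in> {i \<in> I. dm i < k}" for i using l that by simp
    show "topspace (subtopology K (skel k)) \<subseteq> (\<Union>i\<in>{i \<in> I. dm i < k}. \<Psi> i ` topspace (top_of_set (B i)))"
    proof
      fix y assume "y \<in> topspace (subtopology K (skel k))"
      then obtain i where i: "i \<in> I" "dm i < k" "y \<in> cell i" by (auto simp: skel_def)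
      obtain x where "x \<in> B i" "y = \<Psi> i x" using \<Psi>inv[OF i(3)] by blast
      then show "y \<in> (\<Union>i\<in>{i \<in> I. dm i < k}. \<Psi> i ` topspace (top_of_set (B i)))"
        using i by (intro UN_I[of i] image_eqI[of _ _ x]) simp_all
    qed
  qed
  have step: "\<exists>l :: 'u \<Rightarrow> 'u. \<forall>i\<in>I. dm i < k \<longrightarrow> continuous_map (top_of_set (B i)) TE (\<lambda>x. l (\<Psi> i x)) \<and> (\<forall>x\<in>B i. p (l (\<Psi> i x)) = g (\<Psi> i x))" for k
  proof (induction k)
    case 0
    show ?case by simp
  next
    case (Suc k)
    then obtain l :: "'u \<Rightarrow> 'u" where l: "\<forall>i\<in>I. dm i < k \<longrightarrow> continuous_map (top_of_set (B i)) TE (\<lambda>x. l (\<Psi> i x)) \<and> (\<forall>x\<in>B i. p (l (\<Psi> i x)) = g (\<Psi> i x))"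
      by (elim exE)
    have lc: "continuous_map (subtopology K (skel k)) TE l" by (rule skel_cont) (use l in blast)
    have lp: "p (l y) = g y" if y: "y \<in> skel k" for y
    proof -
      obtain i where i: "i \<in> I" "dm i < k" "y \<in> cell i" using y by (auto simp: skel_def)
      obtain x where "x \<in> B i" "y = \<Psi> i x" using \<Psi>inv[OF i(3)] by blast
      then show ?thesis using l i by blast
    qed
    have ex: "\<forall>i\<in>{i \<in> I. dm i = k}. \<exists>L. continuous_map (top_of_set (B i)) TE L \<and> (\<forall>x\<in>B i. p (L x) = g (\<Psi> i x)) \<and> (\<forall>x\<in>sboundary (dm i). L x = l (\<Psi> i x))"
    proof
      fix i assume "i \<in> {i \<in> I. dm i = k}"
      then have i: "i \<in> I" "dm i = k" by auto
      have sub: "sboundary (dm i) \<subseteq> B i" by (auto simp: sboundary_def B_def)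
      have "continuous_map (top_of_set (sboundary (dm i))) K (\<Psi> i)"
        by (rule continuous_map_on_compose[OF \<Psi>c[OF i(1)] continuous_on_id]) (use sub in blast)
      then have "continuous_map (top_of_set (sboundary (dm i))) (subtopology K (skel k)) (\<Psi> i)"
        unfolding continuous_map_in_subtopology using \<Psi>bd[OF i(1)] i(2) by auto
      from continuous_map_compose[OF this lc]
      have a: "continuous_map (top_of_set (sboundary (dm i))) TE (\<lambda>x. l (\<Psi> i x))" by (simp add: o_def)
      have w: "continuous_map (top_of_set (sbox (dm i))) TY (\<lambda>x. g (\<Psi> i x))"
        using continuous_map_compose[OF \<Psi>c[OF i(1)] g] by (simp add: o_def B_def)
      show "\<exists>L. continuous_map (top_of_set (B i)) TE L \<and> (\<forall>x\<in>B i. p (L x) = g (\<Psi> i x)) \<and> (\<forall>x\<in>sboundary (dm i). L x = l (\<Psi> i x))"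
        unfolding B_def by (rule box_extension[OF w a]) (use lp \<Psi>bd[OF i(1)] i(2) in simp)
    qed
    from bchoice[OF ex] obtain L where L: "\<forall>i\<in>{i \<in> I. dm i = k}. continuous_map (top_of_set (B i)) TE (L i) \<and>
        (\<forall>x\<in>B i. p (L i x) = g (\<Psi> i x)) \<and> (\<forall>x\<in>sboundary (dm i). L i x = l (\<Psi> i x))" by (elim exE)
    define new where "new y i \<longleftrightarrow> i \<in> I \<and> dm i = k \<and> y \<in> cell i" for y i
    define l' where "l' y = (if \<exists>i. new y i then L (SOME i. new y i)
       (SOME x. x \<in> B (SOME i. new y i) \<and> x \<notin> sboundary (dm (SOME i. new y i)) \<and> y = \<Psi> (SOME i. new y i) x) else l y)" for y
    have l'old: "l' y = l y" if y: "y \<in> skel k" for y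
    proof -
      obtain j where j: "j \<in> I" "dm j < k" "y \<in> cell j" using y by (auto simp: skel_def)
      have "\<not> new y i" for i
      proof
        assume "new y i"
        then have i: "i \<in> I" "dm i = k" "y \<in> cell i" unfolding new_def by blast+
        have "i = j" by (rule celldisj[OF i(1) j(1) i(3) j(3)])
        then show False using i(2) j(2) by simp
      qed
      then show ?thesis by (simp add: l'_def)
    qed
    have l'new: "l' (\<Psi> i x) = L i x" if i: "i \<in> I" "dm i = k" and x: "x \<in> B i" for i x
    proof (cases "x \<in> sboundary (dm i)")
      case True
      then show ?thesis using l'old[of "\<Psi> i x"] \<Psi>bd[OF i(1) True] L i by simp
    next
      case False
      have c: "\<Psi> i x \<in> cell i" by (rule \<Psi>int[OF x False])
      have n: "new (\<Psi> i x) i" using i c by (simp add: new_def)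
      have u: "j = i" if "new (\<Psi> i x) j" for j
      proof -
        have "j \<in> I" "\<Psi> i x \<in> cell j" using that unfolding new_def by blast+
        then show ?thesis using celldisj[of j i "\<Psi> i x"] i(1) c by blast
      qed
      have s: "(SOME j. new (\<Psi> i x) j) = i" using n u by (rule some_equality)
      have sx: "(SOME x'. x' \<in> B i \<and> x' \<notin> sboundary (dm i) \<and> \<Psi> i x = \<Psi> i x') = x"
      proof (rule some_equality)
        show "x \<in> B i \<and> x \<notin> sboundary (dm i) \<and> \<Psi> i x = \<Psi> i x" using x False by simp
        fix x' assume "x' \<in> B i \<and> x' \<notin> sboundary (dm i) \<and> \<Psi> i x = \<Psi> i x'"
        then show "x' = x" using \<Psi>inj[OF i(1) x _ c False, of x'] by simp
      qed
      have "\<exists>j. new (\<Psi> i x) j" using n by (rule exI)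
      then show ?thesis unfolding l'_def s sx by (simp only: if_True)
    qed
    show ?case
    proof (intro exI[of _ l'] ballI impI)
      fix i assume i: "i \<in> I" "dm i < Suc k"
      show "continuous_map (top_of_set (B i)) TE (\<lambda>x. l' (\<Psi> i x)) \<and> (\<forall>x\<in>B i. p (l' (\<Psi> i x)) = g (\<Psi> i x))"
      proof (cases "dm i = k")
        case True
        have Li: "continuous_map (top_of_set (B i)) TE (L i)" "\<forall>x\<in>B i. p (L i x) = g (\<Psi> i x)" using L i(1) True by simp_all
        have "continuous_map (top_of_set (B i)) TE (\<lambda>x. l' (\<Psi> i x))"
          by (rule continuous_map_on_cong[OF Li(1)]) (simp add: l'new[OF i(1) True])
        then show ?thesis using Li(2) l'new[OF i(1) True] by simp
      next
        case False
        then have k: "dm i < k" using i(2) by simp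
        have li: "continuous_map (top_of_set (B i)) TE (\<lambda>x. l (\<Psi> i x))" "\<forall>x\<in>B i. p (l (\<Psi> i x)) = g (\<Psi> i x)" using l i(1) k by simp_all
        have eq: "l' (\<Psi> i x) = l (\<Psi> i x)" if "x \<in> B i" for x by (rule l'old[OF \<Psi>skel[OF i(1) that k]])
        have "continuous_map (top_of_set (B i)) TE (\<lambda>x. l' (\<Psi> i x))"
          by (rule continuous_map_on_cong[OF li(1)]) (simp add: eq)
        then show ?thesis using li(2) eq by simp
      qed
    qed
  qed
  define k where "k = Suc (Max (insert 0 (dm ` I)))"
  have k: "dm i < k" if "i \<in> I" for i
    using Max_ge[of "insert 0 (dm ` I)" "dm i"] I that by (simp add: k_def less_Suc_eq_le)
  obtain l :: "'u \<Rightarrow> 'u" where l: "\<forall>i\<in>I. dm i < k \<longrightarrow> continuous_map (top_of_set (B i)) TE (\<lambda>x. l (\<Psi> i x)) \<and> (\<forall>x\<in>B i. p (l (\<Psi> i x)) = g (\<Psi> i x))"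
    using step[of k] by (elim exE)
  have sk: "skel k = topspace K" unfolding skel_def top cell_def using k by auto
  have "continuous_map (subtopology K (skel k)) TE l" by (rule skel_cont) (use l in blast)
  then have "continuous_map K TE l" by (simp add: sk)
  moreover have "p (l y) = g y" if y: "y \<in> topspace K" for y
  proof -
    obtain i where i: "i \<in> I" "y \<in> cell i" using y by (auto simp: top cell_def)
    obtain x where "x \<in> B i" "y = \<Psi> i x" using \<Psi>inv[OF i(2)] by blast
    then show ?thesis using l i(1) k[OF i(1)] by blast
  qed
  ultimately show ?thesis by (intro exI[of _ l]) simp
qed

text \<open>
  A lift up to homotopy is obtained from a homotopy equivalence with a finite CW complex, and the
  fibration turns it into a lift.
\<close>

lemma finite_CW_type_lift:
  fixes X :: "'u topology"
  assumes X: "T_space X" and CW: "finite_CW_type X" and g: "continuous_map X TY g"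
  shows "\<exists>l. continuous_map X TE l \<and> (\<forall>x\<in>topspace X. p (l x) = g x)"
proof -
  obtain K :: "'u topology" where K: "finite_CW_complex K" "X homotopy_equivalent_space K"
    using CW by (auto simp: finite_CW_type_def)
  obtain a b where ab: "continuous_map X K a" "continuous_map K X b" "homotopic X X (b \<circ> a) id"
    using K(2) unfolding homotopy_equivalent_space_def by blast
  have "continuous_map K TY (g \<circ> b)" by (rule continuous_map_compose[OF ab(2) g])
  from finite_CW_lift[OF K(1) this] obtain l where l: "continuous_map K TE l" "\<forall>y\<in>topspace K. p (l y) = g (b y)"
    by auto
  obtain h where h: "continuous_map (prod_topology unit_I X) X h" "\<And>x. h (0, x) = b (a x)" "\<And>x. h (1, x) = x"
    using ab(3) unfolding homotopic_with_def by auto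
  have H: "continuous_map (prod_topology unit_I X) TY (g \<circ> h)" by (rule continuous_map_compose[OF h(1) g])
  have f: "continuous_map X TE (l \<circ> a)" by (rule continuous_map_compose[OF ab(1) l(1)])
  have pf: "p ((l \<circ> a) x) = (g \<circ> h) (0, x)" if "x \<in> topspace X" for x
    using l(2) funcset_mem[OF continuous_map_funspace[OF ab(1)] that] h(2) by simp
  obtain f' where f': "continuous_map X TE f'" "\<And>x. x \<in> topspace X \<Longrightarrow> p (f' x) = (g \<circ> h) (1, x)"
    by (rule fibration_lift_end[OF \<iota> E Y fibration X H f pf]) (assumption, rule that, assumption, blast)
  then show ?thesis using h(3) by (intro exI[of _ f']) simp
qed

end

theorem corollary3p18:
  fixes X :: "'u topology"
  assumes universe: "\<exists>\<iota> :: real \<Rightarrow> 'u. inj \<iota>"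
    and "T_space X"
    and "finite_CW_type X"
  shows "uniformly_cofibrant (fine_uspace X)"
  unfolding uniformly_cofibrant_def
proof (intro conjI allI impI)
  show "U_object TYPE('u) (fine_uspace X)" by (rule fine_T_space(2)[OF assms(2)])
  note cr = T_space_cr[OF assms(2)]
  fix E Y :: "'u uspace" and p g
  assume asm: "U_object TYPE('u) E \<and> U_object TYPE('u) Y \<and> uniform_weak_equivalence E Y p \<and>
     uniform_Hurewicz_fibration E Y p \<and> umap (fine_uspace X) Y g"
  obtain \<iota> :: "real \<Rightarrow> 'u" where \<iota>: "inj \<iota>" using universe by blast
  interpret acyclic_fibration E Y p \<iota> by unfold_locales (use asm \<iota> in auto)
  have "continuous_map X (utopology Y) g" using asm umap_fine_iff[OF cr U_object_uspace[OF Y]] by blast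
  from finite_CW_type_lift[OF assms(2,3) this] obtain l where l: "continuous_map X (utopology E) l" "\<forall>x\<in>topspace X. p (l x) = g x"
    by (elim exE conjE)
  have "umap (fine_uspace X) E l" using l(1) umap_fine_iff[OF cr U_object_uspace[OF E]] by blast
  moreover have "upoints (fine_uspace X) = topspace X" by (rule fine_uspace(2)[OF cr])
  ultimately show "\<exists>l. umap (fine_uspace X) E l \<and> (\<forall>x\<in>upoints (fine_uspace X). p (l x) = g x)"
    using l(2) by (intro exI[of _ l]) simp
qed

end
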